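(* Let $(T,r)$ be a bounded (i.e. of finite diameter), locally compact $\mathbb{R}$-tree, and let $\nu$ be a Radon measure on $(T,\mathcal{B}(T))$ (finite on compact sets and positive on every open ball). (i) If $T$ is compact, then the $\nu$-Brownian motion on $(T,r)$ is positive recurrent. (ii) If $T$ is not compact, then the $\nu$-Brownian motion on $(T,r)$ is transient.
   Context: An $\mathbb{R}$-tree is a metric space $(T,r)$ such that (1) for all $u,v\in T$ there is a unique isometric embedding $\phi_{u,v}:[0,r(u,v)]\to T$ with $\phi_{u,v}(0)=u$, $\phi_{u,v}(r(u,v))=v$; (2) every injective continuous $\kappa:[0,1]\to T$ satisfies $\kappa([0,1])=\phi_{\kappa(0),\kappa(1)}([0,r(\kappa(0),\kappa(1))])$. Write $[a,b]=\phi_{a,b}([0,r(a,b)])$ and $]a,b[=\phi_{a,b}(]0,r(a,b)[)$. For $a,b,x\in T$, $c(a,b,x)$ is the unique point with $[a,x]\cap[a,b]=[a,c(a,b,x)]$. Length measure: locally compact $\mathbb{R}$-trees are separable; $\lambda=\lambda^{(T,r)}$ is the unique $\sigma$-finite Borel measure on $T$ with $\lambda(]a,b[)=r(a,b)$ for all $a,b\in T$ and $\lambda(T\setminus T^o)=0$, where $T^o=\bigcup_{a,b\in T}]a,b[$. Gradient: fix a root $\rho\in T$, put $x\wedge y:=c(\rho,x,y)$ and $\int_x^y\lambda(\mathrm{d}z)\,g(z):=-\int_{[x\wedge y,x]}g\,\mathrm{d}\lambda+\int_{[x\wedge y,y]}g\,\mathrm{d}\lambda$. A continuous $f:T\to\mathbb{R}$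 is locally absolutely continuous ($f\in\mathcal{A}$) if for every $\varepsilon>0$ and every $S\subseteq T$ with $\lambda(S)<\infty$ there is $\delta>0$ such that for disjoint arcs $[x_1,y_1],\dots,[x_n,y_n]\subseteq S$ with $\sum_i r(x_i,y_i)<\delta$ one has $\sum_i|f(x_i)-f(y_i)|<\varepsilon$. For $f\in\mathcal{A}$, $\nabla f$ is the $\lambda$-a.e. unique function with $f(y)-f(x)=\int_x^y\lambda(\mathrm{d}z)\,\nabla f(z)$ for all $x,y\in T$. Form: $\mathcal{C}_\infty(T)$ is the set of continuous $f:T\to\mathbb{R}$ such that for every $\varepsilon>0$ there is a compact $K$ with $|f|\le\varepsilon$ on $T\setminus K$. $\mathcal{F}:=\{f\in\mathcal{A}:\nabla f\in L^2(\lambda)\}$, $\mathcal{D}(\mathcal{E}):=\mathcal{F}\cap L^2(\nu)\cap\mathcal{C}_\infty(T)$, and $\mathcal{E}(f,g):=\frac12\int\lambda(\mathrm{d}z)\,\nabla f(z)\nabla g(z)$ (independent of the choice of $\rho$). The $\nu$-Brownian motion on $(T,r)$ is the (unique up to $\nu$-equivalence) continuous $\nu$-symmetric strong Markov process $B=((B_t)_{t\ge0},(\mathbf{P}^x)_{x\in T})$ associated with the Dirichlet form $(\mathcal{E},\mathcal{D}(\mathcal{E}))$ on $L^2(\nu)$. It is transient iff $\int_0^\infty\mathrm{d}u\,\mathbf{P}^\rho\{B_u\in K\}<\infty$ for all compact $K\subseteq T$, and recurrent otherwise. With $\tau_y:=\inf\{t>0:B_t=y\}$, a recurrent $\nu$-Brownian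 motion is null-recurrent if there is $y\in T$ with $\mathbf{E}^x[\tau_y]=\infty$ for some $x\in T$, and positive recurrent otherwise. *)

theory Defs
  imports "HOL-Probability.Probability"
begin

section \<open>Real trees\<close>

text \<open>Paths are taken in \<^term>\<open>extensional {0..dist u v}\<close> so that uniqueness of a function
  on the interval becomes uniqueness of a function on all reals.\<close>

definition isometric_path :: "'a::metric_space \<Rightarrow> 'a \<Rightarrow> (real \<Rightarrow> 'a) \<Rightarrow> bool" where
  "isometric_path u v \<phi> \<longleftrightarrow>
     \<phi> \<in> extensional {0..dist u v} \<and>
     (\<forall>s\<in>{0..dist u v}. \<forall>t\<in>{0..dist u v}. dist (\<phi> s) (\<phi> t) = \<bar>s - t\<bar>) \<and>
     \<phi> 0 = u \<and> \<phi> (dist u v) = v"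

definition geodesic :: "'a::metric_space \<Rightarrow> 'a \<Rightarrow> real \<Rightarrow> 'a" where
  "geodesic u v = (THE \<phi>. isometric_path u v \<phi>)"

definition tree_arc :: "'a::metric_space \<Rightarrow> 'a \<Rightarrow> 'a set" where
  "tree_arc a b = geodesic a b ` {0..dist a b}"

definition open_tree_arc :: "'a::metric_space \<Rightarrow> 'a \<Rightarrow> 'a set" where
  "open_tree_arc a b = geodesic a b ` {0<..<dist a b}"

class real_tree = metric_space +
  assumes ex1_isometric_path: "\<exists>!\<phi>. isometric_path u v \<phi>"
    and injective_path_image:
      "continuous_on {0..1} \<kappa> \<Longrightarrow> inj_on \<kappa> {0..1} \<Longrightarrow> \<kappa> ` {0..1} = tree_arc (\<kappa> (0::real)) (\<kappa> 1)"

definition branch_point :: "'a::real_tree \<Rightarrow> 'a \<Rightarrow> 'a \<Rightarrow> 'a" where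
  "branch_point a b x = (THE c. tree_arc a x \<inter> tree_arc a b = tree_arc a c)"

section \<open>Length measure and gradient\<close>

definition skeleton :: "'a::real_tree set" where
  "skeleton = (\<Union>a. \<Union>b. open_tree_arc a b)"

definition is_length_measure :: "'a::real_tree measure \<Rightarrow> bool" where
  "is_length_measure L \<longleftrightarrow>
     sets L = sets borel \<and> sigma_finite_measure L \<and>
     (\<forall>a b. emeasure L (open_tree_arc a b) = ennreal (dist a b)) \<and>
     - skeleton \<in> null_sets L"

definition length_measure :: "'a::real_tree measure" where
  "length_measure = (THE L. is_length_measure L)"

definition tree_integral :: "'a::real_tree \<Rightarrow> 'a \<Rightarrow> 'a \<Rightarrow> ('a \<Rightarrow> real) \<Rightarrow> real" where
  "tree_integral \<rho> x y g =
     - (LINT z:tree_arc (branch_point \<rho> x y) x|length_measure. g z)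
     + (LINT z:tree_arc (branch_point \<rho> x y) y|length_measure. g z)"

text \<open>Only Borel sets \<open>S\<close> are considered, since \<^const>\<open>emeasure\<close> is \<open>0\<close> on non-measurable sets.\<close>

definition loc_abs_continuous :: "('a::real_tree \<Rightarrow> real) \<Rightarrow> bool" where
  "loc_abs_continuous f \<longleftrightarrow>
     continuous_on UNIV f \<and>
     (\<forall>\<epsilon>>0. \<forall>S\<in>sets borel. emeasure length_measure S < \<infinity> \<longrightarrow>
       (\<exists>\<delta>>0. \<forall>(n::nat) x y.
          disjoint_family_on (\<lambda>i. tree_arc (x i) (y i)) {..<n} \<longrightarrow>
          (\<forall>i<n. tree_arc (x i) (y i) \<subseteq> S) \<longrightarrow>
          (\<Sum>i<n. dist (x i) (y i)) < \<delta> \<longrightarrow>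
          (\<Sum>i<n. \<bar>f (x i) - f (y i)\<bar>) < \<epsilon>))"

text \<open>Integrability on arcs is required explicitly because the Bochner integral of a
  non-integrable function is \<open>0\<close>.\<close>

definition is_gradient :: "'a::real_tree \<Rightarrow> ('a \<Rightarrow> real) \<Rightarrow> ('a \<Rightarrow> real) \<Rightarrow> bool" where
  "is_gradient \<rho> f g \<longleftrightarrow>
     g \<in> borel_measurable borel \<and>
     (\<forall>x y. set_integrable length_measure (tree_arc x y) g) \<and>
     (\<forall>x y. f y - f x = tree_integral \<rho> x y g)"

text \<open>A representative of the class, unique up to null sets of the length measure.\<close>

definition gradient :: "'a::real_tree \<Rightarrow> ('a \<Rightarrow> real) \<Rightarrow> 'a \<Rightarrow> real" where
  "gradient \<rho> f = (SOME g. is_gradient \<rho> f g)"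

section \<open>The Dirichlet form\<close>

definition L2 :: "'a measure \<Rightarrow> ('a \<Rightarrow> real) set" where
  "L2 M = {f \<in> borel_measurable M. integrable M (\<lambda>x. (f x)\<^sup>2)}"

definition C_infty :: "('a::topological_space \<Rightarrow> real) set" where
  "C_infty = {f. continuous_on UNIV f \<and>
     (\<forall>\<epsilon>>0. \<exists>K. compact K \<and> (\<forall>x. x \<notin> K \<longrightarrow> \<bar>f x\<bar> \<le> \<epsilon>))}"

definition finite_energy :: "'a::real_tree \<Rightarrow> ('a \<Rightarrow> real) set" where
  "finite_energy \<rho> =
     {f. loc_abs_continuous f \<and> (\<exists>g. is_gradient \<rho> f g \<and> g \<in> L2 length_measure)}"

definition form_domain :: "'a::real_tree \<Rightarrow> 'a measure \<Rightarrow> ('a \<Rightarrow> real) set" where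
  "form_domain \<rho> \<nu> = finite_energy \<rho> \<inter> L2 \<nu> \<inter> C_infty"

definition energy :: "'a::real_tree \<Rightarrow> ('a \<Rightarrow> real) \<Rightarrow> ('a \<Rightarrow> real) \<Rightarrow> real" where
  "energy \<rho> f g = 1/2 * (LINT z|length_measure. gradient \<rho> f z * gradient \<rho> g z)"

definition radon_measure :: "'a::metric_space measure \<Rightarrow> bool" where
  "radon_measure \<nu> \<longleftrightarrow>
     sets \<nu> = sets borel \<and>
     (\<forall>K. compact K \<longrightarrow> emeasure \<nu> K < \<infinity>) \<and>
     (\<forall>x e. 0 < e \<longrightarrow> 0 < emeasure \<nu> (ball x e))"

section \<open>Continuous strong Markov processes with a cemetery\<close>

text \<open>A process is given by a sample space \<open>W\<close> (of which only the sigma-algebra matters), laws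
  \<open>P x\<close> on \<open>W\<close> and positions \<open>B t \<omega> :: 'a option\<close>, for times \<open>t \<ge> 0\<close>. The value \<^const>\<open>None\<close> is the
  cemetery: on a non-compact tree the semigroup of the form need not be conservative.\<close>

definition cemetery_borel :: "'a::topological_space option measure" where
  "cemetery_borel = sigma UNIV ((`) Some ` sets borel)"

definition zero_ext :: "('a \<Rightarrow> 'b::zero) \<Rightarrow> 'a option \<Rightarrow> 'b" where
  "zero_ext f z = (case z of None \<Rightarrow> 0 | Some y \<Rightarrow> f y)"

definition lifetime :: "(real \<Rightarrow> 'w \<Rightarrow> 'a option) \<Rightarrow> 'w \<Rightarrow> ennreal" where
  "lifetime B \<omega> = Inf {ennreal t | t. 0 \<le> t \<and> B t \<omega> = None}"

text \<open>Filtrations are indexed by \<^typ>\<open>ennreal\<close>, so that stopping times may be infinite.\<close>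

definition natural_filtration ::
    "'w measure \<Rightarrow> (real \<Rightarrow> 'w \<Rightarrow> 'a::topological_space option) \<Rightarrow> ennreal \<Rightarrow> 'w measure" where
  "natural_filtration W B t =
     sigma (space W) {B s -` C \<inter> space W | s C. 0 \<le> s \<and> ennreal s \<le> t \<and> C \<in> sets cemetery_borel}"

definition right_filtration ::
    "'w measure \<Rightarrow> (real \<Rightarrow> 'w \<Rightarrow> 'a::topological_space option) \<Rightarrow> ennreal \<Rightarrow> 'w measure" where
  "right_filtration W B t =
     (if t = \<infinity> then natural_filtration W B \<infinity>
      else sigma (space W) (\<Inter>s\<in>{t<..}. sets (natural_filtration W B s)))"

definition transition ::
    "('a \<Rightarrow> 'w measure) \<Rightarrow> (real \<Rightarrow> 'w \<Rightarrow> 'a option) \<Rightarrow> real \<Rightarrow> 'a \<Rightarrow> 'a set \<Rightarrow> ennreal" where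
  "transition P B t x A = emeasure (P x) {\<omega> \<in> space (P x). B t \<omega> \<in> Some ` A}"

definition continuous_process ::
    "'w measure \<Rightarrow> ('a::metric_space \<Rightarrow> 'w measure) \<Rightarrow> (real \<Rightarrow> 'w \<Rightarrow> 'a option) \<Rightarrow> bool" where
  "continuous_process W P B \<longleftrightarrow>
     (\<forall>x. prob_space (P x) \<and> sets (P x) = sets W) \<and>
     (\<forall>t\<ge>0. B t \<in> W \<rightarrow>\<^sub>M cemetery_borel) \<and>
     (\<forall>t\<ge>0. \<forall>A\<in>sets borel. (\<lambda>x. transition P B t x A) \<in> borel_measurable borel) \<and>
     (\<forall>x. AE \<omega> in P x. B 0 \<omega> = Some x) \<and>
     (\<forall>\<omega>\<in>space W.
        (\<forall>t\<ge>0. B t \<omega> = None \<longleftrightarrow> lifetime B \<omega> \<le> ennreal t) \<and>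
        continuous_on {t. 0 \<le> t \<and> ennreal t < lifetime B \<omega>} (\<lambda>t. the (B t \<omega>)))"

definition strong_markov ::
    "'w measure \<Rightarrow> ('a::metric_space \<Rightarrow> 'w measure) \<Rightarrow> (real \<Rightarrow> 'w \<Rightarrow> 'a option) \<Rightarrow> bool" where
  "strong_markov W P B \<longleftrightarrow>
     (\<forall>x \<sigma>. stopping_time (right_filtration W B) \<sigma> \<longrightarrow>
       (\<forall>\<Lambda>\<in>sets (filtration.pre_sigma (space W) (right_filtration W B) \<sigma>).
         \<forall>s\<ge>0. \<forall>A\<in>sets borel.
           emeasure (P x) {\<omega>\<in>\<Lambda>. \<sigma> \<omega> < \<infinity> \<and> B (enn2real (\<sigma> \<omega>) + s) \<omega> \<in> Some ` A} =
           (\<integral>\<^sup>+\<omega>\<in>{\<omega>\<in>\<Lambda>. \<sigma> \<omega> < \<infinity>}.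
              zero_ext (\<lambda>y. transition P B s y A) (B (enn2real (\<sigma> \<omega>)) \<omega>) \<partial>P x)))"

definition symmetric_process ::
    "'a::metric_space measure \<Rightarrow> ('a \<Rightarrow> 'w measure) \<Rightarrow> (real \<Rightarrow> 'w \<Rightarrow> 'a option) \<Rightarrow> bool" where
  "symmetric_process \<nu> P B \<longleftrightarrow>
     (\<forall>t>0. \<forall>f\<in>borel_measurable borel. \<forall>g\<in>borel_measurable borel.
        (\<integral>\<^sup>+x. (\<integral>\<^sup>+\<omega>. zero_ext f (B t \<omega>) \<partial>P x) * g x \<partial>\<nu>) =
        (\<integral>\<^sup>+x. f x * (\<integral>\<^sup>+\<omega>. zero_ext g (B t \<omega>) \<partial>P x) \<partial>\<nu>))"

section \<open>Association with the Dirichlet form\<close>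

definition semigroup_op ::
    "('a \<Rightarrow> 'w measure) \<Rightarrow> (real \<Rightarrow> 'w \<Rightarrow> 'a option) \<Rightarrow> real \<Rightarrow> ('a \<Rightarrow> real) \<Rightarrow> 'a \<Rightarrow> real" where
  "semigroup_op P B t f x = (LINT \<omega>|P x. zero_ext f (B t \<omega>))"

definition approx_form ::
    "'a measure \<Rightarrow> ('a \<Rightarrow> 'w measure) \<Rightarrow> (real \<Rightarrow> 'w \<Rightarrow> 'a option) \<Rightarrow> real \<Rightarrow>
     ('a \<Rightarrow> real) \<Rightarrow> ('a \<Rightarrow> real) \<Rightarrow> real" where
  "approx_form \<nu> P B t f g = 1/t * (LINT x|\<nu>. (f x - semigroup_op P B t f x) * g x)"

text \<open>The form of a symmetric process with \<open>L\<^sup>2\<close>-semigroup \<open>T\<^sub>t\<close> has domain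
  \<open>{f. lim\<^sub>t\<^sub>\<rightarrow>\<^sub>0 1/t (f - T\<^sub>t f, f) < \<infinity>}\<close> and values \<open>lim\<^sub>t\<^sub>\<rightarrow>\<^sub>0 1/t (f - T\<^sub>t f, g)\<close>.
  As a subspace of \<open>L\<^sup>2(\<nu>)\<close>, the domain consists of the classes having a representative
  in \<^const>\<open>form_domain\<close>.\<close>

definition associated_with_form ::
    "'a::real_tree \<Rightarrow> 'a measure \<Rightarrow> ('a \<Rightarrow> 'w measure) \<Rightarrow> (real \<Rightarrow> 'w \<Rightarrow> 'a option) \<Rightarrow> bool" where
  "associated_with_form \<rho> \<nu> P B \<longleftrightarrow>
     (\<forall>f\<in>L2 \<nu>. (\<exists>g\<in>form_domain \<rho> \<nu>. AE x in \<nu>. f x = g x) \<longleftrightarrow>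
        (\<exists>l. ((\<lambda>t. approx_form \<nu> P B t f f) \<longlongrightarrow> l) (at_right 0))) \<and>
     (\<forall>f\<in>form_domain \<rho> \<nu>. \<forall>g\<in>form_domain \<rho> \<nu>.
        ((\<lambda>t. approx_form \<nu> P B t f g) \<longlongrightarrow> energy \<rho> f g) (at_right 0))"

definition brownian_motion ::
    "'a::real_tree \<Rightarrow> 'a measure \<Rightarrow> 'w measure \<Rightarrow> ('a \<Rightarrow> 'w measure) \<Rightarrow>
     (real \<Rightarrow> 'w \<Rightarrow> 'a option) \<Rightarrow> bool" where
  "brownian_motion \<rho> \<nu> W P B \<longleftrightarrow>
     continuous_process W P B \<and> strong_markov W P B \<and> symmetric_process \<nu> P B \<and>
     associated_with_form \<rho> \<nu> P B"

section \<open>Transience and recurrence\<close>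

definition transient ::
    "'a::metric_space \<Rightarrow> ('a \<Rightarrow> 'w measure) \<Rightarrow> (real \<Rightarrow> 'w \<Rightarrow> 'a option) \<Rightarrow> bool" where
  "transient \<rho> P B \<longleftrightarrow>
     (\<forall>K. compact K \<longrightarrow> (\<integral>\<^sup>+u\<in>{0..}. transition P B u \<rho> K \<partial>lborel) < \<infinity>)"

abbreviation recurrent ::
    "'a::metric_space \<Rightarrow> ('a \<Rightarrow> 'w measure) \<Rightarrow> (real \<Rightarrow> 'w \<Rightarrow> 'a option) \<Rightarrow> bool" where
  "recurrent \<rho> P B \<equiv> \<not> transient \<rho> P B"

definition hitting_time :: "(real \<Rightarrow> 'w \<Rightarrow> 'a option) \<Rightarrow> 'a \<Rightarrow> 'w \<Rightarrow> ennreal" where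
  "hitting_time B y \<omega> = Inf {ennreal t | t. 0 < t \<and> B t \<omega> = Some y}"

definition null_recurrent ::
    "'a::metric_space \<Rightarrow> ('a \<Rightarrow> 'w measure) \<Rightarrow> (real \<Rightarrow> 'w \<Rightarrow> 'a option) \<Rightarrow> bool" where
  "null_recurrent \<rho> P B \<longleftrightarrow>
     recurrent \<rho> P B \<and> (\<exists>y x. (\<integral>\<^sup>+\<omega>. hitting_time B y \<omega> \<partial>P x) = \<infinity>)"

definition positive_recurrent ::
    "'a::metric_space \<Rightarrow> ('a \<Rightarrow> 'w measure) \<Rightarrow> (real \<Rightarrow> 'w \<Rightarrow> 'a option) \<Rightarrow> bool" where
  "positive_recurrent \<rho> P B \<longleftrightarrow> recurrent \<rho> P B \<and> \<not> null_recurrent \<rho> P B"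

end

theory Submission
  imports Defs
begin

text \<open>The potential of a set \<open>A\<close> with killing rate \<open>\<alpha>\<close> has a version \<open>u\<close> in the form domain with
  \<open>\<E>(u, g) + \<alpha> \<integral> u g d\<nu> = \<integral>\<^sub>A g d\<nu>\<close>, and Cauchy-Schwarz along arcs gives
  \<open>(u y - u x)\<^sup>2 \<le> 4 r(x,y) \<E>(u,u)\<close>. Let \<open>D\<close> be the diameter. On a compact tree, testing with \<open>u\<close> and \<open>1\<close>
  shows that the oscillation of \<open>u\<close> is at most \<open>4 D \<nu>(T) \<alpha> sup u\<close>. On a non-compact tree, \<open>u\<close> vanishes at
  infinity, whence \<open>u \<le> 4 D \<nu>(A)\<close> uniformly in \<open>\<alpha>\<close>.

  Both bounds hold only for almost every starting point. Comparing the occupation of a small ball \<open>A\<close>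
  around \<open>y\<close> with the occupation after the first visit to \<open>A\<close> yields
  \<open>E\<^sup>x e\<^sup>-\<^sup>\<alpha>\<^sup>\<tau> \<ge> 1 - (1 + 4 D \<nu>(T)) \<alpha>\<close> for the hitting time \<open>\<tau>\<close> of \<open>y\<close> in the compact case, so \<open>E\<^sup>x \<tau> \<le> 1 + 4 D \<nu>(T)\<close>, and
  yields that the root is hit with positive probability from nearby points in the non-compact case. Thus
  every relevant point is hit from a point where the bounds are valid, and the strong Markov property at
  the hitting time transfers them.\<close>

section \<open>Geometry of real trees\<close>

text \<open>\<open>length_measure\<close> is given by a definite description and
  \<open>gradient\<close> by choice, so existence and uniqueness of the measure and a.e. uniqueness
  of gradients must come before any energy estimate. The association with the form fixes the
  semigroup only up to \<open>\<nu>\<close>-null sets, and nothing makes transition probabilities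
  absolutely continuous. The exceptional null set is therefore removed by reachability: its
  potential vanishes at almost every point and, by \<open>pot_hit\<close>, at every point that is
  hit with positive probability from there. A second obstacle is death: a path may tend to a point
  at its lifetime without ever visiting it. On a compact tree conservativeness excludes this;
  otherwise, time spent in a fixed ball after the visit certifies that the path is still alive. The
  transfer to the root then rests on a cutoff function of finite energy, that is, on the positive
  capacity of a point. The summand 1 in the bound for the expected hitting time pays for a short
  positive waiting time, since \<open>hitting_time\<close> excludes time 0.\<close>

lemma isometric_path_geodesic: "isometric_path u v (geodesic u (v::'a::real_tree))"
  unfolding geodesic_def using theI'[OF ex1_isometric_path[of u v]] by simp

lemma geodesic_dist:
  fixes u v :: "'a::real_tree"
  assumes "0 \<le> s" "s \<le> dist u v" "0 \<le> t" "t \<le> dist u v"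
  shows "dist (geodesic u v s) (geodesic u v t) = \<bar>s - t\<bar>"
  using isometric_path_geodesic[of u v] assms unfolding isometric_path_def by auto

lemma geodesic_0 [simp]: "geodesic u (v::'a::real_tree) 0 = u"
  using isometric_path_geodesic[of u v] unfolding isometric_path_def by auto

lemma geodesic_end [simp]: "geodesic u (v::'a::real_tree) (dist u v) = v"
  using isometric_path_geodesic[of u v] unfolding isometric_path_def by auto

lemma isometric_path_unique:
  fixes u v :: "'a::real_tree"
  shows "isometric_path u v \<phi> \<Longrightarrow> geodesic u v = \<phi>"
  using ex1_isometric_path[of u v] isometric_path_geodesic[of u v] by blast

lemma dist_geodesic_start:
  fixes u v :: "'a::real_tree"
  assumes "0 \<le> s" "s \<le> dist u v"
  shows "dist u (geodesic u v s) = s"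
  using geodesic_dist[of 0 u v s] assms by simp

lemma dist_geodesic_end:
  fixes u v :: "'a::real_tree"
  assumes "0 \<le> s" "s \<le> dist u v"
  shows "dist (geodesic u v s) v = dist u v - s"
  using geodesic_dist[of s u v "dist u v"] assms by simp

text \<open>The geodesics meeting at \<open>z\<close> concatenate to an isometric path because the
  triangle inequality through \<open>z\<close> is an equality; uniqueness of isometric paths
  identifies the concatenation with the geodesic.\<close>

lemma geodesic_through:
  fixes u v z :: "'a::real_tree"
  assumes z: "dist u z + dist z v = dist u v"
  shows "0 \<le> s \<Longrightarrow> s \<le> dist u z \<Longrightarrow> geodesic u v s = geodesic u z s"
    and "dist u z \<le> s \<Longrightarrow> s \<le> dist u v \<Longrightarrow> geodesic u v s = geodesic z v (s - dist u z)"
proof -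
  define \<phi> where "\<phi> = restrict (\<lambda>s. if s \<le> dist u z then geodesic u z s
     else geodesic z v (s - dist u z)) {0..dist u v}"
  have mixed: "dist (geodesic u z s) (geodesic z v t) = dist u z - s + t"
    if "0 \<le> s" "s \<le> dist u z" "0 \<le> t" "t \<le> dist z v" for s t
  proof (rule antisym)
    have "dist (geodesic u z s) (geodesic z v t) \<le> dist (geodesic u z s) z + dist z (geodesic z v t)"
      by (rule dist_triangle)
    then show "dist (geodesic u z s) (geodesic z v t) \<le> dist u z - s + t"
      using that by (simp add: dist_geodesic_start dist_geodesic_end)
    \<comment> \<open>If the two points were any closer, the way through them would lead from
      \<open>u\<close> to \<open>v\<close> in less than their distance.\<close>
    have "dist u v \<le> dist u (geodesic u z s) + dist (geodesic u z s) (geodesic z v t)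
        + dist (geodesic z v t) v"
      using dist_triangle[of u v "geodesic z v t"]
        dist_triangle[of u "geodesic z v t" "geodesic u z s"] by simp
    then show "dist u z - s + t \<le> dist (geodesic u z s) (geodesic z v t)"
      using that z by (simp add: dist_geodesic_start dist_geodesic_end)
  qed
  have "isometric_path u v \<phi>"
    unfolding isometric_path_def
  proof (intro conjI ballI)
    show "\<phi> \<in> extensional {0..dist u v}" by (simp add: \<phi>_def)
    show "\<phi> 0 = u" by (simp add: \<phi>_def)
    show "\<phi> (dist u v) = v"
    proof (cases "dist u v \<le> dist u z")
      case True
      then have "dist z v = 0" using z zero_le_dist[of z v] by linarith
      then show ?thesis by (simp add: \<phi>_def)
    next
      case False
      moreover have "dist u v - dist u z = dist z v" using z by simp
      ultimately show ?thesis by (simp add: \<phi>_def)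
    qed
    fix s t assume st: "s \<in> {0..dist u v}" "t \<in> {0..dist u v}"
    consider "s \<le> dist u z" "t \<le> dist u z" | "s \<le> dist u z" "t > dist u z"
      | "s > dist u z" "t \<le> dist u z" | "s > dist u z" "t > dist u z" by linarith
    then show "dist (\<phi> s) (\<phi> t) = \<bar>s - t\<bar>"
    proof cases
      case 1 then show ?thesis using st by (simp add: \<phi>_def geodesic_dist)
    next
      case 2 then show ?thesis using st z mixed[of s "t - dist u z"] by (simp add: \<phi>_def)
    next
      case 3 then show ?thesis using st z mixed[of t "s - dist u z"]
        by (simp add: \<phi>_def dist_commute)
    next
      case 4 then show ?thesis using st z by (simp add: \<phi>_def geodesic_dist)
    qed
  qed
  then have eq: "geodesic u v = \<phi>" by (rule isometric_path_unique)
  show "0 \<le> s \<Longrightarrow> s \<le> dist u z \<Longrightarrow> geodesic u v s = geodesic u z s"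
  proof -
    assume s: "0 \<le> s" "s \<le> dist u z"
    then have "s \<le> dist u v" using z zero_le_dist[of z v] by linarith
    then show ?thesis unfolding eq using s by (simp add: \<phi>_def)
  qed
  show "geodesic u v s = geodesic z v (s - dist u z)" if "dist u z \<le> s" "s \<le> dist u v"
  proof (cases "s = dist u z")
    case True
    then show ?thesis unfolding eq using that by (simp add: \<phi>_def)
  next
    case False
    then have "0 \<le> s" using that zero_le_dist[of u z] by linarith
    then show ?thesis unfolding eq using that False by (simp add: \<phi>_def)
  qed
qed

text \<open>Replaces parametrisations by a metric identity, so that inclusions between arcs reduce
  to linear arithmetic on distances.\<close>

lemma mem_tree_arc_iff:
  fixes u v z :: "'a::real_tree"
  shows "z \<in> tree_arc u v \<longleftrightarrow> dist u z + dist z v = dist u v"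
proof
  assume "z \<in> tree_arc u v"
  then obtain s where "0 \<le> s" "s \<le> dist u v" "z = geodesic u v s"
    by (auto simp: tree_arc_def)
  then show "dist u z + dist z v = dist u v"
    by (simp add: dist_geodesic_start dist_geodesic_end)
next
  assume *: "dist u z + dist z v = dist u v"
  then have "geodesic u v (dist u z) = z"
    using geodesic_through(1)[OF *, of "dist u z"] by simp
  moreover have "dist u z \<le> dist u v" using * zero_le_dist[of z v] by linarith
  ultimately show "z \<in> tree_arc u v"
    unfolding tree_arc_def by (intro image_eqI[of _ _ "dist u z"]) auto
qed

lemma geodesic_dist_start:
  fixes u v z :: "'a::real_tree"
  assumes "z \<in> tree_arc u v"
  shows "geodesic u v (dist u z) = z"
  using assms geodesic_through(1)[of u z v "dist u z"] by (simp add: mem_tree_arc_iff)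

lemma mem_open_tree_arc_iff:
  fixes u v z :: "'a::real_tree"
  shows "z \<in> open_tree_arc u v \<longleftrightarrow> z \<in> tree_arc u v \<and> z \<noteq> u \<and> z \<noteq> v"
proof
  assume "z \<in> open_tree_arc u v"
  then obtain s where s: "0 < s" "s < dist u v" "z = geodesic u v s"
    by (auto simp: open_tree_arc_def)
  then have "dist u z = s" "dist z v = dist u v - s"
    by (auto simp: dist_geodesic_start dist_geodesic_end)
  then show "z \<in> tree_arc u v \<and> z \<noteq> u \<and> z \<noteq> v"
    using s by (auto simp: mem_tree_arc_iff)
next
  assume *: "z \<in> tree_arc u v \<and> z \<noteq> u \<and> z \<noteq> v"
  then have "0 < dist z v" "0 < dist u z" by auto
  moreover have "dist u z + dist z v = dist u v" using * by (simp add: mem_tree_arc_iff)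
  ultimately have "0 < dist u z" "dist u z < dist u v" by linarith+
  then show "z \<in> open_tree_arc u v"
    using * geodesic_dist_start[of z u v] unfolding open_tree_arc_def
    by (intro image_eqI[of _ _ "dist u z"]) auto
qed

lemma geodesic_in_tree_arc:
  fixes u v :: "'a::real_tree"
  shows "0 \<le> s \<Longrightarrow> s \<le> dist u v \<Longrightarrow> geodesic u v s \<in> tree_arc u v"
  by (auto simp: tree_arc_def)

lemma geodesic_initial:
  fixes u v :: "'a::real_tree"
  assumes "0 \<le> t" "t \<le> s" "s \<le> dist u v"
  shows "geodesic u (geodesic u v s) t = geodesic u v t"
  using geodesic_through(1)[of u "geodesic u v s" v t] assms
  by (simp add: dist_geodesic_start dist_geodesic_end)

lemma continuous_on_geodesic:
  fixes u v :: "'a::real_tree"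
  shows "continuous_on {0..dist u v} (geodesic u v)"
  unfolding continuous_on_iff
proof (intro ballI allI impI)
  fix s e assume "s \<in> {0..dist u v}" "0 < (e::real)"
  then show "\<exists>d>0. \<forall>x'\<in>{0..dist u v}. dist x' s < d \<longrightarrow> dist (geodesic u v x') (geodesic u v s) < e"
    by (intro exI[of _ e]) (auto simp: geodesic_dist dist_real_def)
qed

lemma compact_tree_arc: "compact (tree_arc u (v::'a::real_tree))"
  unfolding tree_arc_def by (intro compact_continuous_image continuous_on_geodesic compact_Icc)

lemma tree_arc_commute: "tree_arc u v = tree_arc v (u::'a::real_tree)"
  by (auto simp: mem_tree_arc_iff dist_commute add.commute)

text \<open>The Gromov product of \<open>x\<close> and \<open>y\<close> based at \<open>r\<close>.
  In a tree it is the height at which the geodesics from \<open>r\<close> to \<open>x\<close> and to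
  \<open>y\<close> part.\<close>

definition gromov :: "'a::metric_space \<Rightarrow> 'a \<Rightarrow> 'a \<Rightarrow> real" where
  "gromov r x y = (dist r x + dist r y - dist x y) / 2"

lemma gromov_commute: "gromov r x y = gromov r y x"
  by (simp add: gromov_def dist_commute add.commute)

lemma gromov_nonneg: "0 \<le> gromov r x y"
  using dist_triangle[of x y r] by (simp add: gromov_def dist_commute)

lemma gromov_le: "gromov r x y \<le> dist r x" "gromov r x y \<le> dist r y"
  using dist_triangle[of r x y] dist_triangle[of r y x] by (simp_all add: gromov_def dist_commute)

lemma gromov_self [simp]: "gromov r x x = dist r x"
  by (simp add: gromov_def)

lemma gromov_ge: "dist r x - dist x y \<le> gromov r x y"
  using dist_triangle[of r x y] by (simp add: gromov_def dist_commute)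

lemma gromov_lipschitz: "\<bar>gromov r x z - gromov r y z\<bar> \<le> dist x y"
  using dist_triangle[of r x y] dist_triangle[of r y x] dist_triangle[of x z y] dist_triangle[of y z x]
  by (intro abs_leI) (simp_all add: gromov_def dist_commute field_simps)

text \<open>The two geodesics from the last common point onwards concatenate to an injective path;
  this is the only use of the second axiom of real trees.\<close>

lemma geodesic_branching:
  fixes r x y :: "'a::real_tree"
  shows "geodesic r x (gromov r x y) = geodesic r y (gromov r x y)"
proof -
  define m where "m = min (dist r x) (dist r y)"
  define A where "A = {t \<in> {0..m}. dist (geodesic r x t) (geodesic r y t) = 0}"
  have "continuous_on {0..m} (\<lambda>t. dist (geodesic r x t) (geodesic r y t))"
    by (intro continuous_on_dist continuous_on_subset[OF continuous_on_geodesic]) (auto simp: m_def)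
  then have clA: "closed A"
    unfolding A_def by (intro continuous_closed_preimage_constant) auto
  have m0: "0 \<le> m" by (simp add: m_def)
  have "0 \<in> A" by (simp add: A_def m0)
  moreover have bdd: "bdd_above A" by (rule bdd_aboveI[of _ m]) (auto simp: A_def)
  ultimately have cA: "Sup A \<in> A" using clA by (intro closed_contains_Sup) auto
  \<comment> \<open>The last common time of the two geodesics. That no later coincidence exists is
    what makes the concatenated path injective.\<close>
  define c where "c = Sup A"
  have c: "0 \<le> c" "c \<le> dist r x" "c \<le> dist r y" "geodesic r x c = geodesic r y c"
    using cA by (auto simp: A_def m_def c_def)
  have max: "t \<le> c" if "geodesic r x t = geodesic r y t" "0 \<le> t" "t \<le> dist r x" "t \<le> dist r y" for t
    unfolding c_def using that bdd by (intro cSup_upper) (auto simp: A_def m_def)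
  define a b where "a = dist r x - c" and "b = dist r y - c"
  have ab: "0 \<le> a" "0 \<le> b" using c by (auto simp: a_def b_def)
  have "dist x y = a + b"
  proof (cases "a + b = 0")
    case True
    then have "c = dist r x" "c = dist r y" using ab by (simp_all add: a_def b_def)
    then have "x = y" using c(4) geodesic_end[of r x] geodesic_end[of r y] by metis
    then show ?thesis using True by simp
  next
    case False
    then have pos: "0 < a + b" using ab by linarith
    \<comment> \<open>Runs from \<open>x\<close> down to the last common point, reached at time
      \<open>a\<close>, and then out to \<open>y\<close>; the distance to \<open>r\<close> falls to
      \<open>c\<close> and rises again.\<close>
    define \<psi> where "\<psi> u = (if u \<le> a then geodesic r x (dist r x - u) else geodesic r y (c + (u - a)))" for u
    have \<psi>dist: "dist r (\<psi> u) = (if u \<le> a then dist r x - u else c + (u - a))"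
      if "0 \<le> u" "u \<le> a + b" for u
      using that c by (auto simp: \<psi>_def a_def b_def dist_geodesic_start)
    have inj: "inj_on \<psi> {0..a+b}"
    proof (rule inj_onI)
      have aux: False if "\<psi> u = \<psi> v" "0 \<le> u" "u \<le> a" "a < v" "v \<le> a + b" for u v
      proof -
        have "dist r x - u = c + (v - a)" using \<psi>dist[of u] \<psi>dist[of v] that ab by simp
        moreover have "geodesic r x (dist r x - u) = geodesic r y (c + (v - a))"
          using that by (simp add: \<psi>_def)
        moreover have "0 \<le> c + (v - a)" "c + (v - a) \<le> dist r x" "c + (v - a) \<le> dist r y"
          using that c \<open>dist r x - u = c + (v - a)\<close>[symmetric] by (auto simp: b_def)
        ultimately have "c + (v - a) \<le> c" by (intro max) simp_all
        then show False using that by simp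
      qed
      fix u v assume uv: "u \<in> {0..a+b}" "v \<in> {0..a+b}" "\<psi> u = \<psi> v"
      show "u = v"
        using \<psi>dist[of u] \<psi>dist[of v] uv aux[of u v] aux[of v u]
        by (cases "u \<le> a"; cases "v \<le> a") auto
    qed
    have cont: "continuous_on {0..a+b} \<psi>"
    proof -
      have "{0..a+b} = {0..a} \<union> {a..a+b}" using ab by auto
      moreover have "continuous_on ({0..a} \<union> {a..a+b}) \<psi>"
        unfolding \<psi>_def
      proof (rule continuous_on_cases)
        show "continuous_on {0..a} (\<lambda>u. geodesic r x (dist r x - u))"
          using c by (intro continuous_on_compose2[OF continuous_on_geodesic[of r x]] continuous_intros)
            (auto simp: a_def)
        show "continuous_on {a..a+b} (\<lambda>u. geodesic r y (c + (u - a)))"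
          using c by (intro continuous_on_compose2[OF continuous_on_geodesic[of r y]] continuous_intros)
            (auto simp: a_def b_def)
      qed (use c in \<open>auto simp: a_def\<close>)
      ultimately show ?thesis by simp
    qed
    define \<kappa> where "\<kappa> s = \<psi> ((a+b) * s)" for s
    have "\<kappa> ` {0..1} = tree_arc (\<kappa> 0) (\<kappa> 1)"
    proof (rule injective_path_image)
      show "continuous_on {0..1} \<kappa>" unfolding \<kappa>_def
        by (rule continuous_on_compose2[OF cont], intro continuous_intros)
          (use pos in \<open>auto simp: mult_left_le\<close>)
      show "inj_on \<kappa> {0..1}"
      proof (rule inj_onI)
        fix s t :: real assume st: "s \<in> {0..1}" "t \<in> {0..1}" "\<kappa> s = \<kappa> t"
        then have "(a+b) * s = (a+b) * t"
          using pos by (intro inj_onD[OF inj]) (auto simp: \<kappa>_def mult_left_le)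
        then show "s = t" using pos by simp
      qed
    qed
    moreover have "\<kappa> 0 = x" using ab by (simp add: \<kappa>_def \<psi>_def)
    moreover have "\<kappa> 1 = y"
      using c ab by (cases "b = 0") (auto simp: \<kappa>_def \<psi>_def a_def b_def)
    moreover have "\<kappa> (a/(a+b)) = geodesic r x c" using pos ab by (simp add: \<kappa>_def \<psi>_def a_def)
    moreover have "a/(a+b) \<in> {0..1}" using ab pos by (auto simp: divide_simps)
    ultimately have "geodesic r x c \<in> tree_arc x y" by (metis image_eqI)
    then have "dist x (geodesic r x c) + dist (geodesic r y c) y = dist x y"
      using c by (simp add: mem_tree_arc_iff)
    moreover have "dist x (geodesic r x c) = a" "dist (geodesic r y c) y = b"
      using c by (metis a_def dist_commute dist_geodesic_end, metis b_def dist_geodesic_end)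
    ultimately show ?thesis by simp
  qed
  then have "gromov r x y = c" by (simp add: gromov_def a_def b_def)
  then show ?thesis using c by simp
qed

text \<open>Restricting the common initial arc gives one direction. For the other, a coincidence at
  time \<open>t\<close> opens a route from \<open>x\<close> to \<open>y\<close> of length
  \<open>dist r x + dist r y - 2 * t\<close>.\<close>

lemma geodesic_eq_iff:
  fixes r x y :: "'a::real_tree"
  assumes "0 \<le> t" "t \<le> dist r x" "t \<le> dist r y"
  shows "geodesic r x t = geodesic r y t \<longleftrightarrow> t \<le> gromov r x y"
proof
  assume "t \<le> gromov r x y"
  then show "geodesic r x t = geodesic r y t"
    using geodesic_initial[of t "gromov r x y" r x] geodesic_initial[of t "gromov r x y" r y]
      assms gromov_le[of r x y] geodesic_branching[of r x y] by simp
next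
  assume eq: "geodesic r x t = geodesic r y t"
  have "dist x y \<le> dist (geodesic r x t) x + dist (geodesic r y t) y"
    unfolding eq using dist_triangle2[of x y "geodesic r y t"] by (simp add: dist_commute)
  then show "t \<le> gromov r x y" using assms by (simp add: dist_geodesic_end gromov_def)
qed

text \<open>The 0-hyperbolicity of the tree: agreement up to time \<open>t\<close> is a transitive
  relation between geodesics from \<open>r\<close>.\<close>

lemma gromov_ultrametric:
  fixes r x y z :: "'a::real_tree"
  shows "min (gromov r x y) (gromov r y z) \<le> gromov r x z"
proof -
  define t where "t = min (gromov r x y) (gromov r y z)"
  have t: "0 \<le> t" "t \<le> dist r x" "t \<le> dist r y" "t \<le> dist r z"
    using gromov_nonneg[of r x y] gromov_nonneg[of r y z] gromov_le[of r x y] gromov_le[of r y z]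
    unfolding t_def by linarith+
  have "t \<le> gromov r x y" "t \<le> gromov r y z" by (simp_all add: t_def)
  then have "geodesic r x t = geodesic r y t" "geodesic r y t = geodesic r z t"
    using t by (simp_all add: geodesic_eq_iff)
  then show ?thesis using t geodesic_eq_iff[of t r x z] by (simp add: t_def)
qed

lemma mem_tree_arc_root:
  fixes r x z :: "'a::real_tree"
  shows "z \<in> tree_arc r x \<longleftrightarrow> gromov r z x = dist r z"
  by (auto simp: mem_tree_arc_iff gromov_def)

text \<open>Stopping at height \<open>s\<close> truncates the common part at \<open>s\<close>. The
  ultrametric inequality, used in both directions between \<open>x\<close> and the stopped point,
  pins the product down.\<close>

lemma gromov_geodesic:
  fixes r x y :: "'a::real_tree"
  assumes "0 \<le> s" "s \<le> dist r x"
  shows "gromov r (geodesic r x s) y = min s (gromov r x y)"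
proof -
  have d: "dist r (geodesic r x s) = s" using assms by (simp add: dist_geodesic_start)
  have g: "gromov r (geodesic r x s) x = s"
    using geodesic_in_tree_arc[of s r x] assms d by (simp add: mem_tree_arc_root)
  have g': "gromov r x (geodesic r x s) = s" using g by (simp add: gromov_commute)
  have 1: "min s (gromov r x y) \<le> gromov r (geodesic r x s) y"
    using gromov_ultrametric[of r "geodesic r x s" x y] by (simp only: g)
  have 2: "min s (gromov r (geodesic r x s) y) \<le> gromov r x y"
    using gromov_ultrametric[of r x "geodesic r x s" y] by (simp only: g')
  have 3: "gromov r (geodesic r x s) y \<le> s"
    using gromov_le(1)[of r "geodesic r x s" y] by (simp only: d)
  show ?thesis using 1 2 3 by linarith
qed

definition meet :: "'a::real_tree \<Rightarrow> 'a \<Rightarrow> 'a \<Rightarrow> 'a" where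
  "meet r x y = geodesic r x (gromov r x y)"

text \<open>An arc from \<open>r\<close> consists of the \<open>z\<close> with
  \<open>gromov r z x = dist r z\<close>, which turns the required equality of sets into
  inequalities between products. Two candidates lie on each other's arcs and hence coincide.\<close>

lemma branch_point_eq: "branch_point r x y = meet r x (y::'a::real_tree)"
  unfolding branch_point_def
proof (rule the_equality)
  have eq: "gromov r z (meet r x y) = min (gromov r z x) (gromov r x y)" for z
    using gromov_geodesic[of "gromov r x y" r x z]
    by (simp add: meet_def gromov_nonneg gromov_le gromov_commute[of r z])
  show *: "tree_arc r y \<inter> tree_arc r x = tree_arc r (meet r x y)"
  proof (intro set_eqI)
    fix z
    show "z \<in> tree_arc r y \<inter> tree_arc r x \<longleftrightarrow> z \<in> tree_arc r (meet r x y)"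
      unfolding Int_iff mem_tree_arc_root eq
      using gromov_ultrametric[of r x z y] gromov_ultrametric[of r z x y]
        gromov_le(1)[of r z x] gromov_le(1)[of r z y]
      unfolding gromov_commute[of r x z] by linarith
  qed
  fix c assume "tree_arc r y \<inter> tree_arc r x = tree_arc r c"
  then have "tree_arc r c = tree_arc r (meet r x y)" using * by simp
  then have "c \<in> tree_arc r (meet r x y)" "meet r x y \<in> tree_arc r c"
    by (metis dist_self add.right_neutral mem_tree_arc_iff)+
  then have "dist r c + dist c (meet r x y) = dist r (meet r x y)"
    "dist r (meet r x y) + dist (meet r x y) c = dist r c" by (simp_all only: mem_tree_arc_iff)
  then have "dist c (meet r x y) = 0"
    using dist_commute[of c "meet r x y"] by linarith
  then show "c = meet r x y" by simp
qed

section \<open>Separability\<close>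

lemma compact_closed_subset: "B \<subseteq> A \<Longrightarrow> compact A \<Longrightarrow> closed B \<Longrightarrow> compact B"
  using compact_Int_closed[of A B] by (simp add: inf.absorb2)

lemma locally_compact_cball:
  fixes z :: "'a::metric_space"
  assumes "locally compact (UNIV :: 'a set)"
  obtains e where "0 < e" "compact (cball z e)"
proof -
  obtain u v where "open u" "compact v" "z \<in> u" "u \<subseteq> v"
    using assms[unfolded locally_def, rule_format, of UNIV z] by auto
  moreover then obtain e where "0 < e" "cball z e \<subseteq> u" by (meson open_contains_cball)
  ultimately show ?thesis
    using that[of e] compact_closed_subset[of "cball z e" v] by auto
qed

lemma compact_countable_dense:
  fixes K :: "'a::metric_space set"
  assumes "compact K"
  shows "\<exists>D. countable D \<and> K \<subseteq> closure D"
proof -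
  have "\<forall>n::nat. \<exists>k. finite k \<and> K \<subseteq> (\<Union>x\<in>k. ball x (1 / Suc n))"
    using assms[unfolded compact_eq_totally_bounded, THEN conjunct2] by simp
  from choice[OF this] obtain k where k: "\<And>n. finite (k n)"
    "\<And>n::nat. K \<subseteq> (\<Union>x\<in>k n. ball x (1 / Suc n))"
    by blast
  have "K \<subseteq> closure (\<Union>n. k n)"
  proof
    fix z assume z: "z \<in> K"
    show "z \<in> closure (\<Union>n. k n)"
      unfolding closure_approachable
    proof (intro allI impI)
      fix e :: real assume "0 < e"
      then obtain n where "1 / Suc n < e" using nat_approx_posE by blast
      moreover obtain y where "y \<in> k n" "dist y z < 1 / Suc n" using k(2)[of n] z by auto
      ultimately show "\<exists>y\<in>\<Union>n. k n. dist y z < e" by (intro bexI[of _ y]) auto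
    qed
  qed
  then show ?thesis using k by (intro exI[of _ "\<Union>n. k n"]) (auto intro: countable_finite)
qed

lemma connected_real_tree: "connected (UNIV :: 'a::real_tree set)"
proof -
  fix r :: 'a
  have "connected (\<Union>z. tree_arc r z)"
  proof (rule connected_Union)
    show "connected S" if "S \<in> range (tree_arc r)" for S
      using that by (auto simp: tree_arc_def intro!: connected_continuous_image continuous_on_geodesic)
    have "r \<in> \<Inter> (range (tree_arc r))" by (auto simp: mem_tree_arc_iff)
    then show "\<Inter> (range (tree_arc r)) \<noteq> {}" by blast
  qed
  moreover have "(\<Union>z. tree_arc r z) = UNIV" by (auto simp: mem_tree_arc_iff)
  ultimately show ?thesis by simp
qed

text \<open>A countable set that is dense in every compact ball \<open>cball d (1 / Suc n)\<close> centred at one of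
  its own points has a closure that is also open.\<close>

lemma locally_compact_connected_dense_sequence:
  assumes lc: "locally compact (UNIV :: 'a::metric_space set)" and conn: "connected (UNIV :: 'a::metric_space set)"
  obtains x :: "nat \<Rightarrow> 'a::metric_space" where "\<And>z e. 0 < e \<Longrightarrow> \<exists>n. dist (x n) z < e"
proof -
  fix r :: 'a
  have "\<forall>(d::'a) (n::nat). \<exists>D. countable D \<and> (compact (cball d (1 / Suc n)) \<longrightarrow> cball d (1 / Suc n) \<subseteq> closure D)"
  proof (intro allI)
    fix d :: 'a and n :: nat
    show "\<exists>D. countable D \<and> (compact (cball d (1 / Suc n)) \<longrightarrow> cball d (1 / Suc n) \<subseteq> closure D)"
    proof (cases "compact (cball d (1 / Suc n))")
      case True
      then show ?thesis using compact_countable_dense[OF True] by blast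
    next
      case False
      then show ?thesis by (intro exI[of _ "{}"]) simp
    qed
  qed
  then obtain E where E: "\<And>(d::'a) (n::nat). countable (E d n)"
    "\<And>d n. compact (cball d (1 / Suc n)) \<Longrightarrow> cball d (1 / Suc n) \<subseteq> closure (E d n)"
    by metis
  \<comment> \<open>Closing \<open>{r}\<close> under this operation adds countably many points at
    each of countably many stages.\<close>
  define step where "step D = D \<union> (\<Union>d\<in>D. \<Union>n. E d n)" for D
  define D where "D = (\<Union>k. (step ^^ k) {r})"
  have cD: "countable D"
  proof -
    have "countable ((step ^^ k) {r})" for k
      by (induction k) (auto simp: step_def E)
    then show ?thesis by (simp add: D_def)
  qed
  have ED: "E d n \<subseteq> D" if "d \<in> D" for d n
  proof
    fix w assume "w \<in> E d n"
    moreover have "\<exists>k. d \<in> (step ^^ k) {r}" using that unfolding D_def by (simp only: UN_iff) blast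
    then obtain k where "d \<in> (step ^^ k) {r}" ..
    ultimately have "w \<in> (step ^^ Suc k) {r}" by (auto simp: step_def)
    then show "w \<in> D" unfolding D_def by blast
  qed
  have rD: "r \<in> D" unfolding D_def by (rule UN_I[of 0]) auto
  have "open (closure D)"
    unfolding open_contains_ball
  proof
    fix z assume z: "z \<in> closure D"
    obtain e where e: "0 < e" "compact (cball z e)" using locally_compact_cball[OF lc] .
    obtain n where n: "1 / Suc n < e / 2" using e nat_approx_posE[of "e/2"] by auto
    define q :: real where "q = 1 / Suc n"
    have q: "0 < q" "q < e / 2" using n by (auto simp: q_def)
    obtain d where d: "d \<in> D" "dist d z < q / 2"
      using z q unfolding closure_approachable by (meson half_gt_zero)
    have "cball d q \<subseteq> cball z e"
    proof
      fix w assume "w \<in> cball d q"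
      then show "w \<in> cball z e" using dist_triangle[of z w d] d q by (simp add: dist_commute)
    qed
    then have "compact (cball d q)"
      using compact_closed_subset e(2) closed_cball by blast
    then have "cball d q \<subseteq> closure D"
      using E(2)[of d n] ED[OF d(1), of n] closure_mono[of "E d n" D] by (auto simp: q_def)
    moreover have "ball z (q / 2) \<subseteq> cball d q"
    proof
      fix w assume "w \<in> ball z (q / 2)"
      then show "w \<in> cball d q" using dist_triangle[of d w z] d by simp
    qed
    ultimately show "\<exists>e>0. ball z e \<subseteq> closure D" using q by (intro exI[of _ "q/2"]) auto
  qed
  then have cl: "closure D = UNIV"
    using conn rD closure_subset[of D] unfolding connected_clopen by auto
  obtain x :: "nat \<Rightarrow> 'a" where x: "range x = D"
    using range_from_nat_into[of D] cD rD by blast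
  have "\<exists>n. dist (x n) z < e" if "0 < e" for z e
    using cl that x closure_approachable[of z D] by auto
  then show ?thesis using that by blast
qed

text \<open>A point with a compact ball of radius \<open>e\<close> lies in the compact ball of
  radius \<open>1 / Suc k\<close> around some sequence point as soon as
  \<open>1 / Suc k < e / 2\<close>.\<close>

lemma locally_compact_countable_cover:
  fixes x :: "nat \<Rightarrow> 'a::metric_space"
  assumes lc: "locally compact (UNIV :: 'a set)" and x: "\<And>z e. 0 < e \<Longrightarrow> \<exists>n. dist (x n) z < e"
  obtains K :: "nat \<Rightarrow> 'a set" where "\<And>n. compact (K n)" "(\<Union>n. K n) = UNIV"
proof -
  \<comment> \<open>Balls that fail to be compact are replaced by the empty set, which keeps the
    enumeration total.\<close>
  define K where "K p = (let (n, k) = prod_decode p in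
     if compact (cball (x n) (1 / Suc k)) then cball (x n) (1 / Suc k) else {})" for p
  have "compact (K p)" for p by (auto simp: K_def split: prod.splits)
  moreover have "z \<in> (\<Union>p. K p)" for z
  proof -
    obtain e where e: "0 < e" "compact (cball z e)" using locally_compact_cball[OF lc] .
    obtain k where k: "1 / Suc k < e / 2" using e nat_approx_posE[of "e/2"] by auto
    obtain n where n: "dist (x n) z < 1 / Suc k" using x by (metis of_nat_0_less_iff zero_less_Suc zero_less_divide_1_iff)
    have "cball (x n) (1 / Suc k) \<subseteq> cball z e"
    proof
      fix w assume "w \<in> cball (x n) (1 / Suc k)"
      then show "w \<in> cball z e" using dist_triangle[of z w "x n"] n k by (simp add: dist_commute)
    qed
    then have "compact (cball (x n) (1 / Suc k))"
      using compact_closed_subset e(2) closed_cball by blast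
    then have "z \<in> K (prod_encode (n, k))" using n by (simp add: K_def)
    then show ?thesis by blast
  qed
  ultimately show ?thesis using that by blast
qed

section \<open>The length measure\<close>

lemma tree_arc_sets [measurable, simp]: "tree_arc a (b::'a::real_tree) \<in> sets borel"
  by (intro borel_closed compact_imp_closed compact_tree_arc)

lemma borel_measurable_dist_const [measurable]: "dist r \<in> borel_measurable borel"
  by (intro borel_measurable_continuous_onI continuous_intros)

lemma open_tree_arc_eq: "open_tree_arc a b = tree_arc a b - {a, b::'a::real_tree}"
  by (auto simp: mem_open_tree_arc_iff)

text \<open>Splits an arc at its branch point relative to \<open>r\<close>. The strict inequality on
  one leg leaves the branch point to the other, so that the measures of the two legs can be
  added.\<close>

lemma tree_arc_decompose:
  fixes r a b :: "'a::real_tree"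
  shows "tree_arc a b = {z \<in> tree_arc r a. gromov r a b < dist r z} \<union> {z \<in> tree_arc r b. gromov r a b \<le> dist r z}"
proof (intro set_eqI iffI)
  fix z assume z: "z \<in> tree_arc a b"
  have eq: "dist r z = gromov r z a + gromov r z b - gromov r a b"
    using z dist_commute[of z a] unfolding mem_tree_arc_iff gromov_def by (simp add: field_simps)
  have "min (gromov r z a) (gromov r z b) \<le> gromov r a b"
    using gromov_ultrametric[of r a z b] by (simp add: gromov_commute)
  moreover have "gromov r z a \<le> dist r z" "gromov r z b \<le> dist r z" by (rule gromov_le)+
  ultimately show "z \<in> {z \<in> tree_arc r a. gromov r a b < dist r z} \<union> {z \<in> tree_arc r b. gromov r a b \<le> dist r z}"
    using eq unfolding Un_iff mem_Collect_eq mem_tree_arc_root by linarith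
next
  have *: "z \<in> tree_arc a b" if "z \<in> tree_arc r a" "gromov r a b \<le> dist r z" for a b z
  proof -
    have "geodesic r a (dist r z) = z" using that by (rule_tac geodesic_dist_start)
    then have "gromov r z b = min (dist r z) (gromov r a b)"
      using gromov_geodesic[of "dist r z" r a b] that(1)
      by (metis gromov_le(2) mem_tree_arc_root zero_le_dist)
    then have "gromov r z b = gromov r a b" using that by simp
    then show ?thesis
      using that(1) dist_commute[of z a] unfolding mem_tree_arc_iff[of z a b] mem_tree_arc_root[of z r a] gromov_def
      by (simp add: field_simps)
  qed
  fix z assume "z \<in> {z \<in> tree_arc r a. gromov r a b < dist r z} \<union> {z \<in> tree_arc r b. gromov r a b \<le> dist r z}"
  then show "z \<in> tree_arc a b"
    using *[of z a b] *[of z b a] by (auto simp: tree_arc_commute[of b a] gromov_commute[of r b a])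
qed

text \<open>Cutting an arc at a height gives an arc again; this is what makes distribution functions
  of heights computable.\<close>

lemma tree_arc_down:
  fixes r y :: "'a::real_tree"
  assumes "0 \<le> t" "t \<le> dist r y"
  shows "{z \<in> tree_arc r y. dist r z \<le> t} = tree_arc r (geodesic r y t)"
proof -
  have "gromov r z (geodesic r y t) = min t (gromov r z y)" for z
    using gromov_geodesic[OF assms, of z] by (simp add: gromov_commute)
  then show ?thesis
    using gromov_le(1)[of r] by (auto simp: mem_tree_arc_root min_def split: if_splits)
      (metis gromov_le(1) order.trans linorder_linear order_antisym)+
qed

text \<open>The height above \<open>r\<close> carries \<open>M\<close>, restricted to any arc from
  \<open>r\<close>, to Lebesgue measure. This links existence and uniqueness of the length measure:
  the explicit construction has the property, it yields the lengths of all arcs, and every length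
  measure has it.\<close>

definition arc_isometric :: "'a::real_tree \<Rightarrow> 'a measure \<Rightarrow> bool" where
  "arc_isometric r M \<longleftrightarrow> sets M = sets borel \<and>
     (\<forall>y. \<forall>S\<in>sets borel. emeasure M {z \<in> tree_arc r y. dist r z \<in> S} = emeasure lborel (S \<inter> {0..dist r y}))"

lemma arc_isometric_point:
  assumes "arc_isometric r M" shows "emeasure M {z} = 0"
proof -
  have "{z} = {w \<in> tree_arc r z. dist r w \<in> {dist r z}}"
    by (auto simp: mem_tree_arc_iff)
  then have "emeasure M {z} = emeasure lborel ({dist r z} \<inter> {0..dist r z})"
    using assms unfolding arc_isometric_def by (metis borel_singleton sets.empty_sets)
  then show ?thesis by simp
qed

text \<open>The two legs occupy the heights from \<open>gromov r a b\<close> up to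
  \<open>dist r a\<close> and up to \<open>dist r b\<close>, and these lengths add up to
  \<open>dist a b\<close>.\<close>

lemma arc_isometric_tree_arc:
  assumes M: "arc_isometric r M"
  shows "emeasure M (tree_arc a b) = ennreal (dist a b)"
proof -
  let ?m = "gromov r a b"
  have sM: "sets M = sets borel" using M by (simp add: arc_isometric_def)
  have [measurable]: "{z \<in> tree_arc r a. ?m < dist r z} \<in> sets borel" "{z \<in> tree_arc r b. ?m \<le> dist r z} \<in> sets borel"
    by measurable
  have "emeasure M (tree_arc a b) = emeasure M {z \<in> tree_arc r a. ?m < dist r z} + emeasure M {z \<in> tree_arc r b. ?m \<le> dist r z}"
    unfolding tree_arc_decompose[of a b r]
  proof (rule plus_emeasure[symmetric])
    show "{z \<in> tree_arc r a. ?m < dist r z} \<inter> {z \<in> tree_arc r b. ?m \<le> dist r z} = {}"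
    proof (safe, goal_cases)
      case (1 z)
      then have "geodesic r a (dist r z) = geodesic r b (dist r z)" by (simp add: geodesic_dist_start)
      moreover have "dist r z \<le> dist r a" "dist r z \<le> dist r b"
        using 1 gromov_le(2) by (metis mem_tree_arc_root)+
      ultimately show ?case using 1 geodesic_eq_iff[of "dist r z" r a b] by simp
    qed
  qed (simp_all add: sM, measurable)
  also have "emeasure M {z \<in> tree_arc r a. ?m < dist r z} = emeasure lborel ({?m<..} \<inter> {0..dist r a})"
    using M unfolding arc_isometric_def by (auto dest!: spec[of _ a] bspec[of _ _ "{?m<..}"])
  also have "{?m<..} \<inter> {0..dist r a} = {?m<..dist r a}" using gromov_nonneg[of r a b] by auto
  also have "emeasure M {z \<in> tree_arc r b. ?m \<le> dist r z} = emeasure lborel ({?m..} \<inter> {0..dist r b})"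
    using M unfolding arc_isometric_def by (auto dest!: spec[of _ b] bspec[of _ _ "{?m..}"])
  also have "{?m..} \<inter> {0..dist r b} = {?m..dist r b}" using gromov_nonneg[of r a b] by auto
  also have "emeasure lborel {?m<..dist r a} + emeasure lborel {?m..dist r b} = ennreal (dist a b)"
    using gromov_le[of r a b] by (simp add: gromov_def flip: ennreal_plus)
  finally show ?thesis .
qed

lemma arc_isometric_open_tree_arc:
  assumes M: "arc_isometric r M"
  shows "emeasure M (open_tree_arc a b) = ennreal (dist a b)"
proof -
  have sM: "sets M = sets borel" using M by (simp add: arc_isometric_def)
  have "{a, b} \<in> null_sets M"
    using null_sets.Un[of "{a}" M "{b}"] arc_isometric_point[OF M]
    by (auto simp: null_sets_def sM insert_commute)
  then show ?thesis
    unfolding open_tree_arc_eq arc_isometric_tree_arc[OF M, symmetric]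
    by (intro emeasure_Diff_null_set) (simp_all add: sM)
qed

text \<open>A point of the skeleton is interior to an open arc whose two open parts already have the
  full length, so nothing is left for the point. All other points lie in the null complement of the
  skeleton.\<close>

lemma is_length_measure_point:
  assumes M: "is_length_measure M" shows "emeasure M {z::'a::real_tree} = 0"
proof (cases "z \<in> skeleton")
  case True
  have sM: "sets M = sets borel" using M by (simp add: is_length_measure_def)
  have open_arc: "emeasure M (open_tree_arc a b) = ennreal (dist a b)" for a b
    using M by (simp add: is_length_measure_def)
  have oM: "open_tree_arc a b \<in> sets borel" for a b :: 'a by (simp add: open_tree_arc_eq)
  obtain a b where ab: "z \<in> open_tree_arc a b" using True by (auto simp: skeleton_def)
  then have z: "dist a z + dist z b = dist a b" by (simp add: mem_open_tree_arc_iff mem_tree_arc_iff)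
  have sub: "open_tree_arc a z \<union> (open_tree_arc z b \<union> {z}) \<subseteq> open_tree_arc a b"
  proof -
    have "w \<in> open_tree_arc a b" if "w \<in> open_tree_arc a z" for w
    proof -
      have w: "dist a w + dist w z = dist a z" "w \<noteq> a" using that by (auto simp: mem_open_tree_arc_iff mem_tree_arc_iff)
      have "0 < dist z b" using ab by (auto simp: mem_open_tree_arc_iff)
      then have "dist a w + dist w b = dist a b" "dist a w < dist a b"
        using w z dist_triangle[of a b w] dist_triangle[of w b z] zero_le_dist[of w z] by linarith+
      then show ?thesis using w by (auto simp: mem_open_tree_arc_iff mem_tree_arc_iff)
    qed
    moreover have "w \<in> open_tree_arc a b" if "w \<in> open_tree_arc z b" for w
    proof -
      have w: "dist z w + dist w b = dist z b" "w \<noteq> b" using that by (auto simp: mem_open_tree_arc_iff mem_tree_arc_iff)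
      have "0 < dist a z" using ab by (auto simp: mem_open_tree_arc_iff)
      then have "dist a w + dist w b = dist a b" "dist w b < dist a b"
        using w z dist_triangle[of a b w] dist_triangle[of a w z] zero_le_dist[of z w] by linarith+
      then show ?thesis using w by (auto simp: mem_open_tree_arc_iff mem_tree_arc_iff)
    qed
    ultimately show ?thesis using ab by auto
  qed
  have disj: "open_tree_arc a z \<inter> open_tree_arc z b = {}"
  proof (safe, goal_cases)
    case (1 w)
    then have "dist a w + dist w z = dist a z" "dist z w + dist w b = dist z b" "w \<noteq> z"
      by (auto simp: mem_open_tree_arc_iff mem_tree_arc_iff)
    then have False using z dist_triangle[of a b w] zero_less_dist_iff[of w z] dist_commute[of w z] by linarith
    then show ?case ..
  qed
  have "ennreal (dist a z) + (ennreal (dist z b) + emeasure M {z}) = emeasure M (open_tree_arc a z \<union> (open_tree_arc z b \<union> {z}))"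
  proof -
    have "emeasure M (open_tree_arc z b \<union> {z}) = ennreal (dist z b) + emeasure M {z}"
      unfolding open_arc[symmetric]
      by (rule plus_emeasure[symmetric]) (use oM[of z b] in \<open>auto simp: sM mem_open_tree_arc_iff\<close>)
    moreover have "emeasure M (open_tree_arc a z \<union> (open_tree_arc z b \<union> {z}))
        = ennreal (dist a z) + emeasure M (open_tree_arc z b \<union> {z})"
      unfolding open_arc[symmetric]
      by (rule plus_emeasure[symmetric]) (use disj oM[of a z] oM[of z b] in \<open>auto simp: sM mem_open_tree_arc_iff\<close>)
    ultimately show ?thesis by simp
  qed
  also have "\<dots> \<le> ennreal (dist a b)"
    unfolding open_arc[symmetric] by (intro emeasure_mono sub) (simp add: sM oM)
  finally have "ennreal (dist a b) + emeasure M {z} \<le> ennreal (dist a b) + 0"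
    by (simp add: z[symmetric] ennreal_plus add.assoc)
  then show ?thesis
    by (simp add: ennreal_add_left_cancel_le)
next
  case False
  then have "{z} \<subseteq> - skeleton" by auto
  moreover have "- skeleton \<in> null_sets M" "sets M = sets borel" using M by (auto simp: is_length_measure_def)
  ultimately show ?thesis by (metis emeasure_mono le_zero_eq null_setsD1 null_setsD2)
qed

lemma is_length_measure_tree_arc:
  assumes M: "is_length_measure M" shows "emeasure M (tree_arc a b) = ennreal (dist a (b::'a::real_tree))"
proof -
  have sM: "sets M = sets borel" using M by (simp add: is_length_measure_def)
  have "{a, b} \<in> null_sets M"
    using null_sets.Un[of "{a}" M "{b}"] is_length_measure_point[OF M]
    by (auto simp: null_sets_def sM insert_commute)
  then have "emeasure M (tree_arc a b - {a, b}) = emeasure M (tree_arc a b)"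
    by (intro emeasure_Diff_null_set) (simp_all add: sM)
  then show ?thesis using M by (simp add: is_length_measure_def open_tree_arc_eq)
qed

text \<open>The part of an arc below height \<open>t\<close> is an arc of known length, so the
  heights have the distribution function of Lebesgue measure; finite measures on the line with equal
  distribution functions agree.\<close>

lemma is_length_measure_arc_isometric:
  fixes r :: "'a::real_tree"
  assumes M: "is_length_measure M" shows "arc_isometric r M"
  unfolding arc_isometric_def
proof (intro conjI allI ballI)
  show sM: "sets M = sets borel" using M by (simp add: is_length_measure_def)
  note [measurable_cong] = sM
  fix y :: 'a and S :: "real set" assume S[measurable]: "S \<in> sets borel"
  define M1 where "M1 = distr (density M (indicator (tree_arc r y))) borel (dist r)"
  define M2 where "M2 = density lborel (indicator {0..dist r y} :: real \<Rightarrow> ennreal)"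
  have e1: "emeasure M1 A = emeasure M {z \<in> tree_arc r y. dist r z \<in> A}" if [measurable]: "A \<in> sets borel" for A
  proof -
    have "emeasure M1 A = emeasure M (tree_arc r y \<inter> (dist r -` A \<inter> space M))"
      unfolding M1_def by (subst emeasure_distr) (auto simp: emeasure_restricted)
    also have "tree_arc r y \<inter> (dist r -` A \<inter> space M) = {z \<in> tree_arc r y. dist r z \<in> A}"
      using sets_eq_imp_space_eq[OF sM] by auto
    finally show ?thesis .
  qed
  have e2: "emeasure M2 A = emeasure lborel (A \<inter> {0..dist r y})" if [measurable]: "A \<in> sets borel" for A
    unfolding M2_def by (subst emeasure_restricted) (auto simp: Int_commute)
  have arc: "emeasure M (tree_arc r b) = ennreal (dist r b)" for b
    by (rule is_length_measure_tree_arc[OF M])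
  have "M1 = M2"
  proof (rule cdf_unique')
    show "finite_borel_measure M1"
      unfolding finite_borel_measure_def finite_borel_measure_axioms_def
    proof
      have "space M1 = UNIV" by (simp add: M1_def)
      then show "finite_measure M1" by (intro finite_measureI) (simp add: e1 arc)
      show "sets M1 = sets borel" by (simp add: M1_def)
    qed
    show "finite_borel_measure M2"
      unfolding finite_borel_measure_def finite_borel_measure_axioms_def
    proof
      have "space M2 = UNIV" by (simp add: M2_def)
      then show "finite_measure M2" by (intro finite_measureI) (simp add: e2)
      show "sets M2 = sets borel" by (simp add: M2_def)
    qed
    show "cdf M1 = cdf M2"
    proof
      fix t
      have "emeasure M1 {..t} = emeasure M2 {..t}"
      proof (cases "t < 0")
        case True
        have 1: "{z \<in> tree_arc r y. dist r z \<in> {..t}} = {}"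
          using True by (auto simp: not_le intro: less_le_trans)
        have 2: "{..t} \<inter> {0..dist r y} = {}" using True by auto
        have "emeasure M1 {..t} = 0" by (subst e1) (auto simp only: 1 emeasure_empty sets.top lborelD atMost_borel)
        moreover have "emeasure M2 {..t} = 0" by (subst e2) (auto simp only: 2 emeasure_empty atMost_borel)
        ultimately show ?thesis by simp
      next
        case False
        define u where "u = min t (dist r y)"
        have u: "0 \<le> u" "u \<le> dist r y" using False by (auto simp: u_def)
        have "{z \<in> tree_arc r y. dist r z \<le> t} = {z \<in> tree_arc r y. dist r z \<le> u}"
          using gromov_le(2)[of r _ y] by (auto simp: u_def mem_tree_arc_root) (metis gromov_le(2))
        also have "\<dots> = tree_arc r (geodesic r y u)" by (rule tree_arc_down[OF u])
        finally have "emeasure M1 {..t} = ennreal u" using u e1[of "{..t}"] by (simp add: arc dist_geodesic_start)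
        moreover have "{..t} \<inter> {0..dist r y} = {0..u}" by (auto simp: u_def)
        then have "emeasure M2 {..t} = ennreal u" using u e2[of "{..t}"] by simp
        ultimately show ?thesis by simp
      qed
      then show "cdf M1 t = cdf M2 t" by (simp add: cdf_def measure_def)
    qed
  qed
  then show "emeasure M {z \<in> tree_arc r y. dist r z \<in> S} = emeasure lborel (S \<inter> {0..dist r y})"
    using e1[of S] e2[of S] by simp
qed

text \<open>Geodesics are unspecified outside their interval. Clamping the parameter makes them
  total and Borel, as pushforward measures require.\<close>

definition clamped :: "'a::real_tree \<Rightarrow> 'a \<Rightarrow> real \<Rightarrow> 'a" where
  "clamped u v s = geodesic u v (max 0 (min s (dist u v)))"

lemma borel_measurable_clamped [measurable]: "clamped u v \<in> borel_measurable borel"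
  unfolding clamped_def
  by (intro borel_measurable_continuous_onI continuous_on_compose2[OF continuous_on_geodesic[of u v]]
      continuous_intros) auto

lemma clamped_eq: "0 \<le> s \<Longrightarrow> s \<le> dist u v \<Longrightarrow> clamped u v s = geodesic u v s"
  by (simp add: clamped_def)

lemma clamped_dist: "z \<in> tree_arc u v \<Longrightarrow> clamped u v (dist u z) = z"
proof -
  assume z: "z \<in> tree_arc u v"
  then have "dist u z \<le> dist u v" using zero_le_dist[of z v] unfolding mem_tree_arc_iff by linarith
  then show ?thesis using z by (simp add: clamped_eq geodesic_dist_start)
qed

text \<open>On an arc from \<open>r\<close> the height determines the point, so every Borel subset
  of the arc is the preimage of a set of heights.\<close>

lemma arc_isometric_subset:
  assumes M: "arc_isometric r M" and B: "B \<in> sets borel" "B \<subseteq> tree_arc r y"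
  shows "emeasure M B = emeasure lborel ((clamped r y -` B) \<inter> {0..dist r y})"
proof -
  have [measurable]: "clamped r y -` B \<in> sets borel"
    using measurable_sets[OF borel_measurable_clamped B(1)] by simp
  have "B = {z \<in> tree_arc r y. dist r z \<in> clamped r y -` B}"
    using B(2) by (auto simp: clamped_dist)
  then show ?thesis using M unfolding arc_isometric_def by (metis \<open>clamped r y -` B \<in> sets borel\<close>)
qed

text \<open>The heights at which the arc to \<open>x n\<close> has left the arcs to all
  predecessors. The strict inequalities leave branching heights to an earlier arc and assign the
  root to none.\<close>

definition arc_index :: "'a::real_tree \<Rightarrow> (nat \<Rightarrow> 'a) \<Rightarrow> nat \<Rightarrow> real set" where
  "arc_index r x n = {s. 0 < s \<and> s \<le> dist r (x n) \<and> (\<forall>k<n. gromov r (x n) (x k) < s)}"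

lemma arc_index_sets [measurable, simp]: "arc_index r x n \<in> sets borel"
proof -
  have "{s \<in> space borel. 0 < s \<and> s \<le> dist r (x n) \<and> (\<forall>k\<in>{..<n}. gromov r (x n) (x k) < s)} \<in> sets borel"
    by measurable
  then show ?thesis by (simp add: arc_index_def lessThan_def)
qed

text \<open>The arcs from the root to the points of a dense sequence, each with the part covered by
  its predecessors removed, carry one copy of Lebesgue measure each.\<close>

definition arc_sum :: "'a::real_tree \<Rightarrow> (nat \<Rightarrow> 'a) \<Rightarrow> 'a measure" where
  "arc_sum r x = distr (restrict_space (count_space UNIV \<Otimes>\<^sub>M lborel) (SIGMA n:UNIV. arc_index r x n))
     borel (\<lambda>(n, s). clamped r (x n) s)"

lemma emeasure_arc_sum:
  assumes [measurable]: "A \<in> sets borel"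
  shows "emeasure (arc_sum r x) A = (\<Sum>n. emeasure lborel (arc_index r x n \<inter> clamped r (x n) -` A))"
proof -
  have \<Omega>: "(SIGMA n:UNIV. arc_index r x n) \<in> sets (count_space UNIV \<Otimes>\<^sub>M lborel)"
  proof -
    have "(SIGMA n:UNIV. arc_index r x n) = (\<Union>n. {n} \<times> arc_index r x n)" by auto
    also have "\<dots> \<in> sets (count_space UNIV \<Otimes>\<^sub>M lborel)"
      by (intro sets.countable_UN' pair_measureI) auto
    finally show ?thesis .
  qed
  have m: "(\<lambda>(n, s). clamped r (x n) s) \<in> count_space UNIV \<Otimes>\<^sub>M lborel \<rightarrow>\<^sub>M borel"
    by (rule measurable_pair_measure_countable1) auto
  have pre: "(\<lambda>(n, s). clamped r (x n) s) -` A \<inter> (SIGMA n:UNIV. arc_index r x n) \<in> sets (count_space UNIV \<Otimes>\<^sub>M lborel)"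
    using sets.Int[OF measurable_sets[OF m assms] \<Omega>] by (simp add: space_pair_measure)
  have "emeasure (arc_sum r x) A = emeasure (count_space UNIV \<Otimes>\<^sub>M lborel)
      ((\<lambda>(n, s). clamped r (x n) s) -` A \<inter> (SIGMA n:UNIV. arc_index r x n))"
    unfolding arc_sum_def using \<Omega>
    by (subst emeasure_distr)
       (auto simp: space_restrict_space space_pair_measure emeasure_restrict_space intro: measurable_restrict_space1[OF m])
  also have "\<dots> = (\<integral>\<^sup>+n. emeasure lborel (Pair n -` ((\<lambda>(n, s). clamped r (x n) s) -` A \<inter> (SIGMA n:UNIV. arc_index r x n))) \<partial>count_space UNIV)"
    by (rule lborel.emeasure_pair_measure_alt[OF pre])
  also have "(\<lambda>n. Pair n -` ((\<lambda>(n, s). clamped r (x n) s) -` A \<inter> (SIGMA n:UNIV. arc_index r x n)))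
      = (\<lambda>n. arc_index r x n \<inter> clamped r (x n) -` A)"
    by auto
  finally show ?thesis by (simp add: nn_integral_count_space_nat)
qed

lemma sets_arc_sum [simp]: "sets (arc_sum r x) = sets borel" and space_arc_sum [simp]: "space (arc_sum r x) = UNIV"
  by (simp_all add: arc_sum_def)

section \<open>Existence and uniqueness of the length measure\<close>

context
  fixes r :: "'a::real_tree" and x :: "nat \<Rightarrow> 'a"
  assumes dense: "\<And>z e. 0 < e \<Longrightarrow> \<exists>n. dist (x n) z < e"
begin

text \<open>Piece \<open>n\<close> meets the arc to \<open>y\<close> at the heights in
  \<open>E n\<close>. Ultrametricity makes these sets disjoint, and density puts every height
  strictly between 0 and \<open>dist r y\<close> that lies in \<open>S\<close> into one of
  them.\<close>

lemma arc_isometric_arc_sum: "arc_isometric r (arc_sum r x)"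
  unfolding arc_isometric_def
proof (intro conjI allI ballI)
  fix y S assume S[measurable]: "S \<in> sets (borel :: real measure)"
  define A where "A = {z \<in> tree_arc r y. dist r z \<in> S}"
  have [measurable]: "A \<in> sets borel" unfolding A_def by measurable
  define E where "E n = arc_index r x n \<inter> S \<inter> {..gromov r (x n) y}" for n
  have "arc_index r x n \<inter> clamped r (x n) -` A = E n" for n
  proof -
    have "clamped r (x n) s \<in> A \<longleftrightarrow> s \<in> S \<and> s \<le> gromov r (x n) y" if "s \<in> arc_index r x n" for s
    proof -
      have s: "0 \<le> s" "s \<le> dist r (x n)" using that by (auto simp: arc_index_def)
      then show ?thesis
        by (auto simp: A_def clamped_eq mem_tree_arc_root gromov_geodesic dist_geodesic_start min_def)
    qed
    then show ?thesis by (auto simp: E_def)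
  qed
  then have "emeasure (arc_sum r x) A = (\<Sum>n. emeasure lborel (E n))"
    by (simp add: emeasure_arc_sum)
  also have "\<dots> = emeasure lborel (\<Union>n. E n)"
  proof (rule suminf_emeasure)
    show "range E \<subseteq> sets lborel" by (auto simp: E_def)
    have "E n \<inter> E k = {}" if "k < n" for n k
    proof (safe, goal_cases)
      case (1 s)
      then show ?case
        using gromov_ultrametric[of r "x n" y "x k"] that
        by (auto simp: E_def arc_index_def gromov_commute[of r "x k" y] dest!: spec[of _ k])
    qed
    then show "disjoint_family E"
      unfolding disjoint_family_on_def by (metis Int_commute linorder_neqE_nat)
  qed
  also have "\<dots> = emeasure lborel (S \<inter> {0..dist r y})"
  proof (rule emeasure_eq_AE)
    have iff: "s \<in> (\<Union>n. E n) \<longleftrightarrow> s \<in> S \<inter> {0..dist r y}" if s: "s \<noteq> 0" "s \<noteq> dist r y" for s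
    proof
      assume "s \<in> (\<Union>n. E n)"
      then obtain n where "s \<in> E n" by blast
      then show "s \<in> S \<inter> {0..dist r y}"
        using gromov_le(2)[of r "x n" y] by (auto simp: E_def arc_index_def)
    next
      assume sS: "s \<in> S \<inter> {0..dist r y}"
      then have "0 < dist r y - s" using s by auto
      then obtain n0 where "dist (x n0) y < dist r y - s" using dense by blast
      then have n0: "s \<le> gromov r (x n0) y"
        using gromov_ge[of r y "x n0"] by (simp add: dist_commute gromov_commute)
      \<comment> \<open>The first point of the sequence whose arc agrees with the arc to
        \<open>y\<close> up to height \<open>s\<close>. A predecessor sharing its arc with
        \<open>x n\<close> that far would agree with \<open>y\<close> as well, by
        ultrametricity.\<close>
      define n where "n = (LEAST n. s \<le> gromov r (x n) y)"
      have n: "s \<le> gromov r (x n) y" unfolding n_def by (rule LeastI, rule n0)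
      have "gromov r (x n) (x k) < s" if "k < n" for k
      proof (rule ccontr)
        assume "\<not> gromov r (x n) (x k) < s"
        then have "s \<le> gromov r (x k) y"
          using gromov_ultrametric[of r "x k" "x n" y] n by (simp add: gromov_commute)
        then have "n \<le> k" unfolding n_def by (rule Least_le)
        then show False using that by simp
      qed
      then have "s \<in> E n"
        using n s sS gromov_le(1)[of r "x n" y] by (auto simp: E_def arc_index_def)
      then show "s \<in> (\<Union>n. E n)" by blast
    qed
    show "AE s in lborel. s \<in> (\<Union>n. E n) \<longleftrightarrow> s \<in> S \<inter> {0..dist r y}"
      using AE_lborel_singleton[of 0] AE_lborel_singleton[of "dist r y"] by eventually_elim (rule iff)
  qed (auto simp: E_def)
  finally show "emeasure (arc_sum r x) {z \<in> tree_arc r y. dist r z \<in> S} = emeasure lborel (S \<inter> {0..dist r y})"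
    by (simp add: A_def)
qed simp

text \<open>An interior point of an arc lies strictly below some \<open>c\<close> as seen from
  \<open>r\<close>, and a sequence point close to \<open>c\<close> has its arc through it. Countably
  many arcs thus exhaust the skeleton up to the root, which also shows it to be Borel.\<close>

lemma skeleton_subset: "skeleton - {r} \<subseteq> (\<Union>n. open_tree_arc r (x n))"
proof
  fix z assume z: "z \<in> skeleton - {r}"
  then obtain a b where ab: "z \<in> open_tree_arc a b" by (auto simp: skeleton_def)
  then have "z \<in> tree_arc a b" "z \<noteq> a" "z \<noteq> b" by (auto simp: mem_open_tree_arc_iff)
  then obtain c where c: "z \<in> tree_arc r c" "z \<noteq> c"
    unfolding tree_arc_decompose[of a b r] by auto
  then have "0 < dist r c - dist r z"
    using zero_less_dist_iff[of z c] unfolding mem_tree_arc_iff by linarith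
  then obtain n where "dist (x n) c < dist r c - dist r z" using dense by blast
  then have lt: "dist r z < gromov r c (x n)"
    using gromov_ge[of r c "x n"] by (simp add: dist_commute)
  then have "gromov r z (x n) = dist r z"
    using gromov_ultrametric[of r z c "x n"] c(1) gromov_le(1)[of r z "x n"] by (simp add: mem_tree_arc_root)
  moreover have "z \<noteq> x n" using lt gromov_le(2)[of r c "x n"] by auto
  ultimately show "z \<in> (\<Union>n. open_tree_arc r (x n))"
    using z by (auto simp: mem_open_tree_arc_iff mem_tree_arc_root)
qed

lemma skeleton_sets: "skeleton \<in> sets (borel :: 'a measure)"
proof -
  have "skeleton = (\<Union>n. open_tree_arc r (x n)) \<union> (skeleton \<inter> {r})"
    using skeleton_subset by (auto simp: skeleton_def)
  also have "\<dots> \<in> sets borel"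
    by (intro sets.Un sets.countable_UN' borel_closed[of "skeleton \<inter> {r}"] finite_imp_closed)
      (auto simp: open_tree_arc_eq)
  finally show ?thesis .
qed

lemma is_length_measure_arc_sum: "is_length_measure (arc_sum r x)"
  unfolding is_length_measure_def
proof (intro conjI allI)
  show "emeasure (arc_sum r x) (open_tree_arc a b) = ennreal (dist a b)" for a b
    by (rule arc_isometric_open_tree_arc[OF arc_isometric_arc_sum])
  have sk: "- skeleton \<in> sets (borel :: 'a measure)"
    using sets.compl_sets[OF skeleton_sets] by (simp add: Compl_eq_Diff_UNIV)
  have "emeasure lborel (arc_index r x n \<inter> clamped r (x n) -` (- skeleton)) = 0" for n
  proof -
    \<comment> \<open>All points of a piece except its top lie on the open arc to
      \<open>x n\<close>, so each piece leaves the skeleton at one height at most.\<close>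
    have "s = dist r (x n)" if "s \<in> arc_index r x n" "clamped r (x n) s \<notin> skeleton" for s
    proof (rule ccontr)
      assume ne: "s \<noteq> dist r (x n)"
      have s: "0 < s" "s \<le> dist r (x n)" using that by (auto simp: arc_index_def)
      then have "clamped r (x n) s \<in> open_tree_arc r (x n)"
        using ne by (auto simp: clamped_eq open_tree_arc_def)
      then show False using that by (auto simp: skeleton_def)
    qed
    then have "arc_index r x n \<inter> clamped r (x n) -` (- skeleton) \<subseteq> {dist r (x n)}" by auto
    then have "emeasure lborel (arc_index r x n \<inter> clamped r (x n) -` (- skeleton)) \<le> emeasure lborel {dist r (x n)}"
      by (intro emeasure_mono) auto
    then show ?thesis by simp
  qed
  then show null: "- skeleton \<in> null_sets (arc_sum r x)"
    using sk by (simp add: null_sets_def emeasure_arc_sum)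
  show "sigma_finite_measure (arc_sum r x)"
  proof
    let ?C = "insert (- skeleton) (insert {r} (range (\<lambda>n. tree_arc r (x n))))"
    have "countable ?C" "?C \<subseteq> sets (arc_sum r x)" using sk by auto
    moreover have "\<Union>?C = space (arc_sum r x)"
      using skeleton_subset by (auto simp: mem_open_tree_arc_iff)
    moreover have "\<forall>a\<in>?C. emeasure (arc_sum r x) a \<noteq> \<infinity>"
      using null arc_isometric_point[OF arc_isometric_arc_sum] arc_isometric_tree_arc[OF arc_isometric_arc_sum]
      by auto
    ultimately show "\<exists>A. countable A \<and> A \<subseteq> sets (arc_sum r x) \<and> \<Union>A = space (arc_sum r x)
        \<and> (\<forall>a\<in>A. emeasure (arc_sum r x) a \<noteq> \<infinity>)"
      by (intro exI[of _ ?C]) blast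
  qed
qed simp

lemma AE_length_measure_arcs:
  assumes M: "is_length_measure M" shows "AE z in M. z \<in> (\<Union>n. tree_arc r (x n))"
proof (rule AE_I')
  have sM: "sets M = sets borel" "- skeleton \<in> null_sets M" using M by (auto simp: is_length_measure_def)
  have "{r} \<in> null_sets M" using is_length_measure_point[OF M] by (simp add: null_sets_def sM)
  then show "- skeleton \<union> {r} \<in> null_sets M" using sM by (intro null_sets.Un)
  show "{z \<in> space M. z \<notin> (\<Union>n. tree_arc r (x n))} \<subseteq> - skeleton \<union> {r}"
    using skeleton_subset by (auto simp: mem_open_tree_arc_iff)
qed

text \<open>A Borel set is cut, up to a null set, into countably many disjoint parts of arcs from
  \<open>r\<close>. On each part both candidates are determined by Lebesgue measure.\<close>

lemma is_length_measure_unique: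
  fixes M N :: "'a measure"
  assumes M: "is_length_measure M" and N: "is_length_measure N"
  shows "M = N"
proof (rule measure_eqI)
  show sMN: "sets M = sets N" using M N by (simp add: is_length_measure_def)
  fix A assume "A \<in> sets M"
  then have A[measurable]: "A \<in> sets borel" using M by (simp add: is_length_measure_def)
  define J where "J n = A \<inter> disjointed (\<lambda>n. tree_arc r (x n)) n" for n
  have "range (disjointed (\<lambda>n. tree_arc r (x n))) \<subseteq> sets borel"
    by (rule sets.range_disjointed_sets) (simp add: image_subset_iff)
  then have "disjointed (\<lambda>n. tree_arc r (x n)) n \<in> sets borel" for n by (simp add: image_subset_iff)
  then have J: "J n \<in> sets borel" for n unfolding J_def by (intro sets.Int A)
  have J': "J n \<subseteq> tree_arc r (x n)" for n
    using disjointed_subset[of "\<lambda>n. tree_arc r (x n)" n] unfolding J_def by (rule le_infI2)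
  have dJ: "disjoint_family J"
    unfolding disjoint_family_on_def
  proof (intro ballI impI)
    fix m n :: nat assume "m \<noteq> n"
    then have "disjointed (\<lambda>n. tree_arc r (x n)) m \<inter> disjointed (\<lambda>n. tree_arc r (x n)) n = {}"
      using disjoint_family_disjointed[of "\<lambda>n. tree_arc r (x n)"] by (simp add: disjoint_family_on_def)
    then show "J m \<inter> J n = {}" by (auto simp: J_def)
  qed
  have eq: "emeasure K A = (\<Sum>n. emeasure lborel (clamped r (x n) -` J n \<inter> {0..dist r (x n)}))" if K: "is_length_measure K" for K
  proof -
    have sK: "sets K = sets borel" using K by (simp add: is_length_measure_def)
    have "emeasure K A = emeasure K (A \<inter> (\<Union>n. tree_arc r (x n)))"
      using AE_length_measure_arcs[OF K] by (intro emeasure_eq_AE) (auto simp: sK)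
    also have "A \<inter> (\<Union>n. tree_arc r (x n)) = (\<Union>n. J n)"
    proof -
      have "(\<Union>n. J n) = A \<inter> (\<Union>n. disjointed (\<lambda>n. tree_arc r (x n)) n)" by (auto simp: J_def)
      then show ?thesis by (simp only: UN_disjointed_eq)
    qed
    also have "emeasure K \<dots> = (\<Sum>n. emeasure K (J n))"
      using J dJ by (intro suminf_emeasure[symmetric]) (simp_all add: sK image_subset_iff)
    finally show ?thesis
      using arc_isometric_subset[OF is_length_measure_arc_isometric[OF K] J J'] by simp
  qed
  show "emeasure M A = emeasure N A" using eq[OF M] eq[OF N] by simp
qed

lemma is_length_measure_length_measure_aux: "is_length_measure (length_measure :: 'a measure)"
  unfolding length_measure_def
  by (rule theI[of _ "arc_sum r x"]) (auto intro: is_length_measure_arc_sum is_length_measure_unique)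

end

lemma is_length_measure_length_measure:
  assumes "locally compact (UNIV :: 'a::real_tree set)"
  shows "is_length_measure (length_measure :: 'a measure)"
proof -
  obtain x :: "nat \<Rightarrow> 'a" where "\<And>z e. 0 < e \<Longrightarrow> \<exists>n. dist (x n) z < e"
    using locally_compact_connected_dense_sequence[OF assms connected_real_tree] by metis
  then show ?thesis by (rule is_length_measure_length_measure_aux)
qed

section \<open>Gradients\<close>

lemma enn2real_eq_finiteD: "enn2real a = enn2real b \<Longrightarrow> a \<noteq> \<infinity> \<Longrightarrow> b \<noteq> \<infinity> \<Longrightarrow> a = b"
  by (cases a; cases b) auto

text \<open>Vanishing integrals over all initial arcs say that the positive and the negative part of
  \<open>g\<close>, pushed to heights, have the same distribution function and so are the same
  measure. Over the heights where \<open>g\<close> is positive the negative part has no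
  mass.\<close>

lemma arc_integral_zero_AE_nonpos:
  fixes r :: "'a::real_tree"
  assumes M: "sets M = sets borel" and g[measurable]: "g \<in> borel_measurable borel"
    and int: "set_integrable M (tree_arc r y) g"
    and zero: "\<And>z. z \<in> tree_arc r y \<Longrightarrow> (LINT w:tree_arc r z|M. g w) = (0::real)"
  shows "AE z in M. z \<in> tree_arc r y \<longrightarrow> g z \<le> 0"
proof -
  define D where "D h = distr (density M (\<lambda>z. ennreal (h z) * indicator (tree_arc r y) z)) borel (dist r)" for h
  have eD: "emeasure (D h) A = (\<integral>\<^sup>+z. ennreal (h z) * indicator {z \<in> tree_arc r y. dist r z \<in> A} z \<partial>M)"
    if [measurable]: "A \<in> sets borel" "h \<in> borel_measurable borel" for A h
  proof -
    have "dist r -` A \<in> sets M"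
      using measurable_sets[OF borel_measurable_dist_const that(1), of r] by (simp add: M)
    note A = this
    have sp: "space M = UNIV" using sets_eq_imp_space_eq[OF M] by simp
    have h: "(\<lambda>z. ennreal (h z) * indicator (tree_arc r y) z) \<in> borel_measurable M"
      unfolding measurable_cong_sets[OF M refl] by measurable
    have "dist r \<in> borel_measurable M"
      unfolding measurable_cong_sets[OF M refl] by (rule borel_measurable_dist_const)
    then have "emeasure (D h) A = emeasure (density M (\<lambda>z. ennreal (h z) * indicator (tree_arc r y) z)) (dist r -` A)"
      unfolding D_def by (subst emeasure_distr) (simp_all add: sp that(1))
    also have "\<dots> = (\<integral>\<^sup>+z. ennreal (h z) * indicator (tree_arc r y) z * indicator (dist r -` A) z \<partial>M)"
      by (rule emeasure_density[OF h A])
    also have "\<dots> = (\<integral>\<^sup>+z. ennreal (h z) * indicator {z \<in> tree_arc r y. dist r z \<in> A} z \<partial>M)"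
      by (intro nn_integral_cong) (simp add: indicator_def)
    finally show ?thesis .
  qed
  have intz: "set_integrable M (tree_arc r z) g" if "z \<in> tree_arc r y" for z
  proof (rule set_integrable_subset[OF int])
    have "dist r z \<le> dist r y" using that gromov_le(2)[of r z y] by (simp add: mem_tree_arc_root)
    then have "{w \<in> tree_arc r y. dist r w \<le> dist r z} = tree_arc r z"
      using tree_arc_down[of "dist r z" r y] geodesic_dist_start[OF that] by simp
    then show "tree_arc r z \<subseteq> tree_arc r y" by blast
  qed (simp add: M)
  have bal: "(\<integral>\<^sup>+w. ennreal (g w) * indicator (tree_arc r z) w \<partial>M)
      = (\<integral>\<^sup>+w. ennreal (- g w) * indicator (tree_arc r z) w \<partial>M)"
    and fin: "(\<integral>\<^sup>+w. ennreal (g w) * indicator (tree_arc r z) w \<partial>M) < \<infinity>" if "z \<in> tree_arc r y" for z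
  proof -
    have i: "integrable M (\<lambda>w. indicator (tree_arc r z) w * g w)"
      using intz[OF that] by (simp add: set_integrable_def)
    have e: "(\<integral>\<^sup>+w. ennreal (indicator (tree_arc r z) w * g w) \<partial>M) = (\<integral>\<^sup>+w. ennreal (g w) * indicator (tree_arc r z) w \<partial>M)"
      "(\<integral>\<^sup>+w. ennreal (- (indicator (tree_arc r z) w * g w)) \<partial>M) = (\<integral>\<^sup>+w. ennreal (- g w) * indicator (tree_arc r z) w \<partial>M)"
      by (rule nn_integral_cong, simp add: indicator_def)+
    have f: "(\<integral>\<^sup>+w. ennreal (g w) * indicator (tree_arc r z) w \<partial>M) \<noteq> \<infinity>"
       "(\<integral>\<^sup>+w. ennreal (- g w) * indicator (tree_arc r z) w \<partial>M) \<noteq> \<infinity>"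
      using i unfolding real_integrable_def e by auto
    then show "(\<integral>\<^sup>+w. ennreal (g w) * indicator (tree_arc r z) w \<partial>M) < \<infinity>" by (simp add: less_top)
    have "(LINT w|M. indicator (tree_arc r z) w * g w) = 0"
      using zero[OF that] by (simp add: set_lebesgue_integral_def)
    then have "enn2real (\<integral>\<^sup>+w. ennreal (g w) * indicator (tree_arc r z) w \<partial>M)
      = enn2real (\<integral>\<^sup>+w. ennreal (- g w) * indicator (tree_arc r z) w \<partial>M)"
      unfolding real_lebesgue_integral_def[OF i] e by simp
    then show "(\<integral>\<^sup>+w. ennreal (g w) * indicator (tree_arc r z) w \<partial>M)
      = (\<integral>\<^sup>+w. ennreal (- g w) * indicator (tree_arc r z) w \<partial>M)"
      using f by (intro enn2real_eq_finiteD)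
  qed
  have y: "y \<in> tree_arc r y" by (simp add: mem_tree_arc_iff)
  have fb: "finite_borel_measure (D h)" if [measurable]: "h \<in> borel_measurable borel"
    and f: "(\<integral>\<^sup>+w. ennreal (h w) * indicator (tree_arc r y) w \<partial>M) < \<infinity>" for h
  proof (intro finite_borel_measure.intro finite_borel_measure_axioms.intro)
    have "space (D h) = UNIV" by (simp add: D_def)
    then show "finite_measure (D h)" using f by (intro finite_measureI) (simp add: eD)
    show "sets (D h) = sets borel" by (simp add: D_def)
  qed
  have "D g = D (\<lambda>z. - g z)"
  proof (rule cdf_unique'[OF fb fb])
    show "cdf (D g) = cdf (D (\<lambda>z. - g z))"
    proof
      fix t
      have "emeasure (D g) {..t} = emeasure (D (\<lambda>z. - g z)) {..t}"
      proof (cases "t < 0")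
        case True
        have "{z \<in> tree_arc r y. dist r z \<in> {..t}} = {}"
          using True by (auto simp: not_le intro: less_le_trans)
        then show ?thesis by (simp add: eD)
      next
        case False
        define u where "u = min t (dist r y)"
        have u: "0 \<le> u" "u \<le> dist r y" using False by (auto simp: u_def)
        have "{z \<in> tree_arc r y. dist r z \<in> {..t}} = {z \<in> tree_arc r y. dist r z \<le> u}"
          using gromov_le(2)[of r _ y] by (auto simp: u_def mem_tree_arc_root) (metis gromov_le(2))
        also have "\<dots> = tree_arc r (geodesic r y u)" by (rule tree_arc_down[OF u])
        finally have s: "{z \<in> tree_arc r y. dist r z \<in> {..t}} = tree_arc r (geodesic r y u)" .
        show ?thesis using bal[OF geodesic_in_tree_arc[OF u]] eD[of "{..t}" g] eD[of "{..t}" "\<lambda>z. - g z"] by (simp add: s[unfolded atMost_iff])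
      qed
      then show "cdf (D g) t = cdf (D (\<lambda>z. - g z)) t" by (simp add: cdf_def measure_def)
    qed
  qed (use fin[OF y] bal[OF y] in auto)
  \<comment> \<open>The heights of the points with \<open>0 < g\<close>, decoded through
    \<open>clamped\<close>: on the arc, \<open>dist r z \<in> S\<close> means
    \<open>0 < g z\<close>.\<close>
  moreover define S where "S = clamped r y -` {z. 0 < g z}"
  have [measurable]: "S \<in> sets borel"
    using measurable_sets[OF borel_measurable_clamped, of "{z. 0 < g z}" r y] unfolding S_def by simp
  have "emeasure (D (\<lambda>z. - g z)) S = (\<integral>\<^sup>+z. 0 \<partial>M)"
    unfolding eD[OF \<open>S \<in> sets borel\<close> borel_measurable_uminus[OF g]]
  proof (intro nn_integral_cong)
    fix z
    have "g z > 0" if "z \<in> tree_arc r y" "dist r z \<in> S"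
      using that by (simp add: S_def clamped_dist)
    then show "ennreal (- g z) * indicator {z \<in> tree_arc r y. dist r z \<in> S} z = 0"
      by (cases "z \<in> tree_arc r y \<and> dist r z \<in> S") (simp_all add: ennreal_neg)
  qed
  ultimately have 0: "emeasure (D g) S = 0" by simp
  have "AE z in M. ennreal (g z) * indicator {z \<in> tree_arc r y. dist r z \<in> S} z = 0"
  proof (rule nn_integral_0_iff_AE[THEN iffD1])
    have "{z \<in> tree_arc r y. dist r z \<in> S} \<in> sets borel" by measurable
    then show "(\<lambda>z. ennreal (g z) * indicator {z \<in> tree_arc r y. dist r z \<in> S} z) \<in> borel_measurable M"
      unfolding measurable_cong_sets[OF M refl] by measurable
    show "(\<integral>\<^sup>+z. ennreal (g z) * indicator {z \<in> tree_arc r y. dist r z \<in> S} z \<partial>M) = 0"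
      using 0 by (simp only: eD[OF \<open>S \<in> sets borel\<close> g])
  qed
  then show ?thesis
  proof (eventually_elim, intro impI)
    fix z assume 1: "ennreal (g z) * indicator {z \<in> tree_arc r y. dist r z \<in> S} z = 0" "z \<in> tree_arc r y"
    then have "dist r z \<in> S \<longleftrightarrow> 0 < g z" by (simp add: S_def clamped_dist)
    then show "g z \<le> 0" using 1 by (cases "0 < g z") (simp_all add: ennreal_eq_0_iff not_less)
  qed
qed

lemma arc_integral_zero_AE:
  fixes r :: "'a::real_tree"
  assumes M: "sets M = sets borel" and g: "g \<in> borel_measurable borel"
    and int: "set_integrable M (tree_arc r y) g"
    and zero: "\<And>z. z \<in> tree_arc r y \<Longrightarrow> (LINT w:tree_arc r z|M. g w) = (0::real)"
  shows "AE z in M. z \<in> tree_arc r y \<longrightarrow> g z = 0"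
proof -
  have "AE z in M. z \<in> tree_arc r y \<longrightarrow> - g z \<le> 0"
  proof (rule arc_integral_zero_AE_nonpos[OF M])
    show "(\<lambda>z. - g z) \<in> borel_measurable borel" using g by (rule borel_measurable_uminus)
    show "set_integrable M (tree_arc r y) (\<lambda>z. - g z)" using int by (simp add: set_integrable_def)
    show "(LINT w:tree_arc r z|M. - g w) = 0" if "z \<in> tree_arc r y" for z
      using zero[OF that] by (simp add: set_lebesgue_integral_def)
  qed
  moreover have "AE z in M. z \<in> tree_arc r y \<longrightarrow> g z \<le> 0"
    using arc_integral_zero_AE_nonpos[OF M g int zero] .
  ultimately show ?thesis by eventually_elim auto
qed

section \<open>Uniqueness of gradients and the estimate along arcs\<close>

context
  fixes L :: "'a::real_tree measure"
  assumes lm: "is_length_measure L" and L_eq: "length_measure = L"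
begin

lemma sets_L: "sets L = sets borel"
  using lm by (simp add: is_length_measure_def)

lemma set_integral_point: "(LINT z:tree_arc r r|L. g z) = (0::real)"
proof -
  have "tree_arc r r = {r}" by (auto simp: mem_tree_arc_iff dist_commute)
  moreover have "AE z in L. z \<notin> {r}"
    using is_length_measure_point[OF lm, of r] by (intro AE_not_in) (simp add: null_sets_def sets_L)
  then have "AE z in L. indicator {r} z *\<^sub>R g z = 0" by (rule eventually_mono) simp
  ultimately show ?thesis
    unfolding set_lebesgue_integral_def by (simp add: integral_eq_zero_AE)
qed

lemma meet_root [simp]: "meet r r z = (r :: 'a)" "meet r z r = r"
  using gromov_le[of r r z] gromov_le[of r z r] gromov_nonneg[of r r z] gromov_nonneg[of r z r]
  by (simp_all add: meet_def)

lemma tree_integral_root: "tree_integral r r z g = (LINT w:tree_arc r z|L. g w)"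
  unfolding tree_integral_def branch_point_eq L_eq by (simp add: set_integral_point)

text \<open>Both gradients have the same integrals over arcs from the root, so they agree a.e. on
  each such arc, and the arcs to a dense sequence cover almost everything.\<close>

lemma is_gradient_unique:
  fixes x :: "nat \<Rightarrow> 'a"
  assumes dense: "\<And>z e. 0 < e \<Longrightarrow> \<exists>n. dist (x n) z < e"
    and g1: "is_gradient r f g1" and g2: "is_gradient r f g2"
  shows "AE z in L. g1 z = g2 z"
proof -
  have "AE z in L. \<forall>n. z \<in> tree_arc r (x n) \<longrightarrow> g1 z - g2 z = 0"
  proof (intro AE_all_countable[THEN iffD2] allI arc_integral_zero_AE[OF sets_L])
    fix n
    have m: "g1 \<in> borel_measurable borel" "g2 \<in> borel_measurable borel"
      and i: "set_integrable L (tree_arc a b) g1" "set_integrable L (tree_arc a b) g2" for a b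
      using g1 g2 by (auto simp: is_gradient_def L_eq)
    show "(\<lambda>z. g1 z - g2 z) \<in> borel_measurable borel" using m by (rule borel_measurable_diff)
    show "set_integrable L (tree_arc r (x n)) (\<lambda>z. g1 z - g2 z)" using i by (rule set_integral_diff)
    fix z
    have "f z - f r = tree_integral r r z g1" using g1 unfolding is_gradient_def by blast
    moreover have "f z - f r = tree_integral r r z g2" using g2 unfolding is_gradient_def by blast
    ultimately have "(LINT w:tree_arc r z|L. g1 w) = f z - f r" "(LINT w:tree_arc r z|L. g2 w) = f z - f r"
      by (simp_all only: tree_integral_root)
    then show "(LINT w:tree_arc r z|L. g1 w - g2 w) = 0"
      using set_integral_diff(2)[OF i] by simp
  qed
  moreover have "AE z in L. z \<in> (\<Union>n. tree_arc r (x n))"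
    by (rule AE_length_measure_arcs[OF dense lm])
  ultimately show ?thesis by eventually_elim auto
qed

text \<open>Cauchy-Schwarz through the polynomial
  \<open>G - 2 * t * I + t\<^sup>2 * dist a b\<close>, which is nonnegative for every
  \<open>t\<close> and is evaluated at its minimum \<open>t = I / dist a b\<close>.\<close>

lemma arc_integral_square_le:
  assumes g: "g \<in> borel_measurable borel" "integrable L (\<lambda>z. (g z)\<^sup>2)"
    and int: "set_integrable L (tree_arc a b) g"
  shows "(LINT z:tree_arc a b|L. g z)\<^sup>2 \<le> dist a b * (LINT z|L. (g z)\<^sup>2)"
proof -
  define S where "S = tree_arc a b"
  have S: "S \<in> sets L" "emeasure L S = ennreal (dist a b)"
    using is_length_measure_tree_arc[OF lm] by (simp_all add: S_def sets_L)
  then have mS: "measure L S = dist a b" by (simp add: measure_def)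
  define I where "I = (LINT z:S|L. g z)"
  define G where "G = (LINT z|L. (g z)\<^sup>2)"
  have i1: "integrable L (\<lambda>z. indicator S z * g z)"
    using int by (simp add: S_def set_integrable_def)
  have i2: "integrable L (indicator S :: 'a \<Rightarrow> real)" using S by (simp add: integrable_indicator_iff)
  have poly: "0 \<le> G - 2 * t * I + t\<^sup>2 * dist a b" for t
  proof -
    have "0 \<le> (LINT z|L. (g z)\<^sup>2 - (2 * t) * (indicator S z * g z) + t\<^sup>2 * indicator S z)"
    proof (rule Bochner_Integration.integral_nonneg)
      fix z
      have "0 \<le> (g z - t)\<^sup>2" by simp
      then have "0 \<le> (g z)\<^sup>2 - 2 * t * g z + t\<^sup>2" by (simp add: power2_diff algebra_simps)
      then show "0 \<le> (g z)\<^sup>2 - (2 * t) * (indicator S z * g z) + t\<^sup>2 * indicator S z"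
        by (cases "z \<in> S") simp_all
    qed
    also have "\<dots> = G - 2 * t * I + t\<^sup>2 * dist a b"
      using g(2) i1 i2 S mS by (simp add: G_def I_def set_lebesgue_integral_def)
    finally show ?thesis .
  qed
  have "I\<^sup>2 \<le> dist a b * G"
  proof (cases "a = b")
    case True
    then have "I = 0" by (simp add: I_def S_def set_integral_point)
    then show ?thesis using True by simp
  next
    case False
    then have d: "0 < dist a b" by simp
    have "0 \<le> G - 2 * (I / dist a b) * I + (I / dist a b)\<^sup>2 * dist a b" by (rule poly)
    also have "\<dots> = G - I\<^sup>2 / dist a b" using d by (simp add: power2_eq_square field_simps)
    finally show ?thesis using d by (simp add: field_simps)
  qed
  then show ?thesis by (simp add: I_def G_def S_def)
qed

text \<open>The two legs at the branch point are estimated separately, and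
  \<open>(J - I)\<^sup>2 \<le> 2 * (I\<^sup>2 + J\<^sup>2)\<close> costs the factor 2; their lengths
  add up to \<open>dist x y\<close>. The 1/2 in \<open>energy\<close> later turns the 2 into a
  4.\<close>

lemma gradient_hoelder:
  assumes g: "is_gradient r f g" and L2: "g \<in> L2 L"
  shows "(f y - f x)\<^sup>2 \<le> 2 * dist x (y::'a) * (LINT z|L. (g z)\<^sup>2)"
proof -
  define a where "a = meet r x y"
  define G where "G = (LINT z|L. (g z)\<^sup>2)"
  define I J where "I = (LINT z:tree_arc a x|L. g z)" and "J = (LINT z:tree_arc a y|L. g z)"
  have eq: "f y - f x = - I + J"
    using g by (simp add: is_gradient_def tree_integral_def branch_point_eq L_eq a_def I_def J_def)
  have "(f y - f x)\<^sup>2 = 2 * (I\<^sup>2 + J\<^sup>2) - (I + J)\<^sup>2" unfolding eq by (simp add: power2_eq_square algebra_simps)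
  also have "\<dots> \<le> 2 * (I\<^sup>2 + J\<^sup>2)" by simp
  also have "\<dots> \<le> 2 * (dist a x * G + dist a y * G)"
    unfolding I_def J_def G_def using g L2
    by (intro mult_left_mono add_mono arc_integral_square_le) (auto simp: is_gradient_def L2_def L_eq)
  also have "dist a x = dist r x - gromov r x y"
    unfolding a_def meet_def by (rule dist_geodesic_end) (simp_all add: gromov_nonneg gromov_le)
  also have "dist a y = dist r y - gromov r x y"
    unfolding a_def meet_def geodesic_branching[of r x y]
    by (rule dist_geodesic_end) (simp_all add: gromov_nonneg gromov_le)
  also have "2 * ((dist r x - gromov r x y) * G + (dist r y - gromov r x y) * G) = 2 * dist x y * G"
    by (simp add: gromov_def field_simps)
  finally show ?thesis by (simp add: G_def)
qed

end

section \<open>Energy inequalities, the constant function and a cutoff function\<close>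

context
  fixes r :: "'a::real_tree" and \<nu> :: "'a measure"
  assumes lc: "locally compact (UNIV :: 'a set)"
begin

text \<open>Square integrability is known of some gradient only; a.e. uniqueness passes it on to the
  one that \<open>gradient\<close> happens to choose.\<close>

lemma finite_energy_gradient:
  assumes f: "f \<in> finite_energy r"
  shows "is_gradient r f (gradient r f)" "gradient r f \<in> L2 length_measure"
proof -
  obtain g where g: "is_gradient r f g" "g \<in> L2 length_measure"
    using f by (auto simp: finite_energy_def)
  show grad: "is_gradient r f (gradient r f)" unfolding gradient_def using someI[of "is_gradient r f", OF g(1)] .
  obtain x :: "nat \<Rightarrow> 'a" where x: "\<And>z e. 0 < e \<Longrightarrow> \<exists>n. dist (x n) z < e"
    using locally_compact_connected_dense_sequence[OF lc connected_real_tree] by metis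
  have "AE z in length_measure. g z = gradient r f z"
    by (rule is_gradient_unique[OF is_length_measure_length_measure[OF lc] refl x g(1) grad])
  moreover have sL: "sets (length_measure :: 'a measure) = sets borel"
    by (rule sets_L[OF is_length_measure_length_measure[OF lc] refl])
  then have m: "gradient r f \<in> borel_measurable length_measure"
    using grad measurable_cong_sets[OF sL refl, where N = borel] by (auto simp: is_gradient_def)
  ultimately have "integrable length_measure (\<lambda>z. (gradient r f z)\<^sup>2)"
    using g(2) by (subst integrable_cong_AE[of _ _ "\<lambda>z. (g z)\<^sup>2"]) (auto simp: L2_def)
  then show "gradient r f \<in> L2 length_measure" using m by (simp add: L2_def)
qed

lemma energy_hoelder:
  assumes f: "f \<in> finite_energy r"
  shows "(f y - f x)\<^sup>2 \<le> 4 * dist x y * energy r f f"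
  using gradient_hoelder[OF is_length_measure_length_measure[OF lc] refl finite_energy_gradient[OF f], of y x]
  by (simp add: energy_def power2_eq_square)

lemma energy_nonneg: "0 \<le> energy r f f"
  by (simp add: energy_def)

text \<open>Young's inequality, integrated. The free weight \<open>s\<close> is chosen in
  \<open>resolvent_near_root\<close> so as to balance the two terms.\<close>

lemma energy_young:
  assumes u: "u \<in> finite_energy r" and f: "f \<in> finite_energy r" and s: "0 < s"
  shows "energy r u f \<le> s / 2 * energy r u u + energy r f f / (2 * s)"
proof -
  let ?L = "length_measure :: 'a measure"
  define a b where "a = gradient r u" and "b = gradient r f"
  have a: "a \<in> borel_measurable ?L" "integrable ?L (\<lambda>z. (a z)\<^sup>2)"
    using finite_energy_gradient(2)[OF u] by (auto simp: L2_def a_def)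
  have b: "b \<in> borel_measurable ?L" "integrable ?L (\<lambda>z. (b z)\<^sup>2)"
    using finite_energy_gradient(2)[OF f] by (auto simp: L2_def b_def)
  have young: "a z * b z \<le> s / 2 * (a z)\<^sup>2 + (b z)\<^sup>2 / (2 * s)" for z
  proof -
    have "0 \<le> (s * a z - b z)\<^sup>2 / (2 * s)" using s by simp
    also have "\<dots> = s / 2 * (a z)\<^sup>2 + (b z)\<^sup>2 / (2 * s) - a z * b z"
      using s by (simp add: power2_eq_square field_simps)
    finally show ?thesis by simp
  qed
  have "integrable ?L (\<lambda>z. a z * b z)"
  proof (rule Bochner_Integration.integrable_bound)
    show "integrable ?L (\<lambda>z. (a z)\<^sup>2 + (b z)\<^sup>2)" using a b by simp
    show "(\<lambda>z. a z * b z) \<in> borel_measurable ?L" using a b by simp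
    have "\<bar>a z * b z\<bar> \<le> (a z)\<^sup>2 + (b z)\<^sup>2" for z
    proof -
      have "0 \<le> \<bar>a z\<bar> * \<bar>b z\<bar>" by simp
      then show ?thesis using sum_squares_bound[of "\<bar>a z\<bar>" "\<bar>b z\<bar>"] unfolding abs_mult power2_abs by linarith
    qed
    then show "AE z in ?L. norm (a z * b z) \<le> norm ((a z)\<^sup>2 + (b z)\<^sup>2)" by simp
  qed
  then have "(LINT z|?L. a z * b z) \<le> (LINT z|?L. s / 2 * (a z)\<^sup>2 + (b z)\<^sup>2 / (2 * s))"
    using a b young by (intro integral_mono) auto
  also have "\<dots> = s / 2 * (LINT z|?L. (a z)\<^sup>2) + (LINT z|?L. (b z)\<^sup>2) / (2 * s)"
    using a b by simp
  finally show ?thesis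
    unfolding energy_def a_def b_def by (simp add: power2_eq_square)
qed

lemma lipschitz_loc_abs_continuous:
  fixes f :: "'a \<Rightarrow> real"
  assumes C: "0 < C" and f: "\<And>x y. \<bar>f x - f y\<bar> \<le> C * dist x y"
  shows "loc_abs_continuous f"
  unfolding loc_abs_continuous_def
proof (intro conjI allI impI ballI)
  have "C-lipschitz_on UNIV f" using C f by (intro lipschitz_onI) (auto simp: dist_real_def)
  then show "continuous_on UNIV f" by (rule lipschitz_on_continuous_on)
  fix \<epsilon> :: real and S :: "'a set" assume e: "0 < \<epsilon>"
  show "\<exists>\<delta>>0. \<forall>(n::nat) x y. disjoint_family_on (\<lambda>i. tree_arc (x i) (y i)) {..<n} \<longrightarrow>
          (\<forall>i<n. tree_arc (x i) (y i) \<subseteq> S) \<longrightarrow> (\<Sum>i<n. dist (x i) (y i)) < \<delta> \<longrightarrow>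
          (\<Sum>i<n. \<bar>f (x i) - f (y i)\<bar>) < \<epsilon>"
  proof (intro exI[of _ "\<epsilon> / C"] conjI allI impI)
    show "0 < \<epsilon> / C" using e C by simp
    fix n :: nat and x y :: "nat \<Rightarrow> 'a" assume "(\<Sum>i<n. dist (x i) (y i)) < \<epsilon> / C"
    then have "C * (\<Sum>i<n. dist (x i) (y i)) < \<epsilon>" using C by (simp add: field_simps)
    moreover have "(\<Sum>i<n. \<bar>f (x i) - f (y i)\<bar>) \<le> C * (\<Sum>i<n. dist (x i) (y i))"
      unfolding sum_distrib_left by (intro sum_mono f)
    ultimately show "(\<Sum>i<n. \<bar>f (x i) - f (y i)\<bar>) < \<epsilon>" by simp
  qed
qed

lemma one_finite_energy: "(\<lambda>_. 1) \<in> finite_energy r"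
proof -
  have "is_gradient r (\<lambda>_. 1) (\<lambda>_. 0)"
    by (simp add: is_gradient_def tree_integral_def set_integrable_def set_lebesgue_integral_def)
  then show ?thesis
    by (auto simp: finite_energy_def L2_def intro!: lipschitz_loc_abs_continuous[of 1])
qed

text \<open>The gradient chosen for the constant function is 0 almost everywhere, by uniqueness,
  which is all that the integral sees.\<close>

lemma energy_one: "energy r f (\<lambda>_. 1) = 0"
proof -
  obtain x :: "nat \<Rightarrow> 'a" where x: "\<And>z e. 0 < e \<Longrightarrow> \<exists>n. dist (x n) z < e"
    using locally_compact_connected_dense_sequence[OF lc connected_real_tree] by metis
  have "is_gradient r (\<lambda>_. 1) (\<lambda>_. 0)"
    by (simp add: is_gradient_def tree_integral_def set_integrable_def set_lebesgue_integral_def)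
  then have "AE z in length_measure. gradient r (\<lambda>_. 1) z = 0"
    using is_gradient_unique[OF is_length_measure_length_measure[OF lc] refl x
        finite_energy_gradient(1)[OF one_finite_energy]] by blast
  then show ?thesis
    unfolding energy_def by (auto intro!: integral_eq_zero_AE)
qed

text \<open>A cutoff function that depends only on the projection to finitely many arcs, so that its gradient
  has support of finite length although balls may have infinite length.\<close>

lemma ex_cutoff_function:
  assumes \<nu>: "radon_measure \<nu>"
  shows "\<exists>f\<in>form_domain r \<nu>. f r = 1"
proof -
  let ?L = "length_measure :: 'a measure"
  have lmL: "is_length_measure ?L" by (rule is_length_measure_length_measure[OF lc])
  have sL: "sets ?L = sets borel" by (rule sets_L[OF lmL refl])
  have iso: "arc_isometric r ?L" by (rule is_length_measure_arc_isometric[OF lmL])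
  obtain e where e: "0 < e" "compact (cball r e)" using locally_compact_cball[OF lc] .
  define K where "K = {z. dist r z = e}"
  have "closed K" unfolding K_def by (intro closed_Collect_eq continuous_intros)
  then have "compact K"
    by (intro compact_closed_subset[OF _ e(2)]) (auto simp: K_def)
  \<comment> \<open>A finite net of the sphere with mesh \<open>e / 4\<close>: every geodesic from
    \<open>r\<close> that reaches distance \<open>e\<close> follows the arc to some net point at
    least up to height \<open>3 * e / 4\<close>.\<close>
  then have "\<exists>k. finite k \<and> K \<subseteq> (\<Union>x\<in>k. ball x (e / 4))"
    using e unfolding compact_eq_totally_bounded by simp
  then obtain k where k: "finite k" "K \<subseteq> (\<Union>x\<in>k. ball x (e / 4))" by blast
  \<comment> \<open>The height of the projection of \<open>z\<close> to the finite tree spanned by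
    \<open>r\<close> and \<open>k\<close>; the inserted 0 covers an empty net.\<close>
  define m where "m z = Max (insert 0 (gromov r z ` k))" for z
  have m_ge: "0 \<le> m z" "w \<in> k \<Longrightarrow> gromov r z w \<le> m z" for z w
    using k by (auto simp: m_def)
  have m_le: "m z \<le> c" if "0 \<le> c" "\<And>w. w \<in> k \<Longrightarrow> gromov r z w \<le> c" for z c
    using k that by (auto simp: m_def)
  have m_dist: "m z \<le> dist r z" for z by (intro m_le) (simp_all add: gromov_le)
  have m_lip1: "m z \<le> m w + dist z w" for z w
  proof (rule m_le)
    show "0 \<le> m w + dist z w" using m_ge(1)[of w] by simp
    show "gromov r z v \<le> m w + dist z w" if "v \<in> k" for v
      using m_ge(2)[OF that, of w] gromov_lipschitz[of r z v w] by linarith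
  qed
  have m_lip: "\<bar>m z - m w\<bar> \<le> dist z w" for z w
    using m_lip1[of z w] m_lip1[of w z] by (simp add: dist_commute)
  have m_geo: "m (geodesic r z s) = min s (m z)" if s: "0 \<le> s" "s \<le> dist r z" for z s
  proof (rule antisym)
    show "m (geodesic r z s) \<le> min s (m z)"
      by (rule m_le) (auto simp: gromov_geodesic[OF s] s m_ge intro: min.coboundedI2)
    have "m z \<in> insert 0 (gromov r z ` k)" unfolding m_def using k by (intro Max_in) auto
    then consider "m z = 0" | w where "w \<in> k" "m z = gromov r z w" by auto
    then show "min s (m z) \<le> m (geodesic r z s)"
    proof cases
      case 1 then show ?thesis using m_ge(1)[of "geodesic r z s"] by simp
    next
      case 2 then show ?thesis using m_ge(2)[OF 2(1), of "geodesic r z s"] by (simp add: gromov_geodesic[OF s])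
    qed
  qed
  have m_far: "3 * e / 4 \<le> m z" if "e \<le> dist r z" for z
  proof -
    have d: "dist r (geodesic r z e) = e" using e that by (simp add: dist_geodesic_start)
    then obtain w where w: "w \<in> k" "dist w (geodesic r z e) < e / 4" using k(2) by (auto simp: K_def)
    have "e - e / 4 \<le> gromov r (geodesic r z e) w"
      using gromov_ge[of r "geodesic r z e" w] w d by (simp add: dist_commute)
    also have "\<dots> \<le> m (geodesic r z e)" using w by (intro m_ge)
    also have "\<dots> \<le> m z" using m_geo[of e z] e that by simp
    finally show ?thesis by simp
  qed
  \<comment> \<open>Falls with slope \<open>2 / e\<close> in the projected height, from 1 at the
    root to 0 at height \<open>e / 2\<close>. All points outside the ball have projected height at
    least \<open>3 * e / 4\<close>, so \<open>f\<close> vanishes there.\<close>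
  define f where "f z = (2 / e) * max 0 (e / 2 - m z)" for z
  have f_lip: "\<bar>f z - f w\<bar> \<le> (2 / e) * dist z w" for z w
  proof -
    have "\<bar>f z - f w\<bar> = (2 / e) * \<bar>max 0 (e / 2 - m z) - max 0 (e / 2 - m w)\<bar>"
      using e unfolding f_def right_diff_distrib[symmetric] abs_mult by simp
    also have "\<dots> \<le> (2 / e) * dist z w"
      using e m_lip[of z w] by (intro mult_left_mono) auto
    finally show ?thesis .
  qed
  have lac: "loc_abs_continuous f"
    using e f_lip by (intro lipschitz_loc_abs_continuous[of "2 / e"]) auto
  then have cf: "continuous_on UNIV f" by (simp add: loc_abs_continuous_def)
  have cm: "continuous_on UNIV m"
    using m_lip by (intro lipschitz_on_continuous_on[of 1] lipschitz_onI) (auto simp: dist_real_def)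
  have f0: "f z = 0" if "z \<notin> cball r e" for z
    using m_far[of z] that e by (simp add: f_def)
  have fb: "0 \<le> f z" "f z \<le> 1" for z
    using e m_ge(1)[of z] by (auto simp: f_def field_simps max_def)
  have fr: "f r = 1"
    using m_dist[of r] m_ge(1)[of r] e by (simp add: f_def)
  have "f \<in> C_infty"
    unfolding C_infty_def using cf e f0 by (auto intro!: exI[of _ "cball r e"])
  moreover have "f \<in> L2 \<nu>"
  proof -
    have s\<nu>: "sets \<nu> = sets borel" using \<nu> by (simp add: radon_measure_def)
    have mf: "f \<in> borel_measurable \<nu>"
      unfolding measurable_cong_sets[OF s\<nu> refl] using cf by (rule borel_measurable_continuous_onI)
    have "emeasure \<nu> (cball r e) < \<infinity>" using \<nu> e by (simp add: radon_measure_def)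
    then have "integrable \<nu> (indicator (cball r e) :: 'a \<Rightarrow> real)"
      by (simp add: integrable_indicator_iff s\<nu>)
    then have "integrable \<nu> (\<lambda>z. (f z)\<^sup>2)"
    proof (rule Bochner_Integration.integrable_bound)
      have "(f z)\<^sup>2 \<le> indicator (cball r e) z" for z
        using fb[of z] f0[of z] power_le_one[of "f z" 2] by (cases "z \<in> cball r e") auto
      then show "AE z in \<nu>. norm ((f z)\<^sup>2) \<le> norm (indicator (cball r e) z :: real)" by simp
    qed (use mf in measurable)
    then show ?thesis using mf by (simp add: L2_def)
  qed
  moreover have "f \<in> finite_energy r"
  proof -
    \<comment> \<open>The part of the finite tree along which \<open>f\<close> decreases. It lies in
      finitely many arcs together with the root, so its length is finite.\<close>
    define G where "G = {z. m z = dist r z \<and> dist r z < e / 2}"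
    define g :: "'a \<Rightarrow> real" where "g z = - (2 / e) * indicator G z" for z
    have G: "G \<in> sets borel"
    proof -
      have "{z. m z = dist r z} \<in> sets borel"
        by (intro borel_closed closed_Collect_eq cm continuous_intros)
      moreover have "{z. dist r z < e / 2} \<in> sets borel"
        by (intro borel_open open_Collect_less continuous_intros)
      ultimately show ?thesis unfolding G_def Collect_conj_eq by (rule sets.Int)
    qed
    have gm: "g \<in> borel_measurable borel" unfolding g_def using G by measurable
    have "G \<subseteq> insert r (\<Union>w\<in>k. tree_arc r w)"
    proof
      fix z assume z: "z \<in> G"
      have "m z \<in> insert 0 (gromov r z ` k)" unfolding m_def using k by (intro Max_in) auto
      then show "z \<in> insert r (\<Union>w\<in>k. tree_arc r w)"
        using z by (auto simp: G_def mem_tree_arc_root)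
    qed
    moreover have T: "(\<Union>w\<in>k. tree_arc r w) \<in> sets borel" "insert r (\<Union>w\<in>k. tree_arc r w) \<in> sets borel"
      using k(1) by (auto intro!: borel_closed compact_imp_closed compact_insert compact_UN compact_tree_arc)
    ultimately have "emeasure ?L G \<le> emeasure ?L (insert r (\<Union>w\<in>k. tree_arc r w))"
      by (intro emeasure_mono) (simp_all only: sL T)
    also have "\<dots> \<le> emeasure ?L {r} + emeasure ?L (\<Union>w\<in>k. tree_arc r w)"
      unfolding insert_is_Un[of r "\<Union>w\<in>k. tree_arc r w"]
      by (rule emeasure_subadditive) (simp_all add: sL T)
    also have "\<dots> \<le> 0 + (\<Sum>w\<in>k. emeasure ?L (tree_arc r w))"
      using k by (intro add_mono emeasure_subadditive_finite) (auto simp: sL is_length_measure_point[OF lmL])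
    also have "\<dots> < \<infinity>" by (simp add: is_length_measure_tree_arc[OF lmL] sum_ennreal)
    finally have "emeasure ?L G < \<infinity>" .
    then have iG: "integrable ?L (indicator G :: 'a \<Rightarrow> real)" using G by (simp add: integrable_indicator_iff sL)
    have gi: "integrable ?L g" unfolding g_def using iG by simp
    have "(g z)\<^sup>2 = (2 / e)\<^sup>2 * indicator G z" for z
      by (cases "z \<in> G") (simp_all add: g_def power2_eq_square)
    then have g2: "integrable ?L (\<lambda>z. (g z)\<^sup>2)" using iG by simp
    have gL2: "g \<in> L2 ?L"
      using g2 gm unfolding L2_def measurable_cong_sets[OF sL refl] by simp
    have gset: "set_integrable ?L (tree_arc x y) g" for x y
      unfolding set_integrable_def by (intro integrable_mult_indicator gi) (simp add: sL)
    have vert: "f x - f (geodesic r x p) = (LINT z:tree_arc (geodesic r x p) x|?L. g z)"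
      if p: "0 \<le> p" "p \<le> dist r x" for x p
    proof -
      define a where "a = geodesic r x p"
      \<comment> \<open>The heights at which the arc from height \<open>p\<close> up to
        \<open>x\<close> runs inside \<open>G\<close>. The open end at \<open>e / 2\<close> mirrors
        the strict inequality in \<open>G\<close> and changes the set by one height only.\<close>
      define S where "S = {p..min (m x) (e / 2)} \<inter> {..<e / 2}"
      have "S \<in> sets borel" by (simp add: S_def)
      have da: "dist r a = p" using p by (simp add: a_def dist_geodesic_start)
      have "gromov r a x = p" using gromov_geodesic[OF p, of x] p by (simp add: a_def)
      then have arc: "tree_arc a x = {z \<in> tree_arc r x. p \<le> dist r z}"
        unfolding tree_arc_decompose[of a x r] using da gromov_le(2)[of r _ a]
        by (auto simp: mem_tree_arc_root) (metis gromov_le(2) not_less)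
      have mz: "m z = min (dist r z) (m x)" if "z \<in> tree_arc r x" for z
        using m_geo[of "dist r z" x] geodesic_dist_start[OF that] that gromov_le(2)[of r z x]
        by (simp add: mem_tree_arc_root)
      have Geq: "tree_arc a x \<inter> G = {z \<in> tree_arc r x. dist r z \<in> S}"
        unfolding arc G_def S_def by (auto simp: mz min_def split: if_splits)
      have "(LINT z:tree_arc a x|?L. g z) = (LINT z|?L. - (2 / e) * indicator (tree_arc a x \<inter> G) z)"
        unfolding set_lebesgue_integral_def g_def
        by (intro Bochner_Integration.integral_cong) (auto simp: indicator_def)
      also have "\<dots> = - (2 / e) * measure ?L (tree_arc a x \<inter> G)"
        using G by (simp add: sL)
      also have "emeasure ?L (tree_arc a x \<inter> G) = emeasure lborel (S \<inter> {0..dist r x})"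
        unfolding Geq using iso \<open>S \<in> sets borel\<close> unfolding arc_isometric_def by blast
      then have "measure ?L (tree_arc a x \<inter> G) = measure lborel (S \<inter> {0..dist r x})"
        by (simp add: measure_def)
      also have "S \<inter> {0..dist r x} = S" using p m_dist[of x] by (auto simp: S_def)
      also have "measure lborel S = measure lborel {p..min (m x) (e / 2)}"
        unfolding measure_def
      proof (intro arg_cong[of _ _ enn2real] emeasure_eq_AE)
        show "AE z in lborel. z \<in> S \<longleftrightarrow> z \<in> {p..min (m x) (e / 2)}"
          using AE_lborel_singleton[of "e / 2"] by eventually_elim (auto simp: S_def)
      qed (auto simp: S_def)
      also have "\<dots> = max 0 (min (m x) (e / 2) - p)" by (simp add: max_def)
      finally have "(LINT z:tree_arc a x|?L. g z) = - (2 / e) * max 0 (min (m x) (e / 2) - p)" .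
      also have "\<dots> = (2 / e) * (max 0 (e / 2 - m x) - max 0 (e / 2 - min p (m x)))"
      proof -
        have "- max 0 (min (m x) (e / 2) - p) = max 0 (e / 2 - m x) - max 0 (e / 2 - min p (m x))"
          by (simp add: max_def min_def)
        then show ?thesis by (metis minus_mult_commute)
      qed
      also have "\<dots> = f x - f a" by (simp add: f_def a_def m_geo[OF p] right_diff_distrib)
      finally show ?thesis by (simp add: a_def)
    qed
    have "is_gradient r f g"
      unfolding is_gradient_def
    proof (intro conjI allI gm gset)
      fix x y
      let ?p = "gromov r x y"
      have "f x - f (meet r x y) = (LINT z:tree_arc (meet r x y) x|?L. g z)"
        unfolding meet_def by (rule vert) (simp_all add: gromov_nonneg gromov_le)
      moreover have "f y - f (meet r x y) = (LINT z:tree_arc (meet r x y) y|?L. g z)"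
        unfolding meet_def geodesic_branching[of r x y] by (rule vert) (simp_all add: gromov_nonneg gromov_le)
      ultimately show "f y - f x = tree_integral r x y g"
        by (simp add: tree_integral_def branch_point_eq)
    qed
    then show ?thesis using lac gL2 by (auto simp: finite_energy_def)
  qed
  ultimately show ?thesis using fr by (auto simp: form_domain_def)
qed

end

section \<open>Continuous strong Markov processes\<close>

lemma space_cemetery [simp]: "space cemetery_borel = UNIV"
  by (simp add: cemetery_borel_def)

lemma sets_cemetery: "sets cemetery_borel = sigma_sets UNIV ((`) Some ` sets borel)"
  by (simp add: cemetery_borel_def)

lemma Some_image_cemetery [measurable]: "A \<in> sets borel \<Longrightarrow> Some ` A \<in> sets cemetery_borel"
  unfolding sets_cemetery by (intro sigma_sets.Basic) auto

lemma None_cemetery [measurable]: "{None} \<in> sets (cemetery_borel :: 'a::topological_space option measure)"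
proof -
  have "{None :: 'a option} = space cemetery_borel - Some ` UNIV"
    by (auto simp: notin_range_Some)
  also have "\<dots> \<in> sets cemetery_borel" by (intro sets.compl_sets Some_image_cemetery) simp
  finally show ?thesis .
qed

lemma zero_ext_simps [simp]: "zero_ext f None = 0" "zero_ext f (Some y) = f y"
  by (simp_all add: zero_ext_def)

lemma borel_measurable_zero_ext [measurable]:
  fixes f :: "'a::topological_space \<Rightarrow> 'b::{topological_space,zero}"
  assumes f: "f \<in> borel_measurable borel"
  shows "zero_ext f \<in> borel_measurable cemetery_borel"
proof (rule measurableI)
  fix C :: "'b set" assume C: "C \<in> sets borel"
  have "zero_ext f -` C \<inter> space cemetery_borel = Some ` (f -` C) \<union> (if 0 \<in> C then {None} else {})"
  proof (intro set_eqI)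
    fix z show "z \<in> zero_ext f -` C \<inter> space cemetery_borel \<longleftrightarrow> z \<in> Some ` (f -` C) \<union> (if 0 \<in> C then {None} else {})"
      by (cases z) auto
  qed
  also have "\<dots> \<in> sets cemetery_borel"
    using measurable_sets[OF f C] by (intro sets.Un Some_image_cemetery) (auto intro: None_cemetery)
  finally show "zero_ext f -` C \<inter> space cemetery_borel \<in> sets cemetery_borel" .
qed simp

lemma indicator_Some_image: "indicator (Some ` A) z = (zero_ext (indicator A) z :: 'b::zero_neq_one)"
  by (cases z) (auto simp: indicator_def)

text \<open>With open sets as generators, measurability can be tested through continuous functions
  of the position, built from distances to closed sets.\<close>

lemma sets_cemetery_open:
  "sets (cemetery_borel :: 'a::topological_space option measure) = sigma_sets UNIV ((`) Some ` {A. open A})"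
proof
  have UN: "Some ` (UNIV :: 'a set) \<in> sigma_sets UNIV ((`) Some ` {A. open A})"
    by (intro sigma_sets.Basic) auto
  interpret sigma_algebra "UNIV :: 'a option set" "sigma_sets UNIV ((`) Some ` {A :: 'a set. open A})"
    by (rule sigma_algebra_sigma_sets) simp
  have "Some ` A \<in> sigma_sets UNIV ((`) Some ` {A. open A})" if "A \<in> sets borel" for A :: "'a set"
  proof -
    have "A \<in> sigma_sets UNIV {S. open S}" using that by (simp add: borel_def)
    then show ?thesis
    proof induction
      case (Basic A) then show ?case by (intro sigma_sets.Basic) auto
    next
      case (Compl A)
      have "Some ` (UNIV - A) = Some ` UNIV - Some ` A" by auto
      then show ?case using UN Compl.IH by (simp add: Diff)
    next
      case (Union A)
      have "Some ` (\<Union>i. A i) = (\<Union>i. Some ` A i)" by auto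
      then show ?case using Union.IH by (simp add: sigma_sets.Union)
    qed (simp add: sigma_sets.Empty)
  qed
  then show "sets (cemetery_borel :: 'a option measure) \<subseteq> sigma_sets UNIV ((`) Some ` {A. open A})"
    unfolding sets_cemetery by (intro sigma_sets_subset) auto
  show "sigma_sets UNIV ((`) Some ` {A. open A}) \<subseteq> sets (cemetery_borel :: 'a option measure)"
    unfolding sets_cemetery by (intro sigma_sets_mono') auto
qed

text \<open>Right-endpoint discretisation of time; it approximates from the right because the paths
  need not be left-continuous at the lifetime.\<close>

definition right_grid :: "nat \<Rightarrow> real \<Rightarrow> real" where
  "right_grid n t = (real_of_int \<lfloor>real (Suc n) * t\<rfloor> + 1) / real (Suc n)"

lemma right_grid_bounds:
  "t < right_grid n t" "right_grid n t \<le> t + 1 / real (Suc n)" "t < 0 \<Longrightarrow> right_grid n t \<le> 0"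
proof -
  define N where "N = real (Suc n)"
  have N: "0 < N" by (simp add: N_def)
  define k where "k = real_of_int \<lfloor>N * t\<rfloor>"
  have k: "k \<le> N * t" "N * t < k + 1" unfolding k_def by (rule of_int_floor_le, rule real_of_int_floor_add_one_gt)
  have eq: "right_grid n t = (k + 1) / N" by (simp only: right_grid_def k_def N_def)
  show "t < right_grid n t" unfolding eq using k N by (simp add: pos_less_divide_eq mult.commute)
  show "right_grid n t \<le> t + 1 / real (Suc n)"
    unfolding eq N_def[symmetric] using k N by (simp add: field_simps)
  show "right_grid n t \<le> 0" if "t < 0"
  proof -
    have "N * t < 0" using N that by (rule mult_pos_neg)
    then have "\<lfloor>N * t\<rfloor> < 0" by (simp only: floor_less_zero)
    then have "k + 1 \<le> 0" unfolding k_def by linarith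
    then show ?thesis unfolding eq using N by (rule divide_nonpos_pos)
  qed
qed

lemma right_grid_filterlim: "filterlim (\<lambda>n. right_grid n t) (at_right t) sequentially"
proof -
  have "(\<lambda>n. t + 1 / real (Suc n)) \<longlonglongrightarrow> t"
    using LIMSEQ_inverse_real_of_nat_add[of t] by (simp only: inverse_eq_divide)
  then have "(\<lambda>n. right_grid n t) \<longlonglongrightarrow> t"
    by (rule tendsto_sandwich[rotated 3, where f = "\<lambda>_. t"]) (rule always_eventually allI right_grid_bounds(2) less_imp_le[OF right_grid_bounds(1)] tendsto_const)+
  then show ?thesis
    using right_grid_bounds(1) unfolding filterlim_at by (auto intro!: always_eventually simp: less_imp_neq[symmetric])
qed
text \<open>Each approximation depends on time through an integer only and is measurable by
  countability; right continuity gives the limit. Negative times repeat the value at 0, so that the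
  whole real line can serve as time axis.\<close>

lemma borel_measurable_right_grid_limit:
  fixes F :: "real \<Rightarrow> 'c \<Rightarrow> real"
  assumes F: "\<And>t. 0 \<le> t \<Longrightarrow> F t \<in> borel_measurable N"
    and rc: "\<And>t w. 0 \<le> t \<Longrightarrow> w \<in> space N \<Longrightarrow> ((\<lambda>s. F s w) \<longlongrightarrow> F t w) (at_right t)"
  shows "(\<lambda>(t, w). F (max 0 t) w) \<in> borel_measurable (borel \<Otimes>\<^sub>M N)"
proof (rule borel_measurable_LIMSEQ_real)
  fix n
  define G where "G = (\<lambda>(k::int, w). F (max 0 ((real_of_int k + 1) / real (Suc n))) w)"
  have [measurable]: "G \<in> borel_measurable (count_space UNIV \<Otimes>\<^sub>M N)"
    unfolding G_def by (rule measurable_pair_measure_countable1) (auto intro: F)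
  have "(\<lambda>p. G (\<lfloor>real (Suc n) * fst p\<rfloor>, snd p)) \<in> borel_measurable (borel \<Otimes>\<^sub>M N)"
    by measurable
  also have "(\<lambda>p. G (\<lfloor>real (Suc n) * fst p\<rfloor>, snd p)) = (\<lambda>(t, w). F (max 0 (right_grid n t)) w)"
    by (auto simp: G_def right_grid_def)
  finally show "(\<lambda>(t, w). F (max 0 (right_grid n t)) w) \<in> borel_measurable (borel \<Otimes>\<^sub>M N)" .
next
  fix p :: "real \<times> 'c" assume "p \<in> space (borel \<Otimes>\<^sub>M N)"
  then obtain t w where p: "p = (t, w)" and w: "w \<in> space N" by (auto simp: space_pair_measure)
  show "(\<lambda>n. case p of (t, w) \<Rightarrow> F (max 0 (right_grid n t)) w) \<longlonglongrightarrow> (case p of (t, w) \<Rightarrow> F (max 0 t) w)"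
  proof (cases "t < 0")
    case True
    then show ?thesis using right_grid_bounds(3)[OF True] by (simp add: p max_absorb1)
  next
    case False
    then have "max 0 (right_grid n t) = right_grid n t" for n using right_grid_bounds(1)[of t n] by simp
    then show ?thesis
      using filterlim_compose[OF rc[OF _ w] right_grid_filterlim, of t] False by (simp add: p)
  qed
qed

section \<open>Path regularity and joint measurability in time and space\<close>

locale markov_process =
  fixes W :: "'w measure" and P :: "'a::metric_space \<Rightarrow> 'w measure" and B :: "real \<Rightarrow> 'w \<Rightarrow> 'a option"
  assumes cont: "continuous_process W P B" and strong: "strong_markov W P B"
begin

abbreviation "tr \<equiv> transition P B"

lemma prob_P: "prob_space (P x)" and sets_P: "sets (P x) = sets W"
  using cont by (auto simp: continuous_process_def)

lemma space_P: "space (P x) = space W"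
  using sets_eq_imp_space_eq[OF sets_P] .

lemma measurable_P: "measurable (P x) N = measurable W N"
  by (rule measurable_cong_sets[OF sets_P refl])

lemma measurable_B: "0 \<le> t \<Longrightarrow> B t \<in> W \<rightarrow>\<^sub>M cemetery_borel"
  using cont by (auto simp: continuous_process_def)

lemma transition_measurable: "0 \<le> t \<Longrightarrow> A \<in> sets borel \<Longrightarrow> (\<lambda>x. tr t x A) \<in> borel_measurable borel"
  using cont by (auto simp: continuous_process_def)

lemma B_0: "AE \<omega> in P x. B 0 \<omega> = Some x"
  using cont by (auto simp: continuous_process_def)

lemma B_None_iff: "\<omega> \<in> space W \<Longrightarrow> 0 \<le> t \<Longrightarrow> B t \<omega> = None \<longleftrightarrow> lifetime B \<omega> \<le> ennreal t"
  using cont by (auto simp: continuous_process_def)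

lemma B_None_mono: "\<omega> \<in> space W \<Longrightarrow> 0 \<le> s \<Longrightarrow> s \<le> t \<Longrightarrow> B s \<omega> = None \<Longrightarrow> B t \<omega> = None"
  using B_None_iff[of \<omega> s] B_None_iff[of \<omega> t] by (auto intro: order_trans ennreal_leI)

lemma B_continuous: "\<omega> \<in> space W \<Longrightarrow> continuous_on {t. 0 \<le> t \<and> B t \<omega> \<noteq> None} (\<lambda>t. the (B t \<omega>))"
proof -
  assume w: "\<omega> \<in> space W"
  have "B t \<omega> \<noteq> None \<longleftrightarrow> ennreal t < lifetime B \<omega>" if "0 \<le> t" for t
    by (simp only: B_None_iff[OF w that] not_le)
  then have "{t. 0 \<le> t \<and> B t \<omega> \<noteq> None} = {t. 0 \<le> t \<and> ennreal t < lifetime B \<omega>}"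
    by blast
  then show ?thesis using cont w by (auto simp: continuous_process_def)
qed

lemma avoid_AE:
  assumes N: "N \<in> sets borel" and t: "0 \<le> t" and 0: "tr t x N = 0"
  shows "AE \<omega> in P x. B t \<omega> \<notin> Some ` N"
proof (rule AE_I[where N = "{\<omega> \<in> space (P x). B t \<omega> \<in> Some ` N}"])
  show "emeasure (P x) {\<omega> \<in> space (P x). B t \<omega> \<in> Some ` N} = 0" using 0 by (simp add: transition_def)
  from measurable_sets[OF measurable_B[OF t] Some_image_cemetery[OF N]]
  show "{\<omega> \<in> space (P x). B t \<omega> \<in> Some ` N} \<in> sets (P x)"
    by (simp add: sets_P space_P vimage_def Int_def conj_commute)
qed auto

text \<open>At its lifetime the path is already in the cemetery, so being alive persists for a while
  to the right.\<close>

lemma alive_right: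
  assumes w: "\<omega> \<in> space W" and t: "0 \<le> t" "B t \<omega> \<noteq> None"
  obtains b where "t < b" "B b \<omega> \<noteq> None"
proof -
  have "ennreal t < lifetime B \<omega>" using B_None_iff[OF w t(1)] t(2) by (simp add: not_le)
  then obtain c where c: "ennreal t < c" "c < lifetime B \<omega>" using dense by blast
  then have cr: "c = ennreal (enn2real c)"
    by (metis ennreal_enn2real less_top_ennreal ennreal_enn2real_if infinity_ennreal_def not_less top_greatest)
  have "t < enn2real c" using c(1) t(1) cr by (metis ennreal_less_iff)
  moreover have "B (enn2real c) \<omega> \<noteq> None"
    using B_None_iff[OF w, of "enn2real c"] c(2) cr by (simp add: not_le)
  ultimately show ?thesis using that by blast
qed

text \<open>After death the value stays 0; a living path stays alive, and continuous, on some
  interval to the right.\<close>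

lemma right_continuous:
  fixes f :: "'a \<Rightarrow> real"
  assumes w: "\<omega> \<in> space W" and t: "0 \<le> t" and f: "continuous_on UNIV f"
  shows "((\<lambda>s. zero_ext f (B s \<omega>)) \<longlongrightarrow> zero_ext f (B t \<omega>)) (at_right t)"
proof (cases "B t \<omega> = None")
  case True
  have "\<forall>\<^sub>F s in at_right t. zero_ext f (B s \<omega>) = 0"
    unfolding eventually_at_right_field
    using B_None_mono[OF w t _ True] by (intro exI[of _ "t + 1"]) auto
  then show ?thesis using True by (simp add: tendsto_eventually)
next
  case False
  then obtain b where b: "t < b" "B b \<omega> \<noteq> None" using alive_right[OF w t] by blast
  let ?I = "{t. 0 \<le> t \<and> B t \<omega> \<noteq> None}"
  have sub: "{t..b} \<subseteq> ?I" using B_None_mono[OF w _ _ , of _ b] b t by force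
  have "continuous_on ?I (\<lambda>s. f (the (B s \<omega>)))"
    by (rule continuous_on_compose2[OF f B_continuous[OF w]]) auto
  then have "continuous_on {t..b} (\<lambda>s. f (the (B s \<omega>)))" using sub by (rule continuous_on_subset)
  then have "continuous_on {t..b} (\<lambda>s. zero_ext f (B s \<omega>))"
  proof (rule continuous_on_eq)
    show "f (the (B s \<omega>)) = zero_ext f (B s \<omega>)" if "s \<in> {t..b}" for s
      using sub that by (cases "B s \<omega>") auto
  qed
  then have "((\<lambda>s. zero_ext f (B s \<omega>)) \<longlongrightarrow> zero_ext f (B t \<omega>)) (at t within {t..b})"
    using b by (auto simp: continuous_on_def)
  then show ?thesis using at_within_Icc_at_right[OF b(1)] by simp
qed

text \<open>Being in an open set \<open>A\<close> means that a continuous function of the position,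
  extended by 0 to the cemetery, is positive, and that function is right continuous along
  paths.\<close>

lemma measurable_B_joint: "(\<lambda>(t, \<omega>). B (max 0 t) \<omega>) \<in> borel \<Otimes>\<^sub>M W \<rightarrow>\<^sub>M cemetery_borel"
proof (rule measurable_sigma_sets[OF sets_cemetery_open])
  fix S assume "S \<in> (`) Some ` {A :: 'a set. open A}"
  then obtain A where A: "open A" "S = Some ` A" by blast
  have ex: "\<exists>f :: 'a \<Rightarrow> real. continuous_on UNIV f \<and> (\<forall>y. 0 < f y \<longleftrightarrow> y \<in> A)"
  \<comment> \<open>\<open>infdist\<close> to the empty set is 0, so the full space needs a function
    of its own.\<close>
  proof (cases "A = UNIV")
    case True
    then show ?thesis by (intro exI[of _ "\<lambda>_. 1"]) auto
  next
    case False
    then have "0 < infdist y (- A) \<longleftrightarrow> y \<in> A" for y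
      using A(1) in_closed_iff_infdist_zero[of "- A" y] infdist_nonneg[of y "- A"]
      by (auto simp: less_le closed_Compl)
    then show ?thesis by (intro exI[of _ "\<lambda>y. infdist y (- A)"]) (auto intro!: continuous_intros)
  qed
  then obtain f :: "'a \<Rightarrow> real" where f: "continuous_on UNIV f" "\<And>y. 0 < f y \<longleftrightarrow> y \<in> A" by blast
  have [measurable]: "f \<in> borel_measurable borel" using f(1) by (rule borel_measurable_continuous_onI)
  have m: "(\<lambda>(t, \<omega>). zero_ext f (B (max 0 t) \<omega>)) \<in> borel_measurable (borel \<Otimes>\<^sub>M W)"
  proof (rule borel_measurable_right_grid_limit)
    show "(\<lambda>\<omega>. zero_ext f (B t \<omega>)) \<in> borel_measurable W" if "0 \<le> t" for t
      using measurable_B[OF that] by measurable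
  qed (rule right_continuous[OF _ _ f(1)])
  have z: "z \<in> Some ` A \<longleftrightarrow> 0 < zero_ext f z" for z using f(2) by (cases z) auto
  have "(\<lambda>(t, \<omega>). B (max 0 t) \<omega>) -` S \<inter> space (borel \<Otimes>\<^sub>M W)
    = (\<lambda>(t, \<omega>). zero_ext f (B (max 0 t) \<omega>)) -` {0<..} \<inter> space (borel \<Otimes>\<^sub>M W)"
    by (simp only: vimage_def A(2) z greaterThan_iff case_prod_beta)
  also have "\<dots> \<in> sets (borel \<Otimes>\<^sub>M W)" using m by (rule measurable_sets) simp
  finally show "(\<lambda>(t, \<omega>). B (max 0 t) \<omega>) -` S \<inter> space (borel \<Otimes>\<^sub>M W) \<in> sets (borel \<Otimes>\<^sub>M W)" .
qed auto

definition kernel :: "real \<times> 'a \<Rightarrow> 'a option measure" where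
  "kernel p = distr (P (snd p)) cemetery_borel (B (max 0 (fst p)))"

lemma prob_kernel: "prob_space (kernel p)"
  unfolding kernel_def
  by (intro prob_space.prob_space_distr prob_P) (simp add: measurable_P measurable_B)

lemma sets_kernel [simp]: "sets (kernel p) = sets cemetery_borel" and space_kernel [simp]: "space (kernel p) = UNIV"
  by (simp_all add: kernel_def)

lemma emeasure_kernel: "A \<in> sets borel \<Longrightarrow> emeasure (kernel (t, x)) (Some ` A) = tr (max 0 t) x A"
  unfolding kernel_def transition_def
  by (subst emeasure_distr) (auto simp: measurable_P measurable_B Some_image_cemetery vimage_def Int_def conj_commute)

lemma nn_integral_kernel:
  "f \<in> borel_measurable cemetery_borel \<Longrightarrow> (\<integral>\<^sup>+z. f z \<partial>kernel (t, x)) = (\<integral>\<^sup>+\<omega>. f (B (max 0 t) \<omega>) \<partial>P x)"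
  unfolding kernel_def by (subst nn_integral_distr) (simp_all add: measurable_P measurable_B)

lemma measurable_kernel_section:
  assumes t: "0 \<le> t"
  shows "(\<lambda>x. kernel (t, x)) \<in> borel \<rightarrow>\<^sub>M subprob_algebra cemetery_borel"
proof (rule measurable_subprob_algebra_generated[OF sets_cemetery])
  show "Int_stable ((`) Some ` (sets borel :: 'a set set))"
  proof (rule Int_stableI)
    fix a b assume "a \<in> (`) Some ` (sets borel :: 'a set set)" "b \<in> (`) Some ` (sets borel :: 'a set set)"
    then obtain A C where AC: "A \<in> sets borel" "C \<in> sets borel" "a = Some ` A" "b = Some ` C" by blast
    have "a \<inter> b = Some ` (A \<inter> C)" using AC by auto
    then show "a \<inter> b \<in> (`) Some ` sets borel" using AC by auto
  qed
  show "(\<lambda>x. emeasure (kernel (t, x)) A) \<in> borel_measurable borel" if "A \<in> (`) Some ` sets borel" for A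
    using that t by (auto simp: emeasure_kernel transition_measurable)
  show "(\<lambda>x. emeasure (kernel (t, x)) UNIV) \<in> borel_measurable borel"
    using prob_space.emeasure_space_1[OF prob_kernel] by simp
qed (simp_all only: Pow_UNIV subset_UNIV sets_kernel prob_space_imp_subprob_space[OF prob_kernel])

text \<open>Continuous functions converging to the indicator of an open set have expectations that
  are right continuous in time by dominated convergence, hence jointly measurable; their limit is
  the kernel of the open set.\<close>

lemma measurable_kernel: "kernel \<in> borel \<Otimes>\<^sub>M borel \<rightarrow>\<^sub>M subprob_algebra cemetery_borel"
proof (rule measurable_subprob_algebra_generated[OF sets_cemetery_open])
  show "Int_stable ((`) Some ` {A :: 'a set. open A})"
  proof (rule Int_stableI)
    fix a b assume "a \<in> (`) Some ` {A :: 'a set. open A}" "b \<in> (`) Some ` {A :: 'a set. open A}"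
    then obtain A C where AC: "open A" "open C" "a = Some ` A" "b = Some ` C" by blast
    have "a \<inter> b = Some ` (A \<inter> C)" using AC by auto
    then show "a \<inter> b \<in> (`) Some ` {A. open A}" using AC by auto
  qed
  show "(\<lambda>p. emeasure (kernel p) S) \<in> borel_measurable (borel \<Otimes>\<^sub>M borel)" if S: "S \<in> (`) Some ` {A :: 'a set. open A}" for S
  proof -
    obtain A where A: "open A" "S = Some ` A" using S by blast
    have "\<exists>f :: nat \<Rightarrow> 'a \<Rightarrow> real. (\<forall>n. continuous_on UNIV (f n)) \<and> (\<forall>n y. 0 \<le> f n y \<and> f n y \<le> 1)
        \<and> (\<forall>y. (\<lambda>n. f n y) \<longlonglongrightarrow> indicator A y)"
    proof (cases "A = UNIV")
      case True
      then show ?thesis by (intro exI[of _ "\<lambda>_ _. 1"]) auto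
    next
      case False
      have pos: "0 < infdist y (- A) \<longleftrightarrow> y \<in> A" for y
        using A(1) False in_closed_iff_infdist_zero[of "- A" y] infdist_nonneg[of y "- A"]
        by (auto simp: less_le closed_Compl)
      have "(\<lambda>n. min 1 (real n * infdist y (- A))) \<longlonglongrightarrow> indicator A y" for y
      proof (cases "y \<in> A")
        case True
        then have "0 < infdist y (- A)" using pos by simp
        then have "filterlim (\<lambda>n. real n * infdist y (- A)) at_top sequentially"
          by (rule filterlim_at_top_mult_tendsto_pos[OF tendsto_const _ filterlim_real_sequentially])
        then have "\<forall>\<^sub>F n in sequentially. 1 \<le> real n * infdist y (- A)" by (simp add: filterlim_at_top)
        then have "\<forall>\<^sub>F n in sequentially. min 1 (real n * infdist y (- A)) = 1" by eventually_elim simp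
        then show ?thesis using True by (simp add: tendsto_eventually)
      next
        case False
        then have "infdist y (- A) = 0" using pos[of y] infdist_nonneg[of y "- A"] by linarith
        then show ?thesis using False by simp
      qed
      then show ?thesis
        by (intro exI[of _ "\<lambda>n y. min 1 (real n * infdist y (- A))"]) (auto intro!: continuous_intros simp: infdist_nonneg)
    qed
    then obtain f :: "nat \<Rightarrow> 'a \<Rightarrow> real" where f: "\<And>n. continuous_on UNIV (f n)"
      "\<And>n y. 0 \<le> f n y" "\<And>n y. f n y \<le> 1" "\<And>y. (\<lambda>n. f n y) \<longlonglongrightarrow> indicator A y"
      by blast
    have fm[measurable]: "f n \<in> borel_measurable borel" for n using f(1) by (rule borel_measurable_continuous_onI)
    have zb: "\<bar>zero_ext (f n) z\<bar> \<le> 1" for n z using f(2,3) by (cases z) auto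
    have Fm: "(\<lambda>(t, x). LINT \<omega>|P x. zero_ext (f n) (B (max 0 t) \<omega>)) \<in> borel_measurable (borel \<Otimes>\<^sub>M borel)" for n
    proof (rule borel_measurable_right_grid_limit)
      fix t :: real assume t: "0 \<le> t"
      have "(\<lambda>x. LINT z|kernel (t, x). zero_ext (f n) z) \<in> borel_measurable borel"
        by (rule measurable_compose[OF measurable_kernel_section[OF t] integral_measurable_subprob_algebra])
           (rule borel_measurable_zero_ext[OF fm])
      also have "(\<lambda>x. LINT z|kernel (t, x). zero_ext (f n) z) = (\<lambda>x. LINT \<omega>|P x. zero_ext (f n) (B t \<omega>))"
        unfolding kernel_def using t
        by (intro ext, subst integral_distr) (simp_all add: measurable_P measurable_B borel_measurable_zero_ext[OF fm])
      finally show "(\<lambda>x. LINT \<omega>|P x. zero_ext (f n) (B t \<omega>)) \<in> borel_measurable borel" .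
      fix x :: 'a
      interpret prob_space "P x" by (rule prob_P)
      show "((\<lambda>s. LINT \<omega>|P x. zero_ext (f n) (B s \<omega>)) \<longlongrightarrow> (LINT \<omega>|P x. zero_ext (f n) (B t \<omega>))) (at_right t)"
      proof (rule tendsto_at_right_sequentially[of t "t + 1"])
        fix S :: "nat \<Rightarrow> real" assume S: "\<And>i. t < S i" "S \<longlonglongrightarrow> t"
        have S0: "0 \<le> S i" for i using S(1)[of i] t by simp
        show "(\<lambda>i. LINT \<omega>|P x. zero_ext (f n) (B (S i) \<omega>)) \<longlonglongrightarrow> (LINT \<omega>|P x. zero_ext (f n) (B t \<omega>))"
        proof (rule integral_dominated_convergence[where w = "\<lambda>_. 1"])
          show "(\<lambda>\<omega>. zero_ext (f n) (B t \<omega>)) \<in> borel_measurable (P x)"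
            unfolding measurable_P by (rule measurable_compose[OF measurable_B[OF t] borel_measurable_zero_ext[OF fm]])
          show "(\<lambda>\<omega>. zero_ext (f n) (B (S i) \<omega>)) \<in> borel_measurable (P x)" for i
            unfolding measurable_P by (rule measurable_compose[OF measurable_B[OF S0] borel_measurable_zero_ext[OF fm]])
          have "filterlim S (at_right t) sequentially"
            using S by (auto intro!: filterlim_at_withinI always_eventually)
          then show "AE \<omega> in P x. (\<lambda>i. zero_ext (f n) (B (S i) \<omega>)) \<longlonglongrightarrow> zero_ext (f n) (B t \<omega>)"
            using filterlim_compose[OF right_continuous[OF _ t f(1)]] by (intro AE_I2) (simp add: space_P)
          show "AE \<omega> in P x. norm (zero_ext (f n) (B (S i) \<omega>)) \<le> 1" for i
            using zb by simp
        qed simp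
      qed simp
    qed
    have lim: "(\<lambda>n. case p of (t, x) \<Rightarrow> LINT \<omega>|P x. zero_ext (f n) (B (max 0 t) \<omega>)) \<longlonglongrightarrow> measure (kernel p) S" for p
    proof -
      obtain t x where p: "p = (t, x)" by (cases p)
      interpret prob_space "P x" by (rule prob_P)
      have m: "B (max 0 t) \<in> W \<rightarrow>\<^sub>M cemetery_borel" by (rule measurable_B) simp
      have Am: "A \<in> sets borel" using A(1) by simp
      have "(\<lambda>n. LINT \<omega>|P x. zero_ext (f n) (B (max 0 t) \<omega>)) \<longlonglongrightarrow> (LINT \<omega>|P x. indicator (Some ` A) (B (max 0 t) \<omega>))"
      proof (rule integral_dominated_convergence[where w = "\<lambda>_. 1"])
        show "(\<lambda>\<omega>. indicator (Some ` A) (B (max 0 t) \<omega>) :: real) \<in> borel_measurable (P x)"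
          unfolding measurable_P using Am by (intro measurable_compose[OF m] borel_measurable_indicator Some_image_cemetery)
        show "(\<lambda>\<omega>. zero_ext (f n) (B (max 0 t) \<omega>)) \<in> borel_measurable (P x)" for n
          unfolding measurable_P by (rule measurable_compose[OF m borel_measurable_zero_ext[OF fm]])
        have "(\<lambda>n. zero_ext (f n) z) \<longlonglongrightarrow> indicator (Some ` A) z" for z
          using f(4) by (cases z) (auto simp: indicator_Some_image)
        then show "AE \<omega> in P x. (\<lambda>n. zero_ext (f n) (B (max 0 t) \<omega>)) \<longlonglongrightarrow> indicator (Some ` A) (B (max 0 t) \<omega>)" by simp
        show "AE \<omega> in P x. norm (zero_ext (f n) (B (max 0 t) \<omega>)) \<le> 1" for n using zb by simp
      qed simp
      also have "(LINT \<omega>|P x. indicator (Some ` A) (B (max 0 t) \<omega>)) = (LINT z|kernel p. indicator (Some ` A) z :: real)"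
        unfolding kernel_def p using Am by (subst integral_distr) (auto simp: measurable_P m Some_image_cemetery)
      also have "\<dots> = measure (kernel p) S"
        using Am by (simp add: A(2))
      finally show ?thesis by (simp add: p)
    qed
    have "(\<lambda>p. measure (kernel p) S) \<in> borel_measurable (borel \<Otimes>\<^sub>M borel)"
      by (rule borel_measurable_LIMSEQ_real[OF lim Fm])
    then show ?thesis
      using finite_measure.emeasure_eq_measure[OF prob_space.finite_measure[OF prob_kernel]] by simp
  qed
  show "(\<lambda>p. emeasure (kernel p) UNIV) \<in> borel_measurable (borel \<Otimes>\<^sub>M borel)"
    using prob_space.emeasure_space_1[OF prob_kernel] by simp
qed (simp_all only: Pow_UNIV subset_UNIV sets_kernel prob_space_imp_subprob_space[OF prob_kernel])

lemma measurable_transition_joint: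
  assumes "A \<in> sets borel"
  shows "(\<lambda>(t, x). tr (max 0 t) x A) \<in> borel_measurable (borel \<Otimes>\<^sub>M borel)"
proof -
  have "(\<lambda>p. emeasure (kernel p) (Some ` A)) \<in> borel_measurable (borel \<Otimes>\<^sub>M borel)"
    by (rule measurable_emeasure_kernel[OF measurable_kernel]) (rule Some_image_cemetery[OF assms])
  also have "(\<lambda>p. emeasure (kernel p) (Some ` A)) = (\<lambda>(t, x). tr (max 0 t) x A)"
    by (auto simp: fun_eq_iff emeasure_kernel[OF assms])
  finally show ?thesis .
qed

subsection \<open>Filtrations and the Markov property\<close>

lemma space_natural [simp]: "space (natural_filtration W B t) = space W"
  by (simp add: natural_filtration_def space_measure_of_conv)

lemma space_right [simp]: "space (right_filtration W B t) = space W"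
  by (simp add: right_filtration_def space_measure_of_conv)

lemma sets_natural: "sets (natural_filtration W B t) = sigma_sets (space W)
    {B s -` C \<inter> space W | s C. 0 \<le> s \<and> ennreal s \<le> t \<and> C \<in> sets cemetery_borel}"
  unfolding natural_filtration_def by (rule sets_measure_of) auto

lemma natural_event:
  "0 \<le> s \<Longrightarrow> ennreal s \<le> t \<Longrightarrow> A \<in> sets borel \<Longrightarrow> {\<omega> \<in> space W. B s \<omega> \<in> Some ` A} \<in> sets (natural_filtration W B t)"
  unfolding sets_natural
  by (intro sigma_sets.Basic CollectI exI[of _ s] exI[of _ "Some ` A"]) (auto intro: Some_image_cemetery)

lemma natural_mono: "s \<le> t \<Longrightarrow> sets (natural_filtration W B s) \<subseteq> sets (natural_filtration W B t)"
  unfolding sets_natural by (intro sigma_sets_mono') (blast intro: order_trans)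

lemma natural_subset: "sets (natural_filtration W B t) \<subseteq> sets W"
  unfolding sets_natural by (intro sets.sigma_sets_subset) (auto intro: measurable_sets[OF measurable_B])

lemma natural_subset_right: "sets (natural_filtration W B t) \<subseteq> sets (right_filtration W B t)"
proof (cases "t = \<infinity>")
  case False
  have "(\<Inter>s\<in>{t<..}. sets (natural_filtration W B s)) \<subseteq> Pow (space W)"
    using False sets.space_closed[of "natural_filtration W B \<infinity>"] by (auto simp: less_top top.not_eq_extremum)
  then have "(\<Inter>s\<in>{t<..}. sets (natural_filtration W B s)) \<subseteq> sets (right_filtration W B t)"
    using False by (auto simp: right_filtration_def sets_measure_of)
  moreover have "sets (natural_filtration W B t) \<subseteq> (\<Inter>s\<in>{t<..}. sets (natural_filtration W B s))"
    by (intro INT_greatest natural_mono) auto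
  ultimately show ?thesis by blast
qed (simp add: right_filtration_def)

lemma right_eq:
  assumes "t \<noteq> \<infinity>"
  shows "sets (right_filtration W B t) = sigma_sets (space W) (\<Inter>s\<in>{t<..}. sets (natural_filtration W B s))"
proof -
  have "(\<Inter>s\<in>{t<..}. sets (natural_filtration W B s)) \<subseteq> Pow (space W)"
    using assms sets.space_closed[of "natural_filtration W B \<infinity>"] by (auto simp: less_top top.not_eq_extremum)
  then show ?thesis using assms by (simp add: right_filtration_def sets_measure_of)
qed

lemma right_subset_natural:
  assumes "t < s"
  shows "sets (right_filtration W B t) \<subseteq> sets (natural_filtration W B s)"
proof -
  have "t \<noteq> \<infinity>" using assms by auto
  show ?thesis
    unfolding right_eq[OF \<open>t \<noteq> \<infinity>\<close>] space_natural[of s, symmetric]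
    using assms by (intro sets.sigma_sets_subset) auto
qed

lemma right_subset: "sets (right_filtration W B t) \<subseteq> sets W"
proof (cases "t = \<infinity>")
  case True
  then show ?thesis using natural_subset by (simp add: right_filtration_def)
next
  case False
  then have "t < \<infinity>" by (simp add: less_top)
  then show ?thesis using right_subset_natural natural_subset by blast
qed

lemma filtration_right: "filtration (space W) (right_filtration W B)"
proof
  show "space (right_filtration W B i) = space W" for i by simp
  show "sets (right_filtration W B i) \<subseteq> sets (right_filtration W B j)" if "i \<le> j" for i j
  proof (cases "i = j")
    case False
    then have "i < j" using that by simp
    then show ?thesis using right_subset_natural natural_subset_right by blast
  qed simp
qed

lemma strong_markov_property:
  assumes "stopping_time (right_filtration W B) \<sigma>"
    and "\<And>t. {\<omega> \<in> \<Lambda>. \<sigma> \<omega> \<le> t} \<in> sets (right_filtration W B t)" and "0 \<le> s" and "A \<in> sets borel"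
  shows "emeasure (P x) {\<omega>\<in>\<Lambda>. \<sigma> \<omega> < \<infinity> \<and> B (enn2real (\<sigma> \<omega>) + s) \<omega> \<in> Some ` A} =
     (\<integral>\<^sup>+\<omega>\<in>{\<omega>\<in>\<Lambda>. \<sigma> \<omega> < \<infinity>}. zero_ext (\<lambda>y. tr s y A) (B (enn2real (\<sigma> \<omega>)) \<omega>) \<partial>P x)"
proof -
  have "\<Lambda> \<in> sets (filtration.pre_sigma (space W) (right_filtration W B) \<sigma>)"
    using assms(1,2) by (rule filtration.sets_pre_sigmaI[OF filtration_right])
  then show ?thesis using strong assms(1,3,4) unfolding strong_markov_def by blast
qed

lemma markov_property:
  assumes q: "0 \<le> q" and \<Lambda>: "\<Lambda> \<in> sets (natural_filtration W B (ennreal q))" and s: "0 \<le> s" and A: "A \<in> sets borel"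
  shows "emeasure (P x) {\<omega>\<in>\<Lambda>. B (q + s) \<omega> \<in> Some ` A} = (\<integral>\<^sup>+\<omega>\<in>\<Lambda>. zero_ext (\<lambda>y. tr s y A) (B q \<omega>) \<partial>P x)"
proof -
  have "{\<omega> \<in> \<Lambda>. ennreal q \<le> t} \<in> sets (right_filtration W B t)" for t
    using \<Lambda> natural_mono[of "ennreal q" t] natural_subset_right[of t] by (cases "ennreal q \<le> t") auto
  from strong_markov_property[OF stopping_time_const this s A]
  show ?thesis using q by (simp add: enn2real_ennreal)
qed

subsection \<open>Potentials\<close>

text \<open>The \<open>\<alpha>\<close>-resolvent kernel, and for \<open>\<alpha> = 0\<close> the
  Green kernel. Extended values keep the latter meaningful before its finiteness is known.\<close>

definition pot :: "real \<Rightarrow> 'a set \<Rightarrow> 'a \<Rightarrow> ennreal" where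
  "pot \<alpha> A x = (\<integral>\<^sup>+s. ennreal (exp (- \<alpha> * s)) * indicator {0..} s * tr (max 0 s) x A \<partial>lborel)"

text \<open>The discount runs from time 0 and not from \<open>q\<close>, so that occupations after
  different times are parts of one total.\<close>

definition occ :: "real \<Rightarrow> 'a set \<Rightarrow> real \<Rightarrow> 'w \<Rightarrow> ennreal" where
  "occ \<alpha> A q \<omega> = (\<integral>\<^sup>+s. ennreal (exp (- \<alpha> * s)) * indicator {q..} s * indicator (Some ` A) (B (max 0 s) \<omega>) \<partial>lborel)"

lemma transition_eq: "0 \<le> t \<Longrightarrow> A \<in> sets borel \<Longrightarrow> tr t x A = (\<integral>\<^sup>+\<omega>. indicator (Some ` A) (B t \<omega>) \<partial>P x)"
  using emeasure_kernel[of A t x] nn_integral_kernel[of "indicator (Some ` A)" t x]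
  by (simp add: Some_image_cemetery)

lemma transition_le_1: "tr t x A \<le> 1"
  unfolding transition_def using prob_space.emeasure_le_1[OF prob_P] by simp

lemma measurable_transition_pair [measurable]:
  assumes A: "A \<in> sets borel"
  shows "(\<lambda>p. tr (max 0 (fst p)) (snd p) A) \<in> borel_measurable (lborel \<Otimes>\<^sub>M borel)"
proof -
  have "sets (lborel \<Otimes>\<^sub>M (borel :: 'a measure)) = sets (borel \<Otimes>\<^sub>M borel)" by (intro sets_pair_measure_cong) auto
  from measurable_cong_sets[OF this refl] measurable_transition_joint[OF A] show ?thesis
    by (simp add: case_prod_beta')
qed

lemma measurable_B_pair: "(\<lambda>p. B (max 0 (fst p)) (snd p)) \<in> lborel \<Otimes>\<^sub>M P x \<rightarrow>\<^sub>M cemetery_borel"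
proof -
  have "sets (lborel \<Otimes>\<^sub>M P x) = sets (borel \<Otimes>\<^sub>M W)" by (intro sets_pair_measure_cong) (auto simp: sets_P)
  then have eq: "lborel \<Otimes>\<^sub>M P x \<rightarrow>\<^sub>M cemetery_borel = borel \<Otimes>\<^sub>M W \<rightarrow>\<^sub>M (cemetery_borel :: 'a option measure)"
    by (rule measurable_cong_sets[OF _ refl])
  show ?thesis unfolding eq using measurable_B_joint by (simp add: case_prod_beta')
qed

lemma measurable_pot [measurable]: assumes [measurable]: "A \<in> sets borel" shows "pot \<alpha> A \<in> borel_measurable borel"
proof -
  have [measurable]: "(\<lambda>p. tr (max 0 (snd p)) (fst p) A) \<in> borel_measurable (borel \<Otimes>\<^sub>M lborel)"
    using measurable_compose[OF measurable_pair_swap' measurable_transition_pair[OF assms]] by (simp add: case_prod_beta')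
  have "(\<lambda>p. ennreal (exp (- \<alpha> * snd p)) * indicator {0..} (snd p) * tr (max 0 (snd p)) (fst p) A) \<in> borel_measurable (borel \<Otimes>\<^sub>M lborel)"
    by measurable
  from lborel.borel_measurable_nn_integral_fst[OF this] show ?thesis
    by (simp add: pot_def[abs_def])
qed

lemma measurable_occ:
  assumes A: "A \<in> sets borel" shows "occ \<alpha> A q \<in> borel_measurable W"
proof -
  have m: "(\<lambda>p. B (max 0 (snd p)) (fst p)) \<in> W \<Otimes>\<^sub>M lborel \<rightarrow>\<^sub>M cemetery_borel"
  proof -
    have "sets (lborel \<Otimes>\<^sub>M W) = sets (borel \<Otimes>\<^sub>M W)" by (intro sets_pair_measure_cong) auto
    from measurable_cong_sets[OF this refl] measurable_B_joint
    have "(\<lambda>p. B (max 0 (fst p)) (snd p)) \<in> lborel \<Otimes>\<^sub>M W \<rightarrow>\<^sub>M cemetery_borel" by (simp add: case_prod_beta')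
    from measurable_compose[OF measurable_pair_swap' this] show ?thesis by (simp add: case_prod_beta')
  qed
  have "(\<lambda>p. ennreal (exp (- \<alpha> * snd p)) * indicator {q..} (snd p) * indicator (Some ` A) (B (max 0 (snd p)) (fst p))) \<in> borel_measurable (W \<Otimes>\<^sub>M lborel)"
    using measurable_compose[OF m borel_measurable_indicator[OF Some_image_cemetery[OF A]]] by measurable
  from lborel.borel_measurable_nn_integral_fst[OF this] show ?thesis
    unfolding occ_def by simp
qed

lemma Fubini_P:
  assumes "f \<in> borel_measurable (lborel \<Otimes>\<^sub>M P x)"
  shows "(\<integral>\<^sup>+\<omega>. (\<integral>\<^sup>+s. f (s, \<omega>) \<partial>lborel) \<partial>P x) = (\<integral>\<^sup>+s. (\<integral>\<^sup>+\<omega>. f (s, \<omega>) \<partial>P x) \<partial>lborel)"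
proof -
  interpret prob_space "P x" by (rule prob_P)
  interpret pair_sigma_finite lborel "P x" ..
  show ?thesis using Fubini[OF assms] by simp
qed

lemma pot_eq_occ:
  assumes A: "A \<in> sets borel"
  shows "pot \<alpha> A x = (\<integral>\<^sup>+\<omega>. occ \<alpha> A 0 \<omega> \<partial>P x)"
proof -
  note [measurable] = measurable_compose[OF measurable_B_pair borel_measurable_indicator[OF Some_image_cemetery[OF A]]]
  have m: "(\<lambda>\<omega>. indicator (Some ` A) (B (max 0 s) \<omega>) :: ennreal) \<in> borel_measurable (P x)" for s
    unfolding measurable_P
    by (rule measurable_compose[OF measurable_B borel_measurable_indicator[OF Some_image_cemetery[OF A]]]) simp
  have "(\<lambda>(s, \<omega>). ennreal (exp (- \<alpha> * s)) * indicator {0..} s * indicator (Some ` A) (B (max 0 s) \<omega>)) \<in> borel_measurable (lborel \<Otimes>\<^sub>M P x)"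
    unfolding case_prod_beta' by measurable
  then have "(\<integral>\<^sup>+\<omega>. occ \<alpha> A 0 \<omega> \<partial>P x) = (\<integral>\<^sup>+s. (\<integral>\<^sup>+\<omega>. ennreal (exp (- \<alpha> * s)) * indicator {0..} s * indicator (Some ` A) (B (max 0 s) \<omega>) \<partial>P x) \<partial>lborel)"
    unfolding occ_def by (drule_tac Fubini_P) simp
  also have "\<dots> = pot \<alpha> A x"
    unfolding pot_def using m by (simp add: nn_integral_cmult transition_eq[OF _ A])
  finally show ?thesis by simp
qed

lemma occ_shift:
  assumes A: "A \<in> sets borel" and q: "0 \<le> q" and w: "\<omega> \<in> space W"
  shows "occ \<alpha> A q \<omega> = (\<integral>\<^sup>+s. ennreal (exp (- \<alpha> * (q + s))) * indicator {0..} s * indicator (Some ` A) (B (q + max 0 s) \<omega>) \<partial>lborel)"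
proof -
  have "(\<lambda>p. B (max 0 (fst p)) (snd p)) \<in> borel \<Otimes>\<^sub>M W \<rightarrow>\<^sub>M cemetery_borel"
    using measurable_B_joint by (simp add: case_prod_beta')
  from measurable_compose[OF measurable_Pair2'[OF w] this]
  have "(\<lambda>s. B (max 0 s) \<omega>) \<in> borel \<rightarrow>\<^sub>M cemetery_borel" by simp
  from measurable_compose[OF this borel_measurable_indicator[OF Some_image_cemetery[OF A]]]
  have m[measurable]: "(\<lambda>s. indicator (Some ` A) (B (max 0 s) \<omega>) :: ennreal) \<in> borel_measurable borel" .
  have "occ \<alpha> A q \<omega> = (\<integral>\<^sup>+s. ennreal (exp (- \<alpha> * (q + 1 * s))) * indicator {q..} (q + 1 * s) * indicator (Some ` A) (B (max 0 (q + 1 * s)) \<omega>) \<partial>lborel)"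
    unfolding occ_def by (subst nn_integral_real_affine[where c = 1 and t = q]) auto
  also have "\<dots> = (\<integral>\<^sup>+s. ennreal (exp (- \<alpha> * (q + s))) * indicator {0..} s * indicator (Some ` A) (B (q + max 0 s) \<omega>) \<partial>lborel)"
    using q by (intro nn_integral_cong) (auto simp: indicator_def max_def)
  finally show ?thesis .
qed

text \<open>Fubini reduces the claim to single times, where it is the Markov property at
  \<open>q\<close>; the factor \<open>exp (- \<alpha> * q)\<close> is the discount accumulated until
  then.\<close>

lemma markov_pot:
  assumes q: "0 \<le> q" and \<Lambda>: "\<Lambda> \<in> sets (natural_filtration W B (ennreal q))" and A: "A \<in> sets borel"
  shows "(\<integral>\<^sup>+\<omega>. occ \<alpha> A q \<omega> * indicator \<Lambda> \<omega> \<partial>P x)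
     = ennreal (exp (- \<alpha> * q)) * (\<integral>\<^sup>+\<omega>. zero_ext (pot \<alpha> A) (B q \<omega>) * indicator \<Lambda> \<omega> \<partial>P x)"
proof -
  have \<Lambda>W: "\<Lambda> \<in> sets W" using \<Lambda> natural_subset by blast
  have \<Lambda>P[measurable]: "\<Lambda> \<in> sets (P x)" using \<Lambda>W by (simp add: sets_P)
  define h where "h s \<omega> = ennreal (exp (- \<alpha> * (q + s))) * indicator {0..} s * (indicator (Some ` A) (B (q + max 0 s) \<omega>) * indicator \<Lambda> \<omega>)" for s \<omega>
  define k where "k s \<omega> = ennreal (exp (- \<alpha> * (q + s))) * indicator {0..} s * (zero_ext (\<lambda>y. tr (max 0 s) y A) (B q \<omega>) * indicator \<Lambda> \<omega>)" for s \<omega>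
  have mh: "(\<lambda>(s, \<omega>). h s \<omega>) \<in> borel_measurable (lborel \<Otimes>\<^sub>M P x)"
  proof -
    have "(\<lambda>p. (q + max 0 (fst p), snd p)) \<in> lborel \<Otimes>\<^sub>M P x \<rightarrow>\<^sub>M lborel \<Otimes>\<^sub>M P x" by measurable
    from measurable_compose[OF this measurable_B_pair]
    have "(\<lambda>p. B (q + max 0 (fst p)) (snd p)) \<in> lborel \<Otimes>\<^sub>M P x \<rightarrow>\<^sub>M cemetery_borel" using q by (simp add: max_absorb2)
    from measurable_compose[OF this borel_measurable_indicator[OF Some_image_cemetery[OF A]]]
    have [measurable]: "(\<lambda>p. indicator (Some ` A) (B (q + max 0 (fst p)) (snd p)) :: ennreal) \<in> borel_measurable (lborel \<Otimes>\<^sub>M P x)" .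
    show ?thesis unfolding h_def case_prod_beta' by measurable
  qed
  have mB: "B q \<in> P x \<rightarrow>\<^sub>M cemetery_borel" unfolding measurable_P by (rule measurable_B[OF q])
  have mk: "(\<lambda>(s, \<omega>). k s \<omega>) \<in> borel_measurable (lborel \<Otimes>\<^sub>M P x)"
  proof -
    define Z where "Z p = (case snd p of None \<Rightarrow> 0 | Some y \<Rightarrow> tr (max 0 (fst p)) y A)" for p :: "real \<times> 'a option"
    \<comment> \<open>A dummy position for the cemetery gives a total map into the tree; the
      indicator of being alive, multiplied in below, removes its contribution.\<close>
    define y0 :: 'a where "y0 = undefined"
    have "(\<lambda>z. case z of None \<Rightarrow> y0 | Some y \<Rightarrow> y) \<in> cemetery_borel \<rightarrow>\<^sub>M borel"
    proof (rule measurableI)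
      fix C :: "'a set" assume C: "C \<in> sets borel"
      have "(\<lambda>z. case z of None \<Rightarrow> y0 | Some y \<Rightarrow> y) -` C \<inter> space cemetery_borel = Some ` C \<union> (if y0 \<in> C then {None} else {})"
        by (intro set_eqI) (auto split: option.splits)
      also have "\<dots> \<in> sets cemetery_borel" using C by (intro sets.Un Some_image_cemetery) (auto intro: None_cemetery)
      finally show "(\<lambda>z. case z of None \<Rightarrow> y0 | Some y \<Rightarrow> y) -` C \<inter> space cemetery_borel \<in> sets cemetery_borel" .
    qed simp
    from measurable_compose[OF mB this] have [measurable]: "(\<lambda>\<omega>. case B q \<omega> of None \<Rightarrow> y0 | Some y \<Rightarrow> y) \<in> P x \<rightarrow>\<^sub>M borel" .
    have "(\<lambda>p. (fst p, case B q (snd p) of None \<Rightarrow> y0 | Some y \<Rightarrow> y)) \<in> lborel \<Otimes>\<^sub>M P x \<rightarrow>\<^sub>M lborel \<Otimes>\<^sub>M borel" by measurable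
    from measurable_compose[OF this measurable_transition_pair[OF A]]
    have [measurable]: "(\<lambda>p. tr (max 0 (fst p)) (case B q (snd p) of None \<Rightarrow> y0 | Some y \<Rightarrow> y) A) \<in> borel_measurable (lborel \<Otimes>\<^sub>M P x)" by simp
    have "(\<lambda>\<omega>. indicator (Some ` UNIV) (B q \<omega>) :: ennreal) \<in> borel_measurable (P x)"
      by (rule measurable_compose[OF mB borel_measurable_indicator[OF Some_image_cemetery]]) simp
    then have [measurable]: "(\<lambda>p. indicator (Some ` UNIV) (B q (snd p)) :: ennreal) \<in> borel_measurable (lborel \<Otimes>\<^sub>M P x)" by measurable
    have "(\<lambda>p. ennreal (exp (- \<alpha> * (q + fst p))) * indicator {0..} (fst p) * ((indicator (Some ` UNIV) (B q (snd p)) * tr (max 0 (fst p)) (case B q (snd p) of None \<Rightarrow> y0 | Some y \<Rightarrow> y) A) * indicator \<Lambda> (snd p)))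
      \<in> borel_measurable (lborel \<Otimes>\<^sub>M P x)" by measurable
    also have "(\<lambda>p. ennreal (exp (- \<alpha> * (q + fst p))) * indicator {0..} (fst p) * ((indicator (Some ` UNIV) (B q (snd p)) * tr (max 0 (fst p)) (case B q (snd p) of None \<Rightarrow> y0 | Some y \<Rightarrow> y) A) * indicator \<Lambda> (snd p)))
      = (\<lambda>(s, \<omega>). k s \<omega>)"
      by (auto simp: k_def fun_eq_iff split: option.splits)
    finally show ?thesis .
  qed
  have inner: "(\<integral>\<^sup>+\<omega>. h s \<omega> \<partial>P x) = (\<integral>\<^sup>+\<omega>. k s \<omega> \<partial>P x)" for s
  proof -
    have s: "0 \<le> max 0 s" by simp
    have ev: "{\<omega>\<in>\<Lambda>. B (q + max 0 s) \<omega> \<in> Some ` A} \<in> sets (P x)"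
    proof -
      have "{\<omega>\<in>\<Lambda>. B (q + max 0 s) \<omega> \<in> Some ` A} = \<Lambda> \<inter> (B (q + max 0 s) -` (Some ` A) \<inter> space W)"
        using sets.sets_into_space[OF \<Lambda>W] by auto
      also have "\<dots> \<in> sets W"
        using q by (intro sets.Int \<Lambda>W measurable_sets[OF measurable_B Some_image_cemetery[OF A]]) simp
      finally show ?thesis by (simp add: sets_P)
    qed
    have "(\<integral>\<^sup>+\<omega>. indicator (Some ` A) (B (q + max 0 s) \<omega>) * indicator \<Lambda> \<omega> \<partial>P x) = emeasure (P x) {\<omega>\<in>\<Lambda>. B (q + max 0 s) \<omega> \<in> Some ` A}"
      unfolding nn_integral_indicator[OF ev, symmetric] by (intro nn_integral_cong) (auto simp: indicator_def)
    also have "\<dots> = (\<integral>\<^sup>+\<omega>. zero_ext (\<lambda>y. tr (max 0 s) y A) (B q \<omega>) * indicator \<Lambda> \<omega> \<partial>P x)"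
      by (rule markov_property[OF q \<Lambda> s A])
    finally have eq: "(\<integral>\<^sup>+\<omega>. indicator (Some ` A) (B (q + max 0 s) \<omega>) * indicator \<Lambda> \<omega> \<partial>P x) = (\<integral>\<^sup>+\<omega>. zero_ext (\<lambda>y. tr (max 0 s) y A) (B q \<omega>) * indicator \<Lambda> \<omega> \<partial>P x)" .
    have m1: "(\<lambda>\<omega>. indicator (Some ` A) (B (q + max 0 s) \<omega>) * indicator \<Lambda> \<omega> :: ennreal) \<in> borel_measurable (P x)"
    proof -
      have "(\<lambda>\<omega>. indicator (Some ` A) (B (q + max 0 s) \<omega>) :: ennreal) \<in> borel_measurable (P x)"
        unfolding measurable_P using q
        by (intro measurable_compose[OF measurable_B borel_measurable_indicator[OF Some_image_cemetery[OF A]]]) simp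
      then show ?thesis by measurable
    qed
    have m2: "(\<lambda>\<omega>. zero_ext (\<lambda>y. tr (max 0 s) y A) (B q \<omega>) * indicator \<Lambda> \<omega>) \<in> borel_measurable (P x)"
    proof -
      have "(\<lambda>\<omega>. zero_ext (\<lambda>y. tr (max 0 s) y A) (B q \<omega>)) \<in> borel_measurable (P x)"
        by (rule measurable_compose[OF mB borel_measurable_zero_ext[OF transition_measurable[OF s A]]])
      then show ?thesis by measurable
    qed
    show ?thesis unfolding h_def k_def by (simp only: nn_integral_cmult[OF m1] nn_integral_cmult[OF m2] eq)
  qed
  have "(\<integral>\<^sup>+\<omega>. occ \<alpha> A q \<omega> * indicator \<Lambda> \<omega> \<partial>P x) = (\<integral>\<^sup>+\<omega>. (\<integral>\<^sup>+s. h s \<omega> \<partial>lborel) \<partial>P x)"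
  proof (intro nn_integral_cong)
    fix \<omega> assume "\<omega> \<in> space (P x)"
    then have w: "\<omega> \<in> space W" by (simp add: space_P)
    show "occ \<alpha> A q \<omega> * indicator \<Lambda> \<omega> = (\<integral>\<^sup>+s. h s \<omega> \<partial>lborel)"
      unfolding occ_shift[OF A q w] h_def by (cases "\<omega> \<in> \<Lambda>") simp_all
  qed
  also have "\<dots> = (\<integral>\<^sup>+s. (\<integral>\<^sup>+\<omega>. h s \<omega> \<partial>P x) \<partial>lborel)"
    using Fubini_P[OF mh] by simp
  also have "\<dots> = (\<integral>\<^sup>+s. (\<integral>\<^sup>+\<omega>. k s \<omega> \<partial>P x) \<partial>lborel)" by (simp only: inner)
  also have "\<dots> = (\<integral>\<^sup>+\<omega>. (\<integral>\<^sup>+s. k s \<omega> \<partial>lborel) \<partial>P x)"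
    using Fubini_P[OF mk] by simp
  also have "\<dots> = (\<integral>\<^sup>+\<omega>. ennreal (exp (- \<alpha> * q)) * (zero_ext (pot \<alpha> A) (B q \<omega>) * indicator \<Lambda> \<omega>) \<partial>P x)"
  proof (intro nn_integral_cong)
    fix \<omega>
    show "(\<integral>\<^sup>+s. k s \<omega> \<partial>lborel) = ennreal (exp (- \<alpha> * q)) * (zero_ext (pot \<alpha> A) (B q \<omega>) * indicator \<Lambda> \<omega>)"
    proof (cases "B q \<omega>")
      case None
      then show ?thesis by (simp add: k_def)
    next
      case (Some y)
      have my: "(\<lambda>s. tr (max 0 s) y A) \<in> borel_measurable lborel"
        using measurable_compose[OF measurable_Pair2'[of y borel lborel] measurable_transition_pair[OF A]] by simp
      have "k s \<omega> = ennreal (exp (- \<alpha> * q)) * indicator \<Lambda> \<omega> * (ennreal (exp (- \<alpha> * s)) * indicator {0..} s * tr (max 0 s) y A)" for s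
      proof -
        have "exp (- \<alpha> * (q + s)) = exp (- \<alpha> * q) * exp (- \<alpha> * s)" by (simp add: exp_add[symmetric] algebra_simps)
        then show ?thesis by (simp only: k_def Some zero_ext_simps ennreal_mult exp_ge_zero mult_ac)
      qed
      then have "(\<integral>\<^sup>+s. k s \<omega> \<partial>lborel) = ennreal (exp (- \<alpha> * q)) * indicator \<Lambda> \<omega> * pot \<alpha> A y"
        unfolding pot_def using my by (simp add: nn_integral_cmult)
      then show ?thesis by (simp add: Some mult_ac)
    qed
  qed
  also have "\<dots> = ennreal (exp (- \<alpha> * q)) * (\<integral>\<^sup>+\<omega>. zero_ext (pot \<alpha> A) (B q \<omega>) * indicator \<Lambda> \<omega> \<partial>P x)"
  proof (rule nn_integral_cmult)
    have "(\<lambda>\<omega>. zero_ext (pot \<alpha> A) (B q \<omega>)) \<in> borel_measurable (P x)"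
      by (rule measurable_compose[OF mB borel_measurable_zero_ext[OF measurable_pot[OF A]]])
    then show "(\<lambda>\<omega>. zero_ext (pot \<alpha> A) (B q \<omega>) * indicator \<Lambda> \<omega>) \<in> borel_measurable (P x)" by measurable
  qed
  finally show ?thesis .
qed

subsection \<open>Hitting a point\<close>

text \<open>Unlike in \<open>hitting_time\<close>, time 0 counts. The infimum, if finite, is then
  attained, so the process sits at \<open>y\<close> at this time and the strong Markov property
  restarts it there.\<close>

definition hit :: "'a \<Rightarrow> 'w \<Rightarrow> ennreal" where
  "hit y \<omega> = Inf {ennreal t | t. 0 \<le> t \<and> B t \<omega> = Some y}"

lemma alive_interval:
  assumes w: "\<omega> \<in> space W" and s: "0 \<le> s" "B s \<omega> \<noteq> None"
  shows "\<And>t. 0 \<le> t \<Longrightarrow> t \<le> s \<Longrightarrow> B t \<omega> = Some (the (B t \<omega>))" "continuous_on {0..s} (\<lambda>t. the (B t \<omega>))"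
proof -
  have *: "B t \<omega> \<noteq> None" if "0 \<le> t" "t \<le> s" for t
    using B_None_mono[OF w that] s by blast
  then show "\<And>t. 0 \<le> t \<Longrightarrow> t \<le> s \<Longrightarrow> B t \<omega> = Some (the (B t \<omega>))" by simp
  show "continuous_on {0..s} (\<lambda>t. the (B t \<omega>))"
    by (rule continuous_on_subset[OF B_continuous[OF w]]) (use * in auto)
qed

text \<open>On an interval ending with a visit to \<open>y\<close> the path is alive and continuous,
  so the visiting times in it form a closed set, which contains its infimum.\<close>

lemma hit_attained:
  assumes w: "\<omega> \<in> space W" and h: "hit y \<omega> < \<infinity>"
  obtains t where "0 \<le> t" "B t \<omega> = Some y" "hit y \<omega> = ennreal t"
proof -
  obtain t0 where t0: "0 \<le> t0" "B t0 \<omega> = Some y"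
  proof (rule ccontr)
    assume "\<not> thesis"
    then have e: "{ennreal t | t. 0 \<le> t \<and> B t \<omega> = Some y} = {}" using that by blast
    have "hit y \<omega> = \<infinity>" unfolding hit_def e by simp
    then show False using h by simp
  qed
  define C where "C = {t \<in> {0..t0}. the (B t \<omega>) = y}"
  have al: "B t \<omega> = Some (the (B t \<omega>))" if "0 \<le> t" "t \<le> t0" for t
    using alive_interval(1)[OF w t0(1)] t0(2) that by simp
  have "closed C"
    unfolding C_def using alive_interval(2)[OF w t0(1)] t0(2)
    by (intro continuous_closed_preimage_constant) auto
  moreover have "t0 \<in> C" using t0 by (simp add: C_def)
  moreover have bdd: "bdd_below C" by (rule bdd_belowI[of _ 0]) (simp add: C_def)
  ultimately have i: "Inf C \<in> C" by (intro closed_contains_Inf) auto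
  define i where "i = Inf C"
  have ii: "0 \<le> i" "i \<le> t0" "B i \<omega> = Some y" using i al[of i] by (auto simp: C_def i_def)
  have min: "i \<le> t" if "0 \<le> t" "B t \<omega> = Some y" for t
  proof (cases "t \<le> t0")
    case True
    then have "t \<in> C" using that by (simp add: C_def)
    then show ?thesis unfolding i_def using bdd by (rule cInf_lower)
  next
    case False then show ?thesis using ii by simp
  qed
  have "hit y \<omega> = ennreal i"
    unfolding hit_def
  proof (rule antisym)
    show "Inf {ennreal t | t. 0 \<le> t \<and> B t \<omega> = Some y} \<le> ennreal i" using ii by (intro Inf_lower) blast
    show "ennreal i \<le> Inf {ennreal t | t. 0 \<le> t \<and> B t \<omega> = Some y}"
      using min by (intro Inf_greatest) (auto intro: ennreal_leI)
  qed
  then show ?thesis using that ii by blast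
qed

lemma hit_le: "0 \<le> t \<Longrightarrow> B t \<omega> = Some y \<Longrightarrow> hit y \<omega> \<le> ennreal t"
  unfolding hit_def by (intro Inf_lower) blast

text \<open>A path alive at \<open>s\<close> is continuous on the compact interval, so its distance
  to \<open>y\<close> attains a minimum, and visits to all balls force that minimum to be 0. A path
  that dies while approaching \<open>y\<close> would escape this argument.\<close>

lemma hit_by_approach:
  assumes w: "\<omega> \<in> space W" and s: "0 \<le> s" "B s \<omega> \<noteq> None" and a: "0 \<le> a"
    and app: "\<And>n::nat. \<exists>q. a \<le> q \<and> q \<le> s \<and> B q \<omega> \<in> Some ` ball y (1 / Suc n)"
  obtains u where "a \<le> u" "u \<le> s" "B u \<omega> = Some y"
proof -
  have as: "a \<le> s" using app[of 0] by auto
  have "continuous_on {a..s} (\<lambda>t. dist y (the (B t \<omega>)))"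
    using a by (intro continuous_intros continuous_on_subset[OF alive_interval(2)[OF w s]]) auto
  then obtain u where u: "u \<in> {a..s}" "\<And>t. t \<in> {a..s} \<Longrightarrow> dist y (the (B u \<omega>)) \<le> dist y (the (B t \<omega>))"
    using continuous_attains_inf[of "{a..s}" "\<lambda>t. dist y (the (B t \<omega>))"] as by auto
  have "dist y (the (B u \<omega>)) \<le> 0"
  proof (rule ccontr)
    assume "\<not> dist y (the (B u \<omega>)) \<le> 0"
    then obtain n :: nat where n: "1 / Suc n < dist y (the (B u \<omega>))"
      using nat_approx_posE[of "dist y (the (B u \<omega>))"] by auto
    obtain q z where q: "a \<le> q" "q \<le> s" "B q \<omega> = Some z" "dist y z < 1 / Suc n"
      using app[of n] by auto
    then show False using u(2)[of q] n by simp
  qed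
  then have "the (B u \<omega>) = y" by simp
  then show ?thesis using that[of u] u(1) a alive_interval(1)[OF w s, of u] by simp
qed

text \<open>Restates the event with countably many times, for the sake of measurability. The time
  \<open>s\<close> certifies that the path survives its approaching times; otherwise it might come
  near \<open>y\<close> only on its way to the cemetery.\<close>

lemma hit_le_iff_approach:
  assumes w: "\<omega> \<in> space W" and t: "0 \<le> t"
  shows "hit y \<omega> \<le> ennreal t \<longleftrightarrow> (\<exists>s\<in>insert t (\<rat> \<inter> {0..t}). B s \<omega> \<in> Some ` UNIV \<and>
     (\<forall>n::nat. \<exists>q\<in>insert t (\<rat> \<inter> {0..t}). q \<le> s \<and> B q \<omega> \<in> Some ` ball y (1 / Suc n)))" (is "?L \<longleftrightarrow> ?R")
proof
  assume ?R
  then obtain s where s: "s \<in> insert t (\<rat> \<inter> {0..t})" "B s \<omega> \<in> Some ` UNIV"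
    "\<And>n::nat. \<exists>q\<in>insert t (\<rat> \<inter> {0..t}). q \<le> s \<and> B q \<omega> \<in> Some ` ball y (1 / Suc n)" by blast
  have s': "0 \<le> s" "s \<le> t" "B s \<omega> \<noteq> None" using s t by auto
  have "\<exists>q. 0 \<le> q \<and> q \<le> s \<and> B q \<omega> \<in> Some ` ball y (1 / Suc n)" for n :: nat
    using s(3)[of n] t by auto
  then obtain u where "0 \<le> u" "u \<le> s" "B u \<omega> = Some y"
    using hit_by_approach[OF w s'(1,3) order_refl] by blast
  then show ?L using hit_le[of u \<omega> y] s'(2) by (meson ennreal_leI order_trans)
next
  assume L: ?L
  then have "hit y \<omega> < \<infinity>" by (metis ennreal_less_top infinity_ennreal_def le_less_trans)
  then obtain u where u: "0 \<le> u" "B u \<omega> = Some y" "hit y \<omega> = ennreal u" using hit_attained[OF w] by blast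
  have ut: "u \<le> t" using L u t by simp
  show ?R
  proof (cases "u = t")
    case True
    then show ?thesis using u by (intro bexI[of _ t]) auto
  next
    case False
    obtain b where b: "u < b" "B b \<omega> \<noteq> None" using alive_right[OF w u(1)] u(2) by auto
    have "u < min b t" using b False ut by simp
    \<comment> \<open>A rational time after the visit at \<open>u\<close> and before death. Rational
      times just after \<open>u\<close> find the path close to \<open>y\<close>, by right
      continuity.\<close>
    then obtain s where s: "s \<in> \<rat>" "u < s" "s < min b t" using Rats_dense_in_real by blast
    have al: "B q \<omega> \<noteq> None" if "0 \<le> q" "q \<le> s" for q
      using B_None_mono[OF w that(1), of b] b(2) that s by auto
    show ?thesis
    proof (rule bexI[of _ s], intro conjI allI)
      show "s \<in> insert t (\<rat> \<inter> {0..t})" using s u by auto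
      show "B s \<omega> \<in> Some ` UNIV" using al[of s] s u by auto
      fix n :: nat
      have "((\<lambda>q. zero_ext (dist y) (B q \<omega>)) \<longlongrightarrow> zero_ext (dist y) (B u \<omega>)) (at_right u)"
        by (rule right_continuous[OF w u(1)]) (intro continuous_intros)
      then have "\<forall>\<^sub>F q in at_right u. zero_ext (dist y) (B q \<omega>) < 1 / Suc n"
        by (rule order_tendstoD(2)) (simp only: u(2) zero_ext_simps dist_self zero_less_divide_1_iff of_nat_0_less_iff zero_less_Suc)
      then obtain c where c: "u < c" "\<And>q. u < q \<Longrightarrow> q < c \<Longrightarrow> zero_ext (dist y) (B q \<omega>) < 1 / Suc n"
        unfolding eventually_at_right_field by blast
      obtain q where q: "q \<in> \<rat>" "u < q" "q < min c s" using Rats_dense_in_real[of u "min c s"] c s by auto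
      obtain z where z: "B q \<omega> = Some z" using al[of q] q u by auto
      then have "dist y z < 1 / Suc n" using c(2)[of q] q by simp
      then have "B q \<omega> \<in> Some ` ball y (1 / Suc n)" using z by auto
      then show "\<exists>q\<in>insert t (\<rat> \<inter> {0..t}). q \<le> s \<and> B q \<omega> \<in> Some ` ball y (1 / Suc n)"
        using q u s by (intro bexI[of _ q]) auto
    qed
  qed
qed

lemma hit_event:
  assumes t: "0 \<le> t" shows "{\<omega> \<in> space W. hit y \<omega> \<le> ennreal t} \<in> sets (natural_filtration W B (ennreal t))"
proof -
  let ?D = "insert t (\<rat> \<inter> {0..t})"
  let ?N = "natural_filtration W B (ennreal t)"
  have cD: "countable ?D" using countable_subset[OF Int_lower1 countable_rat] by simp
  have ev: "{\<omega> \<in> space W. B s \<omega> \<in> Some ` A} \<in> sets ?N" if "s \<in> ?D" "A \<in> sets borel" for s A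
    using that t by (intro natural_event) (auto intro: ennreal_leI)
  have "{\<omega> \<in> space ?N. \<exists>s\<in>?D. B s \<omega> \<in> Some ` UNIV \<and>
     (\<forall>n::nat. \<exists>q\<in>?D. q \<le> s \<and> B q \<omega> \<in> Some ` ball y (1 / Suc n))} \<in> sets ?N"
    by (intro sets.sets_Collect_countable_Ex' sets.sets_Collect_conj sets.sets_Collect_countable_All
        sets.sets_Collect_const cD) (simp_all only: space_natural ev borel_open open_ball open_UNIV)
  also have "{\<omega> \<in> space ?N. \<exists>s\<in>?D. B s \<omega> \<in> Some ` UNIV \<and>
     (\<forall>n::nat. \<exists>q\<in>?D. q \<le> s \<and> B q \<omega> \<in> Some ` ball y (1 / Suc n))} = {\<omega> \<in> space W. hit y \<omega> \<le> ennreal t}"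
    unfolding space_natural by (intro Collect_cong conj_cong refl hit_le_iff_approach[OF _ t, symmetric])
  finally show ?thesis .
qed

lemma stopping_hit: "stopping_time (right_filtration W B) (hit y)"
proof
  fix t :: ennreal
  have "{\<omega> \<in> space W. hit y \<omega> \<le> t} \<in> sets (right_filtration W B t)"
  proof (cases t rule: ennreal_cases)
    case (real r)
    then show ?thesis using hit_event[of r y] natural_subset_right[of t] by auto
  next
    case top
    then show ?thesis using sets.top[of "right_filtration W B t"] by simp
  qed
  then show "Measurable.pred (right_filtration W B t) (\<lambda>\<omega>. hit y \<omega> \<le> t)"
    by (simp add: Measurable.pred_def)
qed

lemma measurable_hit: "hit y \<in> borel_measurable W"
  by (rule measurable_stopping_time[OF stopping_hit right_subset space_right])

lemma hit_finite_event: "{\<omega> \<in> space W. hit y \<omega> < \<infinity>} \<in> sets (P x)"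
  using measurable_sets[OF measurable_hit, of "{..<\<infinity>}" y] by (simp add: sets_P vimage_def Int_def conj_commute)

text \<open>At the hitting time the position is \<open>y\<close>, so the transition factor in the
  strong Markov property is constant and the integral factorises.\<close>

lemma strong_markov_hit:
  assumes s: "0 \<le> s" and A: "A \<in> sets borel"
  shows "emeasure (P x) {\<omega> \<in> space W. hit y \<omega> < \<infinity> \<and> B (enn2real (hit y \<omega>) + s) \<omega> \<in> Some ` A}
     = emeasure (P x) {\<omega> \<in> space W. hit y \<omega> < \<infinity>} * tr s y A"
proof -
  have st: "{\<omega> \<in> space W. hit y \<omega> \<le> t} \<in> sets (right_filtration W B t)" for t
    using stopping_timeD[OF stopping_hit[of y], of t] by (simp add: Measurable.pred_def)
  have "emeasure (P x) {\<omega> \<in> space W. hit y \<omega> < \<infinity> \<and> B (enn2real (hit y \<omega>) + s) \<omega> \<in> Some ` A}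
     = (\<integral>\<^sup>+\<omega>\<in>{\<omega> \<in> space W. hit y \<omega> < \<infinity>}. zero_ext (\<lambda>z. tr s z A) (B (enn2real (hit y \<omega>)) \<omega>) \<partial>P x)"
    by (rule strong_markov_property[OF stopping_hit st s A])
  also have "\<dots> = (\<integral>\<^sup>+\<omega>. tr s y A * indicator {\<omega> \<in> space W. hit y \<omega> < \<infinity>} \<omega> \<partial>P x)"
  proof (intro nn_integral_cong)
    fix \<omega>
    show "zero_ext (\<lambda>z. tr s z A) (B (enn2real (hit y \<omega>)) \<omega>) * indicator {\<omega> \<in> space W. hit y \<omega> < \<infinity>} \<omega>
        = tr s y A * indicator {\<omega> \<in> space W. hit y \<omega> < \<infinity>} \<omega>"
    proof (cases "\<omega> \<in> space W \<and> hit y \<omega> < \<infinity>")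
      case True
      then obtain t where "0 \<le> t" "B t \<omega> = Some y" "hit y \<omega> = ennreal t" using hit_attained by blast
      then show ?thesis by simp
    qed (auto simp: indicator_def)
  qed
  also have "\<dots> = emeasure (P x) {\<omega> \<in> space W. hit y \<omega> < \<infinity>} * tr s y A"
    using hit_finite_event[of y x] by (simp add: nn_integral_cmult mult.commute)
  finally show ?thesis .
qed

text \<open>The occupation of \<open>A\<close> after the first visit to \<open>y\<close> is part of
  the total occupation and, by the strong Markov property, has the law of the occupation from
  \<open>y\<close>. A finite or vanishing Green integral at \<open>x\<close> thus passes to every
  point hit with positive probability from \<open>x\<close>.\<close>

lemma pot_hit:
  assumes A: "A \<in> sets borel"
  shows "emeasure (P x) {\<omega> \<in> space W. hit y \<omega> < \<infinity>} * pot 0 A y \<le> pot 0 A x"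
proof -
  let ?H = "{\<omega> \<in> space W. hit y \<omega> < \<infinity>}"
  have H: "?H \<in> sets (P x)" by (rule hit_finite_event)
  have my: "(\<lambda>s. tr (max 0 s) y A) \<in> borel_measurable lborel"
    using measurable_compose[OF measurable_Pair2'[of y borel lborel] measurable_transition_pair[OF A]] by simp
  define h where "h = (\<lambda>(s, \<omega>). indicator {0..} s * (indicator (Some ` A) (B (enn2real (hit y \<omega>) + max 0 s) \<omega>) * indicator ?H \<omega>) :: ennreal)"
  have mhit: "(\<lambda>\<omega>. enn2real (hit y \<omega>)) \<in> borel_measurable (P x)"
    unfolding measurable_P using measurable_hit by measurable
  have mh: "h \<in> borel_measurable (lborel \<Otimes>\<^sub>M P x)"
  proof -
    have "(\<lambda>p. (enn2real (hit y (snd p)) + max 0 (fst p), snd p)) \<in> lborel \<Otimes>\<^sub>M P x \<rightarrow>\<^sub>M lborel \<Otimes>\<^sub>M P x"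
      using mhit by measurable
    from measurable_compose[OF this measurable_B_pair]
    have "(\<lambda>p. B (enn2real (hit y (snd p)) + max 0 (fst p)) (snd p)) \<in> lborel \<Otimes>\<^sub>M P x \<rightarrow>\<^sub>M cemetery_borel" by (simp add: max_absorb2)
    from measurable_compose[OF this borel_measurable_indicator[OF Some_image_cemetery[OF A]]]
    have [measurable]: "(\<lambda>p. indicator (Some ` A) (B (enn2real (hit y (snd p)) + max 0 (fst p)) (snd p)) :: ennreal) \<in> borel_measurable (lborel \<Otimes>\<^sub>M P x)" .
    have [measurable]: "?H \<in> sets (P x)" by (rule H)
    show ?thesis unfolding h_def case_prod_beta' by measurable
  qed
  have inner: "(\<integral>\<^sup>+\<omega>. h (s, \<omega>) \<partial>P x) = indicator {0..} s * (emeasure (P x) ?H * tr (max 0 s) y A)" for s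
  proof -
    have m1: "(\<lambda>\<omega>. indicator (Some ` A) (B (enn2real (hit y \<omega>) + max 0 s) \<omega>) * indicator ?H \<omega> :: ennreal) \<in> borel_measurable (P x)"
    proof -
      have "(\<lambda>\<omega>. (enn2real (hit y \<omega>) + max 0 s, \<omega>)) \<in> P x \<rightarrow>\<^sub>M lborel \<Otimes>\<^sub>M P x" using mhit by measurable
      from measurable_compose[OF this measurable_B_pair]
      have "(\<lambda>\<omega>. B (enn2real (hit y \<omega>) + max 0 s) \<omega>) \<in> P x \<rightarrow>\<^sub>M cemetery_borel" by (simp add: max_absorb2)
      from measurable_compose[OF this borel_measurable_indicator[OF Some_image_cemetery[OF A]]]
      have [measurable]: "(\<lambda>\<omega>. indicator (Some ` A) (B (enn2real (hit y \<omega>) + max 0 s) \<omega>) :: ennreal) \<in> borel_measurable (P x)" .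
      have [measurable]: "?H \<in> sets (P x)" by (rule H)
      show ?thesis by measurable
    qed
    let ?E = "{\<omega> \<in> space W. hit y \<omega> < \<infinity> \<and> B (enn2real (hit y \<omega>) + max 0 s) \<omega> \<in> Some ` A}"
    have "(\<lambda>\<omega>. indicator (Some ` A) (B (enn2real (hit y \<omega>) + max 0 s) \<omega>) * indicator ?H \<omega> :: ennreal) = indicator ?E"
      by (auto simp: indicator_def fun_eq_iff)
    moreover from this m1 have "?E \<inter> space (P x) \<in> sets (P x)"
      by (simp only: borel_measurable_indicator_iff)
    then have "?E \<in> sets (P x)" by (simp add: space_P Int_def conj_commute conj_left_commute)
    ultimately show ?thesis
      unfolding h_def prod.case nn_integral_cmult[OF m1]
      using strong_markov_hit[of "max 0 s" A x y] A by simp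
  qed
  have "emeasure (P x) ?H * pot 0 A y = (\<integral>\<^sup>+s. indicator {0..} s * (emeasure (P x) ?H * tr (max 0 s) y A) \<partial>lborel)"
    unfolding pot_def using my by (subst nn_integral_cmult[symmetric]) (auto intro!: nn_integral_cong simp: mult_ac)
  also have "\<dots> = (\<integral>\<^sup>+\<omega>. (\<integral>\<^sup>+s. h (s, \<omega>) \<partial>lborel) \<partial>P x)"
    using Fubini_P[OF mh] by (simp only: inner)
  also have "\<dots> \<le> (\<integral>\<^sup>+\<omega>. occ 0 A 0 \<omega> \<partial>P x)"
  proof (intro nn_integral_mono)
    fix \<omega> assume "\<omega> \<in> space (P x)"
    then have w: "\<omega> \<in> space W" by (simp add: space_P)
    show "(\<integral>\<^sup>+s. h (s, \<omega>) \<partial>lborel) \<le> occ 0 A 0 \<omega>"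
    proof (cases "hit y \<omega> < \<infinity>")
      case True
      let ?q = "enn2real (hit y \<omega>)"
      have "(\<integral>\<^sup>+s. h (s, \<omega>) \<partial>lborel) = occ 0 A ?q \<omega>"
        unfolding occ_shift[OF A enn2real_nonneg w] using True w by (intro nn_integral_cong) (simp add: h_def)
      also have "\<dots> \<le> occ 0 A 0 \<omega>"
        unfolding occ_def
        by (intro nn_integral_mono) (auto simp: indicator_def intro: order_trans[OF enn2real_nonneg])
      finally show ?thesis .
    qed (simp add: h_def)
  qed
  also have "\<dots> = pot 0 A x" by (rule pot_eq_occ[OF A, symmetric])
  finally show ?thesis .
qed

text \<open>Death is permanent, so it suffices to be alive at the integer times, which is a
  countable condition.\<close>

lemma AE_alive:
  assumes c: "\<And>n::nat. tr (real n) x UNIV = 1"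
  shows "AE \<omega> in P x. \<forall>t\<ge>0. B t \<omega> \<noteq> None"
proof -
  interpret prob_space "P x" by (rule prob_P)
  have "AE \<omega> in P x. B (real n) \<omega> \<in> Some ` UNIV" for n :: nat
  proof -
    have "{\<omega> \<in> space (P x). B (real n) \<omega> \<in> Some ` UNIV} \<in> events"
      using measurable_sets[OF measurable_B[of "real n"] Some_image_cemetery[of UNIV]]
      by (simp add: sets_P space_P vimage_def Int_def conj_commute)
    then show ?thesis
      using c[of n] unfolding transition_def
      by (subst AE_iff_emeasure_eq_1) auto
  qed
  then have "AE \<omega> in P x. \<forall>n::nat. B (real n) \<omega> \<in> Some ` UNIV" unfolding AE_all_countable ..
  then show ?thesis
  proof (rule AE_mp, intro AE_I2 impI allI)
    fix \<omega> t assume w: "\<omega> \<in> space (P x)" and *: "\<forall>n::nat. B (real n) \<omega> \<in> Some ` UNIV" and t: "0 \<le> (t::real)"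
    obtain n :: nat where "t \<le> real n" using real_arch_simple by blast
    then have "B t \<omega> = None \<Longrightarrow> B (real n) \<omega> = None"
      using B_None_mono[of \<omega> t "real n"] w t by (simp add: space_P)
    moreover have "B (real n) \<omega> \<noteq> None" using *[rule_format, of n] by auto
    ultimately show "B t \<omega> \<noteq> None" by blast
  qed
qed

text \<open>The process from \<open>x\<close> is almost surely still alive at time \<open>s\<close>
  after hitting \<open>y\<close>; the strong Markov identity is divided by the positive hitting
  probability.\<close>

lemma conservative_hit:
  assumes c: "\<And>n::nat. tr (real n) x UNIV = 1" and h: "emeasure (P x) {\<omega> \<in> space W. hit y \<omega> < \<infinity>} \<noteq> 0" and s: "0 \<le> s"
  shows "tr s y UNIV = 1"
proof -
  interpret prob_space "P x" by (rule prob_P)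
  let ?H = "{\<omega> \<in> space W. hit y \<omega> < \<infinity>}"
  have "emeasure (P x) {\<omega> \<in> space W. hit y \<omega> < \<infinity> \<and> B (enn2real (hit y \<omega>) + s) \<omega> \<in> Some ` UNIV} = emeasure (P x) ?H"
  proof (rule emeasure_eq_AE)
    show "AE \<omega> in P x. \<omega> \<in> {\<omega> \<in> space W. hit y \<omega> < \<infinity> \<and> B (enn2real (hit y \<omega>) + s) \<omega> \<in> Some ` UNIV} \<longleftrightarrow> \<omega> \<in> ?H"
      using AE_alive[OF c]
    proof eventually_elim
      case (elim \<omega>)
      then have "B (enn2real (hit y \<omega>) + s) \<omega> \<noteq> None" using s by simp
      then show ?case by auto
    qed
    have "(\<lambda>\<omega>. (enn2real (hit y \<omega>) + s, \<omega>)) \<in> P x \<rightarrow>\<^sub>M lborel \<Otimes>\<^sub>M P x"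
      using measurable_hit[of y] unfolding measurable_P[symmetric, of _ x] by measurable
    from measurable_compose[OF this measurable_B_pair]
    have "(\<lambda>\<omega>. B (enn2real (hit y \<omega>) + s) \<omega>) \<in> P x \<rightarrow>\<^sub>M cemetery_borel" using s by (simp add: max_absorb2)
    from measurable_sets[OF this Some_image_cemetery[OF borel_open[OF open_UNIV]]]
    have "?H \<inter> ((\<lambda>\<omega>. B (enn2real (hit y \<omega>) + s) \<omega>) -` (Some ` UNIV) \<inter> space (P x)) \<in> sets (P x)"
      by (rule sets.Int[OF hit_finite_event])
    also have "?H \<inter> ((\<lambda>\<omega>. B (enn2real (hit y \<omega>) + s) \<omega>) -` (Some ` UNIV) \<inter> space (P x))
      = {\<omega> \<in> space W. hit y \<omega> < \<infinity> \<and> B (enn2real (hit y \<omega>) + s) \<omega> \<in> Some ` UNIV}" by (auto simp: space_P)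
    finally show "{\<omega> \<in> space W. hit y \<omega> < \<infinity> \<and> B (enn2real (hit y \<omega>) + s) \<omega> \<in> Some ` UNIV} \<in> sets (P x)" .
  qed (rule hit_finite_event)
  then have "emeasure (P x) ?H * tr s y UNIV = emeasure (P x) ?H * 1"
    using strong_markov_hit[OF s, of UNIV x y] by simp
  then show ?thesis
    using h emeasure_finite[of ?H] unfolding ennreal_mult_cancel_left by simp
qed

end

lemma nn_integral_exp_atLeast:
  assumes a: "0 < \<alpha>"
  shows "(\<integral>\<^sup>+s. ennreal (exp (- \<alpha> * s)) * indicator {q..} s \<partial>lborel) = ennreal (exp (- \<alpha> * q) / \<alpha>)"
proof -
  have "(\<integral>\<^sup>+s. ennreal (exp (- \<alpha> * s)) * indicator {q..} s \<partial>lborel) = ennreal (0 - (- exp (- \<alpha> * q) / \<alpha>))"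
  proof (rule nn_integral_FTC_atLeast)
    show "((\<lambda>s. - exp (- \<alpha> * s) / \<alpha>) has_real_derivative exp (- \<alpha> * s)) (at s)" for s
      using a by (auto intro!: derivative_eq_intros)
    have "((\<lambda>s. exp (- (\<alpha> * s))) \<longlongrightarrow> 0) at_top"
      using a by (intro filterlim_compose[OF exp_at_bot] filterlim_compose[OF filterlim_uminus_at_bot_at_top]
          filterlim_tendsto_pos_mult_at_top[OF tendsto_const] filterlim_ident)
    then show "((\<lambda>s. - exp (- \<alpha> * s) / \<alpha>) \<longlongrightarrow> 0) at_top"
      using tendsto_divide[OF tendsto_minus, of "\<lambda>s. exp (- (\<alpha> * s))" 0 at_top "\<lambda>_. \<alpha>" \<alpha>] a by simp
  qed auto
  then show ?thesis by simp
qed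

context markov_process
begin

subsection \<open>Visits on a countable time grid\<close>

text \<open>First visits to \<open>A\<close> are taken along a countable set of times \<open>d i\<close>: no entrance time has to be
  shown measurable, and by Fubini the times can be chosen so that \<open>B (d i)\<close> avoids a given null set,
  outside of which the potentials satisfy bounds known only almost everywhere.\<close>

definition grid_disc :: "real \<Rightarrow> 'a set \<Rightarrow> (nat \<Rightarrow> real) \<Rightarrow> nat set \<Rightarrow> 'w \<Rightarrow> ennreal" where
  "grid_disc \<alpha> A d I \<omega> = (SUP i\<in>I. ennreal (exp (- \<alpha> * d i)) * indicator (Some ` A) (B (d i) \<omega>))"

text \<open>An infinite grid may have no first visited time, so the restriction to later times is
  phrased existentially. It is the increasing limit of the versions for finite grids.\<close>

definition grid_occ :: "real \<Rightarrow> 'a set \<Rightarrow> 'a set \<Rightarrow> (nat \<Rightarrow> real) \<Rightarrow> nat set \<Rightarrow> 'w \<Rightarrow> ennreal" where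
  "grid_occ \<alpha> A C d I \<omega> = (\<integral>\<^sup>+s. ennreal (exp (- \<alpha> * s)) * indicator {s. 0 \<le> s \<and> (\<exists>i\<in>I. d i \<le> s \<and> B (d i) \<omega> \<in> Some ` A)} s
      * indicator (Some ` C) (B (max 0 s) \<omega>) \<partial>lborel)"

lemma measurable_path:
  assumes w: "\<omega> \<in> space W" and A: "A \<in> sets borel"
  shows "(\<lambda>s. indicator (Some ` A) (B (max 0 s) \<omega>) :: ennreal) \<in> borel_measurable borel"
proof -
  have "(\<lambda>p. B (max 0 (fst p)) (snd p)) \<in> borel \<Otimes>\<^sub>M W \<rightarrow>\<^sub>M cemetery_borel"
    using measurable_B_joint by (simp add: case_prod_beta')
  from measurable_compose[OF measurable_Pair2'[OF w] this]
  have "(\<lambda>s. B (max 0 s) \<omega>) \<in> borel \<rightarrow>\<^sub>M cemetery_borel" by simp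
  from measurable_compose[OF this borel_measurable_indicator[OF Some_image_cemetery[OF A]]] show ?thesis .
qed

definition first_visit :: "'a set \<Rightarrow> real set \<Rightarrow> real \<Rightarrow> 'w set" where
  "first_visit A F q = {\<omega> \<in> space W. B q \<omega> \<in> Some ` A \<and> (\<forall>p\<in>F. p < q \<longrightarrow> B p \<omega> \<notin> Some ` A)}"

lemma first_visit_event:
  assumes F: "finite F" "\<And>p. p \<in> F \<Longrightarrow> 0 \<le> p" and q: "0 \<le> q" and A: "A \<in> sets borel"
  shows "first_visit A F q \<in> sets (natural_filtration W B (ennreal q))"
proof -
  let ?E = "\<lambda>p. {\<omega> \<in> space W. B p \<omega> \<in> Some ` A}"
  let ?N = "natural_filtration W B (ennreal q)"
  have ev: "?E p \<in> sets ?N" if "0 \<le> p" "p \<le> q" for p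
    using that A by (intro natural_event ennreal_leI)
  have "?E q - (\<Union>p\<in>{p \<in> F. p < q}. ?E p) \<in> sets ?N"
    using F q by (intro sets.Diff sets.finite_UN ev) auto
  also have "?E q - (\<Union>p\<in>{p \<in> F. p < q}. ?E p) = first_visit A F q"
    by (auto simp: first_visit_def)
  finally show ?thesis .
qed

text \<open>On a finite grid the visited times, if there are any, have a least element
  \<open>q\<close>, and among the first-visit events exactly that of \<open>q\<close> occurs. The
  sums range over times and not over indices, so that repeated values of \<open>d\<close> count
  once.\<close>

lemma grid_decompose:
  assumes w: "\<omega> \<in> space W" and d: "\<And>i. 0 \<le> d i" and a: "0 \<le> \<alpha>" and I: "finite I"
  shows "grid_disc \<alpha> A d I \<omega> = (\<Sum>q\<in>d ` I. ennreal (exp (- \<alpha> * q)) * indicator (first_visit A (d ` I) q) \<omega>)" (is ?D)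
    and "grid_occ \<alpha> A C d I \<omega> = (\<Sum>q\<in>d ` I. occ \<alpha> C q \<omega> * indicator (first_visit A (d ` I) q) \<omega>)" (is ?O)
proof -
  define H where "H = {q \<in> d ` I. B q \<omega> \<in> Some ` A}"
  have finH: "finite H" using I by (simp add: H_def)
  have "?D \<and> ?O"
  proof (cases "H = {}")
    case True
    then have no: "B (d i) \<omega> \<notin> Some ` A" if "i \<in> I" for i using that by (auto simp: H_def)
    then have "indicator (first_visit A (d ` I) q) \<omega> = (0::ennreal)" if "q \<in> d ` I" for q
      using that by (auto simp: first_visit_def)
    moreover have "grid_disc \<alpha> A d I \<omega> = 0"
      using no by (simp add: grid_disc_def SUP_eq_const cong: SUP_cong_simp) (cases "I = {}"; simp add: bot_ennreal)
    moreover have "{s. 0 \<le> s \<and> (\<exists>i\<in>I. d i \<le> s \<and> B (d i) \<omega> \<in> Some ` A)} = {}" using no by auto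
    then have "grid_occ \<alpha> A C d I \<omega> = 0" unfolding grid_occ_def by simp
    ultimately show ?thesis by simp
  next
    case False
    define q where "q = Min H"
    have qH: "q \<in> H" unfolding q_def using finH False by (rule Min_in)
    have qmin: "q \<le> p" if "p \<in> H" for p unfolding q_def using finH that by (rule Min_le)
    have ind: "indicator (first_visit A (d ` I) p) \<omega> = (if p = q then 1 else 0 :: ennreal)" if "p \<in> d ` I" for p
    proof -
      have "\<omega> \<in> first_visit A (d ` I) p \<longleftrightarrow> p = q"
      proof
        assume "\<omega> \<in> first_visit A (d ` I) p"
        then have p: "B p \<omega> \<in> Some ` A" "\<And>p'. p' \<in> d ` I \<Longrightarrow> p' < p \<Longrightarrow> B p' \<omega> \<notin> Some ` A"
          by (auto simp: first_visit_def)
        then have "p \<in> H" using that by (simp add: H_def)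
        then have "q \<le> p" by (rule qmin)
        moreover have "\<not> q < p" using p(2)[of q] qH by (auto simp: H_def)
        ultimately show "p = q" by simp
      next
        assume pq: "p = q"
        have "B p' \<omega> \<notin> Some ` A" if "p' \<in> d ` I" "p' < q" for p'
          using qmin[of p'] that by (auto simp: H_def)
        then show "\<omega> \<in> first_visit A (d ` I) p"
          using qH w pq by (simp add: first_visit_def H_def)
      qed
      then show ?thesis by (simp add: indicator_def)
    qed
    have qI: "q \<in> d ` I" using qH by (simp add: H_def)
    have s1: "(\<Sum>p\<in>d ` I. f p * indicator (first_visit A (d ` I) p) \<omega>) = f q" for f :: "real \<Rightarrow> ennreal"
    proof -
      have "(\<Sum>p\<in>d ` I. f p * indicator (first_visit A (d ` I) p) \<omega>) = (\<Sum>p\<in>d ` I. if p = q then f p else 0)"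
        by (intro sum.cong refl) (simp add: ind)
      then show ?thesis using qI I by (simp add: sum.delta)
    qed
    have "grid_disc \<alpha> A d I \<omega> = ennreal (exp (- \<alpha> * q))"
      unfolding grid_disc_def
    proof (rule antisym)
      obtain i where i: "i \<in> I" "d i = q" using qI by auto
      have "ennreal (exp (- \<alpha> * q)) = ennreal (exp (- \<alpha> * d i)) * indicator (Some ` A) (B (d i) \<omega>)"
        using qH i by (simp add: H_def)
      also have "\<dots> \<le> (SUP i\<in>I. ennreal (exp (- \<alpha> * d i)) * indicator (Some ` A) (B (d i) \<omega>))"
        using i(1) by (rule SUP_upper)
      finally show "ennreal (exp (- \<alpha> * q)) \<le> \<dots>" .
      show "(SUP i\<in>I. ennreal (exp (- \<alpha> * d i)) * indicator (Some ` A) (B (d i) \<omega>)) \<le> ennreal (exp (- \<alpha> * q))"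
      proof (rule SUP_least)
        fix i assume "i \<in> I"
        then have "q \<le> d i" if "B (d i) \<omega> \<in> Some ` A" using qmin[of "d i"] that by (simp add: H_def)
        then show "ennreal (exp (- \<alpha> * d i)) * indicator (Some ` A) (B (d i) \<omega>) \<le> ennreal (exp (- \<alpha> * q))"
          using a by (cases "B (d i) \<omega> \<in> Some ` A") (auto intro!: ennreal_leI mult_left_mono)
      qed
    qed
    moreover have "{s. 0 \<le> s \<and> (\<exists>i\<in>I. d i \<le> s \<and> B (d i) \<omega> \<in> Some ` A)} = {q..}"
    proof (intro set_eqI iffI)
      fix s assume "s \<in> {s. 0 \<le> s \<and> (\<exists>i\<in>I. d i \<le> s \<and> B (d i) \<omega> \<in> Some ` A)}"
      then obtain i where "i \<in> I" "d i \<le> s" "B (d i) \<omega> \<in> Some ` A" by blast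
      then show "s \<in> {q..}" using qmin[of "d i"] by (simp add: H_def)
    next
      fix s assume s: "s \<in> {q..}"
      obtain i where i: "i \<in> I" "d i = q" using qI by auto
      then show "s \<in> {s. 0 \<le> s \<and> (\<exists>i\<in>I. d i \<le> s \<and> B (d i) \<omega> \<in> Some ` A)}"
        using s d[of i] qH by (auto simp: H_def)
    qed
    then have "grid_occ \<alpha> A C d I \<omega> = occ \<alpha> C q \<omega>" unfolding grid_occ_def occ_def by simp
    ultimately show ?thesis using s1[of "\<lambda>q. ennreal (exp (- \<alpha> * q))"] s1[of "\<lambda>q. occ \<alpha> C q \<omega>"] by simp
  qed
  then show ?D ?O by blast+
qed

text \<open>The Markov property at each first-visit time replaces the remaining occupation by the
  discounted \<open>pot \<alpha> C\<close> at a position in \<open>A\<close>. At the grid times the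
  process almost surely avoids \<open>N\<close>, so bounds on \<open>A - N\<close> suffice.\<close>

lemma grid_finite_bounds:
  assumes d: "\<And>i. 0 \<le> d i" and a: "0 \<le> \<alpha>" and I: "finite I"
    and [measurable]: "A \<in> sets borel" "C \<in> sets borel" "N \<in> sets borel" and N: "\<And>i. tr (d i) x N = 0"
  shows "grid_disc \<alpha> A d I \<in> borel_measurable (P x)" "grid_occ \<alpha> A C d I \<in> borel_measurable (P x)"
    and "(\<And>z. z \<in> A - N \<Longrightarrow> pot \<alpha> C z \<le> M) \<Longrightarrow> (\<integral>\<^sup>+\<omega>. grid_occ \<alpha> A C d I \<omega> \<partial>P x) \<le> M * (\<integral>\<^sup>+\<omega>. grid_disc \<alpha> A d I \<omega> \<partial>P x)"
    and "(\<And>z. z \<in> A - N \<Longrightarrow> c \<le> pot \<alpha> C z) \<Longrightarrow> c * (\<integral>\<^sup>+\<omega>. grid_disc \<alpha> A d I \<omega> \<partial>P x) \<le> (\<integral>\<^sup>+\<omega>. grid_occ \<alpha> A C d I \<omega> \<partial>P x)"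
proof -
  let ?\<Lambda> = "first_visit A (d ` I)"
  have \<Lambda>N: "?\<Lambda> q \<in> sets (natural_filtration W B (ennreal q))" if "q \<in> d ` I" for q
    using that d I by (intro first_visit_event) auto
  have \<Lambda>: "?\<Lambda> q \<in> sets (P x)" if "q \<in> d ` I" for q
    using \<Lambda>N[OF that] natural_subset by (auto simp: sets_P)
  have occm: "occ \<alpha> C q \<in> borel_measurable (P x)" for q
    unfolding measurable_P by (rule measurable_occ) simp
  note dec = grid_decompose[OF _ d a I]
  have "(\<lambda>\<omega>. \<Sum>q\<in>d ` I. ennreal (exp (- \<alpha> * q)) * indicator (?\<Lambda> q) \<omega>) \<in> borel_measurable (P x)"
    using \<Lambda> by (intro borel_measurable_sum borel_measurable_times_ennreal borel_measurable_const borel_measurable_indicator)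
  then show "grid_disc \<alpha> A d I \<in> borel_measurable (P x)"
    using dec(1) by (subst measurable_cong) (auto simp: space_P)
  have "(\<lambda>\<omega>. \<Sum>q\<in>d ` I. occ \<alpha> C q \<omega> * indicator (?\<Lambda> q) \<omega>) \<in> borel_measurable (P x)"
    using \<Lambda> occm by (intro borel_measurable_sum borel_measurable_times_ennreal borel_measurable_indicator)
  then show "grid_occ \<alpha> A C d I \<in> borel_measurable (P x)"
    using dec(2) by (subst measurable_cong) (auto simp: space_P)
  have iD: "(\<integral>\<^sup>+\<omega>. grid_disc \<alpha> A d I \<omega> \<partial>P x) = (\<Sum>q\<in>d ` I. ennreal (exp (- \<alpha> * q)) * (\<integral>\<^sup>+\<omega>. indicator (?\<Lambda> q) \<omega> \<partial>P x))"
  proof -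
    have "(\<integral>\<^sup>+\<omega>. grid_disc \<alpha> A d I \<omega> \<partial>P x) = (\<integral>\<^sup>+\<omega>. (\<Sum>q\<in>d ` I. ennreal (exp (- \<alpha> * q)) * indicator (?\<Lambda> q) \<omega>) \<partial>P x)"
      by (intro nn_integral_cong dec(1)) (simp add: space_P)
    also have "\<dots> = (\<Sum>q\<in>d ` I. (\<integral>\<^sup>+\<omega>. ennreal (exp (- \<alpha> * q)) * indicator (?\<Lambda> q) \<omega> \<partial>P x))"
      using \<Lambda> by (intro nn_integral_sum borel_measurable_times_ennreal borel_measurable_const borel_measurable_indicator)
    also have "\<dots> = (\<Sum>q\<in>d ` I. ennreal (exp (- \<alpha> * q)) * (\<integral>\<^sup>+\<omega>. indicator (?\<Lambda> q) \<omega> \<partial>P x))"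
      using \<Lambda> by (intro sum.cong refl nn_integral_cmult borel_measurable_indicator)
    finally show ?thesis .
  qed
  have iO: "(\<integral>\<^sup>+\<omega>. grid_occ \<alpha> A C d I \<omega> \<partial>P x) = (\<Sum>q\<in>d ` I. ennreal (exp (- \<alpha> * q)) * (\<integral>\<^sup>+\<omega>. zero_ext (pot \<alpha> C) (B q \<omega>) * indicator (?\<Lambda> q) \<omega> \<partial>P x))"
  proof -
    have "(\<integral>\<^sup>+\<omega>. grid_occ \<alpha> A C d I \<omega> \<partial>P x) = (\<integral>\<^sup>+\<omega>. (\<Sum>q\<in>d ` I. occ \<alpha> C q \<omega> * indicator (?\<Lambda> q) \<omega>) \<partial>P x)"
      by (intro nn_integral_cong dec(2)) (simp add: space_P)
    also have "\<dots> = (\<Sum>q\<in>d ` I. (\<integral>\<^sup>+\<omega>. occ \<alpha> C q \<omega> * indicator (?\<Lambda> q) \<omega> \<partial>P x))"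
      using \<Lambda> occm by (intro nn_integral_sum borel_measurable_times_ennreal borel_measurable_indicator)
    also have "\<dots> = (\<Sum>q\<in>d ` I. ennreal (exp (- \<alpha> * q)) * (\<integral>\<^sup>+\<omega>. zero_ext (pot \<alpha> C) (B q \<omega>) * indicator (?\<Lambda> q) \<omega> \<partial>P x))"
      using d \<Lambda>N by (intro sum.cong refl markov_pot) auto
    finally show ?thesis .
  qed
  have avoid: "AE \<omega> in P x. B q \<omega> \<notin> Some ` N" if "q \<in> d ` I" for q
  proof (rule AE_I[where N = "{\<omega> \<in> space (P x). B q \<omega> \<in> Some ` N}"])
    show "emeasure (P x) {\<omega> \<in> space (P x). B q \<omega> \<in> Some ` N} = 0"
      using N that by (auto simp: transition_def)
    have "B q \<in> W \<rightarrow>\<^sub>M cemetery_borel" using that d by (intro measurable_B) auto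
    from measurable_sets[OF this Some_image_cemetery, of N]
    show "{\<omega> \<in> space (P x). B q \<omega> \<in> Some ` N} \<in> sets (P x)"
      by (simp add: sets_P space_P vimage_def Int_def conj_commute)
  qed auto
  show "(\<integral>\<^sup>+\<omega>. grid_occ \<alpha> A C d I \<omega> \<partial>P x) \<le> M * (\<integral>\<^sup>+\<omega>. grid_disc \<alpha> A d I \<omega> \<partial>P x)"
    if M: "\<And>z. z \<in> A - N \<Longrightarrow> pot \<alpha> C z \<le> M"
  proof -
    have "(\<integral>\<^sup>+\<omega>. zero_ext (pot \<alpha> C) (B q \<omega>) * indicator (?\<Lambda> q) \<omega> \<partial>P x) \<le> M * (\<integral>\<^sup>+\<omega>. indicator (?\<Lambda> q) \<omega> \<partial>P x)" if q: "q \<in> d ` I" for q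
    proof -
      have "(\<integral>\<^sup>+\<omega>. zero_ext (pot \<alpha> C) (B q \<omega>) * indicator (?\<Lambda> q) \<omega> \<partial>P x) \<le> (\<integral>\<^sup>+\<omega>. M * indicator (?\<Lambda> q) \<omega> \<partial>P x)"
        using avoid[OF q]
        by (intro nn_integral_mono_AE) (auto elim!: eventually_mono simp: first_visit_def indicator_def intro!: M)
      then show ?thesis using \<Lambda>[OF q] by (simp add: nn_integral_cmult)
    qed
    then show ?thesis unfolding iO iD sum_distrib_left
      by (intro sum_mono) (simp add: mult.left_commute[of M] mult_left_mono)
  qed
  show "c * (\<integral>\<^sup>+\<omega>. grid_disc \<alpha> A d I \<omega> \<partial>P x) \<le> (\<integral>\<^sup>+\<omega>. grid_occ \<alpha> A C d I \<omega> \<partial>P x)"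
    if c: "\<And>z. z \<in> A - N \<Longrightarrow> c \<le> pot \<alpha> C z"
  proof -
    have "c * (\<integral>\<^sup>+\<omega>. indicator (?\<Lambda> q) \<omega> \<partial>P x) \<le> (\<integral>\<^sup>+\<omega>. zero_ext (pot \<alpha> C) (B q \<omega>) * indicator (?\<Lambda> q) \<omega> \<partial>P x)" if q: "q \<in> d ` I" for q
    proof -
      have "(\<integral>\<^sup>+\<omega>. c * indicator (?\<Lambda> q) \<omega> \<partial>P x) \<le> (\<integral>\<^sup>+\<omega>. zero_ext (pot \<alpha> C) (B q \<omega>) * indicator (?\<Lambda> q) \<omega> \<partial>P x)"
        using avoid[OF q]
        by (intro nn_integral_mono_AE) (auto elim!: eventually_mono simp: first_visit_def indicator_def intro!: c)
      then show ?thesis using \<Lambda>[OF q] by (simp add: nn_integral_cmult)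
    qed
    then show ?thesis unfolding iO iD sum_distrib_left
      by (intro sum_mono) (simp add: mult.left_commute[of c] mult_left_mono)
  qed
qed

lemma grid_disc_SUP: "grid_disc \<alpha> A d UNIV \<omega> = (SUP n. grid_disc \<alpha> A d {..n} \<omega>)"
  unfolding grid_disc_def
proof (rule antisym)
  show "(SUP i. ennreal (exp (- \<alpha> * d i)) * indicator (Some ` A) (B (d i) \<omega>))
     \<le> (SUP n. SUP i\<in>{..n}. ennreal (exp (- \<alpha> * d i)) * indicator (Some ` A) (B (d i) \<omega>))"
  proof (rule SUP_least)
    fix i
    have "ennreal (exp (- \<alpha> * d i)) * indicator (Some ` A) (B (d i) \<omega>)
        \<le> (SUP i\<in>{..i}. ennreal (exp (- \<alpha> * d i)) * indicator (Some ` A) (B (d i) \<omega>))"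
      by (rule SUP_upper) simp
    also have "\<dots> \<le> (SUP n. SUP i\<in>{..n}. ennreal (exp (- \<alpha> * d i)) * indicator (Some ` A) (B (d i) \<omega>))"
      by (rule SUP_upper[of i UNIV]) simp
    finally show "ennreal (exp (- \<alpha> * d i)) * indicator (Some ` A) (B (d i) \<omega>) \<le> \<dots>" .
  qed
  show "(SUP n. SUP i\<in>{..n}. ennreal (exp (- \<alpha> * d i)) * indicator (Some ` A) (B (d i) \<omega>))
     \<le> (SUP i. ennreal (exp (- \<alpha> * d i)) * indicator (Some ` A) (B (d i) \<omega>))"
    by (intro SUP_least SUP_upper UNIV_I)
qed

lemma grid_disc_mono: "I \<subseteq> J \<Longrightarrow> grid_disc \<alpha> A d I \<omega> \<le> grid_disc \<alpha> A d J \<omega>"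
  unfolding grid_disc_def by (rule SUP_subset_mono) auto

lemma grid_occ_mono: "I \<subseteq> J \<Longrightarrow> grid_occ \<alpha> A C d I \<omega> \<le> grid_occ \<alpha> A C d J \<omega>"
  unfolding grid_occ_def
  by (intro nn_integral_mono mult_right_mono mult_left_mono) (auto simp: indicator_def)

lemma grid_occ_SUP:
  assumes w: "\<omega> \<in> space W" and C: "C \<in> sets borel"
  shows "grid_occ \<alpha> A C d UNIV \<omega> = (SUP n. grid_occ \<alpha> A C d {..n} \<omega>)"
proof -
  define f where "f n s = ennreal (exp (- \<alpha> * s)) * indicator {s. 0 \<le> s \<and> (\<exists>i\<in>{..n}. d i \<le> s \<and> B (d i) \<omega> \<in> Some ` A)} s
      * indicator (Some ` C) (B (max 0 s) \<omega>)" for n :: nat and s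
  have fm: "f n \<in> borel_measurable lborel" for n
  proof -
    note [measurable] = measurable_path[OF w C]
    show ?thesis unfolding f_def by simp
  qed
  have finc: "incseq f"
    unfolding incseq_def le_fun_def f_def
    by (intro allI impI mult_right_mono mult_left_mono) (auto simp: indicator_def intro: order_trans)
  define g where "g s = ennreal (exp (- \<alpha> * s)) * indicator {s. 0 \<le> s \<and> (\<exists>i\<in>UNIV. d i \<le> s \<and> B (d i) \<omega> \<in> Some ` A)} s
      * indicator (Some ` C) (B (max 0 s) \<omega>)" for s
  have "(SUP n. f n s) = g s" for s
  proof (rule antisym)
    show "(SUP n. f n s) \<le> g s"
      unfolding f_def g_def by (intro SUP_least mult_right_mono mult_left_mono) (auto simp: indicator_def)
    show "g s \<le> (SUP n. f n s)"
    proof (cases "0 \<le> s \<and> (\<exists>i. d i \<le> s \<and> B (d i) \<omega> \<in> Some ` A)")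
      case True
      then obtain i where "d i \<le> s" "B (d i) \<omega> \<in> Some ` A" by blast
      then have "g s = f i s" using True by (auto simp: f_def g_def indicator_def)
      then show ?thesis by (metis SUP_upper UNIV_I)
    next
      case False
      then have "g s = 0" by (simp add: g_def)
      then show ?thesis by simp
    qed
  qed
  then have "grid_occ \<alpha> A C d UNIV \<omega> = (\<integral>\<^sup>+s. (SUP n. f n s) \<partial>lborel)"
    unfolding grid_occ_def g_def by simp
  also have "\<dots> = (SUP n. \<integral>\<^sup>+s. f n s \<partial>lborel)"
    by (rule nn_integral_monotone_convergence_SUP[OF finc fm])
  finally show ?thesis unfolding grid_occ_def f_def .
qed

lemma measurable_grid:
  assumes d: "\<And>i. 0 \<le> d i" and a: "0 \<le> \<alpha>" and A: "A \<in> sets borel" and C: "C \<in> sets borel"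
    and Nb: "N \<in> sets borel" and N: "\<And>i. tr (d i) x N = 0"
  shows "grid_disc \<alpha> A d UNIV \<in> borel_measurable (P x)" "grid_occ \<alpha> A C d UNIV \<in> borel_measurable (P x)"
proof -
  note fb = grid_finite_bounds[where d = d and \<alpha> = \<alpha> and A = A and C = C and N = N and x = x,
      OF d a finite_atMost A C Nb N]
  have "(\<lambda>\<omega>. SUP n. grid_disc \<alpha> A d {..n} \<omega>) \<in> borel_measurable (P x)"
    by (intro borel_measurable_SUP fb(1)) simp
  then show "grid_disc \<alpha> A d UNIV \<in> borel_measurable (P x)" by (simp only: grid_disc_SUP[symmetric])
  have "(\<lambda>\<omega>. SUP n. grid_occ \<alpha> A C d {..n} \<omega>) \<in> borel_measurable (P x)"
    by (intro borel_measurable_SUP fb(2)) simp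
  then show "grid_occ \<alpha> A C d UNIV \<in> borel_measurable (P x)"
    by (subst measurable_cong[OF grid_occ_SUP[OF _ C]]) (auto simp: space_P)
qed

lemma grid_upper:
  assumes d: "\<And>i. 0 \<le> d i" and a: "0 \<le> \<alpha>" and A: "A \<in> sets borel" and C: "C \<in> sets borel"
    and Nb: "N \<in> sets borel" and N: "\<And>i. tr (d i) x N = 0"
    and M: "\<And>z. z \<in> A - N \<Longrightarrow> pot \<alpha> C z \<le> M"
  shows "(\<integral>\<^sup>+\<omega>. grid_occ \<alpha> A C d UNIV \<omega> \<partial>P x) \<le> M * (\<integral>\<^sup>+\<omega>. grid_disc \<alpha> A d UNIV \<omega> \<partial>P x)"
proof -
  note fb = grid_finite_bounds[where d = d and \<alpha> = \<alpha> and A = A and C = C and N = N and x = x,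
      OF d a finite_atMost A C Nb N]
  have "(\<integral>\<^sup>+\<omega>. grid_occ \<alpha> A C d UNIV \<omega> \<partial>P x) = (\<integral>\<^sup>+\<omega>. (SUP n. grid_occ \<alpha> A C d {..n} \<omega>) \<partial>P x)"
    by (intro nn_integral_cong grid_occ_SUP C) (simp add: space_P)
  also have "\<dots> = (SUP n. \<integral>\<^sup>+\<omega>. grid_occ \<alpha> A C d {..n} \<omega> \<partial>P x)"
  proof (rule nn_integral_monotone_convergence_SUP)
    show "grid_occ \<alpha> A C d {..n} \<in> borel_measurable (P x)" for n :: nat by (rule fb(2))
    show "incseq (\<lambda>n. grid_occ \<alpha> A C d {..n})"
      unfolding incseq_def le_fun_def by (intro allI impI grid_occ_mono) simp
  qed
  also have "\<dots> \<le> M * (\<integral>\<^sup>+\<omega>. grid_disc \<alpha> A d UNIV \<omega> \<partial>P x)"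
  proof (rule SUP_least)
    fix n
    have "(\<integral>\<^sup>+\<omega>. grid_occ \<alpha> A C d {..n} \<omega> \<partial>P x) \<le> M * (\<integral>\<^sup>+\<omega>. grid_disc \<alpha> A d {..n} \<omega> \<partial>P x)"
      by (rule fb(3)) (rule M)
    also have "\<dots> \<le> M * (\<integral>\<^sup>+\<omega>. grid_disc \<alpha> A d UNIV \<omega> \<partial>P x)"
      by (intro mult_left_mono nn_integral_mono grid_disc_mono) auto
    finally show "(\<integral>\<^sup>+\<omega>. grid_occ \<alpha> A C d {..n} \<omega> \<partial>P x) \<le> M * (\<integral>\<^sup>+\<omega>. grid_disc \<alpha> A d UNIV \<omega> \<partial>P x)" .
  qed
  finally show ?thesis .
qed

lemma grid_lower:
  assumes d: "\<And>i. 0 \<le> d i" and a: "0 \<le> \<alpha>" and A: "A \<in> sets borel" and C: "C \<in> sets borel"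
    and Nb: "N \<in> sets borel" and N: "\<And>i. tr (d i) x N = 0"
    and c: "\<And>z. z \<in> A - N \<Longrightarrow> c \<le> pot \<alpha> C z"
  shows "c * (\<integral>\<^sup>+\<omega>. grid_disc \<alpha> A d UNIV \<omega> \<partial>P x) \<le> (\<integral>\<^sup>+\<omega>. grid_occ \<alpha> A C d UNIV \<omega> \<partial>P x)"
proof -
  note fb = grid_finite_bounds[where d = d and \<alpha> = \<alpha> and A = A and C = C and N = N and x = x,
      OF d a finite_atMost A C Nb N]
  have "(\<integral>\<^sup>+\<omega>. grid_disc \<alpha> A d UNIV \<omega> \<partial>P x) = (\<integral>\<^sup>+\<omega>. (SUP n. grid_disc \<alpha> A d {..n} \<omega>) \<partial>P x)"
    by (intro nn_integral_cong grid_disc_SUP)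
  also have "\<dots> = (SUP n. \<integral>\<^sup>+\<omega>. grid_disc \<alpha> A d {..n} \<omega> \<partial>P x)"
  proof (rule nn_integral_monotone_convergence_SUP)
    show "grid_disc \<alpha> A d {..n} \<in> borel_measurable (P x)" for n :: nat by (rule fb(1))
    show "incseq (\<lambda>n. grid_disc \<alpha> A d {..n})"
      unfolding incseq_def le_fun_def by (intro allI impI grid_disc_mono) simp
  qed
  finally have "c * (\<integral>\<^sup>+\<omega>. grid_disc \<alpha> A d UNIV \<omega> \<partial>P x) = (SUP n. c * (\<integral>\<^sup>+\<omega>. grid_disc \<alpha> A d {..n} \<omega> \<partial>P x))"
    by (simp add: SUP_mult_left_ennreal)
  also have "\<dots> \<le> (\<integral>\<^sup>+\<omega>. grid_occ \<alpha> A C d UNIV \<omega> \<partial>P x)"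
  proof (rule SUP_least)
    fix n
    have "c * (\<integral>\<^sup>+\<omega>. grid_disc \<alpha> A d {..n} \<omega> \<partial>P x) \<le> (\<integral>\<^sup>+\<omega>. grid_occ \<alpha> A C d {..n} \<omega> \<partial>P x)"
      by (rule fb(4)) (rule c)
    also have "\<dots> \<le> (\<integral>\<^sup>+\<omega>. grid_occ \<alpha> A C d UNIV \<omega> \<partial>P x)"
      by (intro nn_integral_mono grid_occ_mono) auto
    finally show "c * (\<integral>\<^sup>+\<omega>. grid_disc \<alpha> A d {..n} \<omega> \<partial>P x) \<le> (\<integral>\<^sup>+\<omega>. grid_occ \<alpha> A C d UNIV \<omega> \<partial>P x)" .
  qed
  finally show ?thesis .
qed


text \<open>A path that is in the open set \<open>A\<close> at a time \<open>s > t0\<close> was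
  there during a short interval before \<open>s\<close>, which contains a grid time. At most the
  single time \<open>t0\<close> is missed.\<close>

lemma occ_le_grid_occ:
  assumes w: "\<omega> \<in> space W" and A: "open A" and t0: "0 \<le> t0"
    and dense: "\<And>u v. t0 \<le> u \<Longrightarrow> u < v \<Longrightarrow> \<exists>i::nat. u < d i \<and> d i < v"
  shows "occ \<alpha> A t0 \<omega> \<le> grid_occ \<alpha> A A d UNIV \<omega>"
  unfolding occ_def grid_occ_def
proof (rule nn_integral_mono_AE)
  have "\<exists>i. d i \<le> s \<and> B (d i) \<omega> \<in> Some ` A" if s: "t0 < s" and Bs: "B s \<omega> \<in> Some ` A" for s
  proof -
    have s0: "0 \<le> s" "B s \<omega> \<noteq> None" using s t0 Bs by auto
    have cont: "continuous_on {0..s} (\<lambda>t. the (B t \<omega>))" by (rule alive_interval(2)[OF w s0])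
    have "the (B s \<omega>) \<in> A" using Bs by auto
    then obtain e where e: "0 < e" "ball (the (B s \<omega>)) e \<subseteq> A" using A by (meson open_contains_ball)
    have "\<exists>\<delta>>0. \<forall>r\<in>{0..s}. dist r s < \<delta> \<longrightarrow> dist (the (B r \<omega>)) (the (B s \<omega>)) < e"
      using cont s0(1) e(1) unfolding continuous_on_iff by auto
    then obtain \<delta> where \<delta>: "0 < \<delta>" "\<And>r. r \<in> {0..s} \<Longrightarrow> dist r s < \<delta> \<Longrightarrow> dist (the (B r \<omega>)) (the (B s \<omega>)) < e"
      by blast
    have *: "t0 \<le> max t0 (s - \<delta>)" "max t0 (s - \<delta>) < s" using s \<delta>(1) by auto
    obtain i where "max t0 (s - \<delta>) < d i" "d i < s" using dense[OF *] by blast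
    then have i: "t0 < d i" "s - \<delta> < d i" "d i < s" by auto
    have "dist (the (B (d i) \<omega>)) (the (B s \<omega>)) < e"
      by (rule \<delta>(2)) (use i t0 in \<open>simp_all add: dist_real_def\<close>)
    then have "the (B (d i) \<omega>) \<in> A" using e(2) by (auto simp: dist_commute)
    then have "Some (the (B (d i) \<omega>)) \<in> Some ` A" by (rule imageI)
    then have "B (d i) \<omega> \<in> Some ` A" using alive_interval(1)[OF w s0] i t0 by simp
    then show ?thesis using i by (intro exI[of _ i]) simp
  qed
  then have "ennreal (exp (- \<alpha> * s)) * indicator {t0..} s * indicator (Some ` A) (B (max 0 s) \<omega>)
     \<le> ennreal (exp (- \<alpha> * s)) * indicator {s. 0 \<le> s \<and> (\<exists>i\<in>UNIV. d i \<le> s \<and> B (d i) \<omega> \<in> Some ` A)} s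
      * indicator (Some ` A) (B (max 0 s) \<omega>)" if "s \<noteq> t0" for s
    using t0 that by (cases "t0 < s \<and> B s \<omega> \<in> Some ` A") (auto simp: indicator_def max_def)
  then show "AE s in lborel. ennreal (exp (- \<alpha> * s)) * indicator {t0..} s * indicator (Some ` A) (B (max 0 s) \<omega>)
     \<le> ennreal (exp (- \<alpha> * s)) * indicator {s. 0 \<le> s \<and> (\<exists>i\<in>UNIV. d i \<le> s \<and> B (d i) \<omega> \<in> Some ` A)} s
      * indicator (Some ` A) (B (max 0 s) \<omega>)"
    using AE_lborel_singleton[of t0] by (rule_tac AE_mp) auto
qed

end

lemma indicator_ennreal_mono: "A \<subseteq> C \<Longrightarrow> indicator A z \<le> (indicator C z :: ennreal)"
  by (auto split: split_indicator)

text \<open>From \<open>1 + x \<le> exp x\<close> with \<open>x = r / n\<close>. The left side tends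
  to \<open>r\<close> as \<open>n\<close> grows, which lets Fatou's lemma recover the hitting
  time.\<close>

lemma exp_average_ge: "0 \<le> r \<Longrightarrow> 0 < n \<Longrightarrow> r / (1 + r / n) \<le> n * (1 - exp (- (1 / n) * r))" for r n :: real
proof -
  assume r: "0 \<le> r" and n: "0 < n"
  define x where "x = r / n"
  have x: "0 \<le> x" using r n by (simp add: x_def)
  have "1 + x \<le> exp x" by (rule exp_ge_add_one_self)
  then have "exp (- x) \<le> 1 / (1 + x)" using x by (simp add: exp_minus field_simps)
  then have "x / (1 + x) \<le> 1 - exp (- x)" using x by (simp add: field_simps)
  then have "n * (x / (1 + x)) \<le> n * (1 - exp (- x))" using n by (intro mult_left_mono) auto
  moreover have "n * (x / (1 + x)) = r / (1 + r / n)" using n by (simp add: x_def)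
  ultimately show ?thesis by (simp add: x_def)
qed

section \<open>From visits to shrinking balls to visits to a point\<close>

context markov_process
begin

text \<open>Stands in for \<open>exp (- \<alpha> * \<tau>)\<close> with \<open>\<tau>\<close> the
  hitting time of \<open>y\<close>; being a countable infimum of suprema, it inherits measurability
  from the grid.\<close>

definition near_disc :: "real \<Rightarrow> 'a \<Rightarrow> (nat \<Rightarrow> real) \<Rightarrow> 'w \<Rightarrow> ennreal" where
  "near_disc \<alpha> y d \<omega> = (INF k. grid_disc \<alpha> (ball y (1 / Suc k)) d UNIV \<omega>)"

lemma hitting_time_le: "0 < t \<Longrightarrow> B t \<omega> = Some y \<Longrightarrow> hitting_time B y \<omega> \<le> ennreal t"
  unfolding hitting_time_def by (intro Inf_lower) blast

text \<open>Above the level \<open>\<theta>\<close>, every ball around \<open>y\<close> is visited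
  before \<open>s = - ln \<theta> / \<alpha>\<close>. The path is alive at \<open>s\<close>, so
  \<open>hit_by_approach\<close> gives a visit to \<open>y\<close> itself.\<close>

lemma near_disc_hit:
  assumes w: "\<omega> \<in> space W" and al: "\<And>t. 0 \<le> t \<Longrightarrow> B t \<omega> \<noteq> None"
    and t0: "0 \<le> t0" and d: "\<And>i. t0 \<le> d i" and a: "0 < \<alpha>" and \<theta>: "0 < \<theta>" "ennreal \<theta> < near_disc \<alpha> y d \<omega>"
  obtains u where "t0 \<le> u" "B u \<omega> = Some y" "\<theta> \<le> exp (- \<alpha> * u)"
proof -
  define s where "s = - ln \<theta> / \<alpha>"
  have ex: "\<exists>i. d i < s \<and> B (d i) \<omega> \<in> Some ` ball y (1 / Suc k)" for k :: nat
  proof -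
    have "ennreal \<theta> < grid_disc \<alpha> (ball y (1 / Suc k)) d UNIV \<omega>"
      using \<theta>(2) unfolding near_disc_def by (rule less_le_trans) (rule INF_lower, simp)
    then obtain i where i: "ennreal \<theta> < ennreal (exp (- \<alpha> * d i)) * indicator (Some ` ball y (1 / Suc k)) (B (d i) \<omega>)"
      unfolding grid_disc_def less_SUP_iff by blast
    have b: "B (d i) \<omega> \<in> Some ` ball y (1 / Suc k)"
    proof (rule ccontr)
      assume "B (d i) \<omega> \<notin> Some ` ball y (1 / Suc k)"
      then show False using i by simp
    qed
    then have "\<theta> < exp (- \<alpha> * d i)" using i by (simp add: ennreal_less_iff \<theta>(1) less_imp_le)
    then have "ln \<theta> < - \<alpha> * d i" using \<theta>(1) by (metis ln_exp ln_less_cancel_iff exp_gt_zero)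
    then have "d i < s" using a by (simp add: s_def field_simps)
    then show ?thesis using b by blast
  qed
  have s0: "0 \<le> s" using ex[of 0] d t0 by (meson less_imp_le order_trans)
  have "\<exists>q. t0 \<le> q \<and> q \<le> s \<and> B q \<omega> \<in> Some ` ball y (1 / Suc k)" for k :: nat
    using ex[of k] d by (meson less_imp_le)
  then obtain u where u: "t0 \<le> u" "u \<le> s" "B u \<omega> = Some y"
    using hit_by_approach[OF w s0 al[OF s0] t0] by blast
  have "ln \<theta> \<le> - \<alpha> * u" using u(2) a by (simp add: s_def field_simps)
  then have "\<theta> \<le> exp (- \<alpha> * u)" using \<theta>(1) by (metis exp_le_cancel_iff exp_ln)
  then show ?thesis using that u by blast
qed

lemma near_disc_le_1:
  assumes d: "\<And>i. 0 \<le> d i" and a: "0 \<le> \<alpha>"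
  shows "near_disc \<alpha> y d \<omega> \<le> 1"
proof -
  have "near_disc \<alpha> y d \<omega> \<le> grid_disc \<alpha> (ball y (1 / Suc 0)) d UNIV \<omega>"
    unfolding near_disc_def by (rule INF_lower) simp
  also have "\<dots> \<le> 1"
    unfolding grid_disc_def
  proof (rule SUP_least)
    fix i
    have "exp (- \<alpha> * d i) \<le> 1" using d[of i] a by simp
    then have "ennreal (exp (- \<alpha> * d i)) \<le> 1" using ennreal_leI by fastforce
    then show "ennreal (exp (- \<alpha> * d i)) * indicator (Some ` ball y (1 / Suc 0)) (B (d i) \<omega>) \<le> 1"
      by (cases "B (d i) \<omega> \<in> Some ` ball y (1 / Suc 0)") simp_all
  qed
  finally show ?thesis .
qed

lemma grid_disc_measurable:
  assumes d: "\<And>i. 0 \<le> d i" and a: "0 \<le> \<alpha>" and A: "A \<in> sets borel"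
  shows "grid_disc \<alpha> A d UNIV \<in> borel_measurable (P x)"
proof (rule measurable_grid(1)[where C = UNIV and N = "{}", OF d a A])
  show "tr (d i) x {} = 0" for i by (simp add: transition_def)
qed simp_all

lemma near_disc_measurable:
  assumes d: "\<And>i. 0 \<le> d i" and a: "0 \<le> \<alpha>"
  shows "near_disc \<alpha> y d \<in> borel_measurable (P x)"
proof -
  have "(\<lambda>\<omega>. INF k. grid_disc \<alpha> (ball y (1 / Suc k)) d UNIV \<omega>) \<in> borel_measurable (P x)"
  proof (rule borel_measurable_INF)
    show "grid_disc \<alpha> (ball y (1 / Suc k)) d UNIV \<in> borel_measurable (P x)" for k :: nat
      by (rule grid_disc_measurable[OF d a]) simp
  qed simp
  then show ?thesis by (simp only: near_disc_def[abs_def])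
qed

lemma ball_decseq: "m \<le> n \<Longrightarrow> ball y (1 / Suc n) \<subseteq> ball (y::'a) (1 / Suc m)"
  by (intro subset_ball frac_le) auto

lemma near_disc_integral_ge:
  assumes d: "\<And>i. 0 \<le> d i" and a: "0 \<le> \<alpha>"
    and ge: "\<And>k::nat. c \<le> (\<integral>\<^sup>+\<omega>. grid_disc \<alpha> (ball y (1 / Suc k)) d UNIV \<omega> \<partial>P x)"
  shows "c \<le> (\<integral>\<^sup>+\<omega>. near_disc \<alpha> y d \<omega> \<partial>P x)"
proof -
  interpret prob_space "P x" by (rule prob_P)
  have "(\<integral>\<^sup>+\<omega>. (INF k. grid_disc \<alpha> (ball y (1 / Suc k)) d UNIV \<omega>) \<partial>P x)
     = (INF k. \<integral>\<^sup>+\<omega>. grid_disc \<alpha> (ball y (1 / Suc k)) d UNIV \<omega> \<partial>P x)"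
  proof (rule nn_integral_monotone_convergence_INF_decseq)
    show "decseq (\<lambda>k. grid_disc \<alpha> (ball y (1 / Suc k)) d UNIV)"
      unfolding grid_disc_def
    proof (intro monotoneI le_funI SUP_mono')
      fix m n :: nat and \<omega> i assume mn: "m \<le> n"
      show "ennreal (exp (- \<alpha> * d i)) * indicator (Some ` ball y (1 / Suc n)) (B (d i) \<omega>)
        \<le> ennreal (exp (- \<alpha> * d i)) * indicator (Some ` ball y (1 / Suc m)) (B (d i) \<omega>)"
        using image_mono[OF ball_decseq[OF mn, of y], of Some]
        by (intro mult_left_mono indicator_ennreal_mono) auto
    qed
    show "grid_disc \<alpha> (ball y (1 / Suc k)) d UNIV \<in> borel_measurable (P x)" for k :: nat
      by (rule grid_disc_measurable[OF d a]) simp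
    have "(\<integral>\<^sup>+\<omega>. grid_disc \<alpha> (ball y (1 / Suc 0)) d UNIV \<omega> \<partial>P x) \<le> (\<integral>\<^sup>+\<omega>. 1 \<partial>P x)"
    proof (rule nn_integral_mono)
      fix \<omega>
      show "grid_disc \<alpha> (ball y (1 / Suc 0)) d UNIV \<omega> \<le> 1"
        unfolding grid_disc_def
      proof (rule SUP_least)
        fix i
        have "exp (- \<alpha> * d i) \<le> 1" using d[of i] a by simp
        then have "ennreal (exp (- \<alpha> * d i)) \<le> 1" using ennreal_leI by fastforce
        then show "ennreal (exp (- \<alpha> * d i)) * indicator (Some ` ball y (1 / Suc 0)) (B (d i) \<omega>) \<le> 1"
          by (cases "B (d i) \<omega> \<in> Some ` ball y (1 / Suc 0)") simp_all
      qed
    qed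
    also have "\<dots> < \<infinity>" by (simp add: emeasure_space_1)
    finally show "(\<integral>\<^sup>+\<omega>. grid_disc \<alpha> (ball y (1 / Suc 0)) d UNIV \<omega> \<partial>P x) < \<infinity>" .
  qed
  then show ?thesis unfolding near_disc_def using ge by (simp add: INF_greatest)
qed

text \<open>Fatou's lemma for \<open>(1 - e\<^sup>-\<^sup>\<alpha>\<^sup>\<tau>) / \<alpha>\<close> along \<open>\<alpha> = 1 / Suc j\<close>. The majorant \<open>G\<close> makes the
  measurability of the hitting time itself irrelevant.\<close>

lemma expected_hitting_bound:
  assumes al: "AE \<omega> in P x. \<forall>t\<ge>0. B t \<omega> \<noteq> None" and t0: "0 < t0" and d: "\<And>i. t0 \<le> d i"
    and ge: "\<And>j::nat. ennreal (1 - K / Suc j) \<le> (\<integral>\<^sup>+\<omega>. near_disc (1 / Suc j) y d \<omega> \<partial>P x)" and K: "0 \<le> K"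
  obtains G where "G \<in> borel_measurable (P x)" "AE \<omega> in P x. hitting_time B y \<omega> \<le> G \<omega>" "(\<integral>\<^sup>+\<omega>. G \<omega> \<partial>P x) \<le> ennreal K"
proof -
  interpret prob_space "P x" by (rule prob_P)
  have d0: "0 \<le> d i" for i using d[of i] t0 by simp
  define X where "X j \<omega> = near_disc (1 / Suc j) y d \<omega>" for j :: nat and \<omega>
  have Xm: "X j \<in> borel_measurable (P x)" for j
    unfolding X_def[abs_def] by (rule near_disc_measurable[OF d0]) simp
  have X1: "X j \<omega> \<le> 1" for j \<omega> unfolding X_def by (rule near_disc_le_1[OF d0]) simp
  define Y where "Y j \<omega> = ennreal (real (Suc j)) * (1 - X j \<omega>)" for j \<omega>
  have Ym: "Y j \<in> borel_measurable (P x)" for j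
    unfolding Y_def[abs_def] using Xm by measurable
  define G where "G \<omega> = liminf (\<lambda>j. Y j \<omega>)" for \<omega>
  have Gm: "G \<in> borel_measurable (P x)" unfolding G_def[abs_def] using Ym by (intro borel_measurable_liminf)
  have "(\<integral>\<^sup>+\<omega>. G \<omega> \<partial>P x) \<le> liminf (\<lambda>j. \<integral>\<^sup>+\<omega>. Y j \<omega> \<partial>P x)"
    unfolding G_def by (rule nn_integral_liminf) (rule Ym)
  also have "\<dots> \<le> liminf (\<lambda>j::nat. ennreal K)"
  proof (intro Liminf_mono always_eventually allI)
    fix j
    have fin: "(\<integral>\<^sup>+\<omega>. X j \<omega> \<partial>P x) \<noteq> \<infinity>"
    proof -
      have "(\<integral>\<^sup>+\<omega>. X j \<omega> \<partial>P x) \<le> (\<integral>\<^sup>+\<omega>. 1 \<partial>P x)" by (intro nn_integral_mono X1)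
      then show ?thesis by (simp add: emeasure_space_1 top_unique) (metis ennreal_one_neq_top top_unique)
    qed
    have "(\<integral>\<^sup>+\<omega>. Y j \<omega> \<partial>P x) = ennreal (real (Suc j)) * (\<integral>\<^sup>+\<omega>. 1 - X j \<omega> \<partial>P x)"
      unfolding Y_def using Xm by (intro nn_integral_cmult) measurable
    also have "(\<integral>\<^sup>+\<omega>. 1 - X j \<omega> \<partial>P x) = 1 - (\<integral>\<^sup>+\<omega>. X j \<omega> \<partial>P x)"
      using X1 Xm fin by (subst nn_integral_diff) (auto simp: emeasure_space_1)
    also have "\<dots> \<le> 1 - ennreal (1 - K / Suc j)"
      using ge[of j] by (intro ennreal_minus_mono order_refl) (simp add: X_def)
    also have "\<dots> \<le> ennreal (K / Suc j)"
    \<comment> \<open>For small \<open>j\<close> the lower bound may be negative;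
      \<open>ennreal\<close> turns it into 0, and the claim becomes
      \<open>1 \<le> K / Suc j\<close>.\<close>
    proof (cases "0 \<le> 1 - K / Suc j")
      case True
      have "1 - ennreal (1 - K / Suc j) = ennreal (1 - (1 - K / Suc j))"
        using True by (metis ennreal_1 ennreal_minus)
      then show ?thesis by simp
    next
      case False
      then have "1 \<le> K / Suc j" by simp
      then have "1 \<le> ennreal (K / Suc j)" by (metis ennreal_1 ennreal_leI)
      then show ?thesis using False by (simp add: ennreal_neg)
    qed
    also have "ennreal (real (Suc j)) * ennreal (K / Suc j) = ennreal K"
    proof -
      have "ennreal (real (Suc j)) * ennreal (K / Suc j) = ennreal (real (Suc j) * (K / Suc j))"
        using K by (intro ennreal_mult[symmetric]) simp_all
      then show ?thesis by simp
    qed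
    finally show "(\<integral>\<^sup>+\<omega>. Y j \<omega> \<partial>P x) \<le> ennreal K" by (simp add: mult_left_mono)
  qed
  also have "\<dots> = ennreal K" by (rule Liminf_const) simp
  finally have Gint: "(\<integral>\<^sup>+\<omega>. G \<omega> \<partial>P x) \<le> ennreal K" .
  have "AE \<omega> in P x. hitting_time B y \<omega> \<le> G \<omega>"
  proof (rule AE_mp[OF al], intro AE_I2 impI)
    fix \<omega> assume w': "\<omega> \<in> space (P x)" and alive: "\<forall>t\<ge>0. B t \<omega> \<noteq> None"
    then have w: "\<omega> \<in> space W" by (simp add: space_P)
    have hit: "\<exists>u. hitting_time B y \<omega> \<le> ennreal u \<and> 0 \<le> u \<and> \<theta> \<le> exp (- (1 / Suc j) * u)"
      if \<theta>: "0 < \<theta>" "ennreal \<theta> < X j \<omega>" for \<theta> j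
    proof -
      have "0 < 1 / real (Suc j)" by simp
      from near_disc_hit[OF w _ less_imp_le[OF t0] d this \<theta>(1) \<theta>(2)[unfolded X_def]] alive
      obtain u where u: "t0 \<le> u" "B u \<omega> = Some y" "\<theta> \<le> exp (- (1 / Suc j) * u)" by blast
      then show ?thesis using t0 hitting_time_le[of u \<omega> y] by (intro exI[of _ u]) simp
    qed
    show "hitting_time B y \<omega> \<le> G \<omega>"
    proof (cases "hitting_time B y \<omega>")
      case (real r)
      \<comment> \<open>A larger value would exhibit a visit to \<open>y\<close> at a positive time
        before \<open>r\<close>.\<close>
      have "X j \<omega> \<le> ennreal (exp (- (1 / Suc j) * r))" for j
      proof (rule ccontr)
        assume "\<not> X j \<omega> \<le> ennreal (exp (- (1 / Suc j) * r))"
        then have "ennreal (exp (- (1 / Suc j) * r)) < X j \<omega>" by simp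
        then obtain z where z: "ennreal (exp (- (1 / Suc j) * r)) < z" "z < X j \<omega>" using dense by blast
        then have "z < \<top>" using X1[of j \<omega>] by (metis less_le_trans top_greatest)
        then obtain \<theta> where \<theta>: "z = ennreal \<theta>" "0 \<le> \<theta>" by (cases z) auto
        have lt: "exp (- (1 / Suc j) * r) < \<theta>" using z(1) \<theta> by (simp add: ennreal_less_iff)
        then have "0 < \<theta>" by (meson exp_gt_zero less_trans)
        then obtain u where u: "hitting_time B y \<omega> \<le> ennreal u" "0 \<le> u" "\<theta> \<le> exp (- (1 / Suc j) * u)"
          using hit z(2) \<theta>(1) by blast
        have "r \<le> u" using u(1,2) real by simp
        then have "exp (- (1 / Suc j) * u) \<le> exp (- (1 / Suc j) * r)"
          by (intro exp_le_cancel_iff[THEN iffD2] mult_left_mono_neg) simp_all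
        then show False using lt u(3) by linarith
      qed
      then have "ennreal (r / (1 + r / Suc j)) \<le> Y j \<omega>" for j
      proof -
        assume X: "\<And>j. X j \<omega> \<le> ennreal (exp (- (1 / Suc j) * r))"
        have "ennreal (r / (1 + r / Suc j)) \<le> ennreal (real (Suc j) * (1 - exp (- (1 / Suc j) * r)))"
          using real by (intro ennreal_leI exp_average_ge) simp_all
        also have "\<dots> = ennreal (real (Suc j)) * (1 - ennreal (exp (- (1 / Suc j) * r)))"
        proof -
          have "exp (- (1 / Suc j) * r) \<le> 1" using real by simp
          then show ?thesis by (metis diff_ge_0_iff_ge ennreal_1 ennreal_minus ennreal_mult exp_ge_zero of_nat_0_le_iff)
        qed
        also have "\<dots> \<le> Y j \<omega>" unfolding Y_def by (intro mult_left_mono ennreal_minus_mono order_refl X) simp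
        finally show ?thesis .
      qed
      then have "liminf (\<lambda>j. ennreal (r / (1 + r / Suc j))) \<le> G \<omega>"
        unfolding G_def by (intro Liminf_mono always_eventually allI)
      moreover have "(\<lambda>j. ennreal (r / (1 + r / Suc j))) \<longlonglongrightarrow> ennreal (r / (1 + 0))"
      proof (intro tendsto_ennrealI tendsto_divide tendsto_add tendsto_const)
        have "(\<lambda>j. r * inverse (real (Suc j))) \<longlonglongrightarrow> r * 0"
          by (intro tendsto_mult tendsto_const LIMSEQ_inverse_real_of_nat)
        then show "(\<lambda>j. r / Suc j) \<longlonglongrightarrow> 0" by (simp add: divide_inverse)
      qed simp
      ultimately show ?thesis using real lim_imp_Liminf[OF trivial_limit_sequentially] by fastforce
    next
      case top
      \<comment> \<open>Without any visit at a positive time all discounts vanish, so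
        \<open>Y j \<omega> = Suc j\<close> and the majorant \<open>G\<close> is infinite as
        well.\<close>
      have "X j \<omega> = 0" for j
      proof (rule ccontr)
        assume "X j \<omega> \<noteq> 0"
        then have "0 < X j \<omega>" by (simp add: zero_less_iff_neq_zero)
        then obtain z where z: "0 < z" "z < X j \<omega>" using dense by blast
        then have "z < \<top>" using X1[of j \<omega>] by (metis less_le_trans top_greatest)
        then obtain \<theta> where \<theta>: "z = ennreal \<theta>" "0 \<le> \<theta>" by (cases z) auto
        then have "0 < \<theta>" using z(1) by simp
        then obtain u where "hitting_time B y \<omega> \<le> ennreal u" using hit z(2) \<theta>(1) by blast
        then show False using top by (simp add: top_unique)
      qed
      then have Yj: "Y j \<omega> = of_nat (Suc j)" for j by (simp only: Y_def ennreal_of_nat_eq_real_of_nat) simp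
      have "(\<lambda>j. of_nat (Suc j) :: ennreal) \<longlonglongrightarrow> top" by (rule LIMSEQ_Suc[OF of_nat_tendsto_top_ennreal])
      then have "G \<omega> = top" unfolding G_def Yj by (rule lim_imp_Liminf[OF trivial_limit_sequentially])
      then show ?thesis by simp
    qed
  qed
  then show ?thesis using that Gm Gint by blast
qed

text \<open>If \<open>y\<close> were almost surely missed, the occupation of \<open>C\<close> after
  visits to ever smaller balls would decrease to 0. A time counted in \<open>C\<close> is one at
  which the path is alive, so visits to all balls before it would produce a visit to
  \<open>y\<close> by \<open>hit_by_approach\<close>.\<close>

lemma hit_positive:
  assumes d: "\<And>i. 0 \<le> d i" and a: "0 < \<alpha>" and c: "0 < c" and C: "C \<in> sets borel"
    and ge: "\<And>k::nat. c \<le> (\<integral>\<^sup>+\<omega>. grid_occ \<alpha> (ball y (1 / Suc k)) C d UNIV \<omega> \<partial>P x)"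
  shows "emeasure (P x) {\<omega> \<in> space W. hit y \<omega> < \<infinity>} \<noteq> 0"
proof
  interpret prob_space "P x" by (rule prob_P)
  assume 0: "emeasure (P x) {\<omega> \<in> space W. hit y \<omega> < \<infinity>} = 0"
  have nohit: "AE \<omega> in P x. \<not> hit y \<omega> < \<infinity>"
    by (rule AE_I[OF _ 0 hit_finite_event]) (auto simp: space_P)
  define f where "f k \<omega> = grid_occ \<alpha> (ball y (1 / Suc k)) C d UNIV \<omega>" for k :: nat and \<omega>
  define g where "g k \<omega> s = ennreal (exp (- \<alpha> * s)) * indicator {s. 0 \<le> s \<and> (\<exists>i\<in>UNIV. d i \<le> s \<and> B (d i) \<omega> \<in> Some ` ball y (1 / Suc k))} s
      * indicator (Some ` C) (B (max 0 s) \<omega>)" for k :: nat and \<omega> s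
  have fg: "f k \<omega> = (\<integral>\<^sup>+s. g k \<omega> s \<partial>lborel)" for k \<omega> by (simp add: f_def g_def grid_occ_def)
  have fm: "f k \<in> borel_measurable (P x)" for k
    unfolding f_def[abs_def]
  proof (rule measurable_grid(2)[where N = "{}", OF d less_imp_le[OF a] _ C])
    show "tr (d i) x {} = 0" for i by (simp add: transition_def)
  qed simp_all
  have gdec: "g n \<omega> s \<le> g m \<omega> s" if "m \<le> n" for m n \<omega> s
    unfolding g_def using image_mono[OF ball_decseq[OF that, of y], of Some]
    by (intro mult_right_mono mult_left_mono indicator_ennreal_mono) auto
  have gle: "g k \<omega> s \<le> ennreal (exp (- \<alpha> * s)) * indicator {0..} s" for k \<omega> s
    unfolding g_def by (auto simp: indicator_def)
  have flt: "f k \<omega> \<le> ennreal (1 / \<alpha>)" for k \<omega>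
  proof -
    have "f k \<omega> \<le> (\<integral>\<^sup>+s. ennreal (exp (- \<alpha> * s)) * indicator {0..} s \<partial>lborel)"
      unfolding fg by (intro nn_integral_mono gle)
    then show ?thesis using nn_integral_exp_atLeast[OF a, of 0] by simp
  qed
  have "(\<integral>\<^sup>+\<omega>. (INF k. f k \<omega>) \<partial>P x) = (INF k. \<integral>\<^sup>+\<omega>. f k \<omega> \<partial>P x)"
  proof (rule nn_integral_monotone_convergence_INF_decseq)
    show "decseq f" unfolding fg by (intro monotoneI le_funI nn_integral_mono gdec)
    show "f k \<in> borel_measurable (P x)" for k by (rule fm)
    have "(\<integral>\<^sup>+\<omega>. f 0 \<omega> \<partial>P x) \<le> (\<integral>\<^sup>+\<omega>. ennreal (1 / \<alpha>) \<partial>P x)" by (intro nn_integral_mono flt)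
    also have "\<dots> < \<infinity>" by (simp add: emeasure_space_1)
    finally show "(\<integral>\<^sup>+\<omega>. f 0 \<omega> \<partial>P x) < \<infinity>" .
  qed
  then have "c \<le> (\<integral>\<^sup>+\<omega>. (INF k. f k \<omega>) \<partial>P x)" using ge by (simp add: INF_greatest f_def)
  also have "\<dots> = (\<integral>\<^sup>+\<omega>. 0 \<partial>P x)"
  proof (rule nn_integral_cong_AE, rule AE_mp[OF nohit], intro AE_I2 impI)
    fix \<omega> assume "\<omega> \<in> space (P x)" and nh: "\<not> hit y \<omega> < \<infinity>"
    then have w: "\<omega> \<in> space W" by (simp add: space_P)
    have "(\<integral>\<^sup>+s. (INF k. g k \<omega> s) \<partial>lborel) = (INF k. \<integral>\<^sup>+s. g k \<omega> s \<partial>lborel)"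
    proof (rule nn_integral_monotone_convergence_INF_decseq)
      show "decseq (\<lambda>k. g k \<omega>)" by (intro monotoneI le_funI gdec)
      show "g k \<omega> \<in> borel_measurable lborel" for k
      proof -
        note [measurable] = measurable_path[OF w C]
        show ?thesis unfolding g_def by measurable
      qed
      show "(\<integral>\<^sup>+s. g 0 \<omega> s \<partial>lborel) < \<infinity>"
        using flt[of 0 \<omega>] unfolding fg by (rule le_less_trans) simp
    qed
    moreover have "(INF k. g k \<omega> s) = 0" for s
    proof (rule ccontr)
      assume ne: "(INF k. g k \<omega> s) \<noteq> 0"
      have pos: "g k \<omega> s \<noteq> 0" for k
      proof
        assume "g k \<omega> s = 0"
        moreover have "(INF k. g k \<omega> s) \<le> g k \<omega> s" by (rule INF_lower) simp
        ultimately show False using ne by simp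
      qed
      have s: "0 \<le> s" "B s \<omega> \<noteq> None"
        using pos[of 0] by (auto simp: g_def indicator_def max_def split: if_splits)
      have "\<exists>q. 0 \<le> q \<and> q \<le> s \<and> B q \<omega> \<in> Some ` ball y (1 / Suc k)" for k :: nat
      proof -
        have "\<exists>i. d i \<le> s \<and> B (d i) \<omega> \<in> Some ` ball y (1 / Suc k)"
        proof (rule ccontr)
          assume "\<not> ?thesis"
          then have "g k \<omega> s = 0" by (simp add: g_def)
          then show False using pos by blast
        qed
        then show ?thesis using d by blast
      qed
      then obtain u where u: "0 \<le> u" "B u \<omega> = Some y" using hit_by_approach[OF w s order_refl] by blast
      have "hit y \<omega> < \<infinity>" using hit_le[OF u] by (metis ennreal_less_top infinity_ennreal_def le_less_trans)
      then show False using nh by simp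
    qed
    ultimately show "(INF k. f k \<omega>) = 0" by (simp add: fg)
  qed
  finally show False using c by simp
qed

end

section \<open>Resolvents and the Dirichlet form\<close>

lemma average_tendsto:
  fixes \<phi> :: "real \<Rightarrow> real"
  assumes lim: "(\<phi> \<longlongrightarrow> L) (at_right 0)" and nonneg: "\<And>s. 0 < s \<Longrightarrow> 0 \<le> \<phi> s"
  shows "((\<lambda>t. enn2real (\<integral>\<^sup>+s. ennreal (\<phi> s) * indicator {0<..<t} s \<partial>lborel) / t) \<longlongrightarrow> L) (at_right 0)"
proof (rule tendstoI)
  fix e :: real assume e: "0 < e"
  have "\<forall>\<^sub>F s in at_right 0. dist (\<phi> s) L < e / 2" using lim e by (intro tendstoD) simp_all
  then obtain b where b: "0 < b" "\<And>s. 0 < s \<Longrightarrow> s < b \<Longrightarrow> dist (\<phi> s) L < e / 2"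
    unfolding eventually_at_right_field by blast
  have "dist (enn2real (\<integral>\<^sup>+s. ennreal (\<phi> s) * indicator {0<..<t} s \<partial>lborel) / t) L < e" if t: "0 < t" "t < b" for t
  proof -
    define I where "I = (\<integral>\<^sup>+s. ennreal (\<phi> s) * indicator {0<..<t} s \<partial>lborel)"
    have const: "(\<integral>\<^sup>+s. ennreal c * indicator {0<..<t} s \<partial>lborel) = ennreal (c * t)" if "0 \<le> c" for c
      using that t by (simp add: nn_integral_cmult_indicator ennreal_mult)
    have phi: "\<phi> s \<le> L + e / 2" "L - e / 2 \<le> \<phi> s" if "s \<in> {0<..<t}" for s
    proof -
      have "\<bar>\<phi> s - L\<bar> < e / 2" using b(2)[of s] that t by (simp add: dist_real_def)
      then show "\<phi> s \<le> L + e / 2" "L - e / 2 \<le> \<phi> s" unfolding abs_less_iff by linarith+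
    qed
    have L0: "0 \<le> L + e / 2" using phi(1)[of "t / 2"] nonneg[of "t / 2"] t by simp
    have up: "I \<le> ennreal ((L + e / 2) * t)"
      unfolding const[OF L0, symmetric] I_def using phi(1) by (intro nn_integral_mono) (auto simp: indicator_def intro!: ennreal_leI)
    have lo: "ennreal (max 0 (L - e / 2) * t) \<le> I"
      unfolding const[of "max 0 (L - e / 2)", OF max.cobounded1, symmetric] I_def using phi(2) nonneg
      by (intro nn_integral_mono) (auto simp: indicator_def intro!: ennreal_leI)
    have fin: "I < \<top>" using up by (rule le_less_trans) simp
    have "enn2real I \<le> (L + e / 2) * t" using up L0 t by (intro enn2real_leI) simp_all
    moreover have "max 0 (L - e / 2) * t \<le> enn2real I"
      using enn2real_mono[OF lo fin] t by simp
    then have "(L - e / 2) * t \<le> enn2real I"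
      using t by (meson max.cobounded2 mult_right_mono order_trans less_imp_le)
    ultimately have "enn2real I / t \<le> L + e / 2" "L - e / 2 \<le> enn2real I / t"
      using t by (simp_all add: field_simps)
    then show ?thesis using e by (simp add: I_def dist_real_def abs_less_iff)
  qed
  then show "\<forall>\<^sub>F t in at_right 0. dist (enn2real (\<integral>\<^sup>+s. ennreal (\<phi> s) * indicator {0<..<t} s \<partial>lborel) / t) L < e"
    unfolding eventually_at_right_field using b(1) by blast
qed

section \<open>Potentials of a symmetric process\<close>

locale symmetric_markov = markov_process W P B
  for W :: "'w measure" and P :: "'a::metric_space \<Rightarrow> 'w measure" and B :: "real \<Rightarrow> 'w \<Rightarrow> 'a option" +
  fixes \<nu> :: "'a measure"
  assumes sets_nu: "sets \<nu> = sets borel" and sigma_finite_nu: "sigma_finite_measure \<nu>" and sym: "symmetric_process \<nu> P B"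
begin

lemma measurable_nu: "measurable \<nu> N = measurable borel N"
  by (rule measurable_cong_sets[OF sets_nu refl])

lemma space_nu [simp]: "space \<nu> = UNIV"
  using sets_eq_imp_space_eq[OF sets_nu] by simp

lemma sym_nn:
  "0 < t \<Longrightarrow> f \<in> borel_measurable borel \<Longrightarrow> g \<in> borel_measurable borel \<Longrightarrow>
   (\<integral>\<^sup>+x. (\<integral>\<^sup>+\<omega>. zero_ext f (B t \<omega>) \<partial>P x) * g x \<partial>\<nu>) = (\<integral>\<^sup>+x. f x * (\<integral>\<^sup>+\<omega>. zero_ext g (B t \<omega>) \<partial>P x) \<partial>\<nu>)"
  using sym unfolding symmetric_process_def by blast

lemma transition_zero_ext:
  "0 \<le> t \<Longrightarrow> A \<in> sets borel \<Longrightarrow> tr t x A = (\<integral>\<^sup>+\<omega>. zero_ext (indicator A) (B t \<omega>) \<partial>P x)"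
  using transition_eq[of t A x] by (simp only: indicator_Some_image)

text \<open>Symmetry against the constant 1 moves the indicator of \<open>N\<close> out of the
  expectation, where it integrates to 0.\<close>

lemma transition_null:
  assumes N: "N \<in> null_sets \<nu>" and t: "0 < t"
  shows "AE x in \<nu>. tr t x N = 0"
proof -
  have Nb: "N \<in> sets borel" using N sets_nu by auto
  have "(\<integral>\<^sup>+x. tr t x N \<partial>\<nu>) = (\<integral>\<^sup>+x. (\<integral>\<^sup>+\<omega>. zero_ext (indicator N) (B t \<omega>) \<partial>P x) * 1 \<partial>\<nu>)"
    using t Nb by (simp add: transition_zero_ext)
  also have "\<dots> = (\<integral>\<^sup>+x. indicator N x * (\<integral>\<^sup>+\<omega>. zero_ext (\<lambda>_. 1) (B t \<omega>) \<partial>P x) \<partial>\<nu>)"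
    using t Nb by (intro sym_nn) simp_all
  also have "\<dots> = (\<integral>\<^sup>+x. 0 \<partial>\<nu>)"
    by (rule nn_integral_cong_AE, rule AE_mp[OF AE_not_in[OF N]]) (intro AE_I2 impI, simp)
  finally have 0: "(\<integral>\<^sup>+x. tr t x N \<partial>\<nu>) = 0" by simp
  have "(\<lambda>x. tr t x N) \<in> borel_measurable \<nu>"
    unfolding measurable_nu using t Nb by (intro transition_measurable) simp_all
  from nn_integral_0_iff_AE[OF this] 0 show ?thesis by simp
qed

text \<open>Fubini, and symmetry at each time. Symmetry is available at positive times only, and at
  the others the weight \<open>h\<close> vanishes.\<close>

lemma weighted_transition_integral:
  assumes h: "h \<in> borel_measurable borel" "\<And>s. s \<le> 0 \<Longrightarrow> h s = 0" and A: "A \<in> sets borel" and g: "g \<in> borel_measurable borel"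
  shows "(\<integral>\<^sup>+x. (\<integral>\<^sup>+s. h s * tr (max 0 s) x A \<partial>lborel) * g x \<partial>\<nu>)
     = (\<integral>\<^sup>+s. h s * (\<integral>\<^sup>+x. indicator A x * (\<integral>\<^sup>+\<omega>. zero_ext g (B s \<omega>) \<partial>P x) \<partial>\<nu>) \<partial>lborel)"
proof -
  interpret \<nu>: sigma_finite_measure \<nu> by (rule sigma_finite_nu)
  interpret pair_sigma_finite lborel \<nu> ..
  have eqm: "borel_measurable (lborel \<Otimes>\<^sub>M \<nu>) = borel_measurable (lborel \<Otimes>\<^sub>M (borel :: 'a measure))"
    by (rule measurable_cong_sets[OF _ refl]) (intro sets_pair_measure_cong sets_nu refl)
  have m: "(\<lambda>(s, x). h s * tr (max 0 s) x A * g x) \<in> borel_measurable (lborel \<Otimes>\<^sub>M \<nu>)"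
  proof -
    note [measurable] = h(1) g measurable_transition_pair[OF A]
    show ?thesis unfolding eqm case_prod_beta' by measurable
  qed
  have my: "(\<lambda>s. tr (max 0 s) x A) \<in> borel_measurable lborel" for x
    using measurable_compose[OF measurable_Pair2'[of x borel lborel] measurable_transition_pair[OF A]] by simp
  have "(\<integral>\<^sup>+x. (\<integral>\<^sup>+s. h s * tr (max 0 s) x A \<partial>lborel) * g x \<partial>\<nu>)
      = (\<integral>\<^sup>+x. (\<integral>\<^sup>+s. h s * tr (max 0 s) x A * g x \<partial>lborel) \<partial>\<nu>)"
  proof (intro nn_integral_cong nn_integral_multc[symmetric])
    fix x
    show "(\<lambda>s. h s * tr (max 0 s) x A) \<in> borel_measurable lborel"
      using h(1) my by (intro borel_measurable_times_ennreal) simp_all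
  qed
  also have "\<dots> = (\<integral>\<^sup>+s. (\<integral>\<^sup>+x. h s * tr (max 0 s) x A * g x \<partial>\<nu>) \<partial>lborel)"
    using Fubini[OF m] by simp
  also have "\<dots> = (\<integral>\<^sup>+s. h s * (\<integral>\<^sup>+x. indicator A x * (\<integral>\<^sup>+\<omega>. zero_ext g (B s \<omega>) \<partial>P x) \<partial>\<nu>) \<partial>lborel)"
  proof (intro nn_integral_cong)
    fix s
    show "(\<integral>\<^sup>+x. h s * tr (max 0 s) x A * g x \<partial>\<nu>) = h s * (\<integral>\<^sup>+x. indicator A x * (\<integral>\<^sup>+\<omega>. zero_ext g (B s \<omega>) \<partial>P x) \<partial>\<nu>)"
    proof (cases "0 < s")
      case True
      have mm: "(\<lambda>x. tr s x A * g x) \<in> borel_measurable \<nu>"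
        unfolding measurable_nu using True A g by (intro borel_measurable_times_ennreal transition_measurable) simp_all
      have "(\<integral>\<^sup>+x. h s * tr (max 0 s) x A * g x \<partial>\<nu>) = h s * (\<integral>\<^sup>+x. tr s x A * g x \<partial>\<nu>)"
        using True by (simp add: mult.assoc nn_integral_cmult[OF mm])
      also have "(\<integral>\<^sup>+x. tr s x A * g x \<partial>\<nu>) = (\<integral>\<^sup>+x. (\<integral>\<^sup>+\<omega>. zero_ext (indicator A) (B s \<omega>) \<partial>P x) * g x \<partial>\<nu>)"
        using True A by (simp add: transition_zero_ext)
      also have "\<dots> = (\<integral>\<^sup>+x. indicator A x * (\<integral>\<^sup>+\<omega>. zero_ext g (B s \<omega>) \<partial>P x) \<partial>\<nu>)"
        using True A g by (intro sym_nn) simp_all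
      finally show ?thesis .
    next
      case False
      then show ?thesis using h(2)[of s] by simp
    qed
  qed
  finally show ?thesis .
qed

definition early :: "real \<Rightarrow> 'a set \<Rightarrow> real \<Rightarrow> 'a \<Rightarrow> ennreal" where
  "early \<alpha> A t x = (\<integral>\<^sup>+s. ennreal (exp (- \<alpha> * s)) * indicator {0<..<t} s * tr (max 0 s) x A \<partial>lborel)"

lemma transition_path_measurable: "A \<in> sets borel \<Longrightarrow> (\<lambda>s. tr (max 0 s) x A) \<in> borel_measurable lborel"
  using measurable_compose[OF measurable_Pair2'[of x borel lborel] measurable_transition_pair] by simp

lemma pot_eq_open:
  "pot \<alpha> A x = (\<integral>\<^sup>+s. ennreal (exp (- \<alpha> * s)) * indicator {0<..} s * tr (max 0 s) x A \<partial>lborel)"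
  unfolding pot_def
  by (rule nn_integral_cong_AE, rule AE_mp[OF AE_lborel_singleton[of 0]])
    (intro AE_I2 impI, simp add: indicator_def)

text \<open>By symmetry, the mass \<open>\<integral> tr s x A d\<nu>\<close> is the integral over
  \<open>A\<close> of the survival probability at time \<open>s\<close>, hence at most
  \<open>\<nu>(A)\<close>.\<close>

lemma pot_nu_integral:
  assumes A: "A \<in> sets borel"
  shows "(\<integral>\<^sup>+x. pot \<alpha> A x \<partial>\<nu>) \<le> (\<integral>\<^sup>+s. ennreal (exp (- \<alpha> * s)) * indicator {0<..} s * emeasure \<nu> A \<partial>lborel)"
proof -
  have "(\<integral>\<^sup>+x. pot \<alpha> A x \<partial>\<nu>) = (\<integral>\<^sup>+x. (\<integral>\<^sup>+s. ennreal (exp (- \<alpha> * s)) * indicator {0<..} s * tr (max 0 s) x A \<partial>lborel) * 1 \<partial>\<nu>)"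
    unfolding pot_eq_open by simp
  also have "\<dots> = (\<integral>\<^sup>+s. ennreal (exp (- \<alpha> * s)) * indicator {0<..} s * (\<integral>\<^sup>+x. indicator A x * (\<integral>\<^sup>+\<omega>. zero_ext (\<lambda>_. 1) (B s \<omega>) \<partial>P x) \<partial>\<nu>) \<partial>lborel)"
    by (rule weighted_transition_integral) (use A in simp_all)
  also have "\<dots> \<le> (\<integral>\<^sup>+s. ennreal (exp (- \<alpha> * s)) * indicator {0<..} s * emeasure \<nu> A \<partial>lborel)"
  proof (intro nn_integral_mono mult_left_mono)
    fix s
    have "(\<integral>\<^sup>+\<omega>. zero_ext (\<lambda>_. 1) (B s \<omega>) \<partial>P x) \<le> 1" for x
    proof -
      interpret prob_space "P x" by (rule prob_P)
      have "zero_ext (\<lambda>_. 1) z \<le> (1::ennreal)" for z :: "'a option" by (cases z) simp_all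
      then have "(\<integral>\<^sup>+\<omega>. zero_ext (\<lambda>_. 1) (B s \<omega>) \<partial>P x) \<le> (\<integral>\<^sup>+\<omega>. 1 \<partial>P x)" by (intro nn_integral_mono)
      then show ?thesis by (simp add: emeasure_space_1)
    qed
    then have "(\<integral>\<^sup>+x. indicator A x * (\<integral>\<^sup>+\<omega>. zero_ext (\<lambda>_. 1) (B s \<omega>) \<partial>P x) \<partial>\<nu>) \<le> (\<integral>\<^sup>+x. indicator A x * 1 \<partial>\<nu>)"
      by (intro nn_integral_mono mult_left_mono) simp_all
    then show "(\<integral>\<^sup>+x. indicator A x * (\<integral>\<^sup>+\<omega>. zero_ext (\<lambda>_. 1) (B s \<omega>) \<partial>P x) \<partial>\<nu>) \<le> emeasure \<nu> A"
      using A by (simp add: sets_nu)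
  qed simp
  finally show ?thesis .
qed

lemma pot_null:
  assumes N: "N \<in> null_sets \<nu>"
  shows "AE x in \<nu>. pot \<alpha> N x = 0"
proof -
  have Nb: "N \<in> sets borel" using N sets_nu by auto
  have "(\<integral>\<^sup>+x. pot \<alpha> N x \<partial>\<nu>) = 0" using pot_nu_integral[OF Nb, of \<alpha>] N by (simp add: null_setsD1)
  moreover have "pot \<alpha> N \<in> borel_measurable \<nu>" unfolding measurable_nu by (rule measurable_pot[OF Nb])
  ultimately show ?thesis using nn_integral_0_iff_AE by blast
qed

lemma pot_le:
  assumes a: "0 < \<alpha>" shows "pot \<alpha> A x \<le> ennreal (1 / \<alpha>)"
proof -
  have "pot \<alpha> A x \<le> (\<integral>\<^sup>+s. ennreal (exp (- \<alpha> * s)) * indicator {0..} s * 1 \<partial>lborel)"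
    unfolding pot_def by (intro nn_integral_mono mult_left_mono transition_le_1) simp
  also have "\<dots> = ennreal (1 / \<alpha>)" using nn_integral_exp_atLeast[OF a, of 0] by simp
  finally show ?thesis .
qed

lemma early_le:
  assumes a: "0 \<le> \<alpha>" and t: "0 < t" shows "early \<alpha> A t x \<le> ennreal t"
proof -
  have "early \<alpha> A t x \<le> (\<integral>\<^sup>+s. indicator {0<..<t} s \<partial>lborel)"
    unfolding early_def
  proof (rule nn_integral_mono)
    fix s
    have "ennreal (exp (- \<alpha> * s)) * tr (max 0 s) x A \<le> 1 * 1" if "0 < s"
      using that a ennreal_leI[of "exp (- \<alpha> * s)" 1] by (intro mult_mono transition_le_1) simp_all
    then show "ennreal (exp (- \<alpha> * s)) * indicator {0<..<t} s * tr (max 0 s) x A \<le> indicator {0<..<t} s"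
      by (cases "s \<in> {0<..<t}") simp_all
  qed
  then show ?thesis using t by simp
qed

text \<open>Cuts the time axis at \<open>t\<close>; the Markov property expresses the later part
  through the potential seen from the position at time \<open>t\<close>.\<close>

lemma pot_split:
  assumes a: "0 < \<alpha>" and A: "A \<in> sets borel" and t: "0 < t"
  shows "pot \<alpha> A x = early \<alpha> A t x + ennreal (exp (- \<alpha> * t)) * (\<integral>\<^sup>+\<omega>. zero_ext (pot \<alpha> A) (B t \<omega>) \<partial>P x)"
proof -
  note tm = transition_path_measurable[OF A]
  have "pot \<alpha> A x = (\<integral>\<^sup>+s. ennreal (exp (- \<alpha> * s)) * indicator {0<..<t} s * tr (max 0 s) x A
      + ennreal (exp (- \<alpha> * s)) * indicator {t..} s * tr (max 0 s) x A \<partial>lborel)"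
    unfolding pot_eq_open using t by (intro nn_integral_cong) (simp add: indicator_def)
  also have "\<dots> = early \<alpha> A t x + (\<integral>\<^sup>+s. ennreal (exp (- \<alpha> * s)) * indicator {t..} s * tr (max 0 s) x A \<partial>lborel)"
    unfolding early_def using tm by (intro nn_integral_add) simp_all
  also have "(\<integral>\<^sup>+s. ennreal (exp (- \<alpha> * s)) * indicator {t..} s * tr (max 0 s) x A \<partial>lborel) = (\<integral>\<^sup>+\<omega>. occ \<alpha> A t \<omega> \<partial>P x)"
  proof -
    have m: "(\<lambda>\<omega>. indicator (Some ` A) (B (max 0 s) \<omega>) :: ennreal) \<in> borel_measurable (P x)" for s
      unfolding measurable_P
      by (rule measurable_compose[OF measurable_B borel_measurable_indicator[OF Some_image_cemetery[OF A]]]) simp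
    note [measurable] = measurable_compose[OF measurable_B_pair borel_measurable_indicator[OF Some_image_cemetery[OF A]]]
    have "(\<lambda>(s, \<omega>). ennreal (exp (- \<alpha> * s)) * indicator {t..} s * indicator (Some ` A) (B (max 0 s) \<omega>)) \<in> borel_measurable (lborel \<Otimes>\<^sub>M P x)"
      unfolding case_prod_beta' by measurable
    then have "(\<integral>\<^sup>+\<omega>. occ \<alpha> A t \<omega> \<partial>P x) = (\<integral>\<^sup>+s. (\<integral>\<^sup>+\<omega>. ennreal (exp (- \<alpha> * s)) * indicator {t..} s * indicator (Some ` A) (B (max 0 s) \<omega>) \<partial>P x) \<partial>lborel)"
      unfolding occ_def by (drule_tac Fubini_P) simp
    then show ?thesis using m by (simp add: nn_integral_cmult transition_eq[OF _ A])
  qed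
  also have "(\<integral>\<^sup>+\<omega>. occ \<alpha> A t \<omega> \<partial>P x) = (\<integral>\<^sup>+\<omega>. occ \<alpha> A t \<omega> * indicator (space W) \<omega> \<partial>P x)"
    by (intro nn_integral_cong) (simp add: space_P)
  also have "\<dots> = ennreal (exp (- \<alpha> * t)) * (\<integral>\<^sup>+\<omega>. zero_ext (pot \<alpha> A) (B t \<omega>) * indicator (space W) \<omega> \<partial>P x)"
    using t sets.top[of "natural_filtration W B (ennreal t)"] by (intro markov_pot A) simp_all
  also have "(\<integral>\<^sup>+\<omega>. zero_ext (pot \<alpha> A) (B t \<omega>) * indicator (space W) \<omega> \<partial>P x) = (\<integral>\<^sup>+\<omega>. zero_ext (pot \<alpha> A) (B t \<omega>) \<partial>P x)"
    by (intro nn_integral_cong) (simp add: space_P)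
  finally show ?thesis .
qed

definition res :: "real \<Rightarrow> 'a set \<Rightarrow> 'a \<Rightarrow> real" where
  "res \<alpha> A x = enn2real (pot \<alpha> A x)"

abbreviation "sg \<equiv> semigroup_op P B"

lemma semigroup_nonneg_eq:
  assumes t: "0 \<le> t" and g: "g \<in> borel_measurable borel" "\<And>x. 0 \<le> g x"
  shows "sg t g x = enn2real (\<integral>\<^sup>+\<omega>. zero_ext (\<lambda>x. ennreal (g x)) (B t \<omega>) \<partial>P x)"
proof -
  have m: "(\<lambda>\<omega>. zero_ext g (B t \<omega>)) \<in> borel_measurable (P x)"
    unfolding measurable_P by (rule measurable_compose[OF measurable_B[OF t] borel_measurable_zero_ext[OF g(1)]])
  have z: "0 \<le> zero_ext g z" "ennreal (zero_ext g z) = zero_ext (\<lambda>x. ennreal (g x)) z" for z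
    using g(2) by (cases z; simp)+
  show ?thesis
    unfolding semigroup_op_def using z m by (subst integral_eq_nn_integral) simp_all
qed

lemma ennreal_semigroup:
  assumes t: "0 \<le> t" and g: "g \<in> borel_measurable borel" "\<And>x. 0 \<le> g x" "\<And>x. g x \<le> M"
  shows "ennreal (sg t g x) = (\<integral>\<^sup>+\<omega>. zero_ext (\<lambda>x. ennreal (g x)) (B t \<omega>) \<partial>P x)" "0 \<le> sg t g x" "sg t g x \<le> M"
proof -
  interpret prob_space "P x" by (rule prob_P)
  have M: "0 \<le> M" using g(2,3)[of x] by simp
  have "zero_ext (\<lambda>x. ennreal (g x)) z \<le> ennreal M" for z
    using g(3) by (cases z) (auto intro: ennreal_leI)
  then have "(\<integral>\<^sup>+\<omega>. zero_ext (\<lambda>x. ennreal (g x)) (B t \<omega>) \<partial>P x) \<le> (\<integral>\<^sup>+\<omega>. ennreal M \<partial>P x)"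
    by (intro nn_integral_mono)
  then have le: "(\<integral>\<^sup>+\<omega>. zero_ext (\<lambda>x. ennreal (g x)) (B t \<omega>) \<partial>P x) \<le> ennreal M" by (simp add: emeasure_space_1)
  then have fin: "(\<integral>\<^sup>+\<omega>. zero_ext (\<lambda>x. ennreal (g x)) (B t \<omega>) \<partial>P x) < \<top>" by (rule le_less_trans) simp
  show "ennreal (sg t g x) = (\<integral>\<^sup>+\<omega>. zero_ext (\<lambda>x. ennreal (g x)) (B t \<omega>) \<partial>P x)"
    unfolding semigroup_nonneg_eq[OF t g(1,2)] using fin by simp
  show "0 \<le> sg t g x" unfolding semigroup_nonneg_eq[OF t g(1,2)] by simp
  show "sg t g x \<le> M" unfolding semigroup_nonneg_eq[OF t g(1,2)] using le M by (rule_tac enn2real_leI)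
qed

lemma semigroup_measurable:
  assumes t: "0 \<le> t" and g: "g \<in> borel_measurable borel"
  shows "sg t g \<in> borel_measurable borel"
proof -
  have "(\<lambda>x. LINT z|kernel (t, x). zero_ext g z) \<in> borel_measurable borel"
    by (rule measurable_compose[OF measurable_kernel_section[OF t] integral_measurable_subprob_algebra])
       (rule borel_measurable_zero_ext[OF g])
  also have "(\<lambda>x. LINT z|kernel (t, x). zero_ext g z) = sg t g"
    unfolding kernel_def semigroup_op_def using t
    by (intro ext, subst integral_distr) (simp_all add: measurable_P measurable_B borel_measurable_zero_ext[OF g])
  finally show ?thesis .
qed

section \<open>The resolvent of a set of finite measure in the approximating forms\<close>

context
  fixes \<alpha> :: real and A :: "'a set"
  assumes a: "0 < \<alpha>" and A: "A \<in> sets borel" and finA: "emeasure \<nu> A < \<infinity>"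
begin

lemma pot_finite: "pot \<alpha> A x < \<top>"
  using pot_le[OF a, of A x] by (rule le_less_trans) simp

lemma ennreal_res: "ennreal (res \<alpha> A x) = pot \<alpha> A x"
  unfolding res_def using pot_finite by simp

lemma res_bounds: "0 \<le> res \<alpha> A x" "res \<alpha> A x \<le> 1 / \<alpha>"
  unfolding res_def using pot_le[OF a, of A x] a by (auto intro!: enn2real_leI)

lemma res_measurable: "res \<alpha> A \<in> borel_measurable borel"
  unfolding res_def[abs_def] using measurable_pot[OF A] by measurable

lemma res_integrable: "integrable \<nu> (res \<alpha> A)"
proof (rule integrableI_nonneg)
  show "res \<alpha> A \<in> borel_measurable \<nu>" unfolding measurable_nu by (rule res_measurable)
  have "(\<integral>\<^sup>+x. pot \<alpha> A x \<partial>\<nu>) \<le> (\<integral>\<^sup>+s. ennreal (exp (- \<alpha> * s)) * indicator {0..} s * emeasure \<nu> A \<partial>lborel)"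
    by (rule order_trans[OF pot_nu_integral[OF A]]) (intro nn_integral_mono, simp add: indicator_def)
  also have "\<dots> = ennreal (1 / \<alpha>) * emeasure \<nu> A"
    using nn_integral_exp_atLeast[OF a, of 0] by (subst nn_integral_multc) simp_all
  also have "\<dots> < \<infinity>" using finA by (simp add: ennreal_mult_less_top)
  finally show "(\<integral>\<^sup>+x. ennreal (res \<alpha> A x) \<partial>\<nu>) < \<infinity>" by (simp add: ennreal_res)
qed (simp add: res_bounds)

lemma res_times_integrable:
  assumes g: "g \<in> borel_measurable borel" "\<And>x. \<bar>g x\<bar> \<le> M"
  shows "integrable \<nu> (\<lambda>x. res \<alpha> A x * g x)"
proof (rule Bochner_Integration.integrable_bound)
  show "integrable \<nu> (\<lambda>x. M * res \<alpha> A x)" using res_integrable by simp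
  show "(\<lambda>x. res \<alpha> A x * g x) \<in> borel_measurable \<nu>"
    unfolding measurable_nu using res_measurable g(1) by (rule borel_measurable_times)
  have "\<bar>res \<alpha> A x * g x\<bar> \<le> \<bar>M * res \<alpha> A x\<bar>" for x
    using g(2)[of x] res_bounds(1)[of x] by (simp add: abs_mult mult.commute mult_right_mono)
  then show "AE x in \<nu>. norm (res \<alpha> A x * g x) \<le> norm (M * res \<alpha> A x)" by simp
qed

lemma res_L2: "res \<alpha> A \<in> L2 \<nu>"
proof -
  have "\<bar>res \<alpha> A x\<bar> \<le> 1 / \<alpha>" for x using res_bounds[of x] by simp
  from res_times_integrable[OF res_measurable this] show ?thesis
    using res_measurable by (simp add: L2_def measurable_nu power2_eq_square)
qed

definition early_res :: "real \<Rightarrow> 'a \<Rightarrow> real" where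
  "early_res t x = enn2real (early \<alpha> A t x)"

lemma ennreal_early_res: "0 < t \<Longrightarrow> ennreal (early_res t x) = early \<alpha> A t x"
  unfolding early_res_def using early_le[of \<alpha> t A x] a by (simp add: le_less_trans)

lemma early_res_bounds: "0 \<le> early_res t x" "0 < t \<Longrightarrow> early_res t x \<le> t"
  unfolding early_res_def using early_le[of \<alpha> t A x] a by (auto intro!: enn2real_leI)

text \<open>\<open>pot_split\<close> solved for the semigroup. It makes
  \<open>(u - T_t u) / t\<close> explicit for \<open>u = res \<alpha> A\<close>, so that limits of
  the approximating forms can be computed directly.\<close>

lemma semigroup_res:
  assumes t: "0 < t"
  shows "sg t (res \<alpha> A) x = exp (\<alpha> * t) * (res \<alpha> A x - early_res t x)"
proof -
  have e: "(\<lambda>x. ennreal (res \<alpha> A x)) = pot \<alpha> A" by (simp add: ennreal_res)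
  have eq: "ennreal (sg t (res \<alpha> A) x) = (\<integral>\<^sup>+\<omega>. zero_ext (pot \<alpha> A) (B t \<omega>) \<partial>P x)"
    and nn: "0 \<le> sg t (res \<alpha> A) x"
    using ennreal_semigroup[OF less_imp_le[OF t] res_measurable res_bounds] by (simp_all add: e)
  have "ennreal (res \<alpha> A x) = ennreal (early_res t x) + ennreal (exp (- \<alpha> * t)) * ennreal (sg t (res \<alpha> A) x)"
    unfolding ennreal_res ennreal_early_res[OF t] eq by (rule pot_split[OF a A t])
  also have "\<dots> = ennreal (early_res t x + exp (- \<alpha> * t) * sg t (res \<alpha> A) x)"
    using nn early_res_bounds(1)[of t x] by (simp add: ennreal_mult ennreal_plus)
  finally have "res \<alpha> A x = early_res t x + exp (- \<alpha> * t) * sg t (res \<alpha> A) x"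
    using nn early_res_bounds(1)[of t x] res_bounds(1)[of x] by (subst (asm) ennreal_inj) simp_all
  then have "exp (\<alpha> * t) * (res \<alpha> A x - early_res t x) = (exp (\<alpha> * t) * exp (- \<alpha> * t)) * sg t (res \<alpha> A) x" by simp
  also have "exp (\<alpha> * t) * exp (- \<alpha> * t) = 1" by (simp add: exp_add[symmetric])
  finally show ?thesis by simp
qed

lemma early_res_le_res: "0 < t \<Longrightarrow> early_res t x \<le> res \<alpha> A x"
proof -
  assume t: "0 < t"
  have "0 \<le> sg t (res \<alpha> A) x" using ennreal_semigroup(2)[OF less_imp_le[OF t] res_measurable res_bounds] .
  then show ?thesis unfolding semigroup_res[OF t] by (simp add: zero_le_mult_iff not_le[symmetric])
qed

lemma semigroup_res_tendsto: "((\<lambda>s. sg s (res \<alpha> A) x) \<longlongrightarrow> res \<alpha> A x) (at_right 0)"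
proof -
  have ev: "\<forall>\<^sub>F s in at_right 0. sg s (res \<alpha> A) x = exp (\<alpha> * s) * (res \<alpha> A x - early_res s x)"
    unfolding eventually_at_right_field by (intro exI[of _ 1]) (simp add: semigroup_res)
  have "((\<lambda>s. early_res s x) \<longlongrightarrow> 0) (at_right 0)"
  proof (rule tendsto_sandwich[of "\<lambda>_. 0" _ _ "\<lambda>s. s"])
    show "\<forall>\<^sub>F s in at_right 0. early_res s x \<le> s"
      unfolding eventually_at_right_field by (intro exI[of _ 1]) (simp add: early_res_bounds)
  qed (simp_all add: early_res_bounds tendsto_ident_at)
  then have "((\<lambda>s. exp (\<alpha> * s) * (res \<alpha> A x - early_res s x)) \<longlongrightarrow> exp (\<alpha> * 0) * (res \<alpha> A x - 0)) (at_right 0)"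
    by (intro tendsto_intros)
  then show ?thesis by (subst tendsto_cong[OF ev]) simp
qed

lemma early_res_measurable: "early_res t \<in> borel_measurable borel"
proof -
  have [measurable]: "(\<lambda>p. tr (max 0 (snd p)) (fst p) A) \<in> borel_measurable (borel \<Otimes>\<^sub>M lborel)"
    using measurable_compose[OF measurable_pair_swap' measurable_transition_pair[OF A]] by (simp add: case_prod_beta')
  have "(\<lambda>p. ennreal (exp (- \<alpha> * snd p)) * indicator {0<..<t} (snd p) * tr (max 0 (snd p)) (fst p) A) \<in> borel_measurable (borel \<Otimes>\<^sub>M lborel)"
    by measurable
  from lborel.borel_measurable_nn_integral_fst[OF this]
  have "early \<alpha> A t \<in> borel_measurable borel" by (simp add: early_def[abs_def])
  then show ?thesis unfolding early_res_def[abs_def] by measurable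
qed

lemma early_res_times_integrable:
  assumes t: "0 < t" and g: "g \<in> borel_measurable borel" "\<And>x. \<bar>g x\<bar> \<le> M"
  shows "integrable \<nu> (\<lambda>x. early_res t x * g x)"
proof (rule Bochner_Integration.integrable_bound[OF res_times_integrable[OF g]])
  show "(\<lambda>x. early_res t x * g x) \<in> borel_measurable \<nu>"
    unfolding measurable_nu using early_res_measurable g(1) by (rule borel_measurable_times)
  have "\<bar>early_res t x * g x\<bar> \<le> \<bar>res \<alpha> A x * g x\<bar>" for x
    using early_res_le_res[OF t, of x] early_res_bounds(1)[of t x] by (simp add: abs_mult mult_right_mono)
  then show "AE x in \<nu>. norm (early_res t x * g x) \<le> norm (res \<alpha> A x * g x)" by simp
qed

text \<open>The functions \<open>g\<close> for which \<open>1/t \<integral> (\<integral>\<^sub>0\<^sup>t e\<^sup>-\<^sup>\<alpha>\<^sup>s T\<^sub>s 1\<^sub>A ds) g d\<nu>\<close>, moved onto \<open>g\<close> by symmetry, is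
  seen to converge to \<open>\<integral>\<^sub>A g d\<nu>\<close> by dominated convergence.\<close>

definition nice :: "('a \<Rightarrow> real) \<Rightarrow> bool" where
  "nice g \<longleftrightarrow> g \<in> borel_measurable borel \<and> (\<forall>x. 0 \<le> g x) \<and> (\<exists>M. \<forall>x. g x \<le> M) \<and>
     (\<forall>x. ((\<lambda>s. sg s g x) \<longlongrightarrow> g x) (at_right 0))"

lemma early_res_average:
  assumes "nice g"
  shows "((\<lambda>t. (LINT x|\<nu>. early_res t x * g x) / t) \<longlongrightarrow> (LINT x|\<nu>. indicator A x * g x)) (at_right 0)"
proof -
  obtain M where g: "g \<in> borel_measurable borel" "\<And>x. 0 \<le> g x" "\<And>x. g x \<le> M"
    and lim: "\<And>x. ((\<lambda>s. sg s g x) \<longlongrightarrow> g x) (at_right 0)"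
    using assms by (auto simp: nice_def)
  have iA: "integrable \<nu> (indicator A :: 'a \<Rightarrow> real)" using A finA by (simp add: integrable_indicator_iff sets_nu)
  define q where "q s = (LINT x|\<nu>. indicator A x * sg s g x)" for s
  have im: "(\<lambda>x. indicator A x * sg s g x) \<in> borel_measurable \<nu>" if "0 \<le> s" for s
    unfolding measurable_nu using semigroup_measurable[OF that g(1)] A by (intro borel_measurable_times borel_measurable_indicator)
  have dom: "norm (indicator A x * sg s g x) \<le> M * indicator A x" if "0 \<le> s" for s x
    using ennreal_semigroup(2,3)[OF that g, of x] by (cases "x \<in> A") simp_all
  have iq: "integrable \<nu> (\<lambda>x. indicator A x * sg s g x)" if "0 \<le> s" for s
  proof (rule Bochner_Integration.integrable_bound[OF _ im[OF that]])
    show "integrable \<nu> (\<lambda>x. M * indicator A x)" using iA by simp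
    show "AE x in \<nu>. norm (indicator A x * sg s g x) \<le> norm (M * indicator A x)"
      using dom[OF that] by (intro AE_I2) (simp add: order_trans[OF _ abs_ge_self])
  qed
  have nnq: "0 \<le> q s" if "0 < s" for s
    unfolding q_def using ennreal_semigroup(2)[OF less_imp_le[OF that] g] by (intro Bochner_Integration.integral_nonneg) simp
  have q_ennreal: "(\<integral>\<^sup>+x. indicator A x * (\<integral>\<^sup>+\<omega>. zero_ext (\<lambda>x. ennreal (g x)) (B s \<omega>) \<partial>P x) \<partial>\<nu>) = ennreal (q s)" if s: "0 < s" for s
  proof -
    have "(\<integral>\<^sup>+x. indicator A x * (\<integral>\<^sup>+\<omega>. zero_ext (\<lambda>x. ennreal (g x)) (B s \<omega>) \<partial>P x) \<partial>\<nu>) = (\<integral>\<^sup>+x. ennreal (indicator A x * sg s g x) \<partial>\<nu>)"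
      unfolding ennreal_semigroup(1)[OF less_imp_le[OF s] g, symmetric]
    proof (intro nn_integral_cong)
      fix x
      show "indicator A x * ennreal (sg s g x) = ennreal (indicator A x * sg s g x)"
        by (cases "x \<in> A") simp_all
    qed
    also have "\<dots> = ennreal (q s)"
      unfolding q_def using ennreal_semigroup(2)[OF less_imp_le[OF s] g] s
      by (intro nn_integral_eq_integral iq) simp_all
    finally show ?thesis .
  qed
  have "(q \<longlongrightarrow> (LINT x|\<nu>. indicator A x * g x)) (at_right 0)"
  proof (rule tendsto_at_right_sequentially[of 0 1])
    fix S :: "nat \<Rightarrow> real" assume S: "\<And>i. 0 < S i" "S \<longlonglongrightarrow> 0"
    have fS: "filterlim S (at_right 0) sequentially"
      using S by (auto intro!: filterlim_at_withinI always_eventually) (metis less_irrefl)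
    show "(\<lambda>i. q (S i)) \<longlonglongrightarrow> (LINT x|\<nu>. indicator A x * g x)"
      unfolding q_def
    proof (rule integral_dominated_convergence[where w = "\<lambda>x. M * indicator A x"])
      show "(\<lambda>x. indicator A x * g x) \<in> borel_measurable \<nu>"
        unfolding measurable_nu using g(1) A by (intro borel_measurable_times borel_measurable_indicator)
      show "(\<lambda>x. indicator A x * sg (S i) g x) \<in> borel_measurable \<nu>" for i using S(1)[of i] by (intro im) simp
      show "integrable \<nu> (\<lambda>x. M * indicator A x)" using iA by simp
      show "AE x in \<nu>. (\<lambda>i. indicator A x * sg (S i) g x) \<longlonglongrightarrow> indicator A x * g x"
        by (intro AE_I2 tendsto_mult tendsto_const filterlim_compose[OF lim fS])
      show "AE x in \<nu>. norm (indicator A x * sg (S i) g x) \<le> M * indicator A x" for i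
        using dom S(1)[of i] by (intro AE_I2) simp
    qed
  qed simp
  then have "((\<lambda>s. exp (- \<alpha> * s) * q s) \<longlongrightarrow> exp (- \<alpha> * 0) * (LINT x|\<nu>. indicator A x * g x)) (at_right 0)"
    by (intro tendsto_intros)
  then have "((\<lambda>s. exp (- \<alpha> * s) * q s) \<longlongrightarrow> (LINT x|\<nu>. indicator A x * g x)) (at_right 0)" by simp
  from average_tendsto[OF this] nnq
  have av: "((\<lambda>t. enn2real (\<integral>\<^sup>+s. ennreal (exp (- \<alpha> * s) * q s) * indicator {0<..<t} s \<partial>lborel) / t) \<longlongrightarrow> (LINT x|\<nu>. indicator A x * g x)) (at_right 0)"
    by simp
  have "enn2real (\<integral>\<^sup>+s. ennreal (exp (- \<alpha> * s) * q s) * indicator {0<..<t} s \<partial>lborel) = (LINT x|\<nu>. early_res t x * g x)" if t: "0 < t" for t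
  proof -
    have "(LINT x|\<nu>. early_res t x * g x) = enn2real (\<integral>\<^sup>+x. ennreal (early_res t x * g x) \<partial>\<nu>)"
    proof (rule integral_eq_nn_integral)
      show "(\<lambda>x. early_res t x * g x) \<in> borel_measurable \<nu>"
        unfolding measurable_nu using early_res_measurable g(1) by (rule borel_measurable_times)
    qed (simp add: early_res_bounds g(2))
    also have "(\<integral>\<^sup>+x. ennreal (early_res t x * g x) \<partial>\<nu>) = (\<integral>\<^sup>+x. early \<alpha> A t x * ennreal (g x) \<partial>\<nu>)"
      by (intro nn_integral_cong) (simp add: ennreal_mult early_res_bounds g(2) ennreal_early_res[OF t])
    also have "\<dots> = (\<integral>\<^sup>+s. ennreal (exp (- \<alpha> * s)) * indicator {0<..<t} s * (\<integral>\<^sup>+x. indicator A x * (\<integral>\<^sup>+\<omega>. zero_ext (\<lambda>x. ennreal (g x)) (B s \<omega>) \<partial>P x) \<partial>\<nu>) \<partial>lborel)"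
      unfolding early_def by (rule weighted_transition_integral) (use A g(1) in simp_all)
    also have "\<dots> = (\<integral>\<^sup>+s. ennreal (exp (- \<alpha> * s) * q s) * indicator {0<..<t} s \<partial>lborel)"
    proof (intro nn_integral_cong)
      fix s
      show "ennreal (exp (- \<alpha> * s)) * indicator {0<..<t} s * (\<integral>\<^sup>+x. indicator A x * (\<integral>\<^sup>+\<omega>. zero_ext (\<lambda>x. ennreal (g x)) (B s \<omega>) \<partial>P x) \<partial>\<nu>)
        = ennreal (exp (- \<alpha> * s) * q s) * indicator {0<..<t} s"
        using nnq[of s] q_ennreal[of s] by (cases "s \<in> {0<..<t}") (simp_all add: ennreal_mult)
    qed
    finally show ?thesis by simp
  qed
  then have "\<forall>\<^sub>F t in at_right 0. enn2real (\<integral>\<^sup>+s. ennreal (exp (- \<alpha> * s) * q s) * indicator {0<..<t} s \<partial>lborel) / t = (LINT x|\<nu>. early_res t x * g x) / t"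
    unfolding eventually_at_right_field by (intro exI[of _ 1]) simp
  from tendsto_cong[OF this] av show ?thesis by simp
qed

text \<open>For \<open>u = res \<alpha> A\<close>, \<open>(u - T_t u) / t\<close> is
  \<open>(1 - exp (\<alpha> * t)) / t\<close> times \<open>u\<close> plus
  \<open>exp (\<alpha> * t) / t\<close> times the early part. The first coefficient tends to
  \<open>- \<alpha>\<close>, and the early part contributes the integral over \<open>A\<close>.
  Writing the test function as a difference leaves \<open>early_res_average\<close> with nonnegative
  functions.\<close>

lemma approx_form_res_tendsto:
  assumes g1: "nice g1" and g2: "nice g2"
  shows "((\<lambda>t. approx_form \<nu> P B t (res \<alpha> A) (\<lambda>x. g1 x - g2 x)) \<longlongrightarrow>
     (LINT x|\<nu>. indicator A x * (g1 x - g2 x)) - \<alpha> * (LINT x|\<nu>. res \<alpha> A x * (g1 x - g2 x))) (at_right 0)"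
proof -
  define g where "g x = g1 x - g2 x" for x
  obtain M1 where M1: "g1 \<in> borel_measurable borel" "\<And>x. \<bar>g1 x\<bar> \<le> M1" using g1 by (auto simp: nice_def)
  obtain M2 where M2: "g2 \<in> borel_measurable borel" "\<And>x. \<bar>g2 x\<bar> \<le> M2" using g2 by (auto simp: nice_def)
  have gm: "g \<in> borel_measurable borel" unfolding g_def using M1(1) M2(1) by (rule borel_measurable_diff)
  have gb: "\<bar>g x\<bar> \<le> M1 + M2" for x using M1(2)[of x] M2(2)[of x] by (simp add: g_def abs_le_iff)
  have iA: "integrable \<nu> (\<lambda>x. indicator A x * h x)" if "h \<in> borel_measurable borel" "\<And>x. \<bar>h x\<bar> \<le> M" for h :: "'a \<Rightarrow> real" and M
  proof (rule Bochner_Integration.integrable_bound)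
    show "integrable \<nu> (\<lambda>x. M * indicator A x)" using A finA by (simp add: integrable_indicator_iff sets_nu)
    show "(\<lambda>x. indicator A x * h x) \<in> borel_measurable \<nu>"
      unfolding measurable_nu using that(1) A by (intro borel_measurable_times borel_measurable_indicator)
    have "norm (indicator A x * h x) \<le> norm (M * indicator A x)" for x
      using that(2)[of x] by (cases "x \<in> A") simp_all
    then show "AE x in \<nu>. norm (indicator A x * h x) \<le> norm (M * indicator A x)" by simp
  qed
  have "((\<lambda>t. (LINT x|\<nu>. early_res t x * g1 x) / t - (LINT x|\<nu>. early_res t x * g2 x) / t)
      \<longlongrightarrow> (LINT x|\<nu>. indicator A x * g1 x) - (LINT x|\<nu>. indicator A x * g2 x)) (at_right 0)"
    by (intro tendsto_diff early_res_average g1 g2)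
  moreover have "(LINT x|\<nu>. indicator A x * g1 x) - (LINT x|\<nu>. indicator A x * g2 x) = (LINT x|\<nu>. indicator A x * g x)"
    using iA[OF M1] iA[OF M2] by (simp add: g_def right_diff_distrib)
  moreover have "(LINT x|\<nu>. early_res t x * g1 x) / t - (LINT x|\<nu>. early_res t x * g2 x) / t = (LINT x|\<nu>. early_res t x * g x) / t" if "0 < t" for t
    using early_res_times_integrable[OF that M1] early_res_times_integrable[OF that M2]
    by (simp add: g_def right_diff_distrib diff_divide_distrib)
  then have "\<forall>\<^sub>F t in at_right 0. (LINT x|\<nu>. early_res t x * g1 x) / t - (LINT x|\<nu>. early_res t x * g2 x) / t = (LINT x|\<nu>. early_res t x * g x) / t"
    unfolding eventually_at_right_field by (intro exI[of _ 1]) simp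
  ultimately have w: "((\<lambda>t. (LINT x|\<nu>. early_res t x * g x) / t) \<longlongrightarrow> (LINT x|\<nu>. indicator A x * g x)) (at_right 0)"
    by (simp add: tendsto_cong)
  have "((\<lambda>t. 1 - exp (\<alpha> * t)) has_real_derivative - \<alpha>) (at 0)"
    by (auto intro!: derivative_eq_intros)
  then have "((\<lambda>h. (1 - exp (\<alpha> * h)) / h) \<longlongrightarrow> - \<alpha>) (at 0)"
    unfolding has_field_derivative_iff by simp
  then have e: "((\<lambda>h. (1 - exp (\<alpha> * h)) / h) \<longlongrightarrow> - \<alpha>) (at_right 0)"
    by (rule filterlim_mono[OF _ order_refl at_le]) simp
  have "((\<lambda>t. (1 - exp (\<alpha> * t)) / t * (LINT x|\<nu>. res \<alpha> A x * g x) + exp (\<alpha> * t) * ((LINT x|\<nu>. early_res t x * g x) / t))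
     \<longlongrightarrow> - \<alpha> * (LINT x|\<nu>. res \<alpha> A x * g x) + exp (\<alpha> * 0) * (LINT x|\<nu>. indicator A x * g x)) (at_right 0)"
    by (intro tendsto_add tendsto_mult e w tendsto_const tendsto_exp tendsto_ident_at)
  moreover have "(1 - exp (\<alpha> * t)) / t * (LINT x|\<nu>. res \<alpha> A x * g x) + exp (\<alpha> * t) * ((LINT x|\<nu>. early_res t x * g x) / t)
      = approx_form \<nu> P B t (res \<alpha> A) g" if t: "0 < t" for t
  proof -
    note i1 = res_times_integrable[OF gm gb] and i2 = early_res_times_integrable[OF t gm gb]
    have "approx_form \<nu> P B t (res \<alpha> A) g = 1 / t * (LINT x|\<nu>. (1 - exp (\<alpha> * t)) * (res \<alpha> A x * g x) + exp (\<alpha> * t) * (early_res t x * g x))"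
      unfolding approx_form_def semigroup_res[OF t] by (simp add: algebra_simps)
    also have "\<dots> = 1 / t * ((1 - exp (\<alpha> * t)) * (LINT x|\<nu>. res \<alpha> A x * g x) + exp (\<alpha> * t) * (LINT x|\<nu>. early_res t x * g x))"
      using i1 i2 by simp
    finally show ?thesis by (simp only: distrib_left times_divide_eq_left times_divide_eq_right mult_1)
  qed
  then have "\<forall>\<^sub>F t in at_right 0. (1 - exp (\<alpha> * t)) / t * (LINT x|\<nu>. res \<alpha> A x * g x) + exp (\<alpha> * t) * ((LINT x|\<nu>. early_res t x * g x) / t)
      = approx_form \<nu> P B t (res \<alpha> A) g"
    unfolding eventually_at_right_field by (intro exI[of _ 1]) simp
  ultimately have "((\<lambda>t. approx_form \<nu> P B t (res \<alpha> A) g) \<longlongrightarrow> - \<alpha> * (LINT x|\<nu>. res \<alpha> A x * g x) + (LINT x|\<nu>. indicator A x * g x)) (at_right 0)"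
    by (simp add: tendsto_cong)
  then show ?thesis by (simp add: g_def[abs_def])
qed

lemma nice_res: "nice (res \<alpha> A)"
  using res_measurable res_bounds semigroup_res_tendsto by (auto simp: nice_def)

lemma nice_zero: "nice (\<lambda>_. 0)"
proof -
  have "zero_ext (\<lambda>_. 0) z = (0::real)" for z :: "'a option" by (cases z) simp_all
  then show ?thesis by (auto simp: nice_def semigroup_op_def)
qed

text \<open>Right continuity of paths and dominated convergence, with the limit identified by the
  starting point.\<close>

lemma nice_continuous:
  assumes g: "continuous_on UNIV g" "\<And>x. 0 \<le> g x" "\<And>x. g x \<le> M"
  shows "nice g"
proof -
  have gm: "g \<in> borel_measurable borel" using g(1) by (rule borel_measurable_continuous_onI)
  have "((\<lambda>s. sg s g x) \<longlongrightarrow> g x) (at_right 0)" for x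
  proof (rule tendsto_at_right_sequentially[of 0 1])
    interpret prob_space "P x" by (rule prob_P)
    fix S :: "nat \<Rightarrow> real" assume S: "\<And>i. 0 < S i" "S \<longlonglongrightarrow> 0"
    have fS: "filterlim S (at_right 0) sequentially"
      using S by (auto intro!: filterlim_at_withinI always_eventually) (metis less_irrefl)
    have m: "(\<lambda>\<omega>. zero_ext g (B s \<omega>)) \<in> borel_measurable (P x)" if "0 \<le> s" for s
      unfolding measurable_P by (rule measurable_compose[OF measurable_B[OF that] borel_measurable_zero_ext[OF gm]])
    have zb: "\<bar>zero_ext g z\<bar> \<le> \<bar>M\<bar>" for z
      using g(2,3) order_trans by (cases z) (auto simp: abs_le_iff intro: order_trans[OF _ abs_ge_self])
    have "(\<lambda>i. sg (S i) g x) \<longlonglongrightarrow> (LINT \<omega>|P x. zero_ext g (B 0 \<omega>))"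
      unfolding semigroup_op_def
    proof (rule integral_dominated_convergence[where w = "\<lambda>_. \<bar>M\<bar>"])
      show "(\<lambda>\<omega>. zero_ext g (B (S i) \<omega>)) \<in> borel_measurable (P x)" for i using S(1)[of i] by (intro m) simp
      show "AE \<omega> in P x. (\<lambda>i. zero_ext g (B (S i) \<omega>)) \<longlonglongrightarrow> zero_ext g (B 0 \<omega>)"
        using filterlim_compose[OF right_continuous[OF _ order_refl g(1)] fS] by (intro AE_I2) (simp add: space_P)
      show "AE \<omega> in P x. norm (zero_ext g (B (S i) \<omega>)) \<le> \<bar>M\<bar>" for i using zb by simp
    qed (simp_all add: m)
    also have "(LINT \<omega>|P x. zero_ext g (B 0 \<omega>)) = (LINT \<omega>|P x. g x)"
    proof (rule integral_cong_AE)
      show "AE \<omega> in P x. zero_ext g (B 0 \<omega>) = g x" using B_0[of x] by eventually_elim simp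
    qed (simp_all add: m)
    finally show "(\<lambda>i. sg (S i) g x) \<longlonglongrightarrow> g x" by (simp add: prob_space)
  qed simp
  then show ?thesis using gm g by (auto simp: nice_def)
qed

end

end

lemma AE_lborel_between:
  assumes P: "AE s in lborel. Q (s::real)" and ab: "a < b"
  shows "\<exists>s. a < s \<and> s < b \<and> Q s"
proof (rule ccontr)
  assume no: "\<not> ?thesis"
  have "AE s in lborel. s \<notin> {a<..<b}"
    using P by eventually_elim (use no in auto)
  then have "emeasure lborel {a<..<b} = 0" by (subst (asm) AE_iff_measurable[of "{a<..<b}"]) auto
  then show False using ab by simp
qed

lemma ex_dense_sequence_AE:
  assumes P: "AE s in lborel. 0 < s \<longrightarrow> Q (s::real)" and t0: "0 \<le> t0"
  obtains d :: "nat \<Rightarrow> real" where "\<And>i. t0 < d i" "\<And>i. Q (d i)"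
    "\<And>u v. t0 \<le> u \<Longrightarrow> u < v \<Longrightarrow> \<exists>i. u < d i \<and> d i < v"
proof -
  \<comment> \<open>Intervals with rational ends, cut off at \<open>t0\<close>. A degenerate pair
    gets an interval of length 1, so that every pair selects a time.\<close>
  define lo hi :: "rat \<times> rat \<Rightarrow> real" where "lo pq = max t0 (of_rat (fst pq))"
    and "hi pq = (if lo pq < of_rat (snd pq) then of_rat (snd pq) else lo pq + 1)" for pq
  have "\<exists>s. lo pq < s \<and> s < hi pq \<and> Q s" for pq
  proof -
    have "lo pq < hi pq" by (simp add: hi_def)
    then obtain s where "lo pq < s" "s < hi pq" "0 < s \<longrightarrow> Q s" using AE_lborel_between[OF P] by blast
    moreover have "0 < s" using calculation(1) t0 by (simp add: lo_def)
    ultimately show ?thesis by blast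
  qed
  then obtain f where f: "\<And>pq. lo pq < f pq" "\<And>pq. f pq < hi pq" "\<And>pq. Q (f pq)" by metis
  define d where "d i = f (from_nat i)" for i :: nat
  show ?thesis
  proof
    show "t0 < d i" for i using f(1)[of "from_nat i"] by (simp add: d_def lo_def)
    show "Q (d i)" for i using f(3) by (simp add: d_def)
    fix u v :: real assume uv: "t0 \<le> u" "u < v"
    obtain p where p: "u < of_rat p" "of_rat p < v" using of_rat_dense[OF uv(2)] by blast
    obtain q where q: "of_rat p < (of_rat q :: real)" "of_rat q < v" using of_rat_dense[OF p(2)] by blast
    have "lo (p, q) = of_rat p" "hi (p, q) = of_rat q" using uv p q by (simp_all add: lo_def hi_def)
    then have "u < f (p, q)" "f (p, q) < v" using f(1,2)[of "(p, q)"] p q by simp_all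
    then show "\<exists>i. u < d i \<and> d i < v" by (intro exI[of _ "to_nat (p, q)"]) (simp add: d_def)
  qed
qed

lemma C_infty_bounded:
  fixes f :: "'a::metric_space \<Rightarrow> real"
  assumes "f \<in> C_infty"
  obtains M where "\<And>x. \<bar>f x\<bar> \<le> M"
proof -
  have c: "continuous_on UNIV f" using assms by (simp add: C_infty_def)
  obtain K where K: "compact K" "\<And>x. x \<notin> K \<Longrightarrow> \<bar>f x\<bar> \<le> 1"
    using assms zero_less_one unfolding C_infty_def by blast
  have "compact (f ` K)" using c K(1) by (intro compact_continuous_image) (auto intro: continuous_on_subset)
  then obtain M where M: "\<And>x. x \<in> K \<Longrightarrow> \<bar>f x\<bar> \<le> M"
    using compact_imp_bounded[THEN bounded_iff[THEN iffD1]] by fastforce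
  have "\<bar>f x\<bar> \<le> max 1 M" for x using K(2)[of x] M[of x] by (cases "x \<in> K") auto
  then show ?thesis using that by blast
qed

section \<open>Resolvents as elements of the form domain\<close>

locale tree_brownian = symmetric_markov W P B \<nu>
  for W :: "'w measure" and P :: "'a::real_tree \<Rightarrow> 'w measure" and B :: "real \<Rightarrow> 'w \<Rightarrow> 'a option" and \<nu> :: "'a measure" +
  fixes \<rho> :: 'a
  assumes lc: "locally compact (UNIV :: 'a set)" and radon: "radon_measure \<nu>" and assoc: "associated_with_form \<rho> \<nu> P B"
begin

lemma form_domainD:
  assumes "f \<in> form_domain \<rho> \<nu>"
  shows "f \<in> finite_energy \<rho>" "continuous_on UNIV f" "f \<in> borel_measurable borel" "integrable \<nu> (\<lambda>x. (f x)\<^sup>2)" "f \<in> C_infty"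
  using assms by (auto simp: form_domain_def L2_def C_infty_def intro: borel_measurable_continuous_onI)

lemma hoelder: "f \<in> form_domain \<rho> \<nu> \<Longrightarrow> (f y - f x)\<^sup>2 \<le> 4 * dist x y * energy \<rho> f f"
  using energy_hoelder[OF lc form_domainD(1)] .

text \<open>From almost every starting point the null set of discrepancies is avoided at time
  \<open>t\<close>, by \<open>transition_null\<close>. Versions of a function may thus be exchanged
  in the approximating forms.\<close>

lemma semigroup_cong_AE:
  assumes t: "0 < t" and f: "f \<in> borel_measurable borel" and g: "g \<in> borel_measurable borel" and eq: "AE x in \<nu>. f x = g x"
  shows "AE x in \<nu>. sg t f x = sg t g x"
proof -
  obtain N where N: "N \<in> null_sets \<nu>" "{x. f x \<noteq> g x} \<subseteq> N"
    using eq by (auto elim!: AE_E simp: null_sets_def)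
  have Nb: "N \<in> sets borel" using N sets_nu by auto
  show ?thesis
    using transition_null[OF N(1) t]
  proof eventually_elim
    case (elim x)
    have m: "(\<lambda>\<omega>. zero_ext h (B t \<omega>)) \<in> borel_measurable (P x)" if "h \<in> borel_measurable borel" for h :: "'a \<Rightarrow> real"
      unfolding measurable_P using t by (intro measurable_compose[OF measurable_B borel_measurable_zero_ext[OF that]]) simp
    have "AE \<omega> in P x. B t \<omega> \<notin> Some ` N" by (rule avoid_AE[OF Nb less_imp_le[OF t] elim])
    then have "AE \<omega> in P x. zero_ext f (B t \<omega>) = zero_ext g (B t \<omega>)"
    proof eventually_elim
      case (elim \<omega>)
      then show ?case using N(2) by (cases "B t \<omega>") auto
    qed
    then show ?case unfolding semigroup_op_def by (intro integral_cong_AE m f g)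
  qed
qed

text \<open>The approximating forms of \<open>res \<alpha> A\<close> converge, so the association
  provides a version \<open>u\<close> in the form domain. The limit against \<open>g\<close>, taken
  once by explicit formula and once by the association, yields the weak resolvent equation.\<close>

lemma resolvent_form:
  assumes a: "0 < \<alpha>" and A: "A \<in> sets borel" and fin: "emeasure \<nu> A < \<infinity>"
  obtains u where "u \<in> form_domain \<rho> \<nu>" "AE x in \<nu>. res \<alpha> A x = u x"
    "\<And>g. g \<in> form_domain \<rho> \<nu> \<Longrightarrow> energy \<rho> u g = (LINT x|\<nu>. indicator A x * g x) - \<alpha> * (LINT x|\<nu>. u x * g x)"
proof -
  note ctx = a A fin
  have rm: "res \<alpha> A \<in> borel_measurable borel" by (rule res_measurable[OF ctx])
  \<comment> \<open>The test function is \<open>res \<alpha> A\<close> itself, written as its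
    difference from 0.\<close>
  have "\<exists>l. ((\<lambda>t. approx_form \<nu> P B t (res \<alpha> A) (res \<alpha> A)) \<longlongrightarrow> l) (at_right 0)"
    using approx_form_res_tendsto[OF ctx nice_res[OF ctx] nice_zero[OF ctx]] by auto
  then obtain u where u: "u \<in> form_domain \<rho> \<nu>" "AE x in \<nu>. res \<alpha> A x = u x"
    using assoc res_L2[OF ctx] unfolding associated_with_form_def by blast
  note ud = form_domainD[OF u(1)]
  have "energy \<rho> u g = (LINT x|\<nu>. indicator A x * g x) - \<alpha> * (LINT x|\<nu>. u x * g x)" if g: "g \<in> form_domain \<rho> \<nu>" for g
  proof -
    note gd = form_domainD[OF g]
    obtain M where M: "\<And>x. \<bar>g x\<bar> \<le> M" using C_infty_bounded[OF gd(5)] by blast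
    have n1: "nice (\<lambda>x. max 0 (g x))"
    proof (rule nice_continuous[OF ctx])
      show "continuous_on UNIV (\<lambda>x. max 0 (g x))" by (intro continuous_intros gd(2))
      show "max 0 (g x) \<le> M" for x using M[of x] by auto
    qed simp
    have n2: "nice (\<lambda>x. max 0 (- g x))"
    proof (rule nice_continuous[OF ctx])
      show "continuous_on UNIV (\<lambda>x. max 0 (- g x))" by (intro continuous_intros gd(2))
      show "max 0 (- g x) \<le> M" for x using M[of x] by auto
    qed simp
    have gg: "max 0 (g x) - max 0 (- g x) = g x" for x by (simp add: max_def)
    have lim: "((\<lambda>t. approx_form \<nu> P B t (res \<alpha> A) g) \<longlongrightarrow> (LINT x|\<nu>. indicator A x * g x) - \<alpha> * (LINT x|\<nu>. res \<alpha> A x * g x)) (at_right 0)"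
      using approx_form_res_tendsto[OF ctx n1 n2] by (simp only: gg)
    have "approx_form \<nu> P B t (res \<alpha> A) g = approx_form \<nu> P B t u g" if t: "0 < t" for t
    proof -
      have "AE x in \<nu>. (res \<alpha> A x - sg t (res \<alpha> A) x) * g x = (u x - sg t u x) * g x"
        using u(2) semigroup_cong_AE[OF t rm ud(3) u(2)] by eventually_elim simp
      then have "(LINT x|\<nu>. (res \<alpha> A x - sg t (res \<alpha> A) x) * g x) = (LINT x|\<nu>. (u x - sg t u x) * g x)"
      proof (rule integral_cong_AE[rotated 2])
        show "(\<lambda>x. (res \<alpha> A x - sg t (res \<alpha> A) x) * g x) \<in> borel_measurable \<nu>"
          unfolding measurable_nu using semigroup_measurable[OF less_imp_le[OF t] rm] rm gd(3)
          by (intro borel_measurable_times borel_measurable_diff)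
        show "(\<lambda>x. (u x - sg t u x) * g x) \<in> borel_measurable \<nu>"
          unfolding measurable_nu using semigroup_measurable[OF less_imp_le[OF t] ud(3)] ud(3) gd(3)
          by (intro borel_measurable_times borel_measurable_diff)
      qed
      then show ?thesis by (simp add: approx_form_def)
    qed
    then have "\<forall>\<^sub>F t in at_right 0. approx_form \<nu> P B t (res \<alpha> A) g = approx_form \<nu> P B t u g"
      unfolding eventually_at_right_field by (intro exI[of _ 1]) simp
    from tendsto_cong[OF this] lim
    have "((\<lambda>t. approx_form \<nu> P B t u g) \<longlongrightarrow> (LINT x|\<nu>. indicator A x * g x) - \<alpha> * (LINT x|\<nu>. res \<alpha> A x * g x)) (at_right 0)"
      by simp
    moreover have "((\<lambda>t. approx_form \<nu> P B t u g) \<longlongrightarrow> energy \<rho> u g) (at_right 0)"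
      using assoc u(1) g unfolding associated_with_form_def by blast
    ultimately have "energy \<rho> u g = (LINT x|\<nu>. indicator A x * g x) - \<alpha> * (LINT x|\<nu>. res \<alpha> A x * g x)"
      using tendsto_unique[OF trivial_limit_at_right_real] by blast
    also have "(LINT x|\<nu>. res \<alpha> A x * g x) = (LINT x|\<nu>. u x * g x)"
    proof (rule integral_cong_AE)
      show "AE x in \<nu>. res \<alpha> A x * g x = u x * g x" using u(2) by eventually_elim simp
    qed (auto simp: measurable_nu intro!: borel_measurable_times rm ud(3) gd(3))
    finally show ?thesis .
  qed
  then show ?thesis using that u by blast
qed

lemma indicator_times_integrable:
  assumes A: "A \<in> sets borel" "emeasure \<nu> A < \<infinity>" and f: "f \<in> form_domain \<rho> \<nu>"
  shows "integrable \<nu> (\<lambda>x. indicator A x * f x)"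
proof -
  obtain M where M: "\<And>x. \<bar>f x\<bar> \<le> M" using C_infty_bounded[OF form_domainD(5)[OF f]] by blast
  show ?thesis
  proof (rule Bochner_Integration.integrable_bound)
    show "integrable \<nu> (\<lambda>x. M * indicator A x)" using A by (simp add: integrable_indicator_iff sets_nu)
    show "(\<lambda>x. indicator A x * f x) \<in> borel_measurable \<nu>"
      unfolding measurable_nu using form_domainD(3)[OF f] A by (intro borel_measurable_times borel_measurable_indicator)
    have "norm (indicator A x * f x) \<le> norm (M * indicator A x)" for x
      using M[of x] by (cases "x \<in> A") simp_all
    then show "AE x in \<nu>. norm (indicator A x * f x) \<le> norm (M * indicator A x)" by simp
  qed
qed

lemma indicator_integral_le:
  assumes A: "A \<in> sets borel" "emeasure \<nu> A < \<infinity>" and f: "f \<in> form_domain \<rho> \<nu>" and le: "\<And>x. x \<in> A \<Longrightarrow> f x \<le> c"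
  shows "(LINT x|\<nu>. indicator A x * f x) \<le> c * measure \<nu> A"
proof -
  have iA: "integrable \<nu> (\<lambda>x. c * indicator A x)" using A by (simp add: integrable_indicator_iff sets_nu)
  have "(LINT x|\<nu>. indicator A x * f x) \<le> (LINT x|\<nu>. c * indicator A x)"
    using le by (intro integral_mono indicator_times_integrable A f iA) (auto simp: indicator_def)
  also have "\<dots> = c * measure \<nu> A" using A by (simp add: sets_nu)
  finally show ?thesis .
qed

lemma indicator_integral_ge:
  assumes A: "A \<in> sets borel" "emeasure \<nu> A < \<infinity>" and f: "f \<in> form_domain \<rho> \<nu>" and le: "\<And>x. x \<in> A \<Longrightarrow> c \<le> f x"
  shows "c * measure \<nu> A \<le> (LINT x|\<nu>. indicator A x * f x)"
proof -
  have iA: "integrable \<nu> (\<lambda>x. c * indicator A x)" using A by (simp add: integrable_indicator_iff sets_nu)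
  have "c * measure \<nu> A = (LINT x|\<nu>. c * indicator A x)" using A by (simp add: sets_nu)
  also have "\<dots> \<le> (LINT x|\<nu>. indicator A x * f x)"
    using le by (intro integral_mono indicator_times_integrable A f iA) (auto simp: indicator_def)
  finally show ?thesis .
qed

lemma ball_measure_pos: "0 < e \<Longrightarrow> 0 < emeasure \<nu> (ball x e)"
  using radon by (simp add: radon_measure_def)

lemma AE_ball_ex:
  assumes "AE x in \<nu>. Q x" and e: "0 < e"
  obtains x where "x \<in> ball z e" "Q x"
proof -
  have "\<exists>x. x \<in> ball z e \<and> Q x"
  proof (rule ccontr)
    assume "\<not> ?thesis"
    then have "AE x in \<nu>. x \<notin> ball z e" using assms(1) by (auto elim!: eventually_mono)
    then have "emeasure \<nu> (ball z e) = 0" by (subst (asm) AE_iff_measurable[of "ball z e"]) (auto simp: sets_nu)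
    then show False using ball_measure_pos[OF e, of z] by simp
  qed
  then show ?thesis using that by blast
qed

lemma pot_0_AE_transition:
  assumes N: "N \<in> sets borel" and 0: "pot 0 N x = 0"
  shows "AE s in lborel. 0 < s \<longrightarrow> tr s x N = 0"
proof -
  have m: "(\<lambda>s. ennreal (exp (- 0 * s)) * indicator {0..} s * tr (max 0 s) x N) \<in> borel_measurable lborel"
    using transition_path_measurable[OF N] by simp
  have "(\<integral>\<^sup>+s. ennreal (exp (- 0 * s)) * indicator {0..} s * tr (max 0 s) x N \<partial>lborel) = 0"
    using 0 by (simp only: pot_def)
  then have "AE s in lborel. ennreal (exp (- 0 * s)) * indicator {0..} s * tr (max 0 s) x N = 0"
    by (rule nn_integral_0_iff_AE[OF m, THEN iffD1])
  then show ?thesis by (rule eventually_mono) (auto simp: indicator_def max_def)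
qed

text \<open>The preimage of the complement of \<open>S\<close> is open, and a nonempty open set
  contains a ball, which has positive measure.\<close>

lemma continuous_AE_closed:
  assumes u: "continuous_on UNIV (u :: 'a \<Rightarrow> real)" and S: "closed S" and ae: "AE x in \<nu>. u x \<in> S"
  shows "u z \<in> S"
proof (rule ccontr)
  assume "u z \<notin> S"
  moreover have "open (u -` (- S))" using continuous_on_open_vimage[of UNIV u] u S by auto
  ultimately obtain e where e: "0 < e" "ball z e \<subseteq> u -` (- S)" by (meson ComplI open_contains_ball vimageI2)
  obtain x where "x \<in> ball z e" "u x \<in> S" using AE_ball_ex[OF ae e(1)] by blast
  then show False using e(2) by auto
qed

lemma resolvent_form_bounds:
  assumes a: "0 < \<alpha>" and u: "u \<in> form_domain \<rho> \<nu>" "AE x in \<nu>. res \<alpha> A x = u x"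
    and A: "A \<in> sets borel" "emeasure \<nu> A < \<infinity>"
  shows "0 \<le> u x" "u x \<le> 1 / \<alpha>"
proof -
  have "AE x in \<nu>. u x \<in> {0..1 / \<alpha>}"
    using u(2)
  proof eventually_elim
    case (elim x)
    then show ?case using res_bounds[OF a A, of x] by simp
  qed
  from continuous_AE_closed[OF form_domainD(2)[OF u(1)] closed_atLeastAtMost this]
  show "0 \<le> u x" "u x \<le> 1 / \<alpha>" by auto
qed

lemma AE_pot_bounds:
  assumes a: "0 < \<alpha>" and A: "A \<in> sets borel" "emeasure \<nu> A < \<infinity>" and u: "AE x in \<nu>. res \<alpha> A x = u x"
    and le: "\<And>x. x \<in> C \<Longrightarrow> c \<le> u x \<and> u x \<le> M"
  shows "AE x in \<nu>. x \<in> C \<longrightarrow> ennreal c \<le> pot \<alpha> A x \<and> pot \<alpha> A x \<le> ennreal M"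
  using u
proof eventually_elim
  case (elim x)
  show ?case
  proof
    assume "x \<in> C"
    then have "c \<le> res \<alpha> A x" "res \<alpha> A x \<le> M" using le elim by auto
    then show "ennreal c \<le> pot \<alpha> A x \<and> pot \<alpha> A x \<le> ennreal M"
      unfolding ennreal_res[OF a A, symmetric] by (simp add: ennreal_leI)
  qed
qed

lemma resolvent_energy_le:
  assumes a: "0 < \<alpha>" and A: "A \<in> sets borel" "emeasure \<nu> A < \<infinity>"
    and u: "u \<in> form_domain \<rho> \<nu>"
      "energy \<rho> u u = (LINT x|\<nu>. indicator A x * u x) - \<alpha> * (LINT x|\<nu>. u x * u x)"
    and le: "\<And>x. x \<in> A \<Longrightarrow> u x \<le> M"
  shows "energy \<rho> u u \<le> M * measure \<nu> A"
proof -
  have "0 \<le> \<alpha> * (LINT x|\<nu>. u x * u x)" using a by (intro mult_nonneg_nonneg integral_nonneg_AE) auto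
  then show ?thesis using u(2) indicator_integral_le[OF A u(1) le] by linarith
qed

subsection \<open>Compact trees\<close>

lemma one_form_domain:
  assumes "compact (UNIV :: 'a set)"
  shows "(\<lambda>_. 1) \<in> form_domain \<rho> \<nu>" "emeasure \<nu> UNIV < \<infinity>"
proof -
  show fin: "emeasure \<nu> UNIV < \<infinity>" using radon assms by (simp add: radon_measure_def)
  have eq: "(\<lambda>_::'a. 1 :: real) = indicator UNIV" by (simp add: fun_eq_iff)
  have "integrable \<nu> (\<lambda>_. 1 :: real)" unfolding eq integrable_indicator_iff using fin by (simp add: sets_nu)
  then have "(\<lambda>_. 1) \<in> L2 \<nu>" by (simp add: L2_def)
  moreover have "(\<lambda>_. 1 :: real) \<in> (C_infty :: ('a \<Rightarrow> real) set)"
    using assms by (auto simp: C_infty_def intro!: exI[of _ UNIV])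
  ultimately show "(\<lambda>_. 1) \<in> form_domain \<rho> \<nu>" using one_finite_energy[OF lc] by (simp add: form_domain_def)
qed

lemma resolvent_total_mass:
  assumes c: "compact (UNIV :: 'a set)" and A: "A \<in> sets borel"
    and u: "u \<in> form_domain \<rho> \<nu>"
      "\<And>g. g \<in> form_domain \<rho> \<nu> \<Longrightarrow> energy \<rho> u g = (LINT x|\<nu>. indicator A x * g x) - \<alpha> * (LINT x|\<nu>. u x * g x)"
  shows "\<alpha> * (LINT x|\<nu>. u x) = measure \<nu> A" "integrable \<nu> u"
proof -
  show "\<alpha> * (LINT x|\<nu>. u x) = measure \<nu> A"
    using u(2)[OF one_form_domain(1)[OF c]] A by (simp add: energy_one[OF lc] sets_nu)
  show "integrable \<nu> u" using indicator_times_integrable[OF _ one_form_domain(2)[OF c] u(1)] by simp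
qed

text \<open>Since \<open>\<alpha> \<integral> u d\<nu> = \<nu>(A)\<close>, the term
  \<open>\<alpha> \<integral> u\<^sup>2 d\<nu>\<close> is at least \<open>min u\<close> times
  \<open>\<nu>(A)\<close>, so the energy is at most the oscillation times \<open>\<nu>(A)\<close>.
  One factor cancels in the arc estimate, and \<open>\<nu>(A) \<le> \<alpha> max u \<nu>(T)\<close>
  makes the relative oscillation of order \<open>\<alpha>\<close>, uniformly in the radius.\<close>

lemma compact_resolvent_oscillation:
  assumes c: "compact (UNIV :: 'a set)" and D: "\<And>x y :: 'a. dist x y \<le> D" and a: "0 < \<alpha>" and e: "0 < e"
  shows "\<exists>M>0. AE x in \<nu>. ennreal (M * (1 - 4 * D * measure \<nu> UNIV * \<alpha>)) \<le> pot \<alpha> (ball y e) x \<and> pot \<alpha> (ball y e) x \<le> ennreal M"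
proof -
  let ?A = "ball y e" and ?m = "measure \<nu> UNIV"
  have A: "?A \<in> sets borel" by simp
  have fin: "emeasure \<nu> ?A < \<infinity>"
    by (rule le_less_trans[OF emeasure_mono one_form_domain(2)[OF c]]) (simp_all add: sets_nu)
  have Apos: "0 < measure \<nu> ?A" using ball_measure_pos[OF e, of y] fin by (simp add: measure_def enn2real_positive_iff)
  obtain u where u: "u \<in> form_domain \<rho> \<nu>" "AE x in \<nu>. res \<alpha> ?A x = u x"
    "\<And>g. g \<in> form_domain \<rho> \<nu> \<Longrightarrow> energy \<rho> u g = (LINT x|\<nu>. indicator ?A x * g x) - \<alpha> * (LINT x|\<nu>. u x * g x)"
    using resolvent_form[OF a A fin] by blast
  note tot = resolvent_total_mass[OF c A u(1,3)]
  note nn = resolvent_form_bounds(1)[OF a u(1,2) A fin]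
  obtain p where p: "\<And>x. u x \<le> u p"
    using continuous_attains_sup[OF c _ form_domainD(2)[OF u(1)]] by auto
  obtain q where q: "\<And>x. u q \<le> u x"
    using continuous_attains_inf[OF c _ form_domainD(2)[OF u(1)]] by auto
  have D0: "0 \<le> D" using D[of y y] by simp
  have iu2: "integrable \<nu> (\<lambda>x. u x * u x)" using form_domainD(4)[OF u(1)] by (simp add: power2_eq_square)
  have "integrable \<nu> (\<lambda>_. 1 :: real)" using form_domainD(4)[OF one_form_domain(1)[OF c]] by simp
  then have "integrable \<nu> (\<lambda>_. 1 * u p)" by (intro integrable_mult_left)
  then have ic: "integrable \<nu> (\<lambda>_. u p)" by (simp only: mult_1)
  have "(LINT x|\<nu>. u x) \<le> (LINT x|\<nu>. u p)" using p by (intro integral_mono tot(2) ic)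
  then have "\<alpha> * (LINT x|\<nu>. u x) \<le> \<alpha> * (u p * ?m)" using a by (intro mult_left_mono) (simp_all add: mult.commute)
  then have mass: "measure \<nu> ?A \<le> \<alpha> * (u p * ?m)" using tot(1) by simp
  have pos: "0 < u p"
    using nn[of p] mass Apos by (cases "u p = 0") auto
  have "u q * (LINT x|\<nu>. u x) \<le> (LINT x|\<nu>. u x * u x)"
    unfolding integral_mult_right_zero[symmetric] using q nn
    by (intro integral_mono iu2 integrable_mult_right tot(2) mult_right_mono)
  then have "\<alpha> * (u q * (LINT x|\<nu>. u x)) \<le> \<alpha> * (LINT x|\<nu>. u x * u x)" using a by (intro mult_left_mono) auto
  moreover have "\<alpha> * (u q * (LINT x|\<nu>. u x)) = u q * measure \<nu> ?A" using tot(1) by (simp add: algebra_simps)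
  moreover have "(LINT x|\<nu>. indicator ?A x * u x) \<le> u p * measure \<nu> ?A" by (rule indicator_integral_le[OF A fin u(1) p])
  ultimately have en: "energy \<rho> u u \<le> (u p - u q) * measure \<nu> ?A" using u(3)[OF u(1)] by (simp add: left_diff_distrib)
  have "(u p - u q)\<^sup>2 \<le> 4 * dist q p * energy \<rho> u u" by (rule hoelder[OF u(1)])
  also have "\<dots> \<le> 4 * D * energy \<rho> u u" using D energy_nonneg[OF lc] by (intro mult_right_mono) auto
  also have "\<dots> \<le> 4 * D * ((u p - u q) * measure \<nu> ?A)" using en D0 by (intro mult_left_mono) auto
  finally have "(u p - u q) * (u p - u q) \<le> (u p - u q) * (4 * D * measure \<nu> ?A)" by (simp add: power2_eq_square algebra_simps)
  then have "u p - u q \<le> 4 * D * measure \<nu> ?A"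
    using q[of p] D0 by (cases "u p = u q") (auto simp: mult_le_cancel_left)
  also have "\<dots> \<le> 4 * D * (\<alpha> * (u p * ?m))" using mass D0 by (intro mult_left_mono) auto
  finally have "u p * (1 - 4 * D * ?m * \<alpha>) \<le> u q" by (simp add: algebra_simps)
  then have le: "u p * (1 - 4 * D * ?m * \<alpha>) \<le> u x \<and> u x \<le> u p" for x using p[of x] q[of x] by linarith
  have "AE x in \<nu>. x \<in> UNIV \<longrightarrow> ennreal (u p * (1 - 4 * D * ?m * \<alpha>)) \<le> pot \<alpha> ?A x \<and> pot \<alpha> ?A x \<le> ennreal (u p)"
    by (rule AE_pot_bounds[OF a A fin u(2) le])
  then show ?thesis using pos by (intro exI[of _ "u p"]) simp
qed

lemma transition_UNIV_antimono:
  assumes "0 \<le> s" "s \<le> t"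
  shows "tr t x UNIV \<le> tr s x UNIV"
proof -
  from measurable_sets[OF measurable_B[OF assms(1)] Some_image_cemetery, of UNIV]
  have "{\<omega> \<in> space (P x). B s \<omega> \<in> Some ` UNIV} \<in> sets (P x)"
    by (simp add: sets_P space_P vimage_def Int_def conj_commute)
  then show ?thesis
    unfolding transition_def using B_None_mono[OF _ assms] by (intro emeasure_mono) (fastforce simp: space_P notin_range_Some)+
qed

text \<open>The 1-resolvent of the whole tree is at most 1 and has integral \<open>\<nu>(T)\<close>,
  so it is 1 almost everywhere. Survival then has probability 1 at almost every time, and at the
  integers because it decreases in time.\<close>

lemma compact_AE_conservative:
  assumes c: "compact (UNIV :: 'a set)"
  shows "AE x in \<nu>. \<forall>n::nat. tr (real n) x UNIV = 1"
proof -
  have U: "(UNIV :: 'a set) \<in> sets borel" by simp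
  note fin = one_form_domain(2)[OF c]
  obtain u where u: "u \<in> form_domain \<rho> \<nu>" "AE x in \<nu>. res 1 UNIV x = u x"
    "\<And>g. g \<in> form_domain \<rho> \<nu> \<Longrightarrow> energy \<rho> u g = (LINT x|\<nu>. indicator UNIV x * g x) - 1 * (LINT x|\<nu>. u x * g x)"
    using resolvent_form[OF zero_less_one U fin] by blast
  note tot = resolvent_total_mass[OF c U u(1,3)]
  have u1: "u x \<le> 1" for x using resolvent_form_bounds(2)[OF zero_less_one u(1,2) U fin, of x] by simp
  have i1: "integrable \<nu> (\<lambda>_. 1 :: real)" using form_domainD(4)[OF one_form_domain(1)[OF c]] by simp
  have int0: "(LINT x|\<nu>. 1 - u x) = 0"
    using tot i1 by (subst Bochner_Integration.integral_diff) simp_all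
  have "integrable \<nu> (\<lambda>x. 1 - u x)" using tot(2) i1 by (intro Bochner_Integration.integrable_diff)
  from integral_nonneg_eq_0_iff_AE[OF this] int0 u1
  have "AE x in \<nu>. 1 - u x = 0" by simp
  then show ?thesis using u(2)
  proof eventually_elim
    case (elim x)
    have "pot 1 UNIV x = 1" using ennreal_res[OF zero_less_one U fin, of x] elim by simp
    then have p1: "(\<integral>\<^sup>+s. ennreal (exp (- 1 * s)) * indicator {0..} s * tr (max 0 s) x UNIV \<partial>lborel) = 1" by (simp only: pot_def)
    have e1: "(\<integral>\<^sup>+s. ennreal (exp (- 1 * s)) * indicator {0..} s \<partial>lborel) = 1"
      using nn_integral_exp_atLeast[of 1 0] by simp
    have le: "ennreal (exp (- 1 * s)) * indicator {0..} s * tr (max 0 s) x UNIV \<le> ennreal (exp (- 1 * s)) * indicator {0..} s" for s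
      using mult_left_mono[OF transition_le_1[of "max 0 s" x UNIV], of "ennreal (exp (- 1 * s)) * indicator {0..} s"] by simp
    have ae: "AE s in lborel. ennreal (exp (- 1 * s)) * indicator {0..} s \<le> ennreal (exp (- 1 * s)) * indicator {0..} s * tr (max 0 s) x UNIV"
    proof (rule ccontr)
      assume na: "\<not> ?thesis"
      have "(\<integral>\<^sup>+s. ennreal (exp (- 1 * s)) * indicator {0..} s * tr (max 0 s) x UNIV \<partial>lborel)
          < (\<integral>\<^sup>+s. ennreal (exp (- 1 * s)) * indicator {0..} s \<partial>lborel)"
      proof (rule nn_integral_less[OF _ _ _ _ na])
        show "(\<lambda>s. ennreal (exp (- 1 * s)) * indicator {0..} s * tr (max 0 s) x UNIV) \<in> borel_measurable lborel"
          using transition_path_measurable[OF U] by simp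
        show "AE s in lborel. ennreal (exp (- 1 * s)) * indicator {0..} s * tr (max 0 s) x UNIV \<le> ennreal (exp (- 1 * s)) * indicator {0..} s"
          by (rule AE_I2[OF le])
      qed (simp_all only: p1, simp_all)
      then show False by (simp only: p1 e1)
    qed
    show ?case
    proof
      fix n :: nat
      obtain s where s: "real n < s" "ennreal (exp (- 1 * s)) * indicator {0..} s \<le> ennreal (exp (- 1 * s)) * indicator {0..} s * tr (max 0 s) x UNIV"
        using AE_lborel_between[OF ae, of "real n" "real n + 1"] by auto
      have s0: "0 \<le> s" using s(1) by linarith
      have "ennreal (exp (- 1 * s)) * 1 \<le> ennreal (exp (- 1 * s)) * tr s x UNIV" using s(2) s0 by simp
      then have "1 \<le> tr s x UNIV" by (subst (asm) ennreal_mult_le_mult_iff) auto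
      also have "\<dots> \<le> tr (real n) x UNIV" using s(1) by (intro transition_UNIV_antimono) auto
      finally show "tr (real n) x UNIV = 1" by (rule antisym[OF transition_le_1])
    qed
  qed
qed

text \<open>At time \<open>t\<close> the process is alive and outside \<open>N\<close>, where the
  lower bound for the potential holds; the wait costs the discount
  \<open>exp (- \<alpha> * t)\<close>.\<close>

lemma markov_pot_ge:
  assumes al: "AE \<omega> in P x. \<forall>t\<ge>0. B t \<omega> \<noteq> None" and N: "N \<in> sets borel" "tr t x N = 0" and t: "0 \<le> t"
    and A: "A \<in> sets borel" and ge: "\<And>z. z \<notin> N \<Longrightarrow> c \<le> pot \<alpha> A z"
  shows "ennreal (exp (- \<alpha> * t)) * c \<le> (\<integral>\<^sup>+\<omega>. occ \<alpha> A t \<omega> \<partial>P x)"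
proof -
  interpret prob_space "P x" by (rule prob_P)
  have sw: "space W \<in> sets (natural_filtration W B (ennreal t))"
    using sets.top[of "natural_filtration W B (ennreal t)"] by (simp add: natural_filtration_def space_measure_of_conv)
  have "c = (\<integral>\<^sup>+\<omega>. c \<partial>P x)" by (simp add: emeasure_space_1)
  also have "\<dots> \<le> (\<integral>\<^sup>+\<omega>. zero_ext (pot \<alpha> A) (B t \<omega>) * indicator (space W) \<omega> \<partial>P x)"
  proof (rule nn_integral_mono_AE)
    show "AE \<omega> in P x. c \<le> zero_ext (pot \<alpha> A) (B t \<omega>) * indicator (space W) \<omega>"
      using al avoid_AE[OF N(1) t N(2)] AE_space
    proof eventually_elim
      case (elim \<omega>)
      have w: "\<omega> \<in> space W" using elim(3) by (simp add: space_P)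
      obtain z where z: "B t \<omega> = Some z" using elim(1) t by fastforce
      then have "z \<notin> N" using elim(2) by auto
      then show ?case using ge z w by (simp add: zero_ext_def)
    qed
  qed
  finally have "ennreal (exp (- \<alpha> * t)) * c \<le> ennreal (exp (- \<alpha> * t)) * (\<integral>\<^sup>+\<omega>. zero_ext (pot \<alpha> A) (B t \<omega>) * indicator (space W) \<omega> \<partial>P x)"
    by (rule mult_left_mono) simp
  also have "\<dots> = (\<integral>\<^sup>+\<omega>. occ \<alpha> A t \<omega> * indicator (space W) \<omega> \<partial>P x)" by (rule markov_pot[OF t sw A, symmetric])
  also have "\<dots> = (\<integral>\<^sup>+\<omega>. occ \<alpha> A t \<omega> \<partial>P x)" by (intro nn_integral_cong) (simp add: space_P)
  finally show ?thesis .
qed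

text \<open>The occupation of a small ball is nearly \<open>M\<close> from wherever the process is
  at \<open>t0\<close>, and at most \<open>M\<close> times the discount of the first visit;
  \<open>M\<close> cancels. Rates and radii run through countable families, so one null set serves
  them all.\<close>

lemma hitting_bound_off_null_set:
  assumes osc: "\<And>j k :: nat. \<exists>M>0. AE x in \<nu>. ennreal (M * (1 - K / Suc j)) \<le> pot (1 / Suc j) (ball y (1 / Suc k)) x
      \<and> pot (1 / Suc j) (ball y (1 / Suc k)) x \<le> ennreal M"
    and K: "0 \<le> K"
  obtains N where "N \<in> null_sets \<nu>"
    "\<And>x. pot 0 N x = 0 \<Longrightarrow> (\<And>n::nat. tr (real n) x UNIV = 1) \<Longrightarrow>
      \<exists>G. G \<in> borel_measurable (P x) \<and> (AE \<omega> in P x. hitting_time B y \<omega> \<le> G \<omega>) \<and> (\<integral>\<^sup>+\<omega>. G \<omega> \<partial>P x) \<le> ennreal (1 + K)"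
proof -
  define Q where "Q j k M \<longleftrightarrow> (AE x in \<nu>. ennreal (M * (1 - K / Suc j)) \<le> pot (1 / Suc j) (ball y (1 / Suc k)) x
      \<and> pot (1 / Suc j) (ball y (1 / Suc k)) x \<le> ennreal M)" for j k :: nat and M
  have "\<forall>j k. \<exists>M. 0 < M \<and> Q j k M" using osc unfolding Q_def by blast
  then obtain M where "\<And>j k. 0 < M j k" and "\<And>j k. Q j k (M j k)" unfolding choice_iff by blast
  then have M: "\<And>j k. 0 < M j k"
    "\<And>j k. AE x in \<nu>. ennreal (M j k * (1 - K / Suc j)) \<le> pot (1 / Suc j) (ball y (1 / Suc k)) x
      \<and> pot (1 / Suc j) (ball y (1 / Suc k)) x \<le> ennreal (M j k)"
    unfolding Q_def by blast+
  have "AE x in \<nu>. \<forall>j k. ennreal (M j k * (1 - K / Suc j)) \<le> pot (1 / Suc j) (ball y (1 / Suc k)) x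
      \<and> pot (1 / Suc j) (ball y (1 / Suc k)) x \<le> ennreal (M j k)"
    unfolding AE_all_countable using M(2) by blast
  then obtain N where N: "N \<in> null_sets \<nu>" "{x \<in> space \<nu>. \<not> (\<forall>j k. ennreal (M j k * (1 - K / Suc j)) \<le> pot (1 / Suc j) (ball y (1 / Suc k)) x
      \<and> pot (1 / Suc j) (ball y (1 / Suc k)) x \<le> ennreal (M j k))} \<subseteq> N"
    by (auto elim!: AE_E simp: null_sets_def)
  have bd: "ennreal (M j k * (1 - K / Suc j)) \<le> pot (1 / Suc j) (ball y (1 / Suc k)) z"
    "pot (1 / Suc j) (ball y (1 / Suc k)) z \<le> ennreal (M j k)" if "z \<notin> N" for z j k
    using N(2) that by auto
  have Nb: "N \<in> sets borel" using N sets_nu by auto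
  show ?thesis
  proof (rule that[OF N(1)])
    fix x assume p0: "pot 0 N x = 0" and con: "\<And>n::nat. tr (real n) x UNIV = 1"
    note T = pot_0_AE_transition[OF Nb p0] and al = AE_alive[OF con]
    \<comment> \<open>Grid times beyond \<open>t0\<close> lie at positive distance from 0, as
      \<open>hitting_time\<close> demands. With \<open>t0 < 1\<close> the lost discount
      \<open>exp (- a * t0)\<close> stays above \<open>1 - a\<close>, which is how \<open>K\<close>
      becomes \<open>1 + K\<close>.\<close>
    obtain t0 where t0: "0 < t0" "t0 < 1" "tr t0 x N = 0" using AE_lborel_between[OF T, of 0 1] by auto
    obtain d :: "nat \<Rightarrow> real" where d: "\<And>i. t0 < d i" "\<And>i. tr (d i) x N = 0"
      "\<And>u v. t0 \<le> u \<Longrightarrow> u < v \<Longrightarrow> \<exists>i. u < d i \<and> d i < v"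
      using ex_dense_sequence_AE[OF T less_imp_le[OF t0(1)]] by blast
    have d0: "0 \<le> d i" for i using d(1)[of i] t0(1) by linarith
    have grid: "ennreal (1 - (1 + K) / Suc j) \<le> (\<integral>\<^sup>+\<omega>. grid_disc (1 / Suc j) (ball y (1 / Suc k)) d UNIV \<omega> \<partial>P x)" for j k :: nat
    \<comment> \<open>\<open>ennreal\<close> sends a nonpositive bound to 0, which settles the small
      \<open>j\<close>.\<close>
    proof (cases "1 - (1 + K) / Suc j \<le> 0")
      case True
      then show ?thesis by (simp add: ennreal_neg)
    next
      case False
      define a where "a = 1 / real (Suc j)"
      have a: "0 < a" "a \<le> 1" by (simp_all add: a_def)
      have Ka: "K / Suc j = K * a" "(1 + K) / Suc j = (1 + K) * a" by (simp_all add: a_def)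
      have nn: "0 \<le> 1 - K * a" "0 \<le> 1 - a" using False a K unfolding Ka by (simp_all add: algebra_simps)
      let ?A = "ball y (1 / Suc k)"
      have A: "?A \<in> sets borel" "open ?A" by simp_all
      have "1 - a \<le> exp (- a * t0)"
      proof -
        have "1 - a \<le> 1 + - a * t0" using a t0 mult_left_le[of t0 a] by (simp add: algebra_simps)
        also have "\<dots> \<le> exp (- a * t0)" by (rule exp_ge_add_one_self)
        finally show ?thesis .
      qed
      then have "M j k * (1 - (1 + K) * a) \<le> exp (- a * t0) * (M j k * (1 - K * a))"
      proof -
        assume h: "1 - a \<le> exp (- a * t0)"
        \<comment> \<open>The right side is larger by \<open>K * a\<^sup>2\<close>.\<close>
        have "1 - (1 + K) * a \<le> (1 - a) * (1 - K * a)" using K a by (simp add: algebra_simps)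
        also have "\<dots> \<le> exp (- a * t0) * (1 - K * a)" using h nn by (intro mult_right_mono)
        finally have "M j k * (1 - (1 + K) * a) \<le> M j k * (exp (- a * t0) * (1 - K * a))"
          using M(1)[of j k] by (intro mult_left_mono) simp_all
        then show ?thesis by (simp add: algebra_simps)
      qed
      then have "ennreal (M j k) * ennreal (1 - (1 + K) * a) \<le> ennreal (exp (- a * t0)) * ennreal (M j k * (1 - K * a))"
        using M(1)[of j k] nn False unfolding Ka by (subst (1 2) ennreal_mult[symmetric]) (simp_all add: less_imp_le)
      also have "\<dots> \<le> (\<integral>\<^sup>+\<omega>. occ a ?A t0 \<omega> \<partial>P x)"
        using bd(1)[of _ j k] unfolding Ka a_def by (intro markov_pot_ge[OF al Nb t0(3) less_imp_le[OF t0(1)] A(1)]) (simp add: a_def)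
      also have "\<dots> \<le> (\<integral>\<^sup>+\<omega>. grid_occ a ?A ?A d UNIV \<omega> \<partial>P x)"
        using occ_le_grid_occ[OF _ A(2) less_imp_le[OF t0(1)] d(3)] by (intro nn_integral_mono) (simp add: space_P)
      also have "\<dots> \<le> ennreal (M j k) * (\<integral>\<^sup>+\<omega>. grid_disc a ?A d UNIV \<omega> \<partial>P x)"
        using bd(2)[of _ j k] by (intro grid_upper[OF d0 less_imp_le[OF a(1)] A(1) A(1) Nb d(2)]) (simp add: a_def)
      finally have "ennreal (1 - (1 + K) * a) \<le> (\<integral>\<^sup>+\<omega>. grid_disc a ?A d UNIV \<omega> \<partial>P x)"
        using M(1)[of j k] by (subst (asm) ennreal_mult_le_mult_iff) simp_all
      then show ?thesis unfolding Ka by (simp only: a_def)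
    qed
    have near: "ennreal (1 - (1 + K) / Suc j) \<le> (\<integral>\<^sup>+\<omega>. near_disc (1 / Suc j) y d \<omega> \<partial>P x)" for j :: nat
      by (rule near_disc_integral_ge[OF d0 _ grid]) simp
    have K1: "0 \<le> 1 + K" using K by simp
    obtain G where "G \<in> borel_measurable (P x)" "AE \<omega> in P x. hitting_time B y \<omega> \<le> G \<omega>" "(\<integral>\<^sup>+\<omega>. G \<omega> \<partial>P x) \<le> ennreal (1 + K)"
      using expected_hitting_bound[OF al t0(1) less_imp_le[OF d(1)] near K1] by blast
    then show "\<exists>G. G \<in> borel_measurable (P x) \<and> (AE \<omega> in P x. hitting_time B y \<omega> \<le> G \<omega>) \<and> (\<integral>\<^sup>+\<omega>. G \<omega> \<partial>P x) \<le> ennreal (1 + K)"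
      by blast
  qed
qed

text \<open>A majorant with finite expectation is almost surely finite, and \<open>hit\<close> never
  exceeds \<open>hitting_time\<close>.\<close>

lemma hit_certain:
  assumes G: "G \<in> borel_measurable (P z)" "AE \<omega> in P z. hitting_time B y \<omega> \<le> G \<omega>" "(\<integral>\<^sup>+\<omega>. G \<omega> \<partial>P z) < \<infinity>"
  shows "emeasure (P z) {\<omega> \<in> space W. hit y \<omega> < \<infinity>} = 1"
proof -
  interpret prob_space "P z" by (rule prob_P)
  have "AE \<omega> in P z. G \<omega> \<noteq> \<infinity>" using nn_integral_noteq_infinite[OF G(1)] G(3) by simp
  with G(2) have "AE \<omega> in P z. hit y \<omega> < \<infinity>"
  proof eventually_elim
    case (elim \<omega>)
    have "hit y \<omega> \<le> hitting_time B y \<omega>"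
      unfolding hit_def hitting_time_def by (intro Inf_superset_mono) auto
    then show ?case using elim by (auto simp: less_top)
  qed
  with AE_space have "AE \<omega> in P z. \<omega> \<in> {\<omega> \<in> space W. hit y \<omega> < \<infinity>}"
    by eventually_elim (simp add: space_P)
  then show ?thesis by (rule emeasure_eq_1_AE[OF hit_finite_event])
qed

text \<open>Almost every \<open>z\<close> is a good starting point for the targets \<open>x\<close>
  and \<open>y\<close> at once. From such a \<open>z\<close> the point \<open>x\<close> is hit
  almost surely, and then \<open>conservative_hit\<close> and \<open>pot_hit\<close> make
  \<open>x\<close> itself a good starting point for the target \<open>y\<close>.\<close>

lemma compact_expected_hitting:
  assumes c: "compact (UNIV :: 'a set)"
  shows "(\<integral>\<^sup>+\<omega>. hitting_time B y \<omega> \<partial>P x) < \<infinity>" "\<And>n::nat. tr (real n) x UNIV = 1"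
proof -
  obtain D where D: "\<And>x y :: 'a. dist x y \<le> D"
    using compact_imp_bounded[OF c] unfolding bounded_two_points by auto
  define K where "K = 4 * D * measure \<nu> UNIV"
  have K: "0 \<le> K" using D[of x x] by (simp add: K_def)
  have osc: "\<exists>M>0. AE x in \<nu>. ennreal (M * (1 - K / Suc j)) \<le> pot (1 / Suc j) (ball y (1 / Suc k)) x
      \<and> pot (1 / Suc j) (ball y (1 / Suc k)) x \<le> ennreal M" for y :: 'a and j k :: nat
    using compact_resolvent_oscillation[OF c D, of "1 / Suc j" "1 / Suc k" y] by (simp add: K_def)
  define goal where "goal x y \<longleftrightarrow> (\<exists>G. G \<in> borel_measurable (P x) \<and> (AE \<omega> in P x. hitting_time B y \<omega> \<le> G \<omega>) \<and> (\<integral>\<^sup>+\<omega>. G \<omega> \<partial>P x) \<le> ennreal (1 + K))" for x y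
  have "\<exists>N\<in>null_sets \<nu>. \<forall>x. pot 0 N x = 0 \<longrightarrow> (\<forall>n::nat. tr (real n) x UNIV = 1) \<longrightarrow> goal x y" for y
    unfolding goal_def using hitting_bound_off_null_set[OF osc K] by metis
  then obtain N where N: "\<And>y. N y \<in> null_sets \<nu>" "\<And>x y. pot 0 (N y) x = 0 \<Longrightarrow> (\<And>n::nat. tr (real n) x UNIV = 1) \<Longrightarrow> goal x y" by metis
  have hit1: "emeasure (P z) {\<omega> \<in> space W. hit y \<omega> < \<infinity>} = 1" if g: "goal z y" for z y
  proof -
    obtain G where "G \<in> borel_measurable (P z)" "AE \<omega> in P z. hitting_time B y \<omega> \<le> G \<omega>" "(\<integral>\<^sup>+\<omega>. G \<omega> \<partial>P z) \<le> ennreal (1 + K)"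
      using g unfolding goal_def by blast
    then show ?thesis by (intro hit_certain[of G]) (simp_all add: le_less_trans)
  qed
  have "AE z in \<nu>. pot 0 (N x) z = 0 \<and> pot 0 (N y) z = 0 \<and> (\<forall>n::nat. tr (real n) z UNIV = 1)"
    using pot_null[OF N(1)[of x], of 0] pot_null[OF N(1)[of y], of 0] compact_AE_conservative[OF c] by eventually_elim blast
  from AE_ball_ex[OF this zero_less_one]
  obtain z where z: "pot 0 (N x) z = 0" "pot 0 (N y) z = 0" "\<And>n::nat. tr (real n) z UNIV = 1" by blast
  have h: "emeasure (P z) {\<omega> \<in> space W. hit x \<omega> < \<infinity>} = 1" by (rule hit1[OF N(2)[OF z(1,3)]])
  show con: "tr (real n) x UNIV = 1" for n by (rule conservative_hit[OF z(3)]) (simp_all only: h, simp_all)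
  have "N y \<in> sets borel" using N(1)[of y] sets_nu by auto
  from pot_hit[OF this, of z x] have "pot 0 (N y) x = 0" using z(2) by (simp only: h) simp
  from N(2)[OF this con] obtain G where G: "AE \<omega> in P x. hitting_time B y \<omega> \<le> G \<omega>" "(\<integral>\<^sup>+\<omega>. G \<omega> \<partial>P x) \<le> ennreal (1 + K)"
    unfolding goal_def by blast
  show "(\<integral>\<^sup>+\<omega>. hitting_time B y \<omega> \<partial>P x) < \<infinity>"
    by (rule le_less_trans[OF order_trans[OF nn_integral_mono_AE[OF G(1)] G(2)]]) simp
qed

text \<open>The whole tree is a compact set that the process never leaves, so its expected
  occupation time is infinite, which refutes transience; finiteness of all expected hitting times
  excludes null recurrence.\<close>

lemma compact_positive_recurrent:
  assumes c: "compact (UNIV :: 'a set)"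
  shows "positive_recurrent r P B"
proof -
  have "tr u r UNIV = 1" if u: "0 \<le> u" for u
  proof (rule antisym[OF transition_le_1])
    obtain n :: nat where n: "u \<le> real n" using real_arch_simple by blast
    show "1 \<le> tr u r UNIV"
      using compact_expected_hitting(2)[OF c, of n r] transition_UNIV_antimono[OF u n, of r] by simp
  qed
  then have "(\<integral>\<^sup>+u\<in>{0..}. tr u r UNIV \<partial>lborel) = (\<integral>\<^sup>+u. indicator {0::real..} u \<partial>lborel)"
    by (intro nn_integral_cong) (simp add: indicator_def)
  also have "\<dots> = \<infinity>"
  proof -
    have le: "ennreal (real n) \<le> emeasure lborel {0::real..}" for n :: nat
      using emeasure_mono[of "{0..real n}" "{0::real..}" lborel] by simp
    then show ?thesis
    proof (cases "emeasure lborel {0::real..}" rule: ennreal_cases)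
      case (real r)
      obtain n :: nat where "r < real n" using reals_Archimedean2 by blast
      moreover have "ennreal (real n) \<le> ennreal r" using le[of n] real by simp
      ultimately show ?thesis using real by (simp add: ennreal_le_iff)
    qed simp
  qed
  finally have "\<not> transient r P B" unfolding transient_def using c by auto
  moreover have "(\<integral>\<^sup>+\<omega>. hitting_time B y \<omega> \<partial>P x) \<noteq> \<infinity>" for x y
    using compact_expected_hitting(1)[OF c, of x y] by simp
  ultimately show ?thesis unfolding positive_recurrent_def null_recurrent_def by blast
qed

subsection \<open>Non-compact trees\<close>

text \<open>Non-compactness leaves a point outside the compact set beyond which \<open>u\<close> is
  small, and the diameter bounds its distance to \<open>z\<close> in the arc estimate.\<close>

lemma noncompact_sup_bound:
  assumes nc: "\<not> compact (UNIV :: 'a set)" and D: "\<And>x y :: 'a. dist x y \<le> D" and u: "u \<in> form_domain \<rho> \<nu>"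
  shows "\<bar>u z\<bar> \<le> sqrt (4 * D * energy \<rho> u u)"
proof (rule field_le_epsilon)
  fix e :: real assume e: "0 < e"
  obtain K where K: "compact K" "\<And>x. x \<notin> K \<Longrightarrow> \<bar>u x\<bar> \<le> e"
    using form_domainD(5)[OF u] e unfolding C_infty_def by blast
  then have "K \<noteq> UNIV" using nc by auto
  then obtain x where "x \<notin> K" by blast
  then have x: "\<bar>u x\<bar> \<le> e" by (rule K(2))
  have "(u z - u x)\<^sup>2 \<le> 4 * dist x z * energy \<rho> u u" by (rule hoelder[OF u])
  also have "\<dots> \<le> 4 * D * energy \<rho> u u" using D energy_nonneg[OF lc] by (intro mult_right_mono) auto
  finally have "\<bar>u z - u x\<bar> \<le> sqrt (4 * D * energy \<rho> u u)" using real_sqrt_le_mono by fastforce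
  then show "\<bar>u z\<bar> \<le> sqrt (4 * D * energy \<rho> u u) + e" using x by linarith
qed

text \<open>\<open>S\<^sup>2\<close> is \<open>4 * D\<close> times the energy, and the energy is at
  most \<open>S\<close> times \<open>\<nu>(K)\<close>. Cancelling one factor \<open>S\<close> leaves
  a bound free of \<open>\<alpha>\<close>.\<close>

lemma noncompact_pot_le:
  assumes nc: "\<not> compact (UNIV :: 'a set)" and D: "\<And>x y :: 'a. dist x y \<le> D" and K: "compact K" and a: "0 < \<alpha>"
  shows "AE x in \<nu>. pot \<alpha> K x \<le> ennreal (4 * D * measure \<nu> K)"
proof -
  have Kb: "K \<in> sets borel" using K by (simp add: borel_compact)
  have fin: "emeasure \<nu> K < \<infinity>" using radon K by (simp add: radon_measure_def)
  obtain u where u: "u \<in> form_domain \<rho> \<nu>" "AE x in \<nu>. res \<alpha> K x = u x"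
    "\<And>g. g \<in> form_domain \<rho> \<nu> \<Longrightarrow> energy \<rho> u g = (LINT x|\<nu>. indicator K x * g x) - \<alpha> * (LINT x|\<nu>. u x * g x)"
    using resolvent_form[OF a Kb fin] by blast
  define S where "S = sqrt (4 * D * energy \<rho> u u)"
  have D0: "0 \<le> D" using D[of \<rho> \<rho>] by simp
  have S: "0 \<le> S" "S\<^sup>2 = 4 * D * energy \<rho> u u" unfolding S_def using D0 energy_nonneg[OF lc] by simp_all
  have uS: "u x \<le> S" for x using noncompact_sup_bound[OF nc D u(1), of x] unfolding S_def by linarith
  have "energy \<rho> u u \<le> S * measure \<nu> K" by (rule resolvent_energy_le[OF a Kb fin u(1) u(3)[OF u(1)] uS])
  then have "S\<^sup>2 \<le> 4 * D * (S * measure \<nu> K)" unfolding S(2) using D0 by (intro mult_left_mono) simp_all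
  then have "S * S \<le> S * (4 * D * measure \<nu> K)" by (simp add: power2_eq_square algebra_simps)
  then have "S \<le> 4 * D * measure \<nu> K" using S(1) D0 by (cases "S = 0") (simp_all add: mult_le_cancel_left)
  then have le: "0 \<le> u x \<and> u x \<le> 4 * D * measure \<nu> K" for x
    using uS[of x] resolvent_form_bounds(1)[OF a u(1,2) Kb fin, of x] by linarith
  have "AE x in \<nu>. x \<in> UNIV \<longrightarrow> ennreal 0 \<le> pot \<alpha> K x \<and> pot \<alpha> K x \<le> ennreal (4 * D * measure \<nu> K)"
    by (rule AE_pot_bounds[OF a Kb fin u(2) le])
  then show ?thesis by simp
qed

text \<open>Monotone convergence as the killing rates \<open>1 / Suc j\<close> decrease to
  0.\<close>

lemma pot_0_le:
  assumes K: "K \<in> sets borel" and le: "\<And>j::nat. pot (1 / Suc j) K x \<le> c"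
  shows "pot 0 K x \<le> c"
proof -
  define f where "f j s = ennreal (exp (- (1 / Suc j) * s)) * indicator {0..} s * tr (max 0 s) x K" for j :: nat and s
  have meas: "f j \<in> borel_measurable lborel" for j
    unfolding f_def using transition_path_measurable[OF K] by simp
  have "incseq f"
  proof (intro monotoneI le_funI)
    fix j k :: nat and s :: real assume jk: "j \<le> k"
    show "f j s \<le> f k s"
    proof (cases "s \<in> {0..}")
      case True
      have "1 / real (Suc k) \<le> 1 / real (Suc j)" using jk by (simp add: frac_le)
      then have "1 / real (Suc k) * s \<le> 1 / real (Suc j) * s" using True by (intro mult_right_mono) simp_all
      then have "exp (- (1 / real (Suc j)) * s) \<le> exp (- (1 / real (Suc k)) * s)" by simp
      then show ?thesis unfolding f_def by (intro mult_right_mono ennreal_leI) simp_all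
    qed (simp add: f_def)
  qed
  moreover have "(\<lambda>j. f j s) \<longlonglongrightarrow> ennreal (exp (- 0 * s)) * indicator {0..} s * tr (max 0 s) x K" for s
  proof -
    define c where "c = indicator {0..} s * tr (max 0 s) x K"
    have "c \<le> 1" unfolding c_def using transition_le_1[of "max 0 s" x K] by (cases "s \<in> {0..}") simp_all
    then have c: "c < \<top>" using le_less_trans ennreal_one_less_top by blast
    have "(\<lambda>j. - (1 / real (Suc j)) * s) \<longlonglongrightarrow> - 0 * s"
      by (intro tendsto_intros LIMSEQ_Suc[OF lim_1_over_n])
    then have "(\<lambda>j. ennreal (exp (- (1 / real (Suc j)) * s))) \<longlonglongrightarrow> ennreal (exp (- 0 * s))"
      by (intro tendsto_ennrealI tendsto_exp)
    from ennreal_tendsto_cmult[OF c this] show ?thesis unfolding f_def c_def by (simp only: ac_simps)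
  qed
  ultimately have "(\<lambda>j. \<integral>\<^sup>+s. f j s \<partial>lborel) \<longlonglongrightarrow> (\<integral>\<^sup>+s. ennreal (exp (- 0 * s)) * indicator {0..} s * tr (max 0 s) x K \<partial>lborel)"
    using meas by (intro nn_integral_LIMSEQ)
  moreover have "(\<integral>\<^sup>+s. f j s \<partial>lborel) \<le> c" for j using le[of j] by (simp only: pot_def f_def)
  ultimately show ?thesis unfolding pot_def by (intro LIMSEQ_le_const2) auto
qed

lemma noncompact_Green_le:
  assumes nc: "\<not> compact (UNIV :: 'a set)" and D: "\<And>x y :: 'a. dist x y \<le> D" and K: "compact K"
  shows "AE x in \<nu>. pot 0 K x \<le> ennreal (4 * D * measure \<nu> K)"
proof -
  have "AE x in \<nu>. \<forall>j::nat. pot (1 / Suc j) K x \<le> ennreal (4 * D * measure \<nu> K)"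
    unfolding AE_all_countable using noncompact_pot_le[OF nc D K] by simp
  then show ?thesis using pot_0_le[OF borel_compact[OF K]] by (auto elim!: eventually_mono)
qed

section \<open>Hitting the root with positive probability\<close>

lemma cutoff_at_root:
  obtains f \<eta> where "f \<in> form_domain \<rho> \<nu>" "0 < \<eta>" "\<And>x. x \<in> ball \<rho> \<eta> \<Longrightarrow> 1 / 2 \<le> f x"
    "emeasure \<nu> (ball \<rho> \<eta>) < \<infinity>"
proof -
  obtain f where f: "f \<in> form_domain \<rho> \<nu>" "f \<rho> = 1" using ex_cutoff_function[OF lc radon] by blast
  obtain e where e: "0 < e" "compact (cball \<rho> e)" using locally_compact_cball[OF lc] by metis
  have "open (f -` {1 / 2<..})"
    using continuous_on_open_vimage[of UNIV f] form_domainD(2)[OF f(1)] by simp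
  moreover have "\<rho> \<in> f -` {1 / 2<..}" using f(2) by simp
  ultimately obtain e' where e': "0 < e'" "ball \<rho> e' \<subseteq> f -` {1 / 2<..}" unfolding open_contains_ball by blast
  have "emeasure \<nu> (ball \<rho> (min e e')) \<le> emeasure \<nu> (cball \<rho> e)"
    using e(2) by (intro emeasure_mono) (auto simp: sets_nu borel_compact)
  also have "\<dots> < \<infinity>" using radon e(2) by (simp add: radon_measure_def)
  finally have fin: "emeasure \<nu> (ball \<rho> (min e e')) < \<infinity>" .
  have half: "1 / 2 \<le> f x" if x: "x \<in> ball \<rho> (min e e')" for x
  proof -
    have "x \<in> f -` {1 / 2<..}" using e'(2) x by auto
    then show ?thesis by simp
  qed
  show ?thesis by (rule that[OF f(1) _ half fin]) (use e e' in simp_all)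
qed

lemma form_product_integral_le:
  assumes u: "u \<in> form_domain \<rho> \<nu>" and f: "f \<in> form_domain \<rho> \<nu>" and s: "0 < s"
  shows "(LINT x|\<nu>. u x * f x) \<le> s / 2 * (LINT x|\<nu>. u x * u x) + (LINT x|\<nu>. f x * f x) / (2 * s)"
proof -
  have iu: "integrable \<nu> (\<lambda>x. u x * u x)" and if': "integrable \<nu> (\<lambda>x. f x * f x)"
    using form_domainD(4)[OF u] form_domainD(4)[OF f] by (simp_all add: power2_eq_square)
  have young: "\<bar>u x * f x\<bar> \<le> s / 2 * (u x * u x) + 1 / (2 * s) * (f x * f x)" for x
  proof -
    have sq: "(s * p - q)\<^sup>2 / (2 * s) = s / 2 * (p * p) + 1 / (2 * s) * (q * q) - p * q" for p q :: real
      using s by (simp add: field_simps power2_eq_square)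
    have "0 \<le> (s * \<bar>u x\<bar> - \<bar>f x\<bar>)\<^sup>2 / (2 * s)" using s by simp
    also have "\<dots> = s / 2 * (u x * u x) + 1 / (2 * s) * (f x * f x) - \<bar>u x * f x\<bar>"
      unfolding sq by (simp only: abs_mult abs_mult_self_eq)
    finally show ?thesis by simp
  qed
  have i: "integrable \<nu> (\<lambda>x. s / 2 * (u x * u x) + 1 / (2 * s) * (f x * f x))"
    by (intro Bochner_Integration.integrable_add integrable_mult_right iu if')
  have "integrable \<nu> (\<lambda>x. u x * f x)"
  proof (rule Bochner_Integration.integrable_bound[OF i])
    show "(\<lambda>x. u x * f x) \<in> borel_measurable \<nu>"
      unfolding measurable_nu using form_domainD(3)[OF u] form_domainD(3)[OF f] by (intro borel_measurable_times)
    show "AE x in \<nu>. norm (u x * f x) \<le> norm (s / 2 * (u x * u x) + 1 / (2 * s) * (f x * f x))"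
      using young by (intro AE_I2) (simp add: order_trans[OF _ abs_ge_self])
  qed
  then have "(LINT x|\<nu>. u x * f x) \<le> (LINT x|\<nu>. s / 2 * (u x * u x) + 1 / (2 * s) * (f x * f x))"
    by (rule integral_mono[OF _ i abs_le_D1[OF young]])
  also have "\<dots> = s / 2 * (LINT x|\<nu>. u x * u x) + 1 / (2 * s) * (LINT x|\<nu>. f x * f x)"
    using iu if' by (subst Bochner_Integration.integral_add) simp_all
  finally show ?thesis by simp
qed

text \<open>Testing the resolvent equation with the cutoff \<open>f\<close> bounds the mean
  \<open>J\<close> of \<open>u\<close> over the small ball below by \<open>V / (4 * c0)\<close>,
  which expresses positive capacity of the root. The energy is then at most
  \<open>4 * c0 * J\<^sup>2\<close>, and the arc estimate keeps \<open>u\<close> within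
  \<open>J / 3\<close> of its mean on a ball whose radius \<open>\<eta>\<close> does not depend on
  \<open>\<delta>\<close>.\<close>

lemma resolvent_near_root:
  obtains \<eta> where "0 < \<eta>" "\<And>\<delta>. 0 < \<delta> \<Longrightarrow> \<delta> \<le> \<eta> \<Longrightarrow>
    \<exists>J>0. AE x in \<nu>. x \<in> ball \<rho> \<eta> \<longrightarrow> ennreal (2 / 3 * J) \<le> pot 1 (ball \<rho> \<delta>) x \<and> pot 1 (ball \<rho> \<delta>) x \<le> ennreal (4 / 3 * J)"
proof -
  obtain f \<eta>' where f: "f \<in> form_domain \<rho> \<nu>" and \<eta>': "0 < \<eta>'" "\<And>x. x \<in> ball \<rho> \<eta>' \<Longrightarrow> 1 / 2 \<le> f x"
    and fin': "emeasure \<nu> (ball \<rho> \<eta>') < \<infinity>" by (rule cutoff_at_root) blast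
  define c0 where "c0 = energy \<rho> f f + (LINT x|\<nu>. f x * f x) + 1"
  have c0: "0 < c0" unfolding c0_def using energy_nonneg[OF lc] by (intro add_nonneg_pos add_nonneg_nonneg integral_nonneg_AE) auto
  \<comment> \<open>The squared oscillation on this ball is at most
    \<open>32 * \<eta> * c0 * J\<^sup>2\<close>, which must not exceed
    \<open>(J / 3)\<^sup>2\<close>; hence 288 = 9 * 32.\<close>
  define \<eta> where "\<eta> = min \<eta>' (1 / (288 * c0))"
  have \<eta>: "0 < \<eta>" "\<eta> \<le> \<eta>'" "\<eta> * (288 * c0) \<le> 1"
  proof -
    have "\<eta> \<le> 1 / (288 * c0)" by (simp add: \<eta>_def)
    then show "\<eta> * (288 * c0) \<le> 1" using c0 by (simp add: field_simps)
  qed (use \<eta>' c0 in \<open>simp_all add: \<eta>_def\<close>)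
  show ?thesis
  proof (rule that[OF \<eta>(1)])
    fix \<delta> :: real assume \<delta>: "0 < \<delta>" "\<delta> \<le> \<eta>"
    let ?A = "ball \<rho> \<delta>"
    have A: "?A \<in> sets borel" by simp
    have sub: "?A \<subseteq> ball \<rho> \<eta>" "?A \<subseteq> ball \<rho> \<eta>'" using \<delta> \<eta>(2) by auto
    have fin: "emeasure \<nu> ?A < \<infinity>" by (rule le_less_trans[OF emeasure_mono[OF sub(2)] fin']) (simp add: sets_nu)
    define V where "V = measure \<nu> ?A"
    have V: "0 < V" using ball_measure_pos[OF \<delta>(1), of \<rho>] fin by (simp add: V_def measure_def enn2real_positive_iff)
    obtain u where u: "u \<in> form_domain \<rho> \<nu>" "AE x in \<nu>. res 1 ?A x = u x"
      "\<And>g. g \<in> form_domain \<rho> \<nu> \<Longrightarrow> energy \<rho> u g = (LINT x|\<nu>. indicator ?A x * g x) - 1 * (LINT x|\<nu>. u x * g x)"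
      using resolvent_form[OF zero_less_one A fin] by blast
    define J where "J = (LINT x|\<nu>. indicator ?A x * u x) / V"
    have I: "(LINT x|\<nu>. indicator ?A x * u x) = J * V" using V by (simp add: J_def)
    \<comment> \<open>Balances the Young terms: the first becomes \<open>c0 * J\<close> and the
      second \<open>V / 4\<close>, which absorbs half of the \<open>V / 2\<close> on the
      left.\<close>
    define s where "s = 2 * c0 / V"
    have s: "0 < s" using V c0 by (simp add: s_def)
    have "1 / 2 * V \<le> (LINT x|\<nu>. indicator ?A x * f x)"
      unfolding V_def using \<eta>'(2) sub(2) by (intro indicator_integral_ge[OF A fin f]) blast
    also have "\<dots> = energy \<rho> u f + (LINT x|\<nu>. u x * f x)" using u(3)[OF f] by simp
    also have "\<dots> \<le> (s / 2 * energy \<rho> u u + energy \<rho> f f / (2 * s)) + (s / 2 * (LINT x|\<nu>. u x * u x) + (LINT x|\<nu>. f x * f x) / (2 * s))"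
      by (intro add_mono energy_young[OF lc form_domainD(1)[OF u(1)] form_domainD(1)[OF f] s] form_product_integral_le[OF u(1) f s])
    also have "\<dots> = s / 2 * (energy \<rho> u u + (LINT x|\<nu>. u x * u x)) + (c0 - 1) / (2 * s)"
      by (simp add: c0_def add_divide_distrib algebra_simps)
    also have "\<dots> = s / 2 * (J * V) + (c0 - 1) / (2 * s)" using u(3)[OF u(1)] I by simp
    also have "\<dots> \<le> s / 2 * (J * V) + c0 / (2 * s)" using s by (simp add: divide_right_mono)
    also have "\<dots> = c0 * J + V / 4" using V c0 by (simp add: s_def field_simps)
    finally have VJ: "V \<le> 4 * c0 * J" by simp
    then have "0 < 4 * c0 * J" using V by linarith
    then have J: "0 < J" using c0 by (simp add: zero_less_mult_iff)
    have uu: "0 \<le> (LINT x|\<nu>. u x * u x)" by (intro integral_nonneg_AE) auto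
    have en: "energy \<rho> u u \<le> J * V" using u(3)[OF u(1)] I uu by simp
    have osc: "\<bar>u y - u x\<bar> \<le> J / 3" if x: "x \<in> ball \<rho> \<eta>" and y: "y \<in> ball \<rho> \<eta>" for x y
    proof -
      have d: "dist x y \<le> 2 * \<eta>" using x y dist_triangle[of x y \<rho>] by (simp add: dist_commute)
      have "(u y - u x)\<^sup>2 \<le> 4 * dist x y * energy \<rho> u u" by (rule hoelder[OF u(1)])
      also have "\<dots> \<le> 4 * (2 * \<eta>) * (J * V)"
        using d en \<eta>(1) by (intro mult_mono) (simp_all add: energy_nonneg[OF lc])
      also have "\<dots> \<le> 4 * (2 * \<eta>) * (J * (4 * c0 * J))"
        using VJ J \<eta>(1) by (intro mult_left_mono) simp_all
      also have "\<dots> = (\<eta> * (288 * c0)) * (J / 3)\<^sup>2" by (simp add: power2_eq_square)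
      also have "\<dots> \<le> 1 * (J / 3)\<^sup>2" by (intro mult_right_mono \<eta>(3)) simp
      finally show ?thesis using J by (intro power2_le_imp_le[of "\<bar>u y - u x\<bar>"]) simp_all
    qed
    have le: "2 / 3 * J \<le> u x \<and> u x \<le> 4 / 3 * J" if x: "x \<in> ball \<rho> \<eta>" for x
    proof
      have "(u x - J / 3) * V \<le> J * V"
        unfolding I[symmetric] unfolding V_def
      proof (rule indicator_integral_ge[OF A fin u(1)])
        fix y assume "y \<in> ?A"
        then have "y \<in> ball \<rho> \<eta>" using sub(1) by blast
        from osc[OF x this] show "u x - J / 3 \<le> u y" by linarith
      qed
      then show "u x \<le> 4 / 3 * J" using V by simp
      have "J * V \<le> (u x + J / 3) * V"
        unfolding I[symmetric] unfolding V_def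
      proof (rule indicator_integral_le[OF A fin u(1)])
        fix y assume "y \<in> ?A"
        then have "y \<in> ball \<rho> \<eta>" using sub(1) by blast
        from osc[OF x this] show "u y \<le> u x + J / 3" by linarith
      qed
      then show "2 / 3 * J \<le> u x" using V by simp
    qed
    have "AE x in \<nu>. x \<in> ball \<rho> \<eta> \<longrightarrow> ennreal (2 / 3 * J) \<le> pot 1 ?A x \<and> pot 1 ?A x \<le> ennreal (4 / 3 * J)"
      by (rule AE_pot_bounds[OF zero_less_one A fin u(2) le])
    then show "\<exists>J>0. AE x in \<nu>. x \<in> ball \<rho> \<eta> \<longrightarrow> ennreal (2 / 3 * J) \<le> pot 1 ?A x \<and> pot 1 ?A x \<le> ennreal (4 / 3 * J)"
      using J by blast
  qed
qed

lemma grid_occ_mono_target: "A \<subseteq> A' \<Longrightarrow> grid_occ \<alpha> A C d I \<omega> \<le> grid_occ \<alpha> A' C d I \<omega>"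
  unfolding grid_occ_def
  by (intro nn_integral_mono mult_right_mono mult_left_mono indicator_ennreal_mono) auto

text \<open>Two comparisons, uniform in the shrinking ball around the root. Its potential at
  \<open>x\<close> is at least half of its upper bound on the ball, so the discount of the first
  visit has expectation at least 1/2. From the small ball, the fixed ball of radius
  \<open>\<eta>\<close> has potential at least \<open>2 / 3 * J0\<close>. The product
  \<open>J0 / 3\<close> survives the limit, as \<open>hit_positive\<close> demands.\<close>

lemma hit_root_positive:
  obtains \<eta> N where "0 < \<eta>" "N \<in> null_sets \<nu>"
    "\<And>x. x \<in> ball \<rho> \<eta> \<Longrightarrow> x \<notin> N \<Longrightarrow> pot 0 N x = 0 \<Longrightarrow> emeasure (P x) {\<omega> \<in> space W. hit \<rho> \<omega> < \<infinity>} \<noteq> 0"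
proof -
  obtain \<eta> where \<eta>: "0 < \<eta>" and loc: "\<And>\<delta>. 0 < \<delta> \<Longrightarrow> \<delta> \<le> \<eta> \<Longrightarrow>
    \<exists>J>0. AE x in \<nu>. x \<in> ball \<rho> \<eta> \<longrightarrow> ennreal (2 / 3 * J) \<le> pot 1 (ball \<rho> \<delta>) x \<and> pot 1 (ball \<rho> \<delta>) x \<le> ennreal (4 / 3 * J)"
    by (rule resolvent_near_root) blast
  define Q where "Q \<delta> J x \<longleftrightarrow> (x \<in> ball \<rho> \<eta> \<longrightarrow> ennreal (2 / 3 * J) \<le> pot 1 (ball \<rho> \<delta>) x \<and> pot 1 (ball \<rho> \<delta>) x \<le> ennreal (4 / 3 * J))" for \<delta> J x
  define \<delta> where "\<delta> k = min \<eta> (1 / Suc k)" for k :: nat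
  have \<delta>: "0 < \<delta> k" "\<delta> k \<le> \<eta>" for k using \<eta> by (simp_all add: \<delta>_def)
  have "\<forall>k. \<exists>J>0. AE x in \<nu>. Q (\<delta> k) J x" using loc[OF \<delta>] unfolding Q_def by blast
  then obtain J where J: "\<And>k. 0 < J k" "\<And>k. AE x in \<nu>. Q (\<delta> k) (J k) x" unfolding choice_iff by blast
  obtain J0 where J0: "0 < J0" "AE x in \<nu>. Q \<eta> J0 x" using loc[OF \<eta> order_refl] unfolding Q_def by blast
  define R where "R x \<longleftrightarrow> Q \<eta> J0 x \<and> (\<forall>k. Q (\<delta> k) (J k) x)" for x
  have "AE x in \<nu>. R x" unfolding R_def using J(2) J0(2) by (simp add: AE_all_countable AE_conj_iff)
  then obtain N where N: "N \<in> null_sets \<nu>" "{x \<in> space \<nu>. \<not> R x} \<subseteq> N"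
    by (auto elim!: AE_E simp: null_sets_def)
  have Q: "Q \<eta> J0 z" "Q (\<delta> k) (J k) z" if "z \<notin> N" for z k using N(2) that by (auto simp: R_def)
  have Nb: "N \<in> sets borel" using N sets_nu by auto
  show ?thesis
  proof (rule that[OF \<eta> N(1)])
    fix x assume x: "x \<in> ball \<rho> \<eta>" "x \<notin> N" and p0: "pot 0 N x = 0"
    obtain d :: "nat \<Rightarrow> real" where d: "\<And>i. 0 < d i" "\<And>i. tr (d i) x N = 0"
      "\<And>u v. 0 \<le> u \<Longrightarrow> u < v \<Longrightarrow> \<exists>i. u < d i \<and> d i < v"
      using ex_dense_sequence_AE[OF pot_0_AE_transition[OF Nb p0] order_refl] by blast
    note d0 = less_imp_le[OF d(1)]
    let ?C = "ball \<rho> \<eta>"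
    have C: "?C \<in> sets borel" by simp
    have ge: "ennreal (J0 / 3) \<le> (\<integral>\<^sup>+\<omega>. grid_occ 1 (ball \<rho> (1 / Suc k)) ?C d UNIV \<omega> \<partial>P x)" for k :: nat
    proof -
      let ?A = "ball \<rho> (\<delta> k)"
      have A: "?A \<in> sets borel" "open ?A" by simp_all
      have AC: "?A \<subseteq> ?C" using \<delta>(2)[of k] by auto
      have "ennreal (4 / 3 * J k) * ennreal (1 / 2) = ennreal (2 / 3 * J k)"
        using J(1)[of k] by (subst ennreal_mult[symmetric]) simp_all
      also have "\<dots> \<le> pot 1 ?A x" using Q(2)[OF x(2), of k] x(1) unfolding Q_def by blast
      also have "\<dots> = (\<integral>\<^sup>+\<omega>. occ 1 ?A 0 \<omega> \<partial>P x)" by (rule pot_eq_occ[OF A(1)])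
      also have "\<dots> \<le> (\<integral>\<^sup>+\<omega>. grid_occ 1 ?A ?A d UNIV \<omega> \<partial>P x)"
        using occ_le_grid_occ[OF _ A(2) order_refl d(3)] by (intro nn_integral_mono) (simp add: space_P)
      also have "\<dots> \<le> ennreal (4 / 3 * J k) * (\<integral>\<^sup>+\<omega>. grid_disc 1 ?A d UNIV \<omega> \<partial>P x)"
      proof (rule grid_upper[OF d0 zero_le_one A(1) A(1) Nb d(2)])
        fix z assume "z \<in> ?A - N"
        then show "pot 1 ?A z \<le> ennreal (4 / 3 * J k)" using Q(2)[of z k] AC unfolding Q_def by blast
      qed
      finally have half: "ennreal (1 / 2) \<le> (\<integral>\<^sup>+\<omega>. grid_disc 1 ?A d UNIV \<omega> \<partial>P x)"
        using J(1)[of k] by (subst (asm) ennreal_mult_le_mult_iff) simp_all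
      have "ennreal (J0 / 3) = ennreal (2 / 3 * J0) * ennreal (1 / 2)"
        using J0(1) by (subst ennreal_mult[symmetric]) simp_all
      also have "\<dots> \<le> ennreal (2 / 3 * J0) * (\<integral>\<^sup>+\<omega>. grid_disc 1 ?A d UNIV \<omega> \<partial>P x)" by (intro mult_left_mono half) simp
      also have "\<dots> \<le> (\<integral>\<^sup>+\<omega>. grid_occ 1 ?A ?C d UNIV \<omega> \<partial>P x)"
      proof (rule grid_lower[OF d0 zero_le_one A(1) C Nb d(2)])
        fix z assume "z \<in> ?A - N"
        then show "ennreal (2 / 3 * J0) \<le> pot 1 ?C z" using Q(1)[of z] AC unfolding Q_def by blast
      qed
      also have "\<dots> \<le> (\<integral>\<^sup>+\<omega>. grid_occ 1 (ball \<rho> (1 / Suc k)) ?C d UNIV \<omega> \<partial>P x)"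
        by (intro nn_integral_mono grid_occ_mono_target) (auto simp: \<delta>_def)
      finally show ?thesis .
    qed
    show "emeasure (P x) {\<omega> \<in> space W. hit \<rho> \<omega> < \<infinity>} \<noteq> 0"
      by (rule hit_positive[OF d0 zero_less_one _ C ge]) (use J0 in simp)
  qed
qed

text \<open>Almost every point near the root has a bounded Green integral and hits the root with
  positive probability; \<open>pot_hit\<close> then bounds the Green integral at the root.\<close>

lemma noncompact_transient:
  assumes nc: "\<not> compact (UNIV :: 'a set)" and D: "\<And>x y :: 'a. dist x y \<le> D"
  shows "transient \<rho> P B"
  unfolding transient_def
proof (intro allI impI)
  fix K :: "'a set" assume K: "compact K"
  obtain \<eta> N where \<eta>: "0 < \<eta>" and N: "N \<in> null_sets \<nu>"
    and pos: "\<And>x. x \<in> ball \<rho> \<eta> \<Longrightarrow> x \<notin> N \<Longrightarrow> pot 0 N x = 0 \<Longrightarrow> emeasure (P x) {\<omega> \<in> space W. hit \<rho> \<omega> < \<infinity>} \<noteq> 0"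
    by (rule hit_root_positive) blast
  have "AE x in \<nu>. x \<notin> N \<and> pot 0 N x = 0 \<and> pot 0 K x \<le> ennreal (4 * D * measure \<nu> K)"
    using AE_not_in[OF N] pot_null[OF N, of 0] noncompact_Green_le[OF nc D K] by eventually_elim blast
  from AE_ball_ex[OF this \<eta>] obtain x where x: "x \<in> ball \<rho> \<eta>" "x \<notin> N" "pot 0 N x = 0"
    "pot 0 K x \<le> ennreal (4 * D * measure \<nu> K)" by blast
  have "emeasure (P x) {\<omega> \<in> space W. hit \<rho> \<omega> < \<infinity>} * pot 0 K \<rho> \<le> ennreal (4 * D * measure \<nu> K)"
    by (rule order_trans[OF pot_hit[OF borel_compact[OF K]] x(4)])
  then have fin: "pot 0 K \<rho> < \<infinity>"
    using pos[OF x(1-3)] by (cases "pot 0 K \<rho> = \<top>") (auto simp: ennreal_mult_top less_top top_unique)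
  have "(\<integral>\<^sup>+u\<in>{0..}. tr u \<rho> K \<partial>lborel) = pot 0 K \<rho>"
    unfolding pot_def by (intro nn_integral_cong) (simp add: indicator_def max_def)
  then show "(\<integral>\<^sup>+u\<in>{0..}. tr u \<rho> K \<partial>lborel) < \<infinity>" using fin by simp
qed

end

lemma radon_measure_sigma_finite:
  fixes \<nu> :: "'a::real_tree measure"
  assumes lc: "locally compact (UNIV :: 'a set)" and r: "radon_measure \<nu>"
  shows "sigma_finite_measure \<nu>"
proof -
  obtain x :: "nat \<Rightarrow> 'a" where dense: "\<And>z e. 0 < e \<Longrightarrow> \<exists>n. dist (x n) z < e"
    using locally_compact_connected_dense_sequence[OF lc connected_real_tree] by blast
  obtain K :: "nat \<Rightarrow> 'a set" where K: "\<And>n. compact (K n)" "(\<Union>n. K n) = UNIV"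
    using locally_compact_countable_cover[OF lc dense] by blast
  have s: "sets \<nu> = sets borel" using r by (simp add: radon_measure_def)
  show ?thesis
  proof
    have "range K \<subseteq> sets \<nu>" using K(1) s by (auto simp: borel_compact)
    moreover have "\<Union>(range K) = space \<nu>" using K(2) sets_eq_imp_space_eq[OF s] by simp
    moreover have "\<forall>a\<in>range K. emeasure \<nu> a \<noteq> \<infinity>" using r K(1) by (auto simp: radon_measure_def less_top)
    ultimately show "\<exists>A. countable A \<and> A \<subseteq> sets \<nu> \<and> \<Union>A = space \<nu> \<and> (\<forall>a\<in>A. emeasure \<nu> a \<noteq> \<infinity>)"
      by (intro exI[of _ "range K"]) simp
  qed
qed

theorem theorem2:
  fixes \<rho> :: "'a::real_tree" and \<nu> :: "'a measure"
    and W :: "'w measure" and P :: "'a \<Rightarrow> 'w measure" and B :: "real \<Rightarrow> 'w \<Rightarrow> 'a option"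
  assumes "bounded (UNIV :: 'a set)"
    and "locally compact (UNIV :: 'a set)"
    and "radon_measure \<nu>"
    and "brownian_motion \<rho> \<nu> W P B"
  shows "(compact (UNIV :: 'a set) \<longrightarrow> positive_recurrent \<rho> P B) \<and>
         (\<not> compact (UNIV :: 'a set) \<longrightarrow> transient \<rho> P B)"
proof -
  interpret tree_brownian W P B \<nu> \<rho>
  proof
    show "sets \<nu> = sets borel" using assms(3) by (simp add: radon_measure_def)
    show "\<exists>A. countable A \<and> A \<subseteq> sets \<nu> \<and> \<Union> A = space \<nu> \<and> (\<forall>a\<in>A. emeasure \<nu> a \<noteq> \<infinity>)"
      by (rule sigma_finite_measure.sigma_finite_countable[OF radon_measure_sigma_finite[OF assms(2,3)]])
  qed (use assms in \<open>simp_all add: brownian_motion_def\<close>)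
  obtain D where D: "\<And>x y :: 'a. dist x y \<le> D" using assms(1) unfolding bounded_two_points by auto
  show ?thesis using compact_positive_recurrent noncompact_transient[OF _ D] by blast
qed

end
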